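(* Let $\gamma,\alpha\in\mathbb{C}$, $\Re\alpha>0$, $\Re\gamma>-1$, $z_1,z_2\in\mathbb{C}\setminus[0,\infty)$, $\arg z_1,\arg z_2\in(0,2\pi)$. Then $$N_\gamma^\alpha(z_1)N_\gamma^\alpha(z_2)=\frac{\sqrt{\pi}\,2^{\alpha-\frac12}\Gamma(\alpha+\gamma+1)}{\Gamma(\gamma+1)(z_1z_2)^{\frac{\alpha}{2}-\frac14}}\int_0^\infty N_\gamma^\alpha\big(z_1+z_2+2\sqrt{z_1z_2}\cosh t\big)\,e^{-\sqrt{z_1z_2}\cosh t}\,I_{\alpha-\frac12}\!\left(\sqrt{z_1z_2}\,\sinh t\right)(\sinh t)^{\alpha+\frac12}\,dt .$$
   Context: The Laguerre function of the second kind, for $z\in\mathbb{C}\setminus[0,\infty)$ with $\arg z\in(0,2\pi)$, is $N_\gamma^\alpha(z)=\frac12\Gamma(\alpha+\gamma+1)\,e^{z}\,U(\alpha+\gamma+1,\alpha+1,-z)$, where $-z:=e^{-i\pi}z$ and $U(a,b,z)$ is the Kummer confluent hypergeometric function of the second kind, $U(a,b,z)=\frac{\Gamma(1-b)}{\Gamma(a-b+1)}{}_1F_1(a;b;z)+\frac{\Gamma(b-1)}{\Gamma(a)}z^{1-b}{}_1F_1(a-b+1;2-b;z)$. $I_\nu$ is the modified Bessel function of the first kind. Here $\sqrt{z_1z_2}=\sqrt{z_1}\sqrt{z_2}$ with the phases of $z_1,z_2$ in $(0,2\pi)$; the combination $I_{\alpha-\frac12}(\sqrt{z_1z_2}\sinh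 t)/(z_1z_2)^{\frac\alpha2-\frac14}$ is an even function of $\sqrt{z_1z_2}$.
   Formalization: The formula is proved as displayed, with convergence, when Re √(z1z2) ≤ 0; when Re √(z1z2) > 0 the displayed integral diverges (e.g. z1=z2=1+i), and it is taken instead along the path 0 → ±iπ/2 → ±iπ/2+∞, with the sign of Im √(z1z2). *)

theory Defs
  imports "HOL-Complex_Analysis.Complex_Analysis"
begin

definition kummer_M :: "complex \<Rightarrow> complex \<Rightarrow> complex \<Rightarrow> complex" where
  "kummer_M a b z = eval_fps (fps_hypergeo [a] [b] 1) z"

text \<open>
  The reciprocal Gamma factors are \<^const>\<open>rGamma\<close>, which vanishes at the poles of \<^const>\<open>Gamma\<close>.
  The power is the principal one, for z off the negative real axis.
\<close>

definition kummer_U_nonint :: "complex \<Rightarrow> complex \<Rightarrow> complex \<Rightarrow> complex" where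
  "kummer_U_nonint a b z =
     Gamma (1 - b) * rGamma (a - b + 1) * kummer_M a b z +
     Gamma (b - 1) * rGamma a * z powr (1 - b) * kummer_M (a - b + 1) (2 - b) z"

text \<open>
  At integer b both terms of the formula are singular; there U is, as usual, the limit in b
  (the singularity is removable, as U is entire in b).
\<close>

definition kummer_U :: "complex \<Rightarrow> complex \<Rightarrow> complex \<Rightarrow> complex" where
  "kummer_U a b z =
     (if b \<in> \<int> then Lim (at b) (\<lambda>\<beta>. kummer_U_nonint a \<beta> z) else kummer_U_nonint a b z)"

text \<open>
  For z with phase in (0, 2 pi), exp (-i pi) z has phase in (-pi, pi), so the principal branch
  of \<^const>\<open>kummer_U\<close> at -z is the intended one.
\<close>

definition laguerre_N :: "complex \<Rightarrow> complex \<Rightarrow> complex \<Rightarrow> complex" where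
  "laguerre_N \<gamma> \<alpha> z =
     1 / 2 * Gamma (\<alpha> + \<gamma> + 1) * exp z * kummer_U (\<alpha> + \<gamma> + 1) (\<alpha> + 1) (- z)"

definition bessel_I :: "complex \<Rightarrow> complex \<Rightarrow> complex" where
  "bessel_I \<nu> z =
     (z / 2) powr \<nu> * (\<Sum>k. rGamma (\<nu> + of_nat k + 1) / fact k * (z / 2) ^ (2 * k))"

text \<open>The square root with the phase of z taken in [0, 2 pi), unlike \<^const>\<open>csqrt\<close>.\<close>

definition sqrt_2pi :: "complex \<Rightarrow> complex" where
  "sqrt_2pi z = of_real (sqrt (cmod z)) * cis (Arg2pi z / 2)"

text \<open>
  Here s stands for the square root of the product of the two arguments, and t is complex so that
  the integrand can also be integrated along a path leaving the real axis.
\<close>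

definition product_integrand ::
  "complex \<Rightarrow> complex \<Rightarrow> complex \<Rightarrow> complex \<Rightarrow> complex \<Rightarrow> complex" where
  "product_integrand \<gamma> \<alpha> z1 z2 t =
     (let s = sqrt_2pi z1 * sqrt_2pi z2 in
        laguerre_N \<gamma> \<alpha> (z1 + z2 + 2 * s * cosh t) * exp (- s * cosh t) *
        bessel_I (\<alpha> - 1 / 2) (s * sinh t) * sinh t powr (\<alpha> + 1 / 2))"

text \<open>
  The power of the product of the two arguments is written as the power \<alpha> - 1/2 of s.  For t > 0
  its branch cancels against that of \<^const>\<open>bessel_I\<close> at s sinh t, which leaves an even function of s.
\<close>

definition product_factor :: "complex \<Rightarrow> complex \<Rightarrow> complex \<Rightarrow> complex \<Rightarrow> complex" where
  "product_factor \<gamma> \<alpha> z1 z2 =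
     (let s = sqrt_2pi z1 * sqrt_2pi z2 in
        of_real (sqrt pi) * 2 powr (\<alpha> - 1 / 2) * Gamma (\<alpha> + \<gamma> + 1) /
        (Gamma (\<gamma> + 1) * s powr (\<alpha> - 1 / 2)))"

text \<open>
  The integrand behaves like exp (2 s cosh t) as t tends to infinity when Re s > 0, and like
  exp (- (\<gamma> + 1) t), times a bounded factor, when Re s \<le> 0.  So the integral over the positive
  half-line converges exactly for Re s \<le> 0.  If Re s > 0, the path of integration has to leave
  the real axis: with \<omega> = i pi / 2 for Im s > 0 and \<omega> = - i pi / 2 for Im s < 0, it runs
  from 0 to \<omega> and then parallel to the positive real axis.  There s cosh (\<omega> + t) = \<omega>' s sinh t
  with \<omega>' = i or - i and Re (\<omega>' s) < 0, and the argument of \<^const>\<open>laguerre_N\<close> stays off [0, \<infinity>).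
\<close>

definition path_corner :: "complex \<Rightarrow> complex" where
  "path_corner s = (if Im s > 0 then \<i> * of_real (pi / 2) else - \<i> * of_real (pi / 2))"

end

theory Submission
  imports Defs
begin

text \<open>
  Up to elementary factors, N(z) is the integral V(-z) of t^(c-1) e^(-t) (t - z)^(-a) over t > 0, where
  c = \<gamma> + 1 and a = \<alpha> + \<gamma> + 1; this follows from Kummer's equation, the Wronskian, and the behaviour at 0.
  With z1 = w1^2 and z2 = w2^2 for w1, w2 in the upper half-plane and s = w1 w2, the claim becomes an
  integral formula for V(-z1) V(-z2).

  For negative z1 and z2 it follows from Laplace representations of V, a Laplace transform of the Bessel
  function obtained from Poisson's integral, and a change of variables in a double integral.

  The general case is analytic continuation in one argument at a time.  Dividing by w1 + w2, or by one of
  w1 and w2, shows that the argument of V stays off the cut and grows like e^t along the path, so the integrand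
  is O(e^(-Re c t)).  The integral along the positive axis is holomorphic for Re s < 0, the one
  along the path through i pi / 2 is holomorphic when w1 and w2 lie in the first quadrant, and by
  Cauchy's theorem the two agree there for Re s \<le> 0.  The second quadrant follows by complex conjugation.
\<close>

section \<open>Integrals depending on a complex parameter\<close>

text \<open>The kernel depends on w1 and w2 only through w1^2, w2^2 and w1 w2, and the branch of the
  Bessel function goes into an even entire function, so no root has to be chosen when w1 or w2
  varies. The only remaining power is that of sinh t, and sinh maps the half-strip 0 \<le> Re t, 0
  \<le> Im t \<le> pi/2 into the closed first quadrant. The rate Re c is what is left of two larger
  ones: V decays like e^(-(Re \<alpha> + Re c) t), while sinh^(2 \<alpha>) times the Bessel factor
  grows like e^(t Re \<alpha>) once the exponentials are combined. For this the entire part of the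
  Bessel function must be bounded for all complex arguments, up to the right power, which a Gronwall
  estimate along rays provides. The values at 0 that fix the Wronskians are accessible only for
  second parameters b with 1 \<le> Re b < 2. Differentiation moves the identity to larger Re b, and
  continuity in b covers the integers. In the base case the Bessel kernel comes from one double
  integral evaluated in both orders: one order gives Poisson's integral, the other a Gamma
  integral.\<close>

lemma
  fixes f :: "complex \<Rightarrow> 'a \<Rightarrow> complex" and w :: complex and r :: real
  assumes r: "r > 0"
    and meas: "\<And>v. v \<in> ball w r \<Longrightarrow> f v \<in> borel_measurable M"
    and hol: "\<And>t. t \<in> space M \<Longrightarrow> (\<lambda>v. f v t) holomorphic_on ball w r"
    and g: "integrable M g"
    and bound: "\<And>v t. v \<in> ball w r \<Longrightarrow> t \<in> space M \<Longrightarrow> norm (f v t) \<le> g t"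
  shows has_field_derivative_integral_dominated:
      "((\<lambda>v. LINT t|M. f v t) has_field_derivative (LINT t|M. deriv (\<lambda>v. f v t) w)) (at w)"
    and integrable_dominated: "integrable M (f w)"
proof -
  have int: "integrable M (f v)" if "v \<in> ball w r" for v
  proof (rule Bochner_Integration.integrable_bound[OF g meas[OF that]], rule AE_I2)
    fix t assume "t \<in> space M"
    from bound[OF that this] show "norm (f v t) \<le> norm (g t)" by simp
  qed
  show "integrable M (f w)" using int r by simp
  \<comment> \<open>Cauchy's inequality on discs of radius r/2 turns the bound on \<open>f\<close>
    into one on its derivative, so a majorant of the integrand is all that has to be
    supplied.\<close>
  have der: "norm (deriv (\<lambda>v. f v t) v) \<le> g t / (r/2)" if t: "t \<in> space M" and v: "v \<in> ball w (r/2)" for v t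
  proof -
    have sub: "cball v (r/2) \<subseteq> ball w r"
    proof
      fix x assume "x \<in> cball v (r/2)"
      with v show "x \<in> ball w r" using dist_triangle[of w x v] by simp
    qed
    have "norm ((deriv ^^ 1) (\<lambda>v. f v t) v) \<le> fact 1 * g t / (r/2) ^ 1"
    proof (rule Cauchy_inequality)
      show "(\<lambda>v. f v t) holomorphic_on ball v (r/2)"
        using holomorphic_on_subset[OF hol[OF t]] sub ball_subset_cball by blast
      show "continuous_on (cball v (r/2)) (\<lambda>v. f v t)"
        using holomorphic_on_imp_continuous_on[OF holomorphic_on_subset[OF hol[OF t] sub]] .
      show "norm (f x t) \<le> g t" if "norm (v - x) = r/2" for x
      proof -
        have "x \<in> cball v (r/2)" using that by (simp add: dist_norm)
        then show ?thesis using bound[OF _ t] sub by blast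
      qed
    qed (use r in auto)
    then show ?thesis by simp
  qed
  have lip: "norm (f v t - f w t) \<le> g t / (r/2) * norm (v - w)"
    if t: "t \<in> space M" and v: "v \<in> ball w (r/2)" for v t
  proof -
    have "w \<in> ball w (r/2)" using r by simp
    moreover have "((\<lambda>v. f v t) has_field_derivative deriv (\<lambda>v. f v t) z) (at z within ball w (r/2))"
      if "z \<in> ball w (r/2)" for z
    proof -
      have "z \<in> ball w r" using that r by simp
      from holomorphic_derivI[OF hol[OF t] open_ball this] show ?thesis
        by (rule has_field_derivative_at_within)
    qed
    ultimately show ?thesis
      using field_differentiable_bound[where f = "\<lambda>v. f v t" and f' = "deriv (\<lambda>v. f v t)",
          OF convex_ball _ der[OF t] v] by blast
  qed
  have "((\<lambda>v. ((LINT t|M. f v t) - (LINT t|M. f w t)) / (v - w)) \<longlongrightarrow> (LINT t|M. deriv (\<lambda>v. f v t) w)) (at w)"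
  proof (subst tendsto_at_iff_sequentially, intro allI impI, unfold comp_def)
    fix X :: "nat \<Rightarrow> complex"
    assume X: "\<forall>i. X i \<in> UNIV - {w}" "X \<longlonglongrightarrow> w"
    have "\<forall>\<^sub>F n in sequentially. X n \<in> ball w (r/2)"
      using X(2) r by (intro topological_tendstoD) auto
    then obtain N where N: "\<And>n. n \<ge> N \<Longrightarrow> X n \<in> ball w (r/2)"
      by (auto simp: eventually_sequentially)
    have NN: "X (n + N) \<in> ball w r" "X (n + N) \<in> ball w (r/2)" "X (n+N) \<noteq> w" for n
      using N[of "n + N"] X r by auto
    have conv: "(\<lambda>n. (f (X (n + N)) t - f w t) / (X (n + N) - w)) \<longlonglongrightarrow> deriv (\<lambda>v. f v t) w" if t: "t \<in> space M" for t
    proof -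
        have "((\<lambda>v. f v t) has_field_derivative deriv (\<lambda>v. f v t) w) (at w)"
          using hol[OF t] r by (intro holomorphic_derivI[of _ "ball w r"]) auto
          then have "((\<lambda>v. (f v t - f w t) / (v - w)) \<longlongrightarrow> deriv (\<lambda>v. f v t) w) (at w)"
          by (simp add: has_field_derivative_iff)
        moreover have "filterlim (\<lambda>n. X (n + N)) (at w) sequentially"
          using NN LIMSEQ_ignore_initial_segment[OF X(2)]
          by (auto simp: filterlim_at)
        ultimately show "(\<lambda>n. (f (X (n + N)) t - f w t) / (X (n + N) - w)) \<longlonglongrightarrow> deriv (\<lambda>v. f v t) w"
          by (rule filterlim_compose)
    qed
    have "(\<lambda>n. LINT t|M. (f (X (n + N)) t - f w t) / (X (n + N) - w)) \<longlonglongrightarrow> (LINT t|M. deriv (\<lambda>v. f v t) w)"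
    proof (rule integral_dominated_convergence)
      show "AE t in M. (\<lambda>n. (f (X (n + N)) t - f w t) / (X (n + N) - w)) \<longlonglongrightarrow> deriv (\<lambda>v. f v t) w"
        using conv by (intro AE_I2)
      show m: "(\<lambda>t. (f (X (n + N)) t - f w t) / (X (n + N) - w)) \<in> borel_measurable M" for n
        using meas NN r by (intro borel_measurable_divide borel_measurable_diff) auto
      show "(\<lambda>t. deriv (\<lambda>v. f v t) w) \<in> borel_measurable M"
        by (rule borel_measurable_LIMSEQ_metric[OF m conv])
      show "integrable M (\<lambda>t. g t / (r/2))" using g by simp
      show "AE t in M. norm ((f (X (n + N)) t - f w t) / (X (n + N) - w)) \<le> g t / (r/2)" for n
      proof (rule AE_I2)
        fix t assume "t \<in> space M"
        from lip[OF this NN(2)[of n]] NN(3)[of n]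
        show "norm ((f (X (n + N)) t - f w t) / (X (n + N) - w)) \<le> g t / (r/2)"
          unfolding norm_divide by (subst pos_divide_le_eq) auto
      qed
    qed
    also have "(\<lambda>n. LINT t|M. (f (X (n + N)) t - f w t) / (X (n + N) - w)) =
      (\<lambda>n. ((LINT t|M. f (X (n+N)) t) - (LINT t|M. f w t)) / (X (n+N) - w))"
      using int NN r by (intro ext) (simp add: Bochner_Integration.integral_diff)
    finally show "(\<lambda>n. ((LINT t|M. f (X n) t) - (LINT t|M. f w t)) / (X n - w)) \<longlonglongrightarrow> (LINT t|M. deriv (\<lambda>v. f v t) w)"
      by (rule LIMSEQ_offset)
  qed
  then show "((\<lambda>v. LINT t|M. f v t) has_field_derivative (LINT t|M. deriv (\<lambda>v. f v t) w)) (at w)"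
    by (simp add: has_field_derivative_iff)
qed

text \<open>Dominated convergence speaks of sequences, and first countability of the parameter space
  reduces the limit to them. This gives the behaviour of the confluent function at 0.\<close>

lemma tendsto_integral_dominated:
  fixes f :: "'b::first_countable_topology \<Rightarrow> 'a \<Rightarrow> complex"
  assumes meas: "\<And>v. v \<in> S \<Longrightarrow> f v \<in> borel_measurable M"
    and lim: "\<And>t. t \<in> space M \<Longrightarrow> ((\<lambda>v. f v t) \<longlongrightarrow> l t) (at w within S)"
    and l: "l \<in> borel_measurable M"
    and g: "integrable M g"
    and bound: "\<And>v t. v \<in> S \<Longrightarrow> t \<in> space M \<Longrightarrow> norm (f v t) \<le> g t"
  shows "((\<lambda>v. LINT t|M. f v t) \<longlongrightarrow> (LINT t|M. l t)) (at w within S)"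
proof (subst tendsto_at_iff_sequentially, intro allI impI, unfold comp_def)
  fix X :: "nat \<Rightarrow> 'b"
  assume X: "\<forall>i. X i \<in> S - {w}" "X \<longlonglongrightarrow> w"
  show "(\<lambda>n. LINT t|M. f (X n) t) \<longlonglongrightarrow> (LINT t|M. l t)"
  proof (rule integral_dominated_convergence[OF l _ g])
    show "AE t in M. (\<lambda>n. f (X n) t) \<longlonglongrightarrow> l t"
    proof (rule AE_I2)
      fix t assume "t \<in> space M"
      from lim[OF this] X(2) have "((\<lambda>v. f v t) \<circ> X) \<longlonglongrightarrow> l t"
        unfolding tendsto_at_iff_sequentially using X(1) by (elim allE[of _ X]) simp
      then show "(\<lambda>n. f (X n) t) \<longlonglongrightarrow> l t" by (simp only: comp_def)
    qed
    have XS: "X n \<in> S" for n using X(1) by simp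
    show "f (X n) \<in> borel_measurable M" for n by (rule meas[OF XS])
    show "AE t in M. norm (f (X n) t) \<le> g t" for n
      by (rule AE_I2, rule bound[OF XS])
  qed
qed

section \<open>Lebesgue measure on the positive half-line\<close>

text \<open>A measure of its own rather than set integrals over lborel: Fubini's theorem then
  applies on \<open>posm \<Otimes>\<^sub>M posm\<close> without indicator functions.\<close>

definition posm :: "real measure" where
  "posm = restrict_space lborel {0<..}"

lemma space_posm [simp]: "space posm = {0<..}"
  by (simp add: posm_def space_restrict_space)

lemma sets_posm: "sets posm = sets (restrict_space borel {0<..})"
  by (simp add: posm_def sets_restrict_space)

lemma borel_measurable_posmI: "f \<in> borel_measurable borel \<Longrightarrow> f \<in> borel_measurable posm"
  by (simp add: posm_def measurable_restrict_space1)

lemma measurable_ident_posm: "(\<lambda>x. x) \<in> borel_measurable posm"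
  by (intro borel_measurable_posmI) simp

lemma borel_measurable_posm_continuous_on:
  fixes f :: "real \<Rightarrow> 'a::topological_space"
  shows "continuous_on {0<..} f \<Longrightarrow> f \<in> borel_measurable posm"
  unfolding measurable_cong_sets[OF sets_posm refl] by (rule borel_measurable_continuous_on_restrict)

lemma integral_posm:
  fixes f :: "real \<Rightarrow> 'a::{banach, second_countable_topology}"
  shows "(LINT t|posm. f t) = (LINT t:{0<..}|lborel. f t)"
  by (simp add: posm_def set_lebesgue_integral_def integral_restrict_space)

lemma integrable_posm:
  fixes f :: "real \<Rightarrow> 'a::{banach, second_countable_topology}"
  shows "integrable posm f \<longleftrightarrow> set_integrable lborel {0<..} f"
  by (simp add: posm_def set_integrable_def integrable_restrict_space)

interpretation posm: sigma_finite_measure posm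
  unfolding posm_def by (intro sigma_finite_measure_restrict_space) (auto simp: lborel.sigma_finite_measure_axioms)

interpretation posm_pair: pair_sigma_finite posm posm ..

lemma measurable_fst_posm: "fst \<in> borel_measurable (posm \<Otimes>\<^sub>M N)"
  by (rule measurable_compose[OF measurable_fst measurable_ident_posm])

lemma measurable_snd_posm: "snd \<in> borel_measurable (N \<Otimes>\<^sub>M posm)"
  by (rule measurable_compose[OF measurable_snd measurable_ident_posm])

lemma integral_posm_scale:
  fixes f :: "real \<Rightarrow> 'a::{banach, second_countable_topology}"
  assumes "r > 0"
  shows "(LINT x|posm. f x) = r *\<^sub>R (LINT x|posm. f (r * x))"
proof -
  have "(LINT x|lborel. indicator {0<..} x *\<^sub>R f x) =
      r *\<^sub>R (LINT x|lborel. indicator {0<..} (0 + r * x) *\<^sub>R f (0 + r * x))"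
    by (subst lborel_integral_real_affine[where c = r and t = 0]) (use assms in simp_all)
  also have "(\<lambda>x. indicat_real {0<..} (0 + r * x) *\<^sub>R f (0 + r * x)) = (\<lambda>x. indicator {0<..} x *\<^sub>R f (r * x))"
    using assms by (auto simp: indicator_def fun_eq_iff zero_less_mult_iff)
  finally show ?thesis by (simp add: integral_posm set_lebesgue_integral_def)
qed

lemma integrable_posm_scale_iff:
  fixes f :: "real \<Rightarrow> 'a::{banach, second_countable_topology}"
  assumes "r > 0"
  shows "integrable posm (\<lambda>x. f (r * x)) \<longleftrightarrow> integrable posm f"
proof -
  have "integrable lborel (\<lambda>x. indicator {0<..} (0 + r * x) *\<^sub>R f (0 + r * x)) \<longleftrightarrow> integrable lborel (\<lambda>x. indicator {0<..} x *\<^sub>R f x)"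
    using assms by (intro lborel_integrable_real_affine_iff) auto
  also have "(\<lambda>x. indicat_real {0<..} (0 + r * x) *\<^sub>R f (0 + r * x)) = (\<lambda>x. indicator {0<..} x *\<^sub>R f (r * x))"
    using assms by (auto simp: indicator_def fun_eq_iff zero_less_mult_iff)
  finally show ?thesis by (simp add: integrable_posm set_integrable_def)
qed

lemma integrable_posm_swap:
  fixes f :: "real \<Rightarrow> real \<Rightarrow> complex"
  assumes "integrable (posm \<Otimes>\<^sub>M posm) (\<lambda>(x,y). f x y)"
  shows "integrable (posm \<Otimes>\<^sub>M posm) (\<lambda>(y,x). f x y)"
    "(LINT x|posm. LINT y|posm. f x y) = (LINT y|posm. LINT x|posm. f x y)"
  using posm_pair.integrable_product_swap[OF assms] posm_pair.Fubini_integral[OF assms, symmetric]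
  unfolding case_prod_unfold fst_conv snd_conv .

text \<open>The substitution y = \<rho>(x) q at fixed x only rescales each fibre, so Fubini and
  one-dimensional scaling suffice. Chains of such steps, with the two variables exchanged in
  between, replace a two-dimensional change of variables.\<close>

lemma integrable_posm_skew:
  fixes f :: "real \<Rightarrow> real \<Rightarrow> complex" and \<rho> :: "real \<Rightarrow> real"
  assumes \<rho>: "\<rho> \<in> borel_measurable posm" and pos: "\<And>x. x > 0 \<Longrightarrow> \<rho> x > 0"
    and f: "integrable (posm \<Otimes>\<^sub>M posm) (\<lambda>(x,y). f x y)"
  shows "integrable (posm \<Otimes>\<^sub>M posm) (\<lambda>(x,q). of_real (\<rho> x) * f x (\<rho> x * q))"
    "(LINT x|posm. LINT y|posm. f x y) = (LINT x|posm. LINT q|posm. of_real (\<rho> x) * f x (\<rho> x * q))"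
proof -
  have f2: "(\<lambda>p. f (fst p) (snd p)) \<in> borel_measurable (posm \<Otimes>\<^sub>M posm)"
    using borel_measurable_integrable[OF f] unfolding case_prod_unfold .
  have T: "(\<lambda>p. (fst p, \<rho> (fst p) * snd p)) \<in> measurable (posm \<Otimes>\<^sub>M posm) (posm \<Otimes>\<^sub>M posm)"
  proof (rule measurable_Pair[where f = fst and g = "\<lambda>p. \<rho> (fst p) * snd p"])
    show "(\<lambda>p. \<rho> (fst p) * snd p) \<in> posm \<Otimes>\<^sub>M posm \<rightarrow>\<^sub>M posm"
    proof -
      have "(\<lambda>p. \<rho> (fst p) * snd p) \<in> space (posm \<Otimes>\<^sub>M posm) \<rightarrow> {0<..}"
      proof
        fix p assume "p \<in> space (posm \<Otimes>\<^sub>M posm)"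
        then have "fst p > 0" "snd p > 0" by (auto simp: space_pair_measure)
        then show "\<rho> (fst p) * snd p \<in> {0<..}"
          by (simp add: mult_pos_pos[OF pos])
      qed
      moreover have "(\<lambda>p. \<rho> (fst p) * snd p) \<in> posm \<Otimes>\<^sub>M posm \<rightarrow>\<^sub>M lborel"
        unfolding measurable_lborel1
        by (rule borel_measurable_times[OF measurable_compose[OF measurable_fst \<rho>] measurable_snd_posm])
      ultimately have "(\<lambda>p. \<rho> (fst p) * snd p) \<in> posm \<Otimes>\<^sub>M posm \<rightarrow>\<^sub>M restrict_space lborel {0<..}"
        by (rule measurable_restrict_space2)
      then show ?thesis unfolding posm_def[symmetric] .
    qed
  qed (rule measurable_fst)
  have sc: "(LINT y|posm. f x y) = (LINT q|posm. of_real (\<rho> x) * f x (\<rho> x * q))" if "x > 0" for x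
    by (subst integral_posm_scale[OF pos[OF that]]) (simp add: scaleR_conv_of_real)
  show eq: "(LINT x|posm. LINT y|posm. f x y) = (LINT x|posm. LINT q|posm. of_real (\<rho> x) * f x (\<rho> x * q))"
    by (rule Bochner_Integration.integral_cong[OF refl]) (simp add: sc)
  show "integrable (posm \<Otimes>\<^sub>M posm) (\<lambda>(x,q). of_real (\<rho> x) * f x (\<rho> x * q))"
  proof (rule posm_pair.Fubini_integrable)
    have m1: "(\<lambda>p. f (fst p) (\<rho> (fst p) * snd p)) \<in> borel_measurable (posm \<Otimes>\<^sub>M posm)"
      using measurable_compose[OF T f2] unfolding fst_conv snd_conv .
    have m2: "(\<lambda>p. complex_of_real (\<rho> (fst p))) \<in> borel_measurable (posm \<Otimes>\<^sub>M posm)"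
      by (rule measurable_compose[OF measurable_compose[OF measurable_fst \<rho>] borel_measurable_of_real])
    have "(\<lambda>p. of_real (\<rho> (fst p)) * f (fst p) (\<rho> (fst p) * snd p))
        \<in> borel_measurable (posm \<Otimes>\<^sub>M posm)"
      by (rule borel_measurable_times[OF m2 m1])
    then show "(\<lambda>(x, q). complex_of_real (\<rho> x) * f x (\<rho> x * q)) \<in> borel_measurable (posm \<Otimes>\<^sub>M posm)"
      unfolding case_prod_unfold .
    have I1: "integrable posm (\<lambda>x. LINT y|posm. norm (f x y))"
      using posm_pair.integrable_fst'[OF integrable_norm[OF f]] by simp
    \<comment> \<open>The same scaling applied to the norm preserves the inner integrals that
      Tonelli's criterion asks for.\<close>
    have eqn: "(LINT y|posm. norm (f x y)) = (LINT q|posm. norm (of_real (\<rho> x) * f x (\<rho> x * q)))" if "x > 0" for x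
      by (subst integral_posm_scale[OF pos[OF that]]) (use pos[OF that] in \<open>simp add: norm_mult\<close>)
    have "integrable posm (\<lambda>x. LINT q|posm. norm (of_real (\<rho> x) * f x (\<rho> x * q)))"
      by (rule Bochner_Integration.integrable_cong[THEN iffD1, OF refl eqn I1]) simp
    then show "integrable posm (\<lambda>x. LINT y|posm. norm (case (x, y) of (x, q) \<Rightarrow> of_real (\<rho> x) * f x (\<rho> x * q)))"
      by (simp only: prod.case)
    have "AE x in posm. integrable posm (f x)"
      using posm_pair.AE_integrable_fst'[OF f] by simp
    then show "AE x in posm. integrable posm (\<lambda>y. case (x, y) of (x, q) \<Rightarrow> of_real (\<rho> x) * f x (\<rho> x * q))"
    proof (rule AE_mp, intro AE_I2 impI)
      fix x assume "x \<in> space posm" "integrable posm (f x)"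
      then show "integrable posm (\<lambda>y. case (x, y) of (x, q) \<Rightarrow> of_real (\<rho> x) * f x (\<rho> x * q))"
        using integrable_posm_scale_iff[OF pos, of x "f x"] by simp
    qed
  qed
qed

text \<open>Tonelli's criterion, arranged for the cases below in which the inner integral of the
  norm is known in closed form, usually as a Gamma integral.\<close>

lemma integrable_posm_pairI:
  fixes f :: "real \<Rightarrow> real \<Rightarrow> complex"
  assumes "(\<lambda>(x,y). f x y) \<in> borel_measurable (posm \<Otimes>\<^sub>M posm)"
    and "\<And>x. x > 0 \<Longrightarrow> integrable posm (f x)"
    and "\<And>x. x > 0 \<Longrightarrow> (LINT y|posm. norm (f x y)) = h x"
    and "integrable posm h"
  shows "integrable (posm \<Otimes>\<^sub>M posm) (\<lambda>(x,y). f x y)"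
proof (rule posm_pair.Fubini_integrable[OF assms(1)])
  show "integrable posm (\<lambda>x. LINT y|posm. norm (case (x, y) of (x, y) \<Rightarrow> f x y))"
    using assms(4) unfolding prod.case
    by (rule Bochner_Integration.integrable_cong[THEN iffD2, OF refl, rotated]) (rule assms(3), simp)
  show "AE x in posm. integrable posm (\<lambda>y. case (x, y) of (x, y) \<Rightarrow> f x y)"
    using assms(2) by (intro AE_I2) simp
qed

section \<open>The integral representation of Tricomi's function\<close>

lemma add_of_real_not_nonpos_Reals:
  "w \<notin> \<real>\<^sub>\<le>\<^sub>0 \<Longrightarrow> t \<ge> 0 \<Longrightarrow> w + complex_of_real t \<notin> \<real>\<^sub>\<le>\<^sub>0"
  by (auto simp: complex_nonpos_Reals_iff)

lemma norm_powr_of_real_pos: "x > 0 \<Longrightarrow> norm (complex_of_real x powr a) = x powr Re a"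
  by (simp add: norm_powr_real_powr)

text \<open>The norm of a power carries the factor exp (- Im a * Arg w), and the principal argument
  is at most pi in absolute value.\<close>

lemma norm_powr_complex_le:
  assumes "w \<noteq> 0"
  shows "norm (w powr a) \<le> norm w powr Re a * exp (pi * \<bar>Im a\<bar>)"
proof -
  have eq: "norm (w powr a) = exp (Re a * ln (norm w) - Im a * Im (Ln w))"
    using assms by (simp add: powr_def)
  have "- (Im a * Im (Ln w)) \<le> \<bar>Im a\<bar> * \<bar>Im (Ln w)\<bar>"
    by (metis abs_ge_minus_self abs_mult)
  also have "\<dots> \<le> \<bar>Im a\<bar> * pi"
    using mpi_less_Im_Ln[OF assms] Im_Ln_le_pi[OF assms] by (intro mult_left_mono) auto
  finally have "norm (w powr a) \<le> exp (Re a * ln (norm w) + pi * \<bar>Im a\<bar>)"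
    by (simp add: eq mult.commute)
  then show ?thesis using assms by (simp add: powr_def exp_add)
qed

section \<open>Gamma integrals on the half-line\<close>

lemma integrable_Gamma_posm:
  assumes "p > 0" "k > 0"
  shows "integrable posm (\<lambda>t. t powr (p - 1) * exp (- (k * t)))"
proof -
  have "(\<lambda>t. complex_of_real t powr (of_real p - 1) / of_real (exp (k * t))) absolutely_integrable_on {0<..}"
    by (rule absolutely_integrable_Gamma_integral) (use assms in auto)
  then have "integrable lebesgue (\<lambda>t. norm (indicator {0<..} t *\<^sub>R (complex_of_real t powr (of_real p - 1) / of_real (exp (k * t)))))"
    unfolding set_integrable_def by (rule integrable_norm)
  also have "(\<lambda>t. norm (indicator {0<..} t *\<^sub>R (complex_of_real t powr (of_real p - 1) / of_real (exp (k * t))))) =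
     (\<lambda>t. indicator {0<..} t *\<^sub>R (t powr (p - 1) * exp (- (k * t))))"
    by (auto simp: fun_eq_iff indicator_def norm_divide norm_mult norm_inverse norm_powr_of_real_pos exp_minus divide_inverse)
  finally have "integrable lebesgue (\<lambda>t. indicator {0<..} t *\<^sub>R (t powr (p - 1) * exp (- (k * t))))" .
  then have "integrable lborel (\<lambda>t. indicator {0<..} t *\<^sub>R (t powr (p - 1) * exp (- (k * t))))"
    by (subst (asm) integrable_completion) auto
  then show ?thesis by (simp add: integrable_posm set_integrable_def)
qed

lemma continuous_on_of_real_holomorphic:
  assumes "f holomorphic_on A" "\<And>t. t \<in> S \<Longrightarrow> complex_of_real t \<in> A"
  shows "continuous_on S (\<lambda>t. f (complex_of_real t))"
  by (rule continuous_on_compose2[OF holomorphic_on_imp_continuous_on[OF assms(1)]])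
     (auto intro!: continuous_intros assms(2))

lemma measurable_Gamma_posm: "(\<lambda>t. complex_of_real t powr (c - 1) * exp (- (of_real k * of_real t))) \<in> borel_measurable posm"
  by (rule borel_measurable_posm_continuous_on,
      rule continuous_on_of_real_holomorphic[of "\<lambda>z. z powr (c - 1) * exp (- (of_real k * z))" "- \<real>\<^sub>\<le>\<^sub>0"])
     (auto intro!: holomorphic_intros)

lemma integrable_Gamma_posm_complex:
  assumes "Re c > 0" "k > 0"
  shows "integrable posm (\<lambda>t. complex_of_real t powr (c - 1) * exp (- (of_real k * of_real t)))"
proof (rule Bochner_Integration.integrable_bound[OF integrable_Gamma_posm[OF assms] measurable_Gamma_posm], rule AE_I2)
  fix t :: real assume "t \<in> space posm"
  then show "norm (complex_of_real t powr (c - 1) * exp (- (of_real k * of_real t))) \<le> norm (t powr (Re c - 1) * exp (- (k * t)))"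
    by (simp add: norm_mult norm_powr_of_real_pos)
qed

lemma integral_Gamma_posm:
  assumes "Re c > 0"
  shows "(LINT t|posm. complex_of_real t powr (c - 1) * exp (- of_real t)) = Gamma c"
proof -
  have eq: "complex_of_real t powr (c - 1) / of_real (exp t) = complex_of_real t powr (c - 1) * exp (- of_real t)" for t
    by (simp add: exp_minus divide_inverse exp_of_real of_real_inverse)
  have "integrable posm (\<lambda>t. complex_of_real t powr (c - 1) * exp (- of_real t))"
    using integrable_Gamma_posm_complex[OF assms, of 1] by simp
  then have "((\<lambda>t. complex_of_real t powr (c - 1) * exp (- of_real t)) has_integral
      (LINT t|posm. complex_of_real t powr (c - 1) * exp (- of_real t))) {0<..}"
    unfolding integrable_posm integral_posm
    by (simp only: has_integral_iff set_borel_integral_eq_integral simp_thms)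
  moreover have "((\<lambda>t. complex_of_real t powr (c - 1) * exp (- of_real t)) has_integral Gamma c) {0<..}"
    using Gamma_integral_complex'[OF assms] by (simp only: eq)
  ultimately show ?thesis by (rule has_integral_unique)
qed

lemma integral_Gamma_posm_scaled:
  assumes "Re c > 0" "k > 0"
  shows "(LINT t|posm. complex_of_real t powr (c - 1) * exp (- (of_real k * of_real t))) = Gamma c * of_real k powr (- c)"
proof -
  have "Gamma c = of_real k * (LINT t|posm. of_real (k * t) powr (c - 1) * exp (- complex_of_real (k * t)))"
    unfolding integral_Gamma_posm[OF assms(1), symmetric]
    by (subst integral_posm_scale[OF assms(2)]) (simp add: scaleR_conv_of_real)
  also have "(LINT t|posm. of_real (k * t) powr (c - 1) * exp (- complex_of_real (k * t))) =
     (LINT t|posm. of_real k powr (c - 1) * (complex_of_real t powr (c - 1) * exp (- (of_real k * of_real t))))"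
    by (rule Bochner_Integration.integral_cong[OF refl]) (use assms(2) in \<open>simp add: powr_times_real mult_ac\<close>)
  also have "\<dots> = of_real k powr (c - 1) * (LINT t|posm. complex_of_real t powr (c - 1) * exp (- (of_real k * of_real t)))"
    by (rule integral_mult_right_zero)
  also have "of_real k * \<dots> = of_real k powr c * (LINT t|posm. complex_of_real t powr (c - 1) * exp (- (of_real k * of_real t)))"
  proof -
    have "of_real k * complex_of_real k powr (c - 1) = of_real k powr c"
      using assms(2) by (simp add: powr_diff)
    then show ?thesis by (simp only: mult.assoc[symmetric])
  qed
  finally show ?thesis using assms(2) by (simp add: powr_minus field_simps)
qed

text \<open>This is Gamma c * U(a, a - c + 1, w).\<close>

definition tricomi :: "complex \<Rightarrow> complex \<Rightarrow> complex \<Rightarrow> complex" where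
  "tricomi c a w = (LINT t|posm. of_real t powr (c - 1) * exp (- of_real t) * (w + of_real t) powr (- a))"

lemma measurable_tricomi:
  assumes "w \<notin> \<real>\<^sub>\<le>\<^sub>0"
  shows "(\<lambda>t. complex_of_real t powr (c - 1) * exp (- of_real t) * (w + of_real t) powr (- a)) \<in> borel_measurable posm"
proof (rule borel_measurable_posm_continuous_on,
      rule continuous_on_of_real_holomorphic[of "\<lambda>z. z powr (c - 1) * exp (- z) * (w + z) powr (- a)" "{z. z \<notin> \<real>\<^sub>\<le>\<^sub>0 \<and> w + z \<notin> \<real>\<^sub>\<le>\<^sub>0}"])
  show "(\<lambda>z. z powr (c - 1) * exp (- z) * (w + z) powr (- a)) holomorphic_on {z. z \<notin> \<real>\<^sub>\<le>\<^sub>0 \<and> w + z \<notin> \<real>\<^sub>\<le>\<^sub>0}"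
    by (intro holomorphic_intros) auto
  show "complex_of_real t \<in> {z. z \<notin> \<real>\<^sub>\<le>\<^sub>0 \<and> w + z \<notin> \<real>\<^sub>\<le>\<^sub>0}" if "t \<in> {0<..}" for t
    using that add_of_real_not_nonpos_Reals[OF assms, of t] by simp
qed

text \<open>The point -t lies on the cut, so its distance from w is at least the radius of a disc
  around w that avoids the cut.\<close>

lemma norm_add_of_real_ge:
  assumes "ball w r \<subseteq> - \<real>\<^sub>\<le>\<^sub>0" "t \<ge> 0"
  shows "norm (w + complex_of_real t) \<ge> r"
proof (rule ccontr)
  assume "\<not> ?thesis"
  then have "- complex_of_real t \<in> ball w r" by (simp add: dist_norm)
  with assms show False by (auto simp: complex_nonpos_Reals_iff)
qed

lemma powr_neg_le:
  assumes "0 < r" "r \<le> x" "p \<ge> 0"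
  shows "x powr (- p) \<le> r powr (- (p::real))"
  using assms by (intro powr_mono2') auto

lemma tricomi_integrand_bound:
  assumes "norm (w + complex_of_real t) \<ge> r" "r > 0" "t > 0" "Re a \<ge> 0"
  shows "norm (complex_of_real t powr (c - 1) * exp (- of_real t) * (w + of_real t) powr (- a))
     \<le> (r powr (- Re a) * exp (pi * \<bar>Im a\<bar>)) * (t powr (Re c - 1) * exp (- (1 * t)))"
proof -
  have "w + of_real t \<noteq> 0" using assms by auto
  then have "norm ((w + of_real t) powr (- a)) \<le> norm (w + of_real t) powr (- Re a) * exp (pi * \<bar>Im a\<bar>)"
    using norm_powr_complex_le[of "w + of_real t" "- a"] by simp
  also have "\<dots> \<le> r powr (- Re a) * exp (pi * \<bar>Im a\<bar>)"
    using assms by (intro mult_right_mono powr_neg_le) auto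
  finally have *: "norm ((w + of_real t) powr (- a)) \<le> r powr (- Re a) * exp (pi * \<bar>Im a\<bar>)" .
  have "norm (complex_of_real t powr (c - 1) * exp (- of_real t) * (w + of_real t) powr (- a)) =
     (t powr (Re c - 1) * exp (- t)) * norm ((w + of_real t) powr (- a))"
    using assms by (simp add: norm_mult norm_powr_of_real_pos)
  also have "\<dots> \<le> (t powr (Re c - 1) * exp (- t)) * (r powr (- Re a) * exp (pi * \<bar>Im a\<bar>))"
    by (intro mult_left_mono *) auto
  finally show ?thesis by (simp add: mult_ac)
qed

text \<open>All dependence on w sits in the power of r. With r proportional to e^t this becomes the
  decay of the confluent factor along the path of integration.\<close>

lemma norm_tricomi_le:
  assumes "\<And>t. t \<ge> 0 \<Longrightarrow> norm (w + complex_of_real t) \<ge> r" "r > 0" "Re a \<ge> 0" "Re c > 0"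
  shows "norm (tricomi c a w) \<le> r powr (- Re a) * (exp (pi * \<bar>Im a\<bar>) * (LINT t|posm. t powr (Re c - 1) * exp (- (1 * t))))"
proof -
  let ?g = "\<lambda>t. (r powr (- Re a) * exp (pi * \<bar>Im a\<bar>)) * (t powr (Re c - 1) * exp (- (1 * t)))"
  have w: "w \<notin> \<real>\<^sub>\<le>\<^sub>0"
  proof
    assume "w \<in> \<real>\<^sub>\<le>\<^sub>0"
    then have "w + complex_of_real (- Re w) = 0" "- Re w \<ge> 0"
      by (auto simp: complex_nonpos_Reals_iff complex_eq_iff)
    with assms(1)[of "- Re w"] assms(2) show False by simp
  qed
  have g: "integrable posm ?g"
    by (rule integrable_mult_right[OF integrable_Gamma_posm[OF assms(4) zero_less_one]])
  have le: "norm (complex_of_real t powr (c - 1) * exp (- of_real t) * (w + of_real t) powr (- a)) \<le> ?g t"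
    if "t \<in> space posm" for t
  proof -
    from that have t: "t > 0" by simp
    then have "norm (w + complex_of_real t) \<ge> r" using assms(1) by simp
    from tricomi_integrand_bound[OF this assms(2) t assms(3)] show ?thesis .
  qed
  have "integrable posm (\<lambda>t. complex_of_real t powr (c - 1) * exp (- of_real t) * (w + of_real t) powr (- a))"
  proof (rule Bochner_Integration.integrable_bound[OF g measurable_tricomi[OF w]], rule AE_I2)
    fix t assume "t \<in> space posm"
    then show "norm (complex_of_real t powr (c - 1) * exp (- of_real t) * (w + of_real t) powr (- a)) \<le> norm (?g t)"
      unfolding real_norm_def by (rule order.trans[OF le abs_ge_self])
  qed
  from Bochner_Integration.integral_norm_bound_integral[OF this g le]
  have "norm (tricomi c a w) \<le> (LINT t|posm. ?g t)"
    by (simp only: tricomi_def)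
  also have "\<dots> = (r powr (- Re a) * exp (pi * \<bar>Im a\<bar>)) * (LINT t|posm. t powr (Re c - 1) * exp (- (1 * t)))"
    by (rule integral_mult_right_zero)
  finally show ?thesis by (simp only: mult.assoc)
qed

lemma
  assumes w: "w \<notin> \<real>\<^sub>\<le>\<^sub>0" and c: "Re c > 0" and a: "Re a > 0"
  shows has_field_derivative_tricomi: "(tricomi c a has_field_derivative (- a * tricomi c (a + 1) w)) (at w)"
    and integrable_tricomi: "integrable posm (\<lambda>t. complex_of_real t powr (c - 1) * exp (- of_real t) * (w + of_real t) powr (- a))"
proof -
  have "open (- \<real>\<^sub>\<le>\<^sub>0 :: complex set)" by (simp add: open_Compl)
  then obtain R where R: "R > 0" "ball w R \<subseteq> - \<real>\<^sub>\<le>\<^sub>0"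
    using w openE[of "- \<real>\<^sub>\<le>\<^sub>0" w] by auto
  \<comment> \<open>Half of a radius that avoids the cut: every v within r of w then has itself
    distance at least r from the cut, so one majorant serves the whole disc.\<close>
  define r where "r = R / 2"
  have r: "r > 0" using R by (simp add: r_def)
  have slit: "v \<notin> \<real>\<^sub>\<le>\<^sub>0" if "v \<in> ball w r" for v
  proof -
    have "v \<in> ball w R" using that R(1) by (simp add: r_def)
    with R(2) show ?thesis by blast
  qed
  have low: "norm (v + complex_of_real t) \<ge> r" if "v \<in> ball w r" "t \<ge> 0" for v t
  proof (rule norm_add_of_real_ge[OF _ that(2)])
    show "ball v r \<subseteq> - \<real>\<^sub>\<le>\<^sub>0"
    proof
      fix x assume "x \<in> ball v r"
      with that(1) have "x \<in> ball w R" using dist_triangle[of w x v] by (simp add: r_def)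
      with R show "x \<in> - \<real>\<^sub>\<le>\<^sub>0" by blast
    qed
  qed
  let ?f = "\<lambda>v t. complex_of_real t powr (c - 1) * exp (- of_real t) * (v + of_real t) powr (- a)"
  let ?g = "\<lambda>t. (r powr (- Re a) * exp (pi * \<bar>Im a\<bar>)) * (t powr (Re c - 1) * exp (- (1 * t)))"
  have meas: "?f v \<in> borel_measurable posm" if "v \<in> ball w r" for v
    by (rule measurable_tricomi[OF slit[OF that]])
  have hol: "(\<lambda>v. ?f v t) holomorphic_on ball w r" if "t \<in> space posm" for t
  proof -
    have "v + of_real t \<notin> \<real>\<^sub>\<le>\<^sub>0" if "v \<in> ball w r" for v
      by (rule add_of_real_not_nonpos_Reals[OF slit[OF that]]) (use \<open>t \<in> space posm\<close> in simp)
    then show ?thesis by (intro holomorphic_intros)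
  qed
  have int: "integrable posm ?g"
    by (rule integrable_mult_right[OF integrable_Gamma_posm[OF c zero_less_one]])
  have bound: "norm (?f v t) \<le> ?g t" if "v \<in> ball w r" "t \<in> space posm" for v t
    by (rule tricomi_integrand_bound[OF low r]) (use that a in simp_all)
  from integrable_dominated[OF r meas hol int bound]
  show "integrable posm (?f w)" .
  from has_field_derivative_integral_dominated[OF r meas hol int bound]
  have "(tricomi c a has_field_derivative (LINT t|posm. deriv (\<lambda>v. ?f v t) w)) (at w)"
    by (simp add: tricomi_def[abs_def])
  also have "(LINT t|posm. deriv (\<lambda>v. ?f v t) w) =
     (LINT t|posm. - a * (complex_of_real t powr (c - 1) * exp (- of_real t) * (w + of_real t) powr (- (a + 1))))"
  proof (rule Bochner_Integration.integral_cong[OF refl])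
    fix t assume "t \<in> space posm"
    then have "w + of_real t \<notin> \<real>\<^sub>\<le>\<^sub>0" using w by (simp add: add_of_real_not_nonpos_Reals)
    then have "((\<lambda>v. (v + of_real t) powr (- a)) has_field_derivative - a * (w + of_real t) powr (- a - 1)) (at w)"
      by (auto intro!: derivative_eq_intros)
    then have "((\<lambda>v. ?f v t) has_field_derivative
       (complex_of_real t powr (c - 1) * exp (- of_real t)) * (- a * (w + of_real t) powr (- a - 1))) (at w)"
      by (rule DERIV_cmult)
    moreover have "- a - 1 = - (a + 1)" by simp
    ultimately have "((\<lambda>v. ?f v t) has_field_derivative
       - a * (complex_of_real t powr (c - 1) * exp (- of_real t) * (w + of_real t) powr (- (a + 1)))) (at w)"
      by (simp only: mult_ac)
    then show "deriv (\<lambda>v. ?f v t) w = - a * (complex_of_real t powr (c - 1) * exp (- of_real t) * (w + of_real t) powr (- (a + 1)))"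
      by (rule DERIV_imp_deriv)
  qed
  also have "\<dots> = - a * tricomi c (a + 1) w"
    unfolding tricomi_def by (rule integral_mult_right_zero)
  finally show "(tricomi c a has_field_derivative (- a * tricomi c (a + 1) w)) (at w)" .
qed

lemma holomorphic_on_tricomi:
  assumes "Re c > 0" "Re a > 0"
  shows "tricomi c a holomorphic_on - \<real>\<^sub>\<le>\<^sub>0"
proof (rule holomorphic_onI)
  fix w :: complex assume "w \<in> - \<real>\<^sub>\<le>\<^sub>0"
  then have "w \<notin> \<real>\<^sub>\<le>\<^sub>0" by simp
  from has_field_derivative_at_within[OF has_field_derivative_tricomi[OF this assms]]
  show "tricomi c a field_differentiable at w within - \<real>\<^sub>\<le>\<^sub>0"
    unfolding field_differentiable_def by (rule exI)
qed

lemma tendsto_powr_exp_at_top: "((\<lambda>t::real. t powr p * exp (- t)) \<longlongrightarrow> 0) at_top"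
proof (rule Lim_null_comparison)
  define k where "k = nat \<lceil>p\<rceil>"
  have k: "p \<le> real k" unfolding k_def by linarith
  show "\<forall>\<^sub>F t::real in at_top. norm (t powr p * exp (- t)) \<le> t ^ k / exp t"
    using eventually_ge_at_top[of "1::real"]
  proof eventually_elim
    case (elim t)
    then have "t powr p \<le> t powr (real k)" using k by (intro powr_mono) auto
    then show ?case using elim by (simp add: powr_realpow exp_minus divide_inverse)
  qed
  show "((\<lambda>t::real. t ^ k / exp t) \<longlongrightarrow> 0) at_top"
    by (rule tendsto_power_div_exp_0)
qed

lemma tendsto_powr_exp_at_0:
  assumes "p > 0"
  shows "((\<lambda>t::real. t powr p * exp (- t)) \<longlongrightarrow> 0) (at_right 0)"
proof -
  have "((\<lambda>t::real. t powr p) \<longlongrightarrow> 0) (at_right 0)"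
    using assms by (intro tendsto_zero_powrI[where b = p] tendsto_intros) (auto simp: eventually_at_filter)
  moreover have "((\<lambda>t::real. exp (- t)) \<longlongrightarrow> exp (- 0)) (at_right 0)"
    by (intro tendsto_intros)
  ultimately have "((\<lambda>t::real. t powr p * exp (- t)) \<longlongrightarrow> 0 * exp (- 0)) (at_right 0)"
    by (rule tendsto_mult)
  then show ?thesis by simp
qed

lemma ex_norm_add_of_real_ge:
  assumes "w \<notin> \<real>\<^sub>\<le>\<^sub>0"
  shows "\<exists>r>0. \<forall>t\<ge>0. norm (w + complex_of_real t) \<ge> r"
proof -
  have "open (- \<real>\<^sub>\<le>\<^sub>0 :: complex set)" by (simp add: open_Compl)
  then obtain R where R: "R > 0" "ball w R \<subseteq> - \<real>\<^sub>\<le>\<^sub>0"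
    using assms openE[of "- \<real>\<^sub>\<le>\<^sub>0" w] by auto
  then show ?thesis using norm_add_of_real_ge[OF R(2)] by blast
qed

text \<open>This is the integral over t > 0 of the derivative of t^c e^(-t) (w + t)^(-a). The
  boundary terms vanish, at 0 because Re c > 0 and at infinity because of the exponential.\<close>

lemma tricomi_integration_by_parts:
  assumes w: "w \<notin> \<real>\<^sub>\<le>\<^sub>0" and c: "Re c > 0" and a: "Re a > 0"
  shows "c * tricomi c a w = a * tricomi (c + 1) (a + 1) w + tricomi (c + 1) a w"
proof -
  let ?h = "\<lambda>c a z. z powr (c - 1) * exp (- z) * (w + z) powr (- a)"
  let ?F = "\<lambda>t. ?h (c + 1) a (complex_of_real t)"
  let ?f = "\<lambda>t. c * ?h c a (complex_of_real t) - (a * ?h (c + 1) (a + 1) (complex_of_real t) + ?h (c + 1) a (complex_of_real t))"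
  obtain r where r: "r > 0" "\<forall>t\<ge>0. norm (w + complex_of_real t) \<ge> r"
    using ex_norm_add_of_real_ge[OF w] by blast
  let ?K = "r powr (- Re a) * exp (pi * \<bar>Im a\<bar>)"
  have Fb: "norm (?F t) \<le> ?K * (t powr Re c * exp (- t))" if "t > 0" for t
    using tricomi_integrand_bound[OF r(2)[rule_format, of t] r(1) that, of a "c + 1"] that a by simp
  have I1: "integrable posm (\<lambda>t. ?h c a (complex_of_real t))"
    and I2: "integrable posm (\<lambda>t. ?h (c + 1) (a + 1) (complex_of_real t))"
    and I3: "integrable posm (\<lambda>t. ?h (c + 1) a (complex_of_real t))"
    using integrable_tricomi[OF w, of c a] integrable_tricomi[OF w, of "c + 1" "a + 1"] integrable_tricomi[OF w, of "c + 1" a] c a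
    by simp_all
  have I: "integrable posm ?f"
    by (rule Bochner_Integration.integrable_diff[OF integrable_mult_right[OF I1]
        Bochner_Integration.integrable_add[OF integrable_mult_right[OF I2] I3]])
  have ei: "einterval 0 \<infinity> = {0<..}" by (auto simp: einterval_def zero_ereal_def)
  have slit: "w + complex_of_real t \<notin> \<real>\<^sub>\<le>\<^sub>0" if "t > 0" for t
    by (rule add_of_real_not_nonpos_Reals[OF w]) (use that in simp)
  have "(LBINT t=0..\<infinity>. ?f t) = 0 - 0"
  proof (rule interval_integral_FTC_integrable)
    show "(0::ereal) < \<infinity>" by simp
    show "(?F has_vector_derivative ?f t) (at t)" if "0 < ereal t" for t
    proof (rule has_vector_derivative_real_field)
      from that have t: "t > 0" by (simp add: zero_ereal_def)
      let ?z = "complex_of_real t"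
      have z: "?z \<notin> \<real>\<^sub>\<le>\<^sub>0" "?z \<noteq> 0" using t by simp_all
      note wz = slit[OF t]
      have d1: "((\<lambda>z. z powr (c + 1 - 1)) has_field_derivative c * ?z powr (c - 1)) (at ?z)"
        using has_field_derivative_powr[OF z(1), of c] by simp
      have d2: "((\<lambda>z. exp (- z)) has_field_derivative - exp (- ?z)) (at ?z)"
        by (auto intro!: derivative_eq_intros)
      have e: "- a - 1 = - (a + 1)" by simp
      have d3: "((\<lambda>z. (w + z) powr (- a)) has_field_derivative - a * (w + ?z) powr (- (a + 1))) (at ?z)"
        unfolding e[symmetric] using wz by (auto intro!: derivative_eq_intros)
      show "(?h (c + 1) a has_field_derivative ?f t) (at ?z)"
        by (rule DERIV_cong[OF DERIV_mult'[OF DERIV_mult'[OF d1 d2] d3]]) (simp add: algebra_simps)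
    qed
    show "isCont ?f t" if "0 < ereal t" for t
    proof -
      from that have t: "t > 0" by (simp add: zero_ereal_def)
      have "continuous_on {0<..} (\<lambda>t. ?h c' a' (complex_of_real t))" for c' a'
      proof (rule continuous_on_of_real_holomorphic[of _ "{z. z \<notin> \<real>\<^sub>\<le>\<^sub>0 \<and> w + z \<notin> \<real>\<^sub>\<le>\<^sub>0}"])
        show "?h c' a' holomorphic_on {z. z \<notin> \<real>\<^sub>\<le>\<^sub>0 \<and> w + z \<notin> \<real>\<^sub>\<le>\<^sub>0}"
          by (intro holomorphic_intros) auto
        show "complex_of_real t \<in> {z. z \<notin> \<real>\<^sub>\<le>\<^sub>0 \<and> w + z \<notin> \<real>\<^sub>\<le>\<^sub>0}" if "t \<in> {0<..}" for t
          using that slit[of t] by simp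
      qed
      then have isC: "isCont (\<lambda>t. ?h c' a' (complex_of_real t)) t" for c' a'
        by (rule continuous_on_interior) (use t in \<open>simp add: interior_open\<close>)
      show ?thesis
        by (rule continuous_diff[OF continuous_mult[OF continuous_const isC]
              continuous_add[OF continuous_mult[OF continuous_const isC] isC]])
    qed
    show "set_integrable lborel (einterval 0 \<infinity>) ?f"
      using I by (simp only: ei integrable_posm)
    have lim: "((\<lambda>t. ?F t) \<longlongrightarrow> 0) G" if "((\<lambda>t. t powr Re c * exp (- t)) \<longlongrightarrow> 0) G" "\<forall>\<^sub>F t in G. t > 0" for G
    proof (rule Lim_null_comparison)
      show "\<forall>\<^sub>F t in G. norm (?F t) \<le> ?K * (t powr Re c * exp (- t))"
        using that(2) by eventually_elim (rule Fb)
      show "((\<lambda>t. ?K * (t powr Re c * exp (- t))) \<longlongrightarrow> 0) G"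
        using tendsto_mult_right_zero[OF that(1)] .
    qed
    show "((?F \<circ> real_of_ereal) \<longlongrightarrow> 0) (at_right 0)"
      unfolding zero_ereal_def ereal_tendsto_simps
      by (rule lim[OF tendsto_powr_exp_at_0[OF c]]) (simp add: eventually_at_filter)
    show "((?F \<circ> real_of_ereal) \<longlongrightarrow> 0) (at_left \<infinity>)"
      unfolding ereal_tendsto_simps
      by (rule lim[OF tendsto_powr_exp_at_top eventually_gt_at_top])
  qed
  then have "(LINT t|posm. ?f t) = 0"
    by (simp add: interval_lebesgue_integral_def ei integral_posm)
  also have "(LINT t|posm. ?f t) = c * tricomi c a w - (a * tricomi (c + 1) (a + 1) w + tricomi (c + 1) a w)"
    unfolding tricomi_def Bochner_Integration.integral_diff[OF integrable_mult_right[OF I1]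
        Bochner_Integration.integrable_add[OF integrable_mult_right[OF I2] I3]]
      Bochner_Integration.integral_add[OF integrable_mult_right[OF I2] I3] integral_mult_right_zero ..
  finally show ?thesis by simp
qed

text \<open>Split the additional factor t of the integrand as (w + t) - w.\<close>

lemma tricomi_raise:
  assumes w: "w \<notin> \<real>\<^sub>\<le>\<^sub>0" and c: "Re c > 0" and a: "Re a > 0"
  shows "tricomi (c + 1) (a + 1) w = tricomi c a w - w * tricomi c (a + 1) w"
proof -
  let ?h = "\<lambda>c a t. complex_of_real t powr (c - 1) * exp (- of_real t) * (w + of_real t) powr (- a)"
  have I: "integrable posm (?h c a)" "integrable posm (?h c (a + 1))"
    using integrable_tricomi[OF w, of c a] integrable_tricomi[OF w, of c "a + 1"] c a by simp_all
  have "tricomi (c + 1) (a + 1) w = (LINT t|posm. ?h c a t - w * ?h c (a + 1) t)"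
    unfolding tricomi_def
  proof (rule Bochner_Integration.integral_cong[OF refl])
    fix t assume "t \<in> space posm"
    then have t: "t > 0" by simp
    have "w + of_real t \<notin> \<real>\<^sub>\<le>\<^sub>0" by (rule add_of_real_not_nonpos_Reals[OF w]) (use t in simp)
    then have n: "w + of_real t \<noteq> 0" by auto
    have "(w + of_real t) powr (- a) = (w + of_real t) * (w + of_real t) powr (- (a + 1))"
    proof -
      have e: "- (a + 1) = - a - 1" by simp
      show ?thesis unfolding e using n by (simp add: powr_diff)
    qed
    moreover have "complex_of_real t powr (c + 1 - 1) = of_real t * complex_of_real t powr (c - 1)"
      using t by (simp add: powr_diff)
    ultimately show "?h (c + 1) (a + 1) t = ?h c a t - w * ?h c (a + 1) t"
      by (simp add: algebra_simps)
  qed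
  also have "\<dots> = tricomi c a w - w * tricomi c (a + 1) w"
    unfolding tricomi_def Bochner_Integration.integral_diff[OF I(1) integrable_mult_right[OF I(2)]] integral_mult_right_zero ..
  finally show ?thesis .
qed

lemma tricomi_contiguous:
  assumes "w \<notin> \<real>\<^sub>\<le>\<^sub>0" "Re c > 0" "Re a > 0"
  shows "(c - a) * tricomi c a w + a * w * tricomi c (a + 1) w = tricomi (c + 1) a w"
  using tricomi_integration_by_parts[OF assms] unfolding tricomi_raise[OF assms] by (simp add: algebra_simps)

text \<open>Each derivative raises a by one, so the three terms contain the second derivative, the
  first derivative and the function itself: this is Kummer's equation with b = 1 + a - c.\<close>

lemma tricomi_ode:
  assumes "w \<notin> \<real>\<^sub>\<le>\<^sub>0" "Re c > 0" "Re a > 0"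
  shows "w * (a * (a + 1) * tricomi c (a + 2) w) + (1 + a - c - w) * (- a * tricomi c (a + 1) w) - a * tricomi c a w = 0"
proof -
  have "(c - (a + 1)) * tricomi c (a + 1) w + (a + 1) * w * tricomi c (a + 1 + 1) w = tricomi c a w - w * tricomi c (a + 1) w"
    using tricomi_contiguous[of w c "a + 1"] tricomi_raise[OF assms] assms by simp
  then have "a * ((c - (a + 1)) * tricomi c (a + 1) w + (a + 1) * w * tricomi c (a + 1 + 1) w) = a * (tricomi c a w - w * tricomi c (a + 1) w)"
    by simp
  moreover have "a + 1 + 1 = a + 2" by simp
  ultimately show ?thesis by (simp add: algebra_simps)
qed

text \<open>At w = 0 the integrand becomes t^(c - a - 1) e^(-t), whose norm dominates the integrands
  for w > 0 since Re a \<ge> 0.\<close>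

lemma tendsto_tricomi_at_0:
  assumes "Re c > 0" "Re a \<ge> 0" "Re (c - a) > 0"
  shows "((\<lambda>x. tricomi c a (complex_of_real x)) \<longlongrightarrow> Gamma (c - a)) (at_right 0)"
proof -
  have "((\<lambda>x. tricomi c a (complex_of_real x)) \<longlongrightarrow>
     (LINT t|posm. complex_of_real t powr (c - a - 1) * exp (- (of_real 1 * of_real t)))) (at 0 within {0<..})"
    unfolding tricomi_def
  proof (rule tendsto_integral_dominated)
    show "(\<lambda>t. complex_of_real t powr (c - 1) * exp (- of_real t) * (of_real x + of_real t) powr (- a)) \<in> borel_measurable posm"
      if "x \<in> {0<..}" for x using that by (intro measurable_tricomi) simp
    show "(\<lambda>t. complex_of_real t powr (c - a - 1) * exp (- (of_real 1 * of_real t))) \<in> borel_measurable posm"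
      by (rule measurable_Gamma_posm)
    have "Re c - Re a > 0" using assms by simp
    then show "integrable posm (\<lambda>t. t powr (Re c - Re a - 1) * exp (- (1 * t)))"
      by (rule integrable_Gamma_posm) simp
    fix t assume "t \<in> space posm"
    then have t: "t > 0" by simp
    have "((\<lambda>x. complex_of_real t powr (c - 1) * exp (- of_real t) * (of_real x + of_real t) powr (- a)) \<longlongrightarrow>
       complex_of_real t powr (c - 1) * exp (- of_real t) * (of_real 0 + of_real t) powr (- a)) (at 0 within {0<..})"
      using t by (intro tendsto_intros) auto
    note L = this
    have E: "complex_of_real t powr (c - 1) * exp (- of_real t) * (of_real 0 + of_real t) powr (- a) =
        complex_of_real t powr (c - a - 1) * exp (- (of_real 1 * of_real t))"
    proof -
      have "complex_of_real t powr (c - 1) * of_real t powr (- a) = of_real t powr (c - a - 1)"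
        by (simp add: powr_add[symmetric] algebra_simps)
      then show ?thesis by (simp add: mult_ac)
    qed
    show "((\<lambda>x. complex_of_real t powr (c - 1) * exp (- of_real t) * (of_real x + of_real t) powr (- a)) \<longlongrightarrow>
       complex_of_real t powr (c - a - 1) * exp (- (of_real 1 * of_real t))) (at 0 within {0<..})"
      using L unfolding E .
    fix x :: real assume "x \<in> {0<..}"
    then have x: "x > 0" by simp
    have "norm ((complex_of_real x + of_real t) powr (- a)) = (x + t) powr (- Re a)"
      using x t norm_powr_of_real_pos[of "x + t" "- a"] by simp
    also have "\<dots> \<le> t powr (- Re a)"
      using x t assms by (intro powr_neg_le) auto
    finally have "norm (complex_of_real t powr (c - 1) * exp (- of_real t) * (of_real x + of_real t) powr (- a))
      \<le> t powr (Re c - 1) * exp (- t) * t powr (- Re a)"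
      using t by (simp add: norm_mult norm_powr_of_real_pos)
    also have "\<dots> = t powr (Re c - Re a - 1) * exp (- (1 * t))"
    proof -
      have "t powr (Re c - 1) * t powr (- Re a) = t powr (Re c - Re a - 1)"
        by (simp add: powr_add[symmetric] algebra_simps)
      then show ?thesis by (simp add: mult_ac)
    qed
    finally show "norm (complex_of_real t powr (c - 1) * exp (- of_real t) * (of_real x + of_real t) powr (- a))
      \<le> t powr (Re c - Re a - 1) * exp (- (1 * t))" .
  qed
  then show ?thesis using integral_Gamma_posm[of "c - a"] assms by simp
qed

text \<open>For Re (c - a) \<le> 0 the function may be unbounded at 0. One more power of x, moved
  into the integrand, restores domination as long as Re (c - a) > -1.\<close>

lemma tendsto_of_real_tricomi_at_0:
  assumes "Re c > 0" "Re a > 0" "Re (c - a) > - 1"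
  shows "((\<lambda>x. complex_of_real x * tricomi c a (complex_of_real x)) \<longlongrightarrow> 0) (at_right 0)"
proof -
  have "((\<lambda>x. LINT t|posm. complex_of_real x * (complex_of_real t powr (c - 1) * exp (- of_real t) * (of_real x + of_real t) powr (- a)))
      \<longlongrightarrow> (LINT t|posm. 0)) (at 0 within {0<..<1})"
  proof (rule tendsto_integral_dominated)
    show "(\<lambda>t. complex_of_real x * (complex_of_real t powr (c - 1) * exp (- of_real t) * (of_real x + of_real t) powr (- a))) \<in> borel_measurable posm"
      if "x \<in> {0<..<1}" for x using that by (intro borel_measurable_times[OF borel_measurable_const measurable_tricomi]) simp
    have p: "Re c - Re a + 1 > 0" using assms by simp
    have q: "Re c + 1 > 0" using assms by simp
    show "integrable posm (\<lambda>t. t powr (Re c - Re a + 1 - 1) * exp (- (1 * t)) +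
       (t powr (Re c - 1) * exp (- (1 * t)) + t powr (Re c + 1 - 1) * exp (- (1 * t))))"
      by (rule Bochner_Integration.integrable_add[OF integrable_Gamma_posm[OF p zero_less_one]
            Bochner_Integration.integrable_add[OF integrable_Gamma_posm[OF assms(1) zero_less_one]
              integrable_Gamma_posm[OF q zero_less_one]]])
    fix t assume "t \<in> space posm"
    then have t: "t > 0" by simp
    have "((\<lambda>x. complex_of_real x * (complex_of_real t powr (c - 1) * exp (- of_real t) * (of_real x + of_real t) powr (- a))) \<longlongrightarrow>
       of_real 0 * (complex_of_real t powr (c - 1) * exp (- of_real t) * (of_real 0 + of_real t) powr (- a))) (at 0 within {0<..<1})"
      using t by (intro tendsto_intros) auto
    then show "((\<lambda>x. complex_of_real x * (complex_of_real t powr (c - 1) * exp (- of_real t) * (of_real x + of_real t) powr (- a))) \<longlongrightarrow> 0) (at 0 within {0<..<1})"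
      by simp
    fix x :: real assume "x \<in> {0<..<1}"
    then have x: "x > 0" "x < 1" by auto
    have n: "norm ((complex_of_real x + of_real t) powr (- a)) = (x + t) powr (- Re a)"
      using x t norm_powr_of_real_pos[of "x + t" "- a"] by simp
    have "x * (x + t) powr (- Re a) \<le> (x + t) * (x + t) powr (- Re a)"
      using x t by (intro mult_right_mono) auto
    also have "\<dots> = (x + t) powr (1 - Re a)"
      using x t by (simp add: powr_diff powr_minus_divide)
    \<comment> \<open>One summand for each sign of 1 - Re a: a negative power is largest at x = 0,
      and a positive one, of exponent below 1, is at most 1 + t because x < 1.\<close>
    also have "\<dots> \<le> t powr (1 - Re a) + (1 + t)"
    proof (cases "Re a \<ge> 1")
      case True
      have "(x + t) powr (1 - Re a) \<le> t powr (1 - Re a)"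
        using True x t by (intro powr_mono2') auto
      with t show ?thesis by simp
    next
      case False
      have "(x + t) powr (1 - Re a) \<le> (1 + t) powr (1 - Re a)"
        using False x t by (intro powr_mono2) auto
      also have "\<dots> \<le> (1 + t) powr 1"
        using t assms by (intro powr_mono) auto
      finally have "(x + t) powr (1 - Re a) \<le> 1 + t" using t by simp
      moreover have "0 \<le> t powr (1 - Re a)" by simp
      ultimately show ?thesis by linarith
    qed
    finally have "(t powr (Re c - 1) * exp (- t)) * (x * (x + t) powr (- Re a)) \<le>
       (t powr (Re c - 1) * exp (- t)) * (t powr (1 - Re a) + (1 + t))"
      by (rule mult_left_mono) simp
    also have "\<dots> = t powr (Re c - Re a + 1 - 1) * exp (- (1 * t)) +
       (t powr (Re c - 1) * exp (- (1 * t)) + t powr (Re c + 1 - 1) * exp (- (1 * t)))"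
      using t by (simp add: powr_diff field_simps)
    finally show "norm (complex_of_real x * (complex_of_real t powr (c - 1) * exp (- of_real t) * (of_real x + of_real t) powr (- a)))
      \<le> t powr (Re c - Re a + 1 - 1) * exp (- (1 * t)) +
       (t powr (Re c - 1) * exp (- (1 * t)) + t powr (Re c + 1 - 1) * exp (- (1 * t)))"
      using t x unfolding norm_mult n by (simp add: norm_powr_of_real_pos mult_ac)
  qed simp
  then have "((\<lambda>x. complex_of_real x * tricomi c a (complex_of_real x)) \<longlongrightarrow> 0) (at 0 within {0<..<1})"
    unfolding tricomi_def by (simp only: integral_mult_right_zero Bochner_Integration.integral_zero)
  moreover have "at (0::real) within {0<..<1} = at_right 0"
    by (rule at_within_nhd[of _ "{-1<..<1}"]) auto
  ultimately show ?thesis by simp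
qed

section \<open>Kummer's functions\<close>

lemma fps_hypergeo_1_1_Suc:
  fixes a b :: complex
  assumes "b + of_nat n \<noteq> 0"
  shows "of_nat (Suc n) * (b + of_nat n) * fps_nth (fps_hypergeo [a] [b] 1) (Suc n) =
    (a + of_nat n) * fps_nth (fps_hypergeo [a] [b] 1) n"
proof -
  have nz: "of_nat (Suc n) \<noteq> (0::complex)" by (rule of_nat_neq_0)
  have aux: "S \<noteq> 0 \<Longrightarrow> B \<noteq> 0 \<Longrightarrow> S * B * ((p * A) / ((q * B) * (S * f))) = A * (p / (q * f))" for S B p A q f :: complex
    by simp
  have f1: "fps_nth (fps_hypergeo [a] [b] 1) (Suc n) =
      (pochhammer a n * (a + of_nat n)) / ((pochhammer b n * (b + of_nat n)) * (of_nat (Suc n) * fact n))"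
    by (simp add: pochhammer_Suc mult.assoc distrib_right)
  have f0: "fps_nth (fps_hypergeo [a] [b] 1) n = pochhammer a n / (pochhammer b n * fact n)"
    by simp
  show ?thesis unfolding f1 f0 by (rule aux[OF nz assms])
qed

lemma eval_fps_const_mult:
  fixes f :: "complex fps"
  shows "fps_conv_radius f = \<infinity> \<Longrightarrow> eval_fps (fps_const k * f) z = k * eval_fps f z"
  by (subst eval_fps_mult) simp_all

lemma add_of_nat_nonzero: "b \<notin> \<int> \<Longrightarrow> b + of_nat n \<noteq> (0::complex)"
  by (metis Ints_minus Ints_of_nat add_eq_0_iff2)

lemma add_1_not_Ints: "b \<notin> \<int> \<Longrightarrow> b + 1 \<notin> (\<int> :: complex set)"
  by (metis Ints_1 Ints_diff add_diff_cancel_right')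

lemma fps_conv_radius_hypergeo_1_1:
  fixes a b :: complex
  assumes b: "b \<notin> \<int>"
  shows "fps_conv_radius (fps_hypergeo [a] [b] 1) = \<infinity>"
  unfolding fps_conv_radius_def
proof (rule conv_radius_inftyI'')
  fix z :: complex
  let ?f = "\<lambda>n. fps_nth (fps_hypergeo [a] [b] 1) n * z ^ n"
  have "(\<lambda>n. (a + of_nat n) * z / (of_nat (Suc n) * (b + of_nat n))) \<longlonglongrightarrow> 0"
  proof -
    have i: "filterlim (\<lambda>n. of_nat n :: complex) at_infinity sequentially"
      by (rule tendsto_of_nat)
    have "(\<lambda>n. inverse (of_nat (Suc n) :: complex)) \<longlonglongrightarrow> 0"
      by (rule LIMSEQ_Suc[OF tendsto_inverse_0[THEN filterlim_compose, OF i]])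
    moreover have "(\<lambda>n. inverse (b + of_nat n)) \<longlonglongrightarrow> 0"
      by (rule tendsto_inverse_0[THEN filterlim_compose, OF tendsto_add_filterlim_at_infinity[OF tendsto_const i]])
    \<comment> \<open>The quotient of consecutive terms is written with (a + n) / (b + n) = 1 + (a -
      b) / (b + n), so that each factor has an evident limit.\<close>
    ultimately have "(\<lambda>n. inverse (of_nat (Suc n)) * z * (1 + (a - b) * inverse (b + of_nat n))) \<longlonglongrightarrow> 0 * z * (1 + (a - b) * 0)"
      by (intro tendsto_intros)
    moreover have "inverse (of_nat (Suc n)) * z * (1 + (a - b) * inverse (b + of_nat n)) = (a + of_nat n) * z / (of_nat (Suc n) * (b + of_nat n))" for n
      using add_of_nat_nonzero[OF b, of n] by (simp add: field_simps del: of_nat_Suc)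
    ultimately show ?thesis by simp
  qed
  then have "\<forall>\<^sub>F n in sequentially. norm ((a + of_nat n) * z / (of_nat (Suc n) * (b + of_nat n))) < 1/2"
    by (intro order_tendstoD(2)[OF tendsto_norm_zero]) auto
  then obtain N where N: "\<And>n. n \<ge> N \<Longrightarrow> norm ((a + of_nat n) * z / (of_nat (Suc n) * (b + of_nat n))) < 1/2"
    unfolding eventually_sequentially by blast
  show "summable ?f"
  proof (rule summable_ratio_test)
    fix n assume n: "N \<le> n"
    have "fps_nth (fps_hypergeo [a] [b] 1) (Suc n) = (a + of_nat n) / (of_nat (Suc n) * (b + of_nat n)) * fps_nth (fps_hypergeo [a] [b] 1) n"
    proof -
      have nz: "of_nat (Suc n) \<noteq> (0::complex)" by (rule of_nat_neq_0)
      have aux: "S \<noteq> 0 \<Longrightarrow> B \<noteq> 0 \<Longrightarrow> S * B * x = A * y \<Longrightarrow> x = A / (S * B) * y" for S B x A y :: complex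
        by (simp add: field_simps)
      show ?thesis
        by (rule aux[OF nz add_of_nat_nonzero[OF b] fps_hypergeo_1_1_Suc[OF add_of_nat_nonzero[OF b]]])
    qed
    then have "?f (Suc n) = ((a + of_nat n) * z / (of_nat (Suc n) * (b + of_nat n))) * ?f n"
      by simp
    then have "norm (?f (Suc n)) = norm ((a + of_nat n) * z / (of_nat (Suc n) * (b + of_nat n))) * norm (?f n)"
      by (simp only: norm_mult)
    also have "\<dots> \<le> 1/2 * norm (?f n)"
      by (intro mult_right_mono less_imp_le[OF N[OF n]]) simp
    finally show "norm (?f (Suc n)) \<le> 1/2 * norm (?f n)" .
  qed simp
qed

lemma kummer_M_0 [simp]: "kummer_M a b 0 = 1"
  by (simp add: kummer_M_def eval_fps_at_0)

lemma fps_deriv_hypergeo_1_1: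
  fixes a b :: complex
  assumes b: "b \<notin> \<int>"
  shows "fps_deriv (fps_hypergeo [a] [b] 1) = fps_const (a / b) * fps_hypergeo [a + 1] [b + 1] 1"
proof (rule fps_ext)
  fix n
  have "b \<noteq> 0" using b by auto
  have "pochhammer b (Suc n) = b * pochhammer (b + 1) n" "pochhammer a (Suc n) = a * pochhammer (a + 1) n"
    by (simp_all add: pochhammer_rec)
  moreover have "fact (Suc n) = of_nat (Suc n) * (fact n :: complex)" by simp
  moreover have nz: "of_nat (Suc n) \<noteq> (0::complex)" by (rule of_nat_neq_0)
  moreover have "S \<noteq> 0 \<Longrightarrow> S * ((a * p) / ((b * q) * (S * f))) = a / b * (p / (q * f))" for S p q f :: complex
    using \<open>b \<noteq> 0\<close> by simp
  ultimately show "fps_nth (fps_deriv (fps_hypergeo [a] [b] 1)) n = fps_nth (fps_const (a / b) * fps_hypergeo [a + 1] [b + 1] 1) n"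
    by (simp del: pochhammer_Suc of_nat_Suc fact_Suc)
qed

lemma has_field_derivative_kummer_M:
  assumes "b \<notin> \<int>"
  shows "(kummer_M a b has_field_derivative a / b * kummer_M (a + 1) (b + 1) z) (at z)"
proof -
  have b1: "b + 1 \<notin> \<int>" by (rule add_1_not_Ints[OF assms])
  have "(kummer_M a b has_field_derivative eval_fps (fps_deriv (fps_hypergeo [a] [b] 1)) z) (at z)"
    unfolding kummer_M_def[abs_def]
    by (rule has_field_derivative_eval_fps) (simp add: fps_conv_radius_hypergeo_1_1 assms)
  also have "eval_fps (fps_deriv (fps_hypergeo [a] [b] 1)) z = a / b * kummer_M (a + 1) (b + 1) z"
    unfolding fps_deriv_hypergeo_1_1[OF assms] kummer_M_def
    by (subst eval_fps_mult) (simp_all add: fps_conv_radius_hypergeo_1_1 b1)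
  finally show ?thesis .
qed

text \<open>The operator b + z d/dz multiplies the n-th coefficient by b + n, and pochhammer b n *
  (b + n) = b * pochhammer (b + 1) n turns M(a, b + 1) into b M(a, b). It is needed for the
  derivative of the second solution.\<close>

lemma kummer_M_contiguous:
  assumes b: "b \<notin> \<int>"
  shows "b * kummer_M a b z = b * kummer_M a (b + 1) z + z * (a / (b + 1) * kummer_M (a + 1) (b + 2) z)"
proof -
  have b1: "b + 1 \<notin> \<int>" by (rule add_1_not_Ints[OF b])
  have b2: "b + 2 \<notin> \<int>" using add_1_not_Ints[OF b1] by (simp add: add.assoc)
  let ?H = "fps_hypergeo [a] [b] 1" and ?G = "fps_hypergeo [a] [b + 1] 1"
  have "fps_const b * ?H = fps_const b * ?G + fps_X * fps_deriv ?G"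
  proof (rule fps_ext)
    fix n
    have p: "pochhammer b n * (b + of_nat n) = b * pochhammer (b + 1) n"
      by (metis pochhammer_Suc pochhammer_rec)
    have nz: "pochhammer b n \<noteq> 0" "pochhammer (b + 1) n \<noteq> 0"
      using add_of_nat_nonzero[OF b] add_of_nat_nonzero[OF b1]
      by (auto simp: pochhammer_eq_0_iff add_eq_0_iff2)
    have "q * B = b * q' \<Longrightarrow> q \<noteq> 0 \<Longrightarrow> q' \<noteq> 0 \<Longrightarrow> b * (x / (q * f)) = B * (x / (q' * f))" for q B q' x f :: complex
      by (simp add: divide_simps) (metis mult.commute mult.left_commute)
    from this[OF p nz, of "pochhammer a n" "fact n"]
    have "b * (pochhammer a n / (pochhammer b n * fact n)) = (b + of_nat n) * (pochhammer a n / (pochhammer (b + 1) n * fact n))" .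
    then show "fps_nth (fps_const b * ?H) n = fps_nth (fps_const b * ?G + fps_X * fps_deriv ?G) n"
      unfolding fps_mult_fps_X_deriv_shift by (simp add: ring_distribs add_divide_distrib)
  qed
  then have "eval_fps (fps_const b * ?H) z = eval_fps (fps_const b * ?G + fps_X * fps_deriv ?G) z"
    by simp
  moreover have "fps_conv_radius (fps_const b * ?G) = \<infinity>"
    using fps_conv_radius_mult[of "fps_const b" ?G] by (simp add: fps_conv_radius_hypergeo_1_1 b1)
  moreover have rd: "fps_conv_radius (fps_deriv ?G) = \<infinity>"
    using fps_conv_radius_deriv[of ?G] by (simp add: fps_conv_radius_hypergeo_1_1 b1)
  moreover have "fps_conv_radius (fps_X * fps_deriv ?G) = \<infinity>"
    using fps_conv_radius_mult[of fps_X "fps_deriv ?G"] by (simp add: rd)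
  ultimately have "b * eval_fps ?H z = b * eval_fps ?G z + z * eval_fps (fps_deriv ?G) z"
    by (simp add: eval_fps_add eval_fps_mult eval_fps_const_mult fps_conv_radius_hypergeo_1_1 b b1)
  moreover have "eval_fps (fps_deriv ?G) z = a / (b + 1) * kummer_M (a + 1) (b + 1 + 1) z"
    unfolding fps_deriv_hypergeo_1_1[OF b1] kummer_M_def
    by (rule eval_fps_const_mult[OF fps_conv_radius_hypergeo_1_1[OF add_1_not_Ints[OF b1]]])
  moreover have "b + 1 + 1 = b + 2" by simp
  ultimately show ?thesis by (simp only: kummer_M_def)
qed

text \<open>The coefficient recursion, read as an identity of formal series, is X H'' + b H' = X H'
  + a H.\<close>

lemma kummer_M_ode:
  assumes b: "b \<notin> \<int>"
  shows "z * (a / b * ((a + 1) / (b + 1) * kummer_M (a + 2) (b + 2) z)) + (b - z) * (a / b * kummer_M (a + 1) (b + 1) z) - a * kummer_M a b z = 0"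
proof -
  have b1: "b + 1 \<notin> \<int>" by (rule add_1_not_Ints[OF b])
  let ?H = "fps_hypergeo [a] [b] 1"
  let ?D = "fps_deriv ?H" and ?DD = "fps_deriv (fps_deriv ?H)"
  have rD: "fps_conv_radius ?D = \<infinity>"
    using fps_conv_radius_deriv[of ?H] by (simp add: fps_conv_radius_hypergeo_1_1 b)
  have rDD: "fps_conv_radius ?DD = \<infinity>"
    using fps_conv_radius_deriv[of ?D] by (simp add: rD)
  have "fps_X * ?DD + fps_const b * ?D = fps_X * ?D + fps_const a * ?H"
  proof (rule fps_ext)
    fix n
    show "fps_nth (fps_X * ?DD + fps_const b * ?D) n = fps_nth (fps_X * ?D + fps_const a * ?H) n"
      using fps_hypergeo_1_1_Suc[OF add_of_nat_nonzero[OF b], of n a]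
      unfolding fps_mult_fps_X_deriv_shift by (simp add: algebra_simps del: fps_hypergeo_nth)
  qed
  then have "eval_fps (fps_X * ?DD + fps_const b * ?D) z = eval_fps (fps_X * ?D + fps_const a * ?H) z" by simp
  moreover have "fps_conv_radius (fps_X * ?DD) = \<infinity>" "fps_conv_radius (fps_const b * ?D) = \<infinity>"
      "fps_conv_radius (fps_X * ?D) = \<infinity>" "fps_conv_radius (fps_const a * ?H) = \<infinity>"
    using fps_conv_radius_mult[of fps_X ?DD] fps_conv_radius_mult[of "fps_const b" ?D]
      fps_conv_radius_mult[of fps_X ?D] fps_conv_radius_mult[of "fps_const a" ?H]
    by (simp_all add: rD rDD fps_conv_radius_hypergeo_1_1 b)
  ultimately have *: "z * eval_fps ?DD z + b * eval_fps ?D z = z * eval_fps ?D z + a * eval_fps ?H z"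
    by (simp add: eval_fps_add eval_fps_mult eval_fps_const_mult rD rDD fps_conv_radius_hypergeo_1_1 b)
  have e1: "eval_fps ?D z = a / b * kummer_M (a + 1) (b + 1) z"
    unfolding fps_deriv_hypergeo_1_1[OF b] kummer_M_def
    by (rule eval_fps_const_mult[OF fps_conv_radius_hypergeo_1_1[OF b1]])
  have DD: "?DD = fps_const (a / b) * fps_deriv (fps_hypergeo [a + 1] [b + 1] 1)"
    unfolding fps_deriv_hypergeo_1_1[OF b] by simp
  have rG: "fps_conv_radius (fps_deriv (fps_hypergeo [a + 1] [b + 1] 1)) = \<infinity>"
    using fps_conv_radius_deriv[of "fps_hypergeo [a + 1] [b + 1] 1"] by (simp add: fps_conv_radius_hypergeo_1_1 b1)
  have e2: "eval_fps ?DD z = a / b * ((a + 1) / (b + 1) * kummer_M (a + 1 + 1) (b + 1 + 1) z)"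
  proof -
    have "eval_fps (fps_deriv (fps_hypergeo [a + 1] [b + 1] 1)) z = (a + 1) / (b + 1) * kummer_M (a + 1 + 1) (b + 1 + 1) z"
      unfolding fps_deriv_hypergeo_1_1[OF b1] kummer_M_def
      by (rule eval_fps_const_mult[OF fps_conv_radius_hypergeo_1_1[OF add_1_not_Ints[OF b1]]])
    then show ?thesis unfolding DD eval_fps_const_mult[OF rG] by simp
  qed
  have s: "a + 1 + 1 = a + 2" "b + 1 + 1 = b + 2" by simp_all
  have "b * D = z * D + a * H - z * E \<Longrightarrow> z * E + (b - z) * D - a * H = 0" for D H E :: complex
    by (simp add: algebra_simps)
  moreover have "b * eval_fps ?D z = z * eval_fps ?D z + a * eval_fps ?H z - z * eval_fps ?DD z"
    using * by (simp add: algebra_simps)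
  ultimately have "z * eval_fps ?DD z + (b - z) * eval_fps ?D z - a * eval_fps ?H z = 0" by blast
  then show ?thesis unfolding e1 e2 s by (simp only: kummer_M_def)
qed

text \<open>Abel's identity: the equation gives W' = (1 - b/z) W, and z^b e^(-z) is the integrating
  factor. On the connected slit plane a vanishing derivative means a constant.\<close>

lemma wronskian_constant_on:
  fixes a b :: complex
  assumes S: "S = - \<real>\<^sub>\<le>\<^sub>0"
    and f: "\<And>z. z \<in> S \<Longrightarrow> (f has_field_derivative f1 z) (at z)"
      "\<And>z. z \<in> S \<Longrightarrow> (f1 has_field_derivative f2 z) (at z)"
      "\<And>z. z \<in> S \<Longrightarrow> z * f2 z + (b - z) * f1 z - a * f z = 0"
    and g: "\<And>z. z \<in> S \<Longrightarrow> (g has_field_derivative g1 z) (at z)"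
      "\<And>z. z \<in> S \<Longrightarrow> (g1 has_field_derivative g2 z) (at z)"
      "\<And>z. z \<in> S \<Longrightarrow> z * g2 z + (b - z) * g1 z - a * g z = 0"
  shows "(\<lambda>z. (f z * g1 z - f1 z * g z) * (z powr b * exp (- z))) constant_on S"
proof (rule has_field_derivative_0_imp_constant_on)
  fix z assume z: "z \<in> S"
  then have zn: "z \<notin> \<real>\<^sub>\<le>\<^sub>0" "z \<noteq> 0" using S by auto
  have dp: "((\<lambda>z. z powr b * exp (- z)) has_field_derivative (b / z - 1) * (z powr b * exp (- z))) (at z)"
    using zn by (auto intro!: derivative_eq_intros simp: powr_diff field_simps)
  have dw: "((\<lambda>z. f z * g1 z - f1 z * g z) has_field_derivative f z * g2 z - f2 z * g z) (at z)"
    by (rule DERIV_cong[OF DERIV_diff[OF DERIV_mult'[OF f(1)[OF z] g(2)[OF z]] DERIV_mult'[OF f(2)[OF z] g(1)[OF z]]]])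
       (simp add: algebra_simps)
  have "z * f2 z = a * f z - (b - z) * f1 z" "z * g2 z = a * g z - (b - z) * g1 z"
    using f(3)[OF z] g(3)[OF z] by (simp_all add: algebra_simps)
  then have "f z * (z * g2 z) - (z * f2 z) * g z = (z - b) * (f z * g1 z - f1 z * g z)"
    by (simp only:) (simp add: algebra_simps)
  then have "z * (f z * g2 z - f2 z * g z) = z * (- (b / z - 1) * (f z * g1 z - f1 z * g z))"
    using zn(2) by (simp add: algebra_simps)
  then have D: "f z * g2 z - f2 z * g z = - (b / z - 1) * (f z * g1 z - f1 z * g z)"
    by (rule mult_left_cancel[THEN iffD1, OF zn(2)])
  have "W * (k * E) + (- k * W) * E = 0" for W k E :: complex by simp
  then show "((\<lambda>z. (f z * g1 z - f1 z * g z) * (z powr b * exp (- z))) has_field_derivative 0) (at z)"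
    by (intro DERIV_cong[OF DERIV_mult'[OF dw dp]]) (simp only: D)
next
  show "open S" by (simp add: S open_Compl)
  have "starlike (- (complex_of_real ` {..0}))"
    by (rule starlike_slotted_complex_plane_left)
  moreover have "complex_of_real ` {..0} = \<real>\<^sub>\<le>\<^sub>0"
    by (auto simp: nonpos_Reals_def)
  ultimately show "connected S" by (simp add: S starlike_imp_connected)
qed

lemma of_real_in_slit: "x > 0 \<Longrightarrow> complex_of_real x \<in> - \<real>\<^sub>\<le>\<^sub>0"
  by simp

text \<open>The value of a normalised Wronskian is read off at 0 along the positive axis, where the
  leading terms of all the solutions are known.\<close>

lemma constant_on_slit_limit:
  fixes f :: "complex \<Rightarrow> complex"
  assumes "f constant_on - \<real>\<^sub>\<le>\<^sub>0" "((\<lambda>x. f (complex_of_real x)) \<longlongrightarrow> l) (at_right 0)" "z \<notin> \<real>\<^sub>\<le>\<^sub>0"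
  shows "f z = l"
proof -
  from assms(1) obtain k where k: "\<And>z. z \<in> - \<real>\<^sub>\<le>\<^sub>0 \<Longrightarrow> f z = k"
    unfolding constant_on_def by blast
  have "\<forall>\<^sub>F x in at_right (0::real). f (complex_of_real x) = k"
    using eventually_at_right_less[of 0] by eventually_elim (rule k[OF of_real_in_slit])
  then have "((\<lambda>x. f (complex_of_real x)) \<longlongrightarrow> k) (at_right 0)"
    by (rule tendsto_eventually)
  then have "k = l" using assms(2) by (intro tendsto_unique[of "at_right (0::real)"]) auto
  with k[of z] assms(3) show ?thesis by simp
qed

lemma isCont_kummer_M: "b \<notin> \<int> \<Longrightarrow> isCont (kummer_M a b) z"
  by (rule DERIV_isCont[OF has_field_derivative_kummer_M])

lemma tendsto_of_real_at_0: "((\<lambda>x. complex_of_real x) \<longlongrightarrow> 0) (at_right 0)"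
  using tendsto_of_real[OF tendsto_ident_at, of 0 "{0<..}", where ?'a = complex] by simp

lemma tendsto_kummer_M_at_0:
  "b \<notin> \<int> \<Longrightarrow> ((\<lambda>x. kummer_M a b (complex_of_real x)) \<longlongrightarrow> 1) (at_right 0)"
  using isCont_tendsto_compose[OF isCont_kummer_M tendsto_of_real_at_0, of b a] by simp

lemma two_minus_not_Ints: "b \<notin> \<int> \<Longrightarrow> 2 - b \<notin> (\<int> :: complex set)"
  by (metis Ints_diff Ints_numeral diff_diff_eq2 add_diff_cancel_left')

text \<open>The second solution of Kummer's equation with its first two derivatives, up to a power of z.\<close>

lemma
  fixes a b c z :: complex
  assumes b: "b \<notin> \<int>" and z: "z \<notin> \<real>\<^sub>\<le>\<^sub>0" and c: "c = a - b + 1"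
  defines "g \<equiv> \<lambda>z. kummer_M c (2 - b) z"
    and "g1 \<equiv> \<lambda>z. c / (2 - b) * kummer_M (c + 1) (2 - b + 1) z"
    and "g2 \<equiv> \<lambda>z. c / (2 - b) * ((c + 1) / (2 - b + 1) * kummer_M (c + 2) (2 - b + 2) z)"
  shows has_field_derivative_kummer_second:
      "((\<lambda>z. z powr (1 - b) * g z) has_field_derivative z powr (- b) * ((1 - b) * g z + z * g1 z)) (at z)"
    and has_field_derivative_kummer_second':
      "((\<lambda>z. z powr (- b) * ((1 - b) * g z + z * g1 z)) has_field_derivative
        z powr (- b - 1) * (- b * ((1 - b) * g z + z * g1 z) + z * ((2 - b) * g1 z + z * g2 z))) (at z)"
    and kummer_second_ode:
      "z * (z powr (- b - 1) * (- b * ((1 - b) * g z + z * g1 z) + z * ((2 - b) * g1 z + z * g2 z)))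
        + (b - z) * (z powr (- b) * ((1 - b) * g z + z * g1 z)) - a * (z powr (1 - b) * g z) = 0"
proof -
  have z0: "z \<noteq> 0" using z by auto
  have b2: "2 - b \<notin> \<int>" by (rule two_minus_not_Ints[OF b])
  have b3: "2 - b + 1 \<notin> \<int>" by (rule add_1_not_Ints[OF b2])
  have dg: "(g has_field_derivative g1 z) (at z)"
    unfolding g_def g1_def by (rule has_field_derivative_kummer_M[OF b2])
  have dg1: "(g1 has_field_derivative g2 z) (at z)"
  proof -
    have s: "c + 1 + 1 = c + 2" "2 - b + 1 + 1 = 2 - b + 2" by simp_all
    show ?thesis unfolding g1_def g2_def
      using DERIV_cmult[OF has_field_derivative_kummer_M[OF b3, of "c + 1" z], of "c / (2 - b)"]
      unfolding s .
  qed
  have dp: "((\<lambda>z. z powr p) has_field_derivative p * z powr (p - 1)) (at z)" for p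
    by (rule has_field_derivative_powr[OF z])
  have p0: "z powr (1 - b) = z * z powr (- b)" "z powr (- b) = z * z powr (- b - 1)"
    using z0 by (simp_all add: powr_diff powr_minus_divide)
  have e: "1 - b - 1 = - b" by simp
  show "((\<lambda>z. z powr (1 - b) * g z) has_field_derivative z powr (- b) * ((1 - b) * g z + z * g1 z)) (at z)"
    by (rule DERIV_cong[OF DERIV_mult'[OF dp dg]]) (simp add: p0(1) e algebra_simps)
  have di: "((\<lambda>z. (1 - b) * g z + z * g1 z) has_field_derivative (2 - b) * g1 z + z * g2 z) (at z)"
    by (rule DERIV_cong[OF DERIV_add[OF DERIV_cmult[OF dg] DERIV_mult'[OF DERIV_ident dg1]]]) (simp add: algebra_simps)
  show "((\<lambda>z. z powr (- b) * ((1 - b) * g z + z * g1 z)) has_field_derivative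
        z powr (- b - 1) * (- b * ((1 - b) * g z + z * g1 z) + z * ((2 - b) * g1 z + z * g2 z))) (at z)"
    by (rule DERIV_cong[OF DERIV_mult'[OF dp di]]) (simp add: p0(2) algebra_simps)
  have ode: "z * g2 z + (2 - b - z) * g1 z - c * g z = 0"
    using kummer_M_ode[OF b2, of z c] by (simp only: g_def g1_def g2_def)
  \<comment> \<open>With P = z^(-b - 1): Kummer's operator with parameters a, b applied to z^(1 - b)
    g is z^(1 - b) times the operator with parameters c, 2 - b applied to g.\<close>
  have "z * (P * (- b * ((1 - b) * G + z * G1) + z * ((2 - b) * G1 + z * G2)))
        + (b - z) * (z * P * ((1 - b) * G + z * G1)) - a * (z * (z * P) * G)
      = z * z * P * (z * G2 + (2 - b - z) * G1 - c * G)" for P G G1 G2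
    unfolding c by (simp add: algebra_simps)
  from this[of "z powr (- b - 1)" "g z" "g1 z" "g2 z"]
  show "z * (z powr (- b - 1) * (- b * ((1 - b) * g z + z * g1 z) + z * ((2 - b) * g1 z + z * g2 z)))
        + (b - z) * (z powr (- b) * ((1 - b) * g z + z * g1 z)) - a * (z powr (1 - b) * g z) = 0"
    unfolding ode p0 by simp
qed

section \<open>Laplace representations on the positive axis\<close>

lemma tricomi_symmetric_Laplace_integrable:
  assumes "Re c > 0" "Re a > 0" "w > 0"
  shows "integrable (posm \<Otimes>\<^sub>M posm) (\<lambda>(t,x). complex_of_real t powr (c - 1) * exp (- of_real t) *
      (complex_of_real x powr (a - 1) * exp (- (of_real (w + t) * of_real x))))"
proof (rule integrable_posm_pairI[where h = "\<lambda>t. t powr (Re c - 1) * exp (- t) * (norm (Gamma (of_real (Re a)) :: complex) * (w + t) powr (- Re a))"])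
  let ?f = "\<lambda>t x. complex_of_real t powr (c - 1) * exp (- of_real t) *
      (complex_of_real x powr (a - 1) * exp (- (of_real (w + t) * of_real x)))"
  have m1: "(\<lambda>t. complex_of_real t powr (c - 1) * exp (- of_real t)) \<in> borel_measurable posm"
    using measurable_Gamma_posm[of c 1] by simp
  have m2: "(\<lambda>x. complex_of_real x powr (a - 1)) \<in> borel_measurable posm"
    using measurable_Gamma_posm[of a 0] by simp
  have m3: "(\<lambda>p. exp (- (complex_of_real (w + fst p) * of_real (snd p)))) \<in> borel_measurable (posm \<Otimes>\<^sub>M posm)"
    by (rule measurable_compose[of "\<lambda>p. - (complex_of_real (w + fst p) * of_real (snd p))" _ borel])
       (intro borel_measurable_uminus borel_measurable_times borel_measurable_exp
          measurable_compose[OF _ borel_measurable_of_real] borel_measurable_add borel_measurable_const measurable_fst_posm measurable_snd_posm | simp)+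
  have "(\<lambda>p. (complex_of_real (fst p) powr (c - 1) * exp (- of_real (fst p))) * (complex_of_real (snd p) powr (a - 1) *
       exp (- (complex_of_real (w + fst p) * of_real (snd p))))) \<in> borel_measurable (posm \<Otimes>\<^sub>M posm)"
    by (intro borel_measurable_times[OF measurable_compose[OF measurable_fst m1]
          borel_measurable_times[OF measurable_compose[OF measurable_snd m2] m3]])
  then show "(\<lambda>(t,x). ?f t x) \<in> borel_measurable (posm \<Otimes>\<^sub>M posm)"
    unfolding case_prod_unfold .
  show "integrable posm (?f t)" if t: "t > 0" for t
    using integrable_Gamma_posm_complex[OF assms(2), of "w + t"] assms(3) t
    by (intro integrable_mult_right) simp
  show "(LINT x|posm. norm (?f t x)) = t powr (Re c - 1) * exp (- t) * (norm (Gamma (of_real (Re a)) :: complex) * (w + t) powr (- Re a))"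
    if t: "t > 0" for t
  proof -
    have wt: "w + t > 0" using t assms by simp
    have "(LINT x|posm. norm (?f t x)) = (LINT x|posm. (t powr (Re c - 1) * exp (- t)) * (x powr (Re a - 1) * exp (- ((w + t) * x))))"
      by (rule Bochner_Integration.integral_cong[OF refl]) (use t in \<open>simp add: norm_mult norm_powr_of_real_pos\<close>)
    also have "\<dots> = (t powr (Re c - 1) * exp (- t)) * (LINT x|posm. x powr (Re a - 1) * exp (- ((w + t) * x)))"
      by (rule integral_mult_right_zero)
    also have "(LINT x|posm. x powr (Re a - 1) * exp (- ((w + t) * x))) = norm (Gamma (of_real (Re a)) :: complex) * (w + t) powr (- Re a)"
    proof -
      have "complex_of_real (LINT x|posm. x powr (Re a - 1) * exp (- ((w + t) * x))) =
          (LINT x|posm. complex_of_real (x powr (Re a - 1) * exp (- ((w + t) * x))))"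
        by (rule integral_of_real[symmetric], rule integrable_Gamma_posm[OF assms(2) wt])
      also have "\<dots> = (LINT x|posm. complex_of_real x powr (of_real (Re a) - 1) * exp (- (of_real (w + t) * of_real x)))"
        by (rule Bochner_Integration.integral_cong[OF refl]) (simp add: powr_of_real[symmetric] exp_of_real[symmetric])
      also have "\<dots> = Gamma (of_real (Re a)) * of_real (w + t) powr (- of_real (Re a))"
        by (rule integral_Gamma_posm_scaled) (use wt assms in auto)
      finally have *: "complex_of_real (LINT x|posm. x powr (Re a - 1) * exp (- ((w + t) * x))) = Gamma (of_real (Re a)) * of_real (w + t) powr (- of_real (Re a))" .
      \<comment> \<open>The closed form is available over the complex numbers only. A nonnegative
        integral is recovered as the norm of its complex value.\<close>
      have "0 \<le> (LINT x|posm. x powr (Re a - 1) * exp (- ((w + t) * x)))"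
        by (rule Bochner_Integration.integral_nonneg) simp
      then have "(LINT x|posm. x powr (Re a - 1) * exp (- ((w + t) * x))) = norm (complex_of_real (LINT x|posm. x powr (Re a - 1) * exp (- ((w + t) * x))))"
        by simp
      then show ?thesis unfolding * norm_mult using norm_powr_of_real_pos[OF wt, of "- of_real (Re a)"] by simp
    qed
    finally show ?thesis .
  qed
  have "integrable posm (\<lambda>t. norm (complex_of_real t powr (c - 1) * exp (- of_real t) * (of_real w + of_real t) powr (- a)))"
    using assms by (intro integrable_norm integrable_tricomi) auto
  also have "?this \<longleftrightarrow> integrable posm (\<lambda>t. t powr (Re c - 1) * exp (- t) * (w + t) powr (- Re a))"
  proof (rule Bochner_Integration.integrable_cong[OF refl])
    fix t assume "t \<in> space posm"
    then have t: "t > 0" by simp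
    then show "norm (complex_of_real t powr (c - 1) * exp (- of_real t) * (of_real w + of_real t) powr (- a)) = t powr (Re c - 1) * exp (- t) * (w + t) powr (- Re a)"
      using assms norm_powr_of_real_pos[of "w + t" "- a"] by (simp add: norm_mult norm_powr_of_real_pos)
  qed
  finally have "integrable posm (\<lambda>t. norm (Gamma (of_real (Re a)) :: complex) * (t powr (Re c - 1) * exp (- t) * (w + t) powr (- Re a)))"
    by (rule integrable_mult_right)
  then show "integrable posm (\<lambda>t. t powr (Re c - 1) * exp (- t) * (norm (Gamma (of_real (Re a)) :: complex) * (w + t) powr (- Re a)))"
    by (simp only: mult_ac)
qed

text \<open>Write Gamma a * (w + t)^(-a) as the integral of x^(a - 1) e^(-(w + t) x) over x > 0 and
  integrate over t first. The t-integral is a Gamma integral with scale 1 + x.\<close>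

lemma tricomi_Laplace:
  assumes "Re c > 0" "Re a > 0" "w > 0"
  shows "Gamma a * tricomi c a (of_real w) =
    Gamma c * (LINT x|posm. complex_of_real x powr (a - 1) * of_real (1 + x) powr (- c) * exp (- (of_real w * of_real x)))"
proof -
  let ?A = "\<lambda>t. complex_of_real t powr (c - 1) * exp (- of_real t)"
  let ?B = "\<lambda>x. complex_of_real x powr (a - 1)"
  have "Gamma a * tricomi c a (of_real w) = (LINT t|posm. Gamma a * (?A t * (of_real w + of_real t) powr (- a)))"
    unfolding tricomi_def by (rule integral_mult_right_zero[symmetric])
  also have "\<dots> = (LINT t|posm. LINT x|posm. ?A t * (?B x * exp (- (of_real (w + t) * of_real x))))"
  proof (rule Bochner_Integration.integral_cong[OF refl])
    fix t assume "t \<in> space posm"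
    then have "w + t > 0" using assms by simp
    show "Gamma a * (?A t * (of_real w + of_real t) powr (- a)) = (LINT x|posm. ?A t * (?B x * exp (- (of_real (w + t) * of_real x))))"
      unfolding integral_mult_right_zero integral_Gamma_posm_scaled[OF assms(2) \<open>w + t > 0\<close>]
      by (simp only: of_real_add mult_ac)
  qed
  also have "\<dots> = (LINT x|posm. LINT t|posm. ?A t * (?B x * exp (- (of_real (w + t) * of_real x))))"
    by (rule integrable_posm_swap(2)[OF tricomi_symmetric_Laplace_integrable[OF assms]])
  also have "\<dots> = (LINT x|posm. Gamma c * (?B x * of_real (1 + x) powr (- c) * exp (- (of_real w * of_real x))))"
  proof (rule Bochner_Integration.integral_cong[OF refl])
    fix x assume "x \<in> space posm"
    then have x: "1 + x > 0" by simp
    have "(LINT t|posm. ?A t * (?B x * exp (- (of_real (w + t) * of_real x)))) =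
        (LINT t|posm. (?B x * exp (- (of_real w * of_real x))) * (complex_of_real t powr (c - 1) * exp (- (of_real (1 + x) * of_real t))))"
    proof (rule Bochner_Integration.integral_cong[OF refl])
      fix t :: real
      have "exp (- of_real t) * exp (- (of_real (w + t) * of_real x)) = exp (- (of_real w * of_real x)) * exp (- (of_real (1 + x) * complex_of_real t))"
        unfolding exp_add[symmetric] by (simp add: algebra_simps)
      then show "?A t * (?B x * exp (- (of_real (w + t) * of_real x))) = (?B x * exp (- (of_real w * of_real x))) * (complex_of_real t powr (c - 1) * exp (- (of_real (1 + x) * of_real t)))"
        by (metis (no_types, lifting) mult.assoc mult.commute mult.left_commute)
    qed
    also have "\<dots> = (?B x * exp (- (of_real w * of_real x))) * (Gamma c * of_real (1 + x) powr (- c))"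
      unfolding integral_mult_right_zero integral_Gamma_posm_scaled[OF assms(1) x] ..
    finally show "(LINT t|posm. ?A t * (?B x * exp (- (of_real (w + t) * of_real x)))) = Gamma c * (?B x * of_real (1 + x) powr (- c) * exp (- (of_real w * of_real x)))"
      by (simp only: mult_ac)
  qed
  also have "\<dots> = Gamma c * (LINT x|posm. ?B x * of_real (1 + x) powr (- c) * exp (- (of_real w * of_real x)))"
    by (rule integral_mult_right_zero)
  finally show ?thesis .
qed

text \<open>The substitution t = w x. Compared with \<open>tricomi_Laplace\<close>, the parameters a
  and c have traded places inside the integral.\<close>

lemma tricomi_scaled:
  assumes "w > 0"
  shows "tricomi c a (of_real w) =
    of_real w powr (c - a) * (LINT x|posm. complex_of_real x powr (c - 1) * of_real (1 + x) powr (- a) * exp (- (of_real w * of_real x)))"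
proof -
  have "tricomi c a (of_real w) = of_real w * (LINT x|posm. complex_of_real (w * x) powr (c - 1) * exp (- of_real (w * x)) * (of_real w + of_real (w * x)) powr (- a))"
    unfolding tricomi_def by (subst integral_posm_scale[OF assms]) (simp only: scaleR_conv_of_real)
  also have "(LINT x|posm. complex_of_real (w * x) powr (c - 1) * exp (- of_real (w * x)) * (of_real w + of_real (w * x)) powr (- a)) =
     (LINT x|posm. (of_real w powr (c - 1) * of_real w powr (- a)) * (complex_of_real x powr (c - 1) * of_real (1 + x) powr (- a) * exp (- (of_real w * of_real x))))"
  proof (rule Bochner_Integration.integral_cong[OF refl])
    fix x assume "x \<in> space posm"
    then have x: "x > 0" by simp
    have "complex_of_real w + of_real (w * x) = of_real w * of_real (1 + x)" by (simp add: algebra_simps)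
    then have 1: "(complex_of_real w + of_real (w * x)) powr (- a) = of_real w powr (- a) * of_real (1 + x) powr (- a)"
      using x assms by (simp only: powr_times_real) (simp add: powr_times_real)
    have 2: "complex_of_real (w * x) powr (c - 1) = of_real w powr (c - 1) * of_real x powr (c - 1)"
      using x assms by (simp add: powr_times_real)
    show "complex_of_real (w * x) powr (c - 1) * exp (- of_real (w * x)) * (of_real w + of_real (w * x)) powr (- a) =
      (of_real w powr (c - 1) * of_real w powr (- a)) * (complex_of_real x powr (c - 1) * of_real (1 + x) powr (- a) * exp (- (of_real w * of_real x)))"
      unfolding 1 2 by (simp only: of_real_mult mult_ac)
  qed
  also have "\<dots> = (of_real w powr (c - 1) * of_real w powr (- a)) * (LINT x|posm. complex_of_real x powr (c - 1) * of_real (1 + x) powr (- a) * exp (- (of_real w * of_real x)))"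
    by (rule integral_mult_right_zero)
  also have "of_real w * \<dots> = of_real w powr (c - a) * (LINT x|posm. complex_of_real x powr (c - 1) * of_real (1 + x) powr (- a) * exp (- (of_real w * of_real x)))"
  proof -
    have "complex_of_real w * (of_real w powr (c - 1) * of_real w powr (- a)) = of_real w powr (c - a)"
      using assms by (simp add: powr_diff powr_minus_divide)
    then show ?thesis by (simp only: mult.assoc[symmetric])
  qed
  finally show ?thesis .
qed

text \<open>Both sides are the same Laplace integral, represented once by Fubini and once by
  scaling. This is Kummer's transformation U(a, b, w) = w^(1 - b) U(a - b + 1, 2 - b, w).\<close>

lemma tricomi_symmetric:
  assumes "Re c > 0" "Re a > 0" "w > 0"
  shows "Gamma a * of_real w powr (a - c) * tricomi c a (of_real w) = Gamma c * tricomi a c (of_real w)"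
proof -
  let ?L = "LINT x|posm. complex_of_real x powr (a - 1) * of_real (1 + x) powr (- c) * exp (- (of_real w * of_real x))"
  have "Gamma a * of_real w powr (a - c) * tricomi c a (of_real w) = of_real w powr (a - c) * (Gamma c * ?L)"
    unfolding tricomi_Laplace[OF assms, symmetric] by (simp only: mult_ac)
  also have "\<dots> = Gamma c * tricomi a c (of_real w)"
    unfolding tricomi_scaled[OF assms(3), of a c] by (simp only: mult_ac)
  finally show ?thesis .
qed

section \<open>Tricomi's function as a combination of the two Kummer solutions\<close>

lemma Re_pos_not_nonpos_Ints:
  assumes "Re z > 0"
  shows "z \<notin> \<int>\<^sub>\<le>\<^sub>0"
proof
  assume "z \<in> \<int>\<^sub>\<le>\<^sub>0"
  then obtain n where "z = of_int n" "n \<le> 0" by (rule nonpos_Ints_cases)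
  with assms show False by simp
qed

lemma Gamma_nonzero_Re_pos: "Re z > 0 \<Longrightarrow> Gamma z \<noteq> 0"
  using Re_pos_not_nonpos_Ints[of z] by (simp add: Gamma_eq_zero_iff)

text \<open>Three solutions of a second-order equation are linearly dependent, and the coefficients
  are their pairwise Wronskians \<open>K1\<close>, \<open>K2\<close>, \<open>K3\<close>. The strip 1
  \<le> Re b < 2 is where the limits at 0 below can be computed: Re b < 2 enters in
  \<open>t1\<close> and \<open>t2\<close>, Re b \<ge> 1 in \<open>t4\<close>.\<close>

lemma tricomi_eq_kummer_combination:
  assumes z: "z \<notin> \<real>\<^sub>\<le>\<^sub>0" and c: "Re c > 0" and b: "b \<notin> \<int>" "1 \<le> Re b" "Re b < 2" and a: "a = b + c - 1"
  shows "(1 - b) * tricomi c a z = Gamma (2 - b) * kummer_M a b z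
    - Gamma c * Gamma b / Gamma a * (z powr (1 - b) * kummer_M c (2 - b) z)"
proof -
  define g where "g = (\<lambda>z. kummer_M c (2 - b) z)"
  define g1 where "g1 = (\<lambda>z. c / (2 - b) * kummer_M (c + 1) (2 - b + 1) z)"
  define g2 where "g2 = (\<lambda>z. c / (2 - b) * ((c + 1) / (2 - b + 1) * kummer_M (c + 2) (2 - b + 2) z))"
  define y1 where "y1 = (\<lambda>z. z powr (- b) * ((1 - b) * g z + z * g1 z))"
  define M1 where "M1 = (\<lambda>z. a / b * kummer_M (a + 1) (b + 1) z)"
  define V1 where "V1 = (\<lambda>z. - a * tricomi c (a + 1) z)"
  have ra: "Re a > 0" using a b c by simp
  have a0: "a \<noteq> 0" using ra by auto
  have b2: "2 - b \<notin> \<int>" by (rule two_minus_not_Ints[OF b(1)])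
  have ca: "c = a - b + 1" using a by simp
  have b1: "b + 1 \<notin> \<int>" by (rule add_1_not_Ints[OF b(1)])
  have b3: "2 - b + 1 \<notin> \<int>" by (rule add_1_not_Ints[OF b2])
  have pz: "z powr (- b) * z powr b = 1" "z powr (1 - b) = z * z powr (- b)" if "z \<notin> \<real>\<^sub>\<le>\<^sub>0" for z
    using that by (auto simp: powr_minus powr_diff field_simps)

  have M: "(kummer_M a b has_field_derivative M1 z) (at z)"
       "(M1 has_field_derivative a / b * ((a + 1) / (b + 1) * kummer_M (a + 2) (b + 2) z)) (at z)"
       "z * (a / b * ((a + 1) / (b + 1) * kummer_M (a + 2) (b + 2) z)) + (b - z) * M1 z - a * kummer_M a b z = 0"
       if "z \<in> - \<real>\<^sub>\<le>\<^sub>0" for z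
  proof -
    have s: "a + 1 + 1 = a + 2" "b + 1 + 1 = b + 2" by simp_all
    show "(kummer_M a b has_field_derivative M1 z) (at z)"
      unfolding M1_def by (rule has_field_derivative_kummer_M[OF b(1)])
    show "(M1 has_field_derivative a / b * ((a + 1) / (b + 1) * kummer_M (a + 2) (b + 2) z)) (at z)"
      unfolding M1_def using DERIV_cmult[OF has_field_derivative_kummer_M[OF b1, of "a + 1" z], of "a / b"] unfolding s .
    show "z * (a / b * ((a + 1) / (b + 1) * kummer_M (a + 2) (b + 2) z)) + (b - z) * M1 z - a * kummer_M a b z = 0"
      unfolding M1_def by (rule kummer_M_ode[OF b(1)])
  qed
  have Y: "((\<lambda>z. z powr (1 - b) * g z) has_field_derivative y1 z) (at z)"
      "(y1 has_field_derivative z powr (- b - 1) * (- b * ((1 - b) * g z + z * g1 z) + z * ((2 - b) * g1 z + z * g2 z))) (at z)"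
      "z * (z powr (- b - 1) * (- b * ((1 - b) * g z + z * g1 z) + z * ((2 - b) * g1 z + z * g2 z)))
        + (b - z) * y1 z - a * (z powr (1 - b) * g z) = 0"
    if "z \<in> - \<real>\<^sub>\<le>\<^sub>0" for z
    unfolding y1_def g_def g1_def g2_def
    using has_field_derivative_kummer_second[OF b(1) _ ca] has_field_derivative_kummer_second'[OF b(1) _ ca]
      kummer_second_ode[OF b(1) _ ca] that by blast+
  have V: "(tricomi c a has_field_derivative V1 z) (at z)"
      "(V1 has_field_derivative a * (a + 1) * tricomi c (a + 2) z) (at z)"
      "z * (a * (a + 1) * tricomi c (a + 2) z) + (b - z) * V1 z - a * tricomi c a z = 0"
    if "z \<in> - \<real>\<^sub>\<le>\<^sub>0" for z
  proof -
    have zn: "z \<notin> \<real>\<^sub>\<le>\<^sub>0" using that by simp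
    show "(tricomi c a has_field_derivative V1 z) (at z)"
      unfolding V1_def by (rule has_field_derivative_tricomi[OF zn c ra])
    have s: "a + 1 + 1 = a + 2" by simp
    have ra1: "Re (a + 1) > 0" using ra by simp
    show "(V1 has_field_derivative a * (a + 1) * tricomi c (a + 2) z) (at z)"
      unfolding V1_def by (rule DERIV_cong[OF DERIV_cmult[OF has_field_derivative_tricomi[OF zn c ra1]]])
        (simp add: s algebra_simps)
    have "1 + a - c = b" using a by simp
    then show "z * (a * (a + 1) * tricomi c (a + 2) z) + (b - z) * V1 z - a * tricomi c a z = 0"
      using tricomi_ode[OF zn c ra] unfolding V1_def by simp
  qed
  have x0: "((\<lambda>x. complex_of_real x) \<longlongrightarrow> 0) (at_right 0)" by (rule tendsto_of_real_at_0)
  have ex: "((\<lambda>x. exp (- complex_of_real x)) \<longlongrightarrow> 1) (at_right 0)"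
    using tendsto_exp[OF tendsto_minus[OF x0]] by simp
  have g0: "((\<lambda>x. g (complex_of_real x)) \<longlongrightarrow> 1) (at_right 0)"
    unfolding g_def by (rule tendsto_kummer_M_at_0[OF b2])
  have g10: "((\<lambda>x. g1 (complex_of_real x)) \<longlongrightarrow> c / (2 - b) * 1) (at_right 0)"
    unfolding g1_def by (intro tendsto_mult tendsto_const tendsto_kummer_M_at_0[OF b3])
  have M0: "((\<lambda>x. kummer_M a b (complex_of_real x)) \<longlongrightarrow> 1) (at_right 0)"
    by (rule tendsto_kummer_M_at_0[OF b(1)])
  have M10: "((\<lambda>x. M1 (complex_of_real x)) \<longlongrightarrow> a / b * 1) (at_right 0)"
    unfolding M1_def by (intro tendsto_mult tendsto_const tendsto_kummer_M_at_0[OF b1])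
  have pos: "\<forall>\<^sub>F x in at_right (0::real). x > 0"
    by (rule eventually_at_right_less)

  \<comment> \<open>M and z^(b - 1) times the second solution both tend to 1 at 0, so only the
    derivative of z^(1 - b) contributes, with the factor 1 - b.\<close>
  have K1: "(kummer_M a b z * y1 z - M1 z * (z powr (1 - b) * g z)) * (z powr b * exp (- z)) = 1 - b"
  proof (rule constant_on_slit_limit[OF wronskian_constant_on[OF refl M Y] _ z])
    have "((\<lambda>x. (kummer_M a b (of_real x) * ((1 - b) * g (of_real x) + of_real x * g1 (of_real x)) - M1 (of_real x) * (of_real x * g (of_real x))) * exp (- complex_of_real x))
      \<longlongrightarrow> (1 * ((1 - b) * 1 + 0 * (c / (2 - b) * 1)) - (a / b * 1) * (0 * 1)) * 1) (at_right 0)"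
      by (intro tendsto_intros x0 ex g0 g10 M0 M10)
    then have "((\<lambda>x. (kummer_M a b (of_real x) * ((1 - b) * g (of_real x) + of_real x * g1 (of_real x)) - M1 (of_real x) * (of_real x * g (of_real x))) * exp (- complex_of_real x))
      \<longlongrightarrow> 1 - b) (at_right 0)" by simp
    then show "((\<lambda>x. (kummer_M a b (of_real x) * y1 (of_real x) - M1 (of_real x) * (of_real x powr (1 - b) * g (of_real x))) * (of_real x powr b * exp (- complex_of_real x))) \<longlongrightarrow> 1 - b) (at_right 0)"
    proof (rule Lim_transform_eventually)
      show "\<forall>\<^sub>F x in at_right 0. (kummer_M a b (of_real x) * ((1 - b) * g (of_real x) + of_real x * g1 (of_real x)) - M1 (of_real x) * (of_real x * g (of_real x))) * exp (- complex_of_real x)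
        = (kummer_M a b (of_real x) * y1 (of_real x) - M1 (of_real x) * (of_real x powr (1 - b) * g (of_real x))) * (of_real x powr b * exp (- complex_of_real x))"
        using pos
      proof eventually_elim
        fix x :: real assume "x > 0"
        then have zn: "complex_of_real x \<notin> \<real>\<^sub>\<le>\<^sub>0" by simp
        have "(K * A - M * (zz * G)) * E = (K * (P * A) - M * ((zz * P) * G)) * (Q * E)" if "P * Q = 1" for K A M zz G E P Q :: complex
        proof -
          have "(K * (P * A) - M * ((zz * P) * G)) * (Q * E) = (P * Q) * ((K * A - M * (zz * G)) * E)" by (simp add: algebra_simps)
          then show ?thesis by (simp only: that mult_1_left)
        qed
        from this[OF pz(1)[OF zn]]
        show "(kummer_M a b (of_real x) * ((1 - b) * g (of_real x) + of_real x * g1 (of_real x)) - M1 (of_real x) * (of_real x * g (of_real x))) * exp (- complex_of_real x)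
        = (kummer_M a b (of_real x) * y1 (of_real x) - M1 (of_real x) * (of_real x powr (1 - b) * g (of_real x))) * (of_real x powr b * exp (- complex_of_real x))"
          unfolding y1_def pz(2)[OF zn] .
      qed
    qed
  qed

  have rc1: "Re (c + 1) > 0" using c by simp
  have cma: "c - a = 1 - b" using a by simp
  have t1: "((\<lambda>x. tricomi (c + 1) a (complex_of_real x)) \<longlongrightarrow> Gamma (2 - b)) (at_right 0)"
    using tendsto_tricomi_at_0[OF rc1, of a] ra a b by (simp add: add.commute diff_add_eq)
  have t2: "((\<lambda>x. complex_of_real x * tricomi c a (complex_of_real x)) \<longlongrightarrow> 0) (at_right 0)"
    by (rule tendsto_of_real_tricomi_at_0[OF c ra]) (use a b in simp)
  \<comment> \<open>The function V may be unbounded at 0, but it enters with its derivative in the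
    combination (c - a) V + a z V(a + 1). By the contiguous relation this is the function with c +
    1, which has the limit \<open>t1\<close>.\<close>
  have K2: "(tricomi c a z * y1 z - V1 z * (z powr (1 - b) * g z)) * (z powr b * exp (- z)) = Gamma (2 - b)"
  proof (rule constant_on_slit_limit[OF wronskian_constant_on[OF refl V Y] _ z])
    have "((\<lambda>x. (g (of_real x) * tricomi (c + 1) a (of_real x) + (of_real x * tricomi c a (of_real x)) * g1 (of_real x)) * exp (- complex_of_real x))
      \<longlongrightarrow> (1 * Gamma (2 - b) + 0 * (c / (2 - b) * 1)) * 1) (at_right 0)"
      by (intro tendsto_intros ex g0 g10 t1 t2)
    then have "((\<lambda>x. (g (of_real x) * tricomi (c + 1) a (of_real x) + (of_real x * tricomi c a (of_real x)) * g1 (of_real x)) * exp (- complex_of_real x))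
      \<longlongrightarrow> Gamma (2 - b)) (at_right 0)" by simp
    then show "((\<lambda>x. (tricomi c a (of_real x) * y1 (of_real x) - V1 (of_real x) * (of_real x powr (1 - b) * g (of_real x))) * (of_real x powr b * exp (- complex_of_real x))) \<longlongrightarrow> Gamma (2 - b)) (at_right 0)"
    proof (rule Lim_transform_eventually)
      show "\<forall>\<^sub>F x in at_right 0. (g (of_real x) * tricomi (c + 1) a (of_real x) + (of_real x * tricomi c a (of_real x)) * g1 (of_real x)) * exp (- complex_of_real x)
        = (tricomi c a (of_real x) * y1 (of_real x) - V1 (of_real x) * (of_real x powr (1 - b) * g (of_real x))) * (of_real x powr b * exp (- complex_of_real x))"
        using pos
      proof eventually_elim
        fix x :: real assume "x > 0"
        then have zn: "complex_of_real x \<notin> \<real>\<^sub>\<le>\<^sub>0" by simp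
        have "(G * ((1 - b) * V + a * zz * W) + (zz * V) * G1) * E = (V * (P * ((1 - b) * G + zz * G1)) - (- a * W) * ((zz * P) * G)) * (Q * E)"
          if "P * Q = 1" for G V zz W G1 E P Q :: complex
        proof -
          have "(V * (P * ((1 - b) * G + zz * G1)) - (- a * W) * ((zz * P) * G)) * (Q * E) = (P * Q) * ((G * ((1 - b) * V + a * zz * W) + (zz * V) * G1) * E)"
            by (simp add: algebra_simps)
          then show ?thesis by (simp only: that mult_1_left)
        qed
        from this[OF pz(1)[OF zn]]
        show "(g (of_real x) * tricomi (c + 1) a (of_real x) + (of_real x * tricomi c a (of_real x)) * g1 (of_real x)) * exp (- complex_of_real x)
        = (tricomi c a (of_real x) * y1 (of_real x) - V1 (of_real x) * (of_real x powr (1 - b) * g (of_real x))) * (of_real x powr b * exp (- complex_of_real x))"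
          unfolding y1_def V1_def pz(2)[OF zn] tricomi_contiguous[OF zn c ra, symmetric] cma .
      qed
    qed
  qed

  \<comment> \<open>The derivative of V is too singular at 0 for a majorant. Kummer's transformation
    replaces x^b V(a + 1) by the function with exchanged parameters, which has a finite limit
    there.\<close>
  have t3: "((\<lambda>x. complex_of_real x powr b * tricomi c (a + 1) (complex_of_real x)) \<longlongrightarrow> Gamma c / Gamma (a + 1) * Gamma b) (at_right 0)"
  proof -
    have ra1: "Re (a + 1) > 0" using ra by simp
    have G: "Gamma (a + 1) \<noteq> 0" by (rule Gamma_nonzero_Re_pos[OF ra1])
    have "((\<lambda>x. Gamma c / Gamma (a + 1) * tricomi (a + 1) c (complex_of_real x)) \<longlongrightarrow> Gamma c / Gamma (a + 1) * Gamma b) (at_right 0)"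
      using tendsto_tricomi_at_0[OF ra1, of c] c a b by (intro tendsto_mult tendsto_const) (simp add: algebra_simps)
    then show ?thesis
    proof (rule Lim_transform_eventually)
      have e: "a + 1 - c = b" using a by simp
      show "\<forall>\<^sub>F x in at_right 0. Gamma c / Gamma (a + 1) * tricomi (a + 1) c (complex_of_real x) = complex_of_real x powr b * tricomi c (a + 1) (complex_of_real x)"
        using pos
      proof eventually_elim
        fix x :: real assume "x > 0"
        from tricomi_symmetric[OF c ra1 this] G
        show "Gamma c / Gamma (a + 1) * tricomi (a + 1) c (complex_of_real x) = complex_of_real x powr b * tricomi c (a + 1) (complex_of_real x)"
          unfolding e by (simp add: field_simps)
      qed
    qed
  qed
  \<comment> \<open>For x < 1 and Re b \<ge> 1 the power x^b is at most x in norm, which reduces the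
    claim to \<open>t2\<close>.\<close>
  have t4: "((\<lambda>x. complex_of_real x powr b * tricomi c a (complex_of_real x)) \<longlongrightarrow> 0) (at_right 0)"
  proof (rule Lim_null_comparison)
    show "((\<lambda>x. norm (complex_of_real x * tricomi c a (complex_of_real x))) \<longlongrightarrow> 0) (at_right 0)"
      by (rule tendsto_norm_zero[OF t2])
    have "\<forall>\<^sub>F x in at_right (0::real). x < 1"
      by (rule eventually_at_right_real[THEN eventually_mono, of 0 1]) auto
    with pos show "\<forall>\<^sub>F x in at_right 0. norm (complex_of_real x powr b * tricomi c a (complex_of_real x)) \<le> norm (complex_of_real x * tricomi c a (complex_of_real x))"
    proof eventually_elim
      fix x :: real assume x: "x > 0" "x < 1"
      have "x powr Re b \<le> x powr 1" using x b by (intro powr_mono') auto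
      then have "x powr Re b * norm (tricomi c a (complex_of_real x)) \<le> x * norm (tricomi c a (complex_of_real x))"
        using x by (intro mult_right_mono) auto
      then show "norm (complex_of_real x powr b * tricomi c a (complex_of_real x)) \<le> norm (complex_of_real x * tricomi c a (complex_of_real x))"
        using x by (simp add: norm_mult norm_powr_of_real_pos)
    qed
  qed
  have K3: "(tricomi c a z * M1 z - V1 z * kummer_M a b z) * (z powr b * exp (- z)) = Gamma c * Gamma b / Gamma a"
  proof (rule constant_on_slit_limit[OF wronskian_constant_on[OF refl V M] _ z])
    have "((\<lambda>x. ((of_real x powr b * tricomi c a (of_real x)) * M1 (of_real x) + a * (of_real x powr b * tricomi c (a + 1) (of_real x)) * kummer_M a b (of_real x)) * exp (- complex_of_real x))
      \<longlongrightarrow> (0 * (a / b * 1) + a * (Gamma c / Gamma (a + 1) * Gamma b) * 1) * 1) (at_right 0)"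
      by (intro tendsto_intros ex M0 M10 t3 t4)
    moreover have "(0 * (a / b * 1) + a * (Gamma c / Gamma (a + 1) * Gamma b) * 1) * 1 = Gamma c * Gamma b / Gamma a"
      using Gamma_plus1[OF Re_pos_not_nonpos_Ints[OF ra]] a0 by simp
    moreover have "((of_real x powr b * tricomi c a (of_real x)) * M1 (of_real x) + a * (of_real x powr b * tricomi c (a + 1) (of_real x)) * kummer_M a b (of_real x)) * exp (- complex_of_real x) =
       (tricomi c a (of_real x) * M1 (of_real x) - V1 (of_real x) * kummer_M a b (of_real x)) * (of_real x powr b * exp (- complex_of_real x))" for x
      unfolding V1_def by (simp add: algebra_simps)
    ultimately show "((\<lambda>x. (tricomi c a (of_real x) * M1 (of_real x) - V1 (of_real x) * kummer_M a b (of_real x)) * (of_real x powr b * exp (- complex_of_real x))) \<longlongrightarrow> Gamma c * Gamma b / Gamma a) (at_right 0)"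
      by simp
  qed
  \<comment> \<open>The linear dependence in explicit form: the products without a Wronskian cancel,
    so inserting the three constants solves for V.\<close>
  have "v * ((m * y' - m' * y) * E) = m * ((v * y' - v' * y) * E) - y * ((v * m' - v' * m) * E)" for v m y v' m' y' E :: complex
    by (simp add: algebra_simps)
  from this[of "tricomi c a z" "kummer_M a b z" "y1 z" "M1 z" "z powr (1 - b) * g z" "z powr b * exp (- z)" "V1 z"]
  have "tricomi c a z * (1 - b) = kummer_M a b z * Gamma (2 - b) - z powr (1 - b) * g z * (Gamma c * Gamma b / Gamma a)"
    unfolding K1 K2 K3 .
  then show ?thesis unfolding g_def by (simp add: mult_ac)
qed

section \<open>From the strip to all b with real part greater than 1\<close>

lemma minus_not_Ints: "b \<notin> \<int> \<Longrightarrow> - b \<notin> (\<int> :: complex set)"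
  by (metis Ints_minus minus_minus)

lemma minus_1_not_Ints: "b \<notin> \<int> \<Longrightarrow> b - 1 \<notin> (\<int> :: complex set)"
  by (metis Ints_1 Ints_add diff_add_cancel)

lemma tricomi_eq_kummer_U_strip:
  assumes z: "z \<notin> \<real>\<^sub>\<le>\<^sub>0" and c: "Re c > 0" and b: "b \<notin> \<int>" "1 \<le> Re b" "Re b < 2" and a: "a = b + c - 1"
  shows "tricomi c a z = Gamma c * kummer_U_nonint a b z"
proof -
  have b1: "1 - b \<noteq> 0" using b(1) by auto
  have nz: "1 - b \<notin> \<int>" "b - 1 \<notin> \<int>"
    using b(1) by (metis Ints_1 Ints_diff diff_diff_eq2 add_diff_cancel_left', metis Ints_1 Ints_add diff_add_cancel)
  have "Gamma ((1 - b) + 1) = (1 - b) * Gamma (1 - b)"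
    using nz nonpos_Ints_subset_Ints by (intro Gamma_plus1) auto
  then have g2: "Gamma (2 - b) = (1 - b) * Gamma (1 - b)" by simp
  have "Gamma ((b - 1) + 1) = (b - 1) * Gamma (b - 1)"
    using nz nonpos_Ints_subset_Ints by (intro Gamma_plus1) auto
  then have gb: "Gamma b = - (1 - b) * Gamma (b - 1)" by simp
  have cc: "a - b + 1 = c" using a by simp
  have rc: "rGamma c = inverse (Gamma c)" "rGamma a = inverse (Gamma a)"
    by (simp_all add: rGamma_inverse_Gamma)
  have "(1 - b) * tricomi c a z = (1 - b) * (Gamma (1 - b) * kummer_M a b z + Gamma c * Gamma (b - 1) / Gamma a * (z powr (1 - b) * kummer_M c (2 - b) z))"
    unfolding tricomi_eq_kummer_combination[OF assms] g2 gb by (simp add: algebra_simps add_divide_distrib diff_divide_distrib)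
  then have "tricomi c a z = Gamma (1 - b) * kummer_M a b z + Gamma c * Gamma (b - 1) / Gamma a * (z powr (1 - b) * kummer_M c (2 - b) z)"
    using b1 by (simp only: mult_left_cancel simp_thms)
  also have "\<dots> = Gamma c * kummer_U_nonint a b z"
    unfolding kummer_U_nonint_def cc rc using Gamma_nonzero_Re_pos[OF c] by (simp add: field_simps)
  finally show ?thesis .
qed

text \<open>In the second solution the derivative is collected by
  \<open>kummer_M_contiguous\<close>, and the Gamma factors follow by recursion. The rule is the
  same as for the integral representation, so an identity between the two can be
  differentiated.\<close>

lemma kummer_U_nonint_deriv:
  assumes z: "z \<notin> \<real>\<^sub>\<le>\<^sub>0" and b: "b \<notin> \<int>" and a: "Re a > 0"
  shows "(kummer_U_nonint a b has_field_derivative - a * kummer_U_nonint (a + 1) (b + 1) z) (at z)"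
proof -
  let ?c = "a - b + 1"
  have b2: "2 - b \<notin> \<int>" by (rule two_minus_not_Ints[OF b])
  have b1: "1 - b \<notin> \<int>" using b by (metis Ints_1 Ints_diff diff_diff_eq2 add_diff_cancel_left')
  have b0: "b \<noteq> 0" "1 - b \<noteq> 0" using b b1 by auto
  have "((\<lambda>z. z powr (1 - b) * kummer_M ?c (2 - b) z) has_field_derivative
      z powr (- b) * ((1 - b) * kummer_M ?c (2 - b) z + z * (?c / (2 - b) * kummer_M (?c + 1) (2 - b + 1) z))) (at z)"
    by (rule has_field_derivative_kummer_second[OF b z refl])
  moreover have "(1 - b) * kummer_M ?c (2 - b) z + z * (?c / (2 - b) * kummer_M (?c + 1) (2 - b + 1) z) = (1 - b) * kummer_M ?c (1 - b) z"
  proof -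
    have s: "1 - b + 1 = 2 - b" "1 - b + 2 = 2 - b + 1" by simp_all
    show ?thesis using kummer_M_contiguous[OF b1, of ?c z] unfolding s by simp
  qed
  ultimately have dy: "((\<lambda>z. z powr (1 - b) * kummer_M ?c (2 - b) z) has_field_derivative
      z powr (- b) * ((1 - b) * kummer_M ?c (1 - b) z)) (at z)" by simp
  have dm: "(kummer_M a b has_field_derivative a / b * kummer_M (a + 1) (b + 1) z) (at z)"
    by (rule has_field_derivative_kummer_M[OF b])
  have "Gamma (- b + 1) = - b * Gamma (- b)"
    using minus_not_Ints[OF b] nonpos_Ints_subset_Ints by (intro Gamma_plus1) auto
  then have g1: "Gamma (1 - b) = - b * Gamma (- b)" by simp
  have "Gamma (b - 1 + 1) = (b - 1) * Gamma (b - 1)"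
    using minus_1_not_Ints[OF b] nonpos_Ints_subset_Ints by (intro Gamma_plus1) auto
  then have g2: "Gamma b = - (1 - b) * Gamma (b - 1)" by simp
  have g3: "rGamma a = a * rGamma (a + 1)" by (simp add: rGamma_plus1)
  have e: "a + 1 - (b + 1) + 1 = ?c" "1 - (b + 1) = - b" "b + 1 - 1 = b" "2 - (b + 1) = 1 - b" by simp_all
  have "((\<lambda>z. Gamma (1 - b) * rGamma ?c * kummer_M a b z + Gamma (b - 1) * rGamma a * (z powr (1 - b) * kummer_M ?c (2 - b) z)) has_field_derivative
      Gamma (1 - b) * rGamma ?c * (a / b * kummer_M (a + 1) (b + 1) z) + Gamma (b - 1) * rGamma a * (z powr (- b) * ((1 - b) * kummer_M ?c (1 - b) z))) (at z)"
    by (rule DERIV_add[OF DERIV_cmult[OF dm] DERIV_cmult[OF dy]])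
  also have "Gamma (1 - b) * rGamma ?c * (a / b * kummer_M (a + 1) (b + 1) z) + Gamma (b - 1) * rGamma a * (z powr (- b) * ((1 - b) * kummer_M ?c (1 - b) z))
     = - a * kummer_U_nonint (a + 1) (b + 1) z"
    unfolding kummer_U_nonint_def e g1 g2 g3 using b0 by (simp add: field_simps)
  finally show ?thesis unfolding kummer_U_nonint_def[abs_def] by (simp add: mult.assoc)
qed

text \<open>Differentiating the identity in z raises a and b by one and leaves c = a - b + 1
  unchanged. The factor - a is common to both sides and nonzero.\<close>

lemma tricomi_eq_kummer_U_nonint_aux:
  assumes c: "Re c > 0" and b: "b \<notin> \<int>" "1 \<le> Re b" "Re b < 2" and z: "z \<notin> \<real>\<^sub>\<le>\<^sub>0"
  shows "tricomi c (b + of_nat n + c - 1) z = Gamma c * kummer_U_nonint (b + of_nat n + c - 1) (b + of_nat n) z"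
  using z
proof (induction n arbitrary: z)
  case 0
  then show ?case using tricomi_eq_kummer_U_strip[OF 0 c b] by simp
next
  case (Suc n)
  let ?b = "b + of_nat n" and ?a = "b + of_nat n + c - 1"
  have ra: "Re ?a > 0" using b c by simp
  then have a0: "?a \<noteq> 0" by (metis zero_complex.sel(1) less_irrefl)
  have bn: "?b \<notin> \<int>" using b(1) by (metis Ints_diff Ints_of_nat add_diff_cancel_right')
  have "(tricomi c ?a has_field_derivative - ?a * tricomi c (?a + 1) z) (at z)"
    by (rule has_field_derivative_tricomi[OF Suc.prems c ra])
  moreover have "((\<lambda>z. Gamma c * kummer_U_nonint ?a ?b z) has_field_derivative Gamma c * (- ?a * kummer_U_nonint (?a + 1) (?b + 1) z)) (at z)"
    by (rule DERIV_cmult[OF kummer_U_nonint_deriv[OF Suc.prems bn ra]])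
  then have "(tricomi c ?a has_field_derivative Gamma c * (- ?a * kummer_U_nonint (?a + 1) (?b + 1) z)) (at z)"
  proof (rule has_field_derivative_transform_within_open[of _ _ _ "- \<real>\<^sub>\<le>\<^sub>0"])
    show "open (- \<real>\<^sub>\<le>\<^sub>0 :: complex set)" by (simp add: open_Compl)
    show "z \<in> - \<real>\<^sub>\<le>\<^sub>0" using Suc.prems by simp
    show "Gamma c * kummer_U_nonint ?a ?b x = tricomi c ?a x" if "x \<in> - \<real>\<^sub>\<le>\<^sub>0" for x
      using Suc.IH[of x] that by simp
  qed
  ultimately have "- ?a * tricomi c (?a + 1) z = Gamma c * (- ?a * kummer_U_nonint (?a + 1) (?b + 1) z)"
    by (rule DERIV_unique)
  then have "?a * tricomi c (?a + 1) z = ?a * (Gamma c * kummer_U_nonint (?a + 1) (?b + 1) z)"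
    by (simp add: mult_ac)
  then have "tricomi c (?a + 1) z = Gamma c * kummer_U_nonint (?a + 1) (?b + 1) z"
    by (rule mult_left_cancel[THEN iffD1, OF a0])
  moreover have E: "?a + 1 = b + of_nat (Suc n) + c - 1" "?b + 1 = b + of_nat (Suc n)" by simp_all
  ultimately show ?case by (simp only: E)
qed

lemma tricomi_eq_kummer_U_nonint:
  assumes z: "z \<notin> \<real>\<^sub>\<le>\<^sub>0" and "Re (a - b + 1) > 0" "b \<notin> \<int>" "1 \<le> Re b"
  shows "kummer_U_nonint a b z = tricomi (a - b + 1) a z / Gamma (a - b + 1)"
proof -
  define n where "n = nat \<lfloor>Re b - 1\<rfloor>"
  have n: "real n = of_int \<lfloor>Re b - 1\<rfloor>" using assms by (simp add: n_def)
  define b0 where "b0 = b - of_nat n"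
  have "b0 \<notin> \<int>" unfolding b0_def using assms(3) by (metis Ints_add Ints_of_nat diff_add_cancel)
  moreover have "1 \<le> Re b0" "Re b0 < 2" unfolding b0_def using n by (simp_all) linarith+
  ultimately have "tricomi (a - b + 1) (b0 + of_nat n + (a - b + 1) - 1) z
      = Gamma (a - b + 1) * kummer_U_nonint (b0 + of_nat n + (a - b + 1) - 1) (b0 + of_nat n) z"
    by (intro tricomi_eq_kummer_U_nonint_aux assms)
  then have "tricomi (a - b + 1) a z = Gamma (a - b + 1) * kummer_U_nonint a b z"
    by (simp add: b0_def)
  then show ?thesis using Gamma_nonzero_Re_pos[OF assms(2)] by simp
qed

text \<open>Continuity in c follows from complex differentiability under the integral. It is what
  identifies U at integer b, which is defined by a limit.\<close>

lemma tendsto_tricomi_parameter: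
  assumes z: "z \<notin> \<real>\<^sub>\<le>\<^sub>0" and a: "Re a > 0" and c: "Re c > 0"
  shows "((\<lambda>c. tricomi c a z) \<longlongrightarrow> tricomi c a z) (at c)"
proof -
  obtain r where r: "r > 0" "\<forall>t\<ge>0. norm (z + complex_of_real t) \<ge> r"
    using ex_norm_add_of_real_ge[OF z] by blast
  define d where "d = Re c / 2"
  have d: "d > 0" "Re c - d > 0" "Re c + d > 0" using c by (simp_all add: d_def)
  let ?K = "r powr (- Re a) * exp (pi * \<bar>Im a\<bar>)"
  \<comment> \<open>Near c the exponent of t ranges over an interval. Its lower end dominates for t
    \<le> 1 and its upper end for t > 1, and the sum covers both.\<close>
  let ?g = "\<lambda>t. ?K * (t powr (Re c - d - 1) * exp (- (1 * t)) + t powr (Re c + d - 1) * exp (- (1 * t)))"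
  have "((\<lambda>v. LINT t|posm. complex_of_real t powr (v - 1) * exp (- of_real t) * (z + of_real t) powr (- a)) has_field_derivative
      (LINT t|posm. deriv (\<lambda>v. complex_of_real t powr (v - 1) * exp (- of_real t) * (z + of_real t) powr (- a)) c)) (at c)"
  proof (rule has_field_derivative_integral_dominated[OF d(1), where g = ?g])
    show "(\<lambda>t. complex_of_real t powr (v - 1) * exp (- of_real t) * (z + of_real t) powr (- a)) \<in> borel_measurable posm" for v
      by (rule measurable_tricomi[OF z])
    show "(\<lambda>v. complex_of_real t powr (v - 1) * exp (- of_real t) * (z + of_real t) powr (- a)) holomorphic_on ball c d" if "t \<in> space posm" for t
    proof -
      have "complex_of_real t \<noteq> 0" using that by simp
      then have "(\<lambda>v. complex_of_real t powr (v - 1)) = (\<lambda>v. exp ((v - 1) * Ln (of_real t)))"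
        by (simp add: powr_def)
      then have "(\<lambda>v. complex_of_real t powr (v - 1)) holomorphic_on ball c d"
        by (simp only:) (intro holomorphic_intros)
      then show ?thesis by (intro holomorphic_on_mult holomorphic_on_const)
    qed
    show "integrable posm ?g"
      by (rule integrable_mult_right[OF Bochner_Integration.integrable_add[OF integrable_Gamma_posm[OF d(2) zero_less_one] integrable_Gamma_posm[OF d(3) zero_less_one]]])
    fix v :: complex and t :: real
    assume v: "v \<in> ball c d" and "t \<in> space posm"
    then have t: "t > 0" by simp
    have vr: "\<bar>Re v - Re c\<bar> < d" using v abs_Re_le_cmod[of "v - c"] by (simp add: dist_norm norm_minus_commute)
    have "norm (complex_of_real t powr (v - 1) * exp (- of_real t) * (z + of_real t) powr (- a)) \<le> ?K * (t powr (Re v - 1) * exp (- (1 * t)))"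
      by (rule tricomi_integrand_bound[OF r(2)[rule_format] r(1) t]) (use t a in simp_all)
    also have "t powr (Re v - 1) \<le> t powr (Re c - d - 1) + t powr (Re c + d - 1)"
    proof (cases "t \<le> 1")
      case True
      then have "t powr (Re v - 1) \<le> t powr (Re c - d - 1)" using vr t by (intro powr_mono') auto
      moreover have "0 \<le> t powr (Re c + d - 1)" by simp
      ultimately show ?thesis by linarith
    next
      case False
      then have "t powr (Re v - 1) \<le> t powr (Re c + d - 1)" using vr by (intro powr_mono) auto
      moreover have "0 \<le> t powr (Re c - d - 1)" by simp
      ultimately show ?thesis by linarith
    qed
    then have "?K * (t powr (Re v - 1) * exp (- (1 * t))) \<le> ?K * ((t powr (Re c - d - 1) + t powr (Re c + d - 1)) * exp (- (1 * t)))"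
      by (intro mult_left_mono mult_right_mono) auto
    finally show "norm (complex_of_real t powr (v - 1) * exp (- of_real t) * (z + of_real t) powr (- a)) \<le> ?g t"
      by (simp only: distrib_right)
  qed
  then have "isCont (\<lambda>c. tricomi c a z) c" unfolding tricomi_def by (rule DERIV_isCont)
  then show ?thesis by (simp add: isCont_def)
qed

text \<open>In the limit that defines U at an integer b the parameter a stays fixed, so the integral
  varies only through its first parameter a - b + 1. Close to b there is no other integer, so the
  formula for nonintegers applies on a punctured neighbourhood.\<close>

lemma kummer_U_eq_tricomi:
  assumes z: "z \<notin> \<real>\<^sub>\<le>\<^sub>0" and c: "Re (a - b + 1) > 0" and b: "Re b > 1"
  shows "kummer_U a b z = tricomi (a - b + 1) a z / Gamma (a - b + 1)"
proof (cases "b \<in> \<int>")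
  case False
  then show ?thesis using tricomi_eq_kummer_U_nonint[OF z c] b by (simp add: kummer_U_def)
next
  case True
  have ra: "Re a > 0" using c b by simp
  have "((\<lambda>\<beta>. kummer_U_nonint a \<beta> z) \<longlongrightarrow> tricomi (a - b + 1) a z / Gamma (a - b + 1)) (at b)"
  proof (rule Lim_transform_eventually)
    have cont: "isCont (\<lambda>\<beta>. tricomi (a - \<beta> + 1) a z) b"
    proof (rule isCont_o2[where g = "\<lambda>c. tricomi c a z" and f = "\<lambda>\<beta>. a - \<beta> + 1"])
      show "isCont (\<lambda>\<beta>. a - \<beta> + 1) b" by (intro continuous_intros)
      show "isCont (\<lambda>c. tricomi c a z) (a - b + 1)"
        using tendsto_tricomi_parameter[OF z ra c] by (simp add: isCont_def)
    qed
    have "isCont (\<lambda>\<beta>. Gamma (a - \<beta> + 1)) b"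
      by (intro continuous_intros Re_pos_not_nonpos_Ints c)
    from tendsto_divide[OF cont[unfolded isCont_def] this[unfolded isCont_def] Gamma_nonzero_Re_pos[OF c]]
    show "((\<lambda>\<beta>. tricomi (a - \<beta> + 1) a z / Gamma (a - \<beta> + 1)) \<longlongrightarrow> tricomi (a - b + 1) a z / Gamma (a - b + 1)) (at b)" .
    have o: "open {\<beta>::complex. Re \<beta> > 1 \<and> Re (a - \<beta> + 1) > 0}"
      by (intro open_Collect_conj open_Collect_less continuous_intros)
    have "\<forall>\<^sub>F \<beta> in at b. \<beta> \<in> {\<beta>::complex. Re \<beta> > 1 \<and> Re (a - \<beta> + 1) > 0}"
      using b c by (intro eventually_at_in_open' o) auto
    moreover have "\<forall>\<^sub>F \<beta> in at b. \<beta> \<notin> \<int>"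
    proof -
      have "\<forall>\<^sub>F \<beta> in at b. \<beta> \<in> - (\<int> - {b})"
        by (intro eventually_at_in_open' open_Compl closed_subset_Ints) auto
      moreover have "\<forall>\<^sub>F \<beta> in at b. \<beta> \<noteq> b" by (rule eventually_neq_at_within)
      ultimately show ?thesis by eventually_elim auto
    qed
    ultimately show "\<forall>\<^sub>F \<beta> in at b. tricomi (a - \<beta> + 1) a z / Gamma (a - \<beta> + 1) = kummer_U_nonint a \<beta> z"
      by eventually_elim (rule tricomi_eq_kummer_U_nonint[OF z, symmetric], auto)
  qed
  then show ?thesis unfolding kummer_U_def using True by (simp add: tendsto_Lim)
qed

text \<open>Here b = \<alpha> + 1 and a - b + 1 = \<gamma> + 1, so the two assumptions on real parts
  are exactly Re b > 1 and convergence at t = 0.\<close>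

lemma laguerre_N_eq_tricomi:
  assumes z: "z \<notin> \<real>\<^sub>\<ge>\<^sub>0" and \<alpha>: "Re \<alpha> > 0" and \<gamma>: "Re \<gamma> > -1"
  shows "laguerre_N \<gamma> \<alpha> z = 1 / 2 * Gamma (\<alpha> + \<gamma> + 1) / Gamma (\<gamma> + 1) * exp z * tricomi (\<gamma> + 1) (\<alpha> + \<gamma> + 1) (- z)"
proof -
  have zn: "- z \<notin> \<real>\<^sub>\<le>\<^sub>0" using z by (auto simp: complex_nonpos_Reals_iff complex_nonneg_Reals_iff)
  have e: "\<alpha> + \<gamma> + 1 - (\<alpha> + 1) + 1 = \<gamma> + 1" by simp
  have "kummer_U (\<alpha> + \<gamma> + 1) (\<alpha> + 1) (- z) = tricomi (\<gamma> + 1) (\<alpha> + \<gamma> + 1) (- z) / Gamma (\<gamma> + 1)"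
    using kummer_U_eq_tricomi[OF zn, of "\<alpha> + \<gamma> + 1" "\<alpha> + 1"] \<alpha> \<gamma> unfolding e by simp
  then show ?thesis by (simp add: laguerre_N_def)
qed

section \<open>The entire part of the modified Bessel function\<close>

definition bes_fps :: "complex \<Rightarrow> complex fps" where
  "bes_fps \<alpha> = Abs_fps (\<lambda>k. rGamma (\<alpha> + 1/2 + of_nat k) / (fact k * 4 ^ k))"

text \<open>This is (x/2)^(1/2 - \<alpha>) times the modified Bessel function of order \<alpha> -
  1/2. As a power series in x^2 it is even and free of branches.\<close>

definition bes :: "complex \<Rightarrow> complex \<Rightarrow> complex" where
  "bes \<alpha> x = eval_fps (bes_fps \<alpha>) (x\<^sup>2)"

lemma bes_fps_Suc:
  "4 * of_nat (Suc n) * (\<alpha> + 1/2 + of_nat n) * fps_nth (bes_fps \<alpha>) (Suc n) = fps_nth (bes_fps \<alpha>) n"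
proof -
  have nz: "of_nat (Suc n) \<noteq> (0::complex)" by (rule of_nat_neq_0)
  have g: "rGamma (\<alpha> + 1/2 + of_nat n) = (\<alpha> + 1/2 + of_nat n) * rGamma (\<alpha> + 1/2 + of_nat (Suc n))"
    using rGamma_plus1[of "\<alpha> + 1/2 + of_nat n"] by (simp add: add_ac)
  have f: "fact (Suc n) * (4::complex) ^ Suc n = (of_nat (Suc n) * 4) * (fact n * 4 ^ n)" by (simp del: of_nat_Suc)
  have "S \<noteq> 0 \<Longrightarrow> 4 * S * A * (r / (S * 4 * p)) = A * r / p" for S A r p :: complex by simp
  from this[OF nz] show ?thesis
    unfolding bes_fps_def fps_nth_Abs_fps f g by blast
qed

lemma fps_conv_radius_bes_fps:
  assumes \<alpha>: "Re \<alpha> > 0"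
  shows "fps_conv_radius (bes_fps \<alpha>) = \<infinity>"
  unfolding fps_conv_radius_def
proof (rule conv_radius_inftyI'')
  fix z :: complex
  let ?f = "\<lambda>n. fps_nth (bes_fps \<alpha>) n * z ^ n"
  obtain N where N: "real N \<ge> norm z" using real_arch_simple by blast
  show "summable ?f"
  proof (rule summable_ratio_test[of "1/2" N])
    fix n assume n: "N \<le> n"
    let ?d = "4 * of_nat (Suc n) * (\<alpha> + 1/2 + of_nat n)"
    have "1/2 \<le> Re (\<alpha> + 1/2 + of_nat n)" using \<alpha> by simp
    also have "\<dots> \<le> norm (\<alpha> + 1/2 + of_nat n)" by (rule complex_Re_le_cmod)
    finally have "real (Suc n) * 4 * (1/2) \<le> real (Suc n) * 4 * norm (\<alpha> + 1/2 + of_nat n)"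
      by (intro mult_left_mono) auto
    also have "\<dots> = norm ?d" by (simp add: norm_mult del: of_nat_Suc)
    finally have d: "2 * norm z \<le> norm ?d" using N n by simp
    have "norm (?f n) * norm z = norm (?d * ?f (Suc n))"
      unfolding bes_fps_Suc[symmetric, of \<alpha> n] by (simp add: norm_mult mult_ac del: of_nat_Suc)
    also have "\<dots> = norm ?d * norm (?f (Suc n))" by (rule norm_mult)
    finally have eq: "norm (?f n) * norm z = norm ?d * norm (?f (Suc n))" .
    show "norm (?f (Suc n)) \<le> 1/2 * norm (?f n)"
    proof (cases "z = 0")
      case False
      then have z: "norm z > 0" by simp
      have "2 * norm z * norm (?f (Suc n)) \<le> norm (?f n) * norm z"
        unfolding eq by (rule mult_right_mono[OF d]) simp
      then have "(2 * norm (?f (Suc n))) * norm z \<le> norm (?f n) * norm z"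
        by (simp only: mult_ac)
      then have "2 * norm (?f (Suc n)) \<le> norm (?f n)" by (rule mult_right_le_imp_le[OF _ z])
      then show ?thesis by simp
    qed simp
  qed simp
qed

definition bes1 :: "complex \<Rightarrow> complex \<Rightarrow> complex" where
  "bes1 \<alpha> x = 2 * x * eval_fps (fps_deriv (bes_fps \<alpha>)) (x\<^sup>2)"

definition bes2 :: "complex \<Rightarrow> complex \<Rightarrow> complex" where
  "bes2 \<alpha> x = 2 * eval_fps (fps_deriv (bes_fps \<alpha>)) (x\<^sup>2) + 4 * x\<^sup>2 * eval_fps (fps_deriv (fps_deriv (bes_fps \<alpha>))) (x\<^sup>2)"

context
  fixes \<alpha> :: complex
  assumes \<alpha>: "Re \<alpha> > 0"
begin

lemma bes_radii:
  "fps_conv_radius (bes_fps \<alpha>) = \<infinity>" "fps_conv_radius (fps_deriv (bes_fps \<alpha>)) = \<infinity>"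
  "fps_conv_radius (fps_deriv (fps_deriv (bes_fps \<alpha>))) = \<infinity>"
proof -
  show 1: "fps_conv_radius (bes_fps \<alpha>) = \<infinity>" by (rule fps_conv_radius_bes_fps[OF \<alpha>])
  show 2: "fps_conv_radius (fps_deriv (bes_fps \<alpha>)) = \<infinity>"
    using fps_conv_radius_deriv[of "bes_fps \<alpha>"] by (simp add: 1)
  show "fps_conv_radius (fps_deriv (fps_deriv (bes_fps \<alpha>))) = \<infinity>"
    using fps_conv_radius_deriv[of "fps_deriv (bes_fps \<alpha>)"] by (simp add: 2)
qed

lemma has_field_derivative_bes: "(bes \<alpha> has_field_derivative bes1 \<alpha> x) (at x)"
proof -
  have sq: "((\<lambda>x. x\<^sup>2) has_field_derivative 2 * x) (at x)" for x :: complex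
    by (auto intro!: derivative_eq_intros)
  have "(eval_fps (bes_fps \<alpha>) has_field_derivative eval_fps (fps_deriv (bes_fps \<alpha>)) (x\<^sup>2)) (at (x\<^sup>2))"
    by (rule has_field_derivative_eval_fps) (simp add: bes_radii)
  from DERIV_chain2[OF this sq] show ?thesis
    by (simp add: bes_def[abs_def] bes1_def mult_ac)
qed

lemma has_field_derivative_bes1: "(bes1 \<alpha> has_field_derivative bes2 \<alpha> x) (at x)"
proof -
  have sq: "((\<lambda>x. x\<^sup>2) has_field_derivative 2 * x) (at x)" for x :: complex
    by (auto intro!: derivative_eq_intros)
  have l: "((\<lambda>x. 2 * x) has_field_derivative 2) (at x)" for x :: complex
    by (auto intro!: derivative_eq_intros)
  have "(eval_fps (fps_deriv (bes_fps \<alpha>)) has_field_derivative eval_fps (fps_deriv (fps_deriv (bes_fps \<alpha>))) (x\<^sup>2)) (at (x\<^sup>2))"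
    by (rule has_field_derivative_eval_fps) (simp add: bes_radii)
  from DERIV_mult'[OF l DERIV_chain2[OF this sq]] show ?thesis
    unfolding bes1_def[abs_def] bes2_def by (rule DERIV_cong) (simp add: power2_eq_square algebra_simps)
qed

text \<open>The modified Bessel equation of order \<alpha> - 1/2 after division by x^(\<alpha> -
  1/2). In the variable X = x^2 it reads 4 X F'' + (2 + 4 \<alpha>) F' = F, which is the coefficient
  recursion.\<close>

lemma bes_ode: "x * bes2 \<alpha> x + 2 * \<alpha> * bes1 \<alpha> x = x * bes \<alpha> x"
proof -
  let ?D = "fps_deriv (bes_fps \<alpha>)" and ?DD = "fps_deriv (fps_deriv (bes_fps \<alpha>))"
  have "fps_const 4 * (fps_X * ?DD) + fps_const (2 + 4 * \<alpha>) * ?D = bes_fps \<alpha>"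
  proof (rule fps_ext)
    fix n
    show "fps_nth (fps_const 4 * (fps_X * ?DD) + fps_const (2 + 4 * \<alpha>) * ?D) n = fps_nth (bes_fps \<alpha>) n"
      unfolding bes_fps_Suc[symmetric, of \<alpha> n] fps_mult_fps_X_deriv_shift
      by (simp add: algebra_simps)
  qed
  then have "eval_fps (fps_const 4 * (fps_X * ?DD) + fps_const (2 + 4 * \<alpha>) * ?D) (x\<^sup>2) = eval_fps (bes_fps \<alpha>) (x\<^sup>2)"
    by simp
  moreover have r1: "fps_conv_radius (fps_X * ?DD) = \<infinity>"
    using fps_conv_radius_mult[of fps_X ?DD] by (simp add: bes_radii)
  moreover have "fps_conv_radius (fps_const 4 * (fps_X * ?DD)) = \<infinity>" "fps_conv_radius (fps_const (2 + 4 * \<alpha>) * ?D) = \<infinity>"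
    using fps_conv_radius_mult[of "fps_const 4" "fps_X * ?DD"] fps_conv_radius_mult[of "fps_const (2 + 4 * \<alpha>)" ?D]
    by (simp_all add: bes_radii r1)
  ultimately have *: "4 * (x\<^sup>2 * eval_fps ?DD (x\<^sup>2)) + (2 + 4 * \<alpha>) * eval_fps ?D (x\<^sup>2) = bes \<alpha> x"
    by (simp add: eval_fps_add eval_fps_const_mult eval_fps_mult bes_radii bes_def)
  show ?thesis unfolding *[symmetric] bes1_def bes2_def by (simp add: algebra_simps power2_eq_square)
qed

lemma holomorphic_on_bes: "bes \<alpha> holomorphic_on S"
  using has_field_derivative_bes by (meson field_differentiable_at_within field_differentiable_def holomorphic_onI)

lemma bes_sums: "(\<lambda>k. rGamma (\<alpha> + 1/2 + of_nat k) / (fact k * 4 ^ k) * (x\<^sup>2) ^ k) sums bes \<alpha> x"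
proof -
  have "ereal (norm (x\<^sup>2)) < fps_conv_radius (bes_fps \<alpha>)" by (simp add: bes_radii)
  from sums_eval_fps[OF this] show ?thesis by (simp add: bes_def bes_fps_def)
qed

lemma bessel_I_eq_bes: "bessel_I (\<alpha> - 1/2) x = (x / 2) powr (\<alpha> - 1/2) * bes \<alpha> x"
proof -
  have "rGamma (\<alpha> - 1/2 + of_nat k + 1) / fact k * (x / 2) ^ (2 * k) = rGamma (\<alpha> + 1/2 + of_nat k) / (fact k * 4 ^ k) * (x\<^sup>2) ^ k" for k
  proof -
    have e: "\<alpha> - 1/2 + of_nat k + 1 = \<alpha> + 1/2 + of_nat k" by simp
    have "(x / 2) ^ (2 * k) = (x\<^sup>2) ^ k / 4 ^ k" by (simp add: power_mult power_divide)
    then show ?thesis unfolding e by simp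
  qed
  then have "(\<Sum>k. rGamma (\<alpha> - 1/2 + of_nat k + 1) / fact k * (x / 2) ^ (2 * k)) = bes \<alpha> x"
    using sums_unique[OF bes_sums[of x]] by simp
  then show ?thesis by (simp add: bessel_I_def)
qed

end

text \<open>
  The function h(r) = r powr \<alpha> * bes(\<mu> r) satisfies h'' = (\<mu>^2 + q / r^2) h. So h' + \<mu> h and h' - \<mu> h solve
  first-order equations with rates \<mu> and - \<mu>, up to a perturbation that is integrable at infinity,
  and Gronwall's inequality applies to the sum T of the squares of their norms.
\<close>

lemma bes_growth_ray:
  assumes \<alpha>: "Re \<alpha> > 0" and \<mu>: "norm \<mu> = 1" and r: "r \<ge> 1"
    and B: "norm (\<alpha> * bes \<alpha> \<mu> + \<mu> * bes1 \<alpha> \<mu> + \<mu> * bes \<alpha> \<mu>) \<le> B"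
      "norm (\<alpha> * bes \<alpha> \<mu> + \<mu> * bes1 \<alpha> \<mu> - \<mu> * bes \<alpha> \<mu>) \<le> B"
  shows "r powr Re \<alpha> * norm (bes \<alpha> (\<mu> * of_real r)) \<le> 2 * B * exp (norm (\<alpha> * (\<alpha> - 1))) * exp (\<bar>Re \<mu>\<bar> * r)"
proof -
  define q where "q = \<alpha> * (\<alpha> - 1)"
  define h where "h = (\<lambda>z. z powr \<alpha> * bes \<alpha> (\<mu> * z))"
  define d where "d = (\<lambda>z. z powr (\<alpha> - 1) * (\<alpha> * bes \<alpha> (\<mu> * z) + \<mu> * z * bes1 \<alpha> (\<mu> * z)))"
  define p where "p = (\<lambda>x::real. d (of_real x) + \<mu> * h (of_real x))"
  define m where "m = (\<lambda>x::real. d (of_real x) - \<mu> * h (of_real x))"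
  define K where "K = (\<lambda>x::real. q / (of_real x)\<^sup>2)"
  define T where "T = (\<lambda>x. p x \<bullet> p x + m x \<bullet> m x)"
  \<comment> \<open>The exponent is minus a primitive of the growth rate 2 |Re \<mu>| + 2 |q| / x^2
    of T. Its second part is bounded for x \<ge> 1, so it costs only the constant factor that
    involves q.\<close>
  define E where "E = (\<lambda>x. exp (- (2 * \<bar>Re \<mu>\<bar> * x) + 2 * norm q / x))"
  have mu0: "\<mu> \<noteq> 0" using \<mu> by auto
  have dl: "((\<lambda>z. \<mu> * z) has_field_derivative \<mu>) (at z)" for z
    by (auto intro!: derivative_eq_intros)
  have de: "((\<lambda>z. bes \<alpha> (\<mu> * z)) has_field_derivative bes1 \<alpha> (\<mu> * z) * \<mu>) (at z)" for z
    by (rule DERIV_chain2[OF has_field_derivative_bes[OF \<alpha>] dl])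
  have de1: "((\<lambda>z. bes1 \<alpha> (\<mu> * z)) has_field_derivative bes2 \<alpha> (\<mu> * z) * \<mu>) (at z)" for z
    by (rule DERIV_chain2[OF has_field_derivative_bes1[OF \<alpha>] dl])
  have dp: "((\<lambda>z. z powr a) has_field_derivative a * z powr (a - 1)) (at z)" if "z \<notin> \<real>\<^sub>\<le>\<^sub>0" for z a :: complex
    by (rule has_field_derivative_powr[OF that])
  have pw: "z powr \<alpha> = z * z powr (\<alpha> - 1)" "z powr (\<alpha> - 1) = z * z powr (\<alpha> - 1 - 1)" if "z \<notin> \<real>\<^sub>\<le>\<^sub>0" for z
  proof -
    have "z powr a = z * z powr (a - 1)" for a
      using that by (auto simp: powr_diff)
    then show "z powr \<alpha> = z * z powr (\<alpha> - 1)" "z powr (\<alpha> - 1) = z * z powr (\<alpha> - 1 - 1)" by blast+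
  qed
  have dh: "(h has_field_derivative d z) (at z)" if z: "z \<notin> \<real>\<^sub>\<le>\<^sub>0" for z
    unfolding h_def d_def by (rule DERIV_cong[OF DERIV_mult'[OF dp[OF z] de]]) (simp add: pw(1)[OF z] algebra_simps)
  have dd: "(d has_field_derivative (\<mu>\<^sup>2 + q / z\<^sup>2) * h z) (at z)" if z: "z \<notin> \<real>\<^sub>\<le>\<^sub>0" for z
  proof -
    have z0: "z \<noteq> 0" using z by auto
    define P where "P = z powr (\<alpha> - 1 - 1)"
    have di: "((\<lambda>z. \<alpha> * bes \<alpha> (\<mu> * z) + \<mu> * z * bes1 \<alpha> (\<mu> * z)) has_field_derivative
        \<alpha> * (bes1 \<alpha> (\<mu> * z) * \<mu>) + (\<mu> * z * (bes2 \<alpha> (\<mu> * z) * \<mu>) + \<mu> * bes1 \<alpha> (\<mu> * z))) (at z)"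
      by (rule DERIV_add[OF DERIV_cmult[OF de] DERIV_mult'[OF dl de1]])
    have ode: "\<mu> * z * bes2 \<alpha> (\<mu> * z) = \<mu> * z * bes \<alpha> (\<mu> * z) - 2 * \<alpha> * bes1 \<alpha> (\<mu> * z)"
      using bes_ode[OF \<alpha>, of "\<mu> * z"] by (simp add: algebra_simps)
    have "(d has_field_derivative z powr (\<alpha> - 1) * (\<alpha> * (bes1 \<alpha> (\<mu> * z) * \<mu>) + (\<mu> * z * (bes2 \<alpha> (\<mu> * z) * \<mu>) + \<mu> * bes1 \<alpha> (\<mu> * z)))
       + (\<alpha> - 1) * z powr (\<alpha> - 1 - 1) * (\<alpha> * bes \<alpha> (\<mu> * z) + \<mu> * z * bes1 \<alpha> (\<mu> * z))) (at z)"
      unfolding d_def by (rule DERIV_mult'[OF dp[OF z] di])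
    moreover have "z powr (\<alpha> - 1) * (\<alpha> * (bes1 \<alpha> (\<mu> * z) * \<mu>) + (\<mu> * z * (bes2 \<alpha> (\<mu> * z) * \<mu>) + \<mu> * bes1 \<alpha> (\<mu> * z)))
       + (\<alpha> - 1) * z powr (\<alpha> - 1 - 1) * (\<alpha> * bes \<alpha> (\<mu> * z) + \<mu> * z * bes1 \<alpha> (\<mu> * z)) = (\<mu>\<^sup>2 + q / z\<^sup>2) * h z"
    proof -
      have "\<mu> * z * (bes2 \<alpha> (\<mu> * z) * \<mu>) = (\<mu> * z * bes2 \<alpha> (\<mu> * z)) * \<mu>" by simp
      also have "\<dots> = (\<mu> * z * bes \<alpha> (\<mu> * z) - 2 * \<alpha> * bes1 \<alpha> (\<mu> * z)) * \<mu>" by (simp only: ode)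
      finally have o2: "\<mu> * z * (bes2 \<alpha> (\<mu> * z) * \<mu>) = (\<mu> * z * bes \<alpha> (\<mu> * z) - 2 * \<alpha> * bes1 \<alpha> (\<mu> * z)) * \<mu>" .
      have hz: "(\<mu>\<^sup>2 + q / z\<^sup>2) * h z = (\<mu>\<^sup>2 * z\<^sup>2 + q) * P * bes \<alpha> (\<mu> * z)"
        unfolding h_def pw[OF z] P_def using z0 by (simp add: field_simps power2_eq_square)
      show ?thesis
        unfolding hz o2 pw(2)[OF z] P_def[symmetric] by (simp add: q_def algebra_simps power2_eq_square)
    qed
    ultimately show ?thesis by simp
  qed
  have slit: "complex_of_real x \<notin> \<real>\<^sub>\<le>\<^sub>0" if "x > 0" for x using that by simp
  have vp: "(p has_vector_derivative \<mu> * p x + K x * h (of_real x)) (at x)"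
    and vm: "(m has_vector_derivative - \<mu> * m x + K x * h (of_real x)) (at x)" if x: "x > 0" for x
  proof -
    have "((\<lambda>z. d z + \<mu> * h z) has_field_derivative (\<mu>\<^sup>2 + q / (of_real x)\<^sup>2) * h (of_real x) + \<mu> * d (of_real x)) (at (of_real x))"
      by (rule DERIV_add[OF dd[OF slit[OF x]] DERIV_cmult[OF dh[OF slit[OF x]]]])
    from has_vector_derivative_real_field[OF this]
    have "(p has_vector_derivative (\<mu>\<^sup>2 + q / (of_real x)\<^sup>2) * h (of_real x) + \<mu> * d (of_real x)) (at x)"
      unfolding p_def .
    moreover have "(\<mu>\<^sup>2 + q / (of_real x)\<^sup>2) * h (of_real x) + \<mu> * d (of_real x) = \<mu> * p x + K x * h (of_real x)"
      unfolding p_def K_def by (simp add: algebra_simps power2_eq_square)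
    ultimately show "(p has_vector_derivative \<mu> * p x + K x * h (of_real x)) (at x)" by simp
    have "((\<lambda>z. d z - \<mu> * h z) has_field_derivative (\<mu>\<^sup>2 + q / (of_real x)\<^sup>2) * h (of_real x) - \<mu> * d (of_real x)) (at (of_real x))"
      by (rule DERIV_diff[OF dd[OF slit[OF x]] DERIV_cmult[OF dh[OF slit[OF x]]]])
    from has_vector_derivative_real_field[OF this]
    have "(m has_vector_derivative (\<mu>\<^sup>2 + q / (of_real x)\<^sup>2) * h (of_real x) - \<mu> * d (of_real x)) (at x)"
      unfolding m_def .
    moreover have "(\<mu>\<^sup>2 + q / (of_real x)\<^sup>2) * h (of_real x) - \<mu> * d (of_real x) = - \<mu> * m x + K x * h (of_real x)"
      unfolding m_def K_def by (simp add: algebra_simps power2_eq_square)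
    ultimately show "(m has_vector_derivative - \<mu> * m x + K x * h (of_real x)) (at x)" by simp
  qed
  have hle: "2 * norm (h (of_real x)) \<le> norm (p x) + norm (m x)" for x
  proof -
    have "p x - m x = 2 * \<mu> * h (of_real x)" unfolding p_def m_def by simp
    then have "norm (p x - m x) = 2 * norm (h (of_real x))" by (simp add: norm_mult \<mu>)
    then show ?thesis using norm_triangle_ineq4[of "p x" "m x"] by simp
  qed
  have inner_mu: "v \<bullet> (\<nu> * v) = Re \<nu> * (v \<bullet> v)" for v \<nu> :: complex
    by (simp add: inner_complex_def algebra_simps)
  define T' where "T' = (\<lambda>x. 2 * (p x \<bullet> (\<mu> * p x + K x * h (of_real x))) + 2 * (m x \<bullet> (- \<mu> * m x + K x * h (of_real x))))"
  have vT: "(T has_real_derivative T' x) (at x)" if "x > 0" for x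
  proof -
    have "(T has_vector_derivative ((p x \<bullet> (\<mu> * p x + K x * h (of_real x)) + (\<mu> * p x + K x * h (of_real x)) \<bullet> p x)
       + (m x \<bullet> (- \<mu> * m x + K x * h (of_real x)) + (- \<mu> * m x + K x * h (of_real x)) \<bullet> m x))) (at x)"
      unfolding T_def
      by (intro has_vector_derivative_add bounded_bilinear.has_vector_derivative[OF bounded_bilinear_inner] vp vm that)
    then show ?thesis
      unfolding has_real_derivative_iff_has_vector_derivative T'_def by (simp add: inner_commute)
  qed
  have T'le: "T' x \<le> (2 * \<bar>Re \<mu>\<bar> + 2 * (norm q / x\<^sup>2)) * T x" if "x > 0" for x
  proof -
    let ?k = "norm q / x\<^sup>2" and ?a = "norm (p x)" and ?b = "norm (m x)" and ?c = "norm (h (of_real x))"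
    have k: "norm (K x) = ?k" unfolding K_def by (simp add: norm_divide norm_power)
    have TT: "T x = ?a\<^sup>2 + ?b\<^sup>2" unfolding T_def by (simp add: power2_norm_eq_inner)
    have "p x \<bullet> (K x * h (of_real x)) \<le> ?a * (?k * ?c)" "m x \<bullet> (K x * h (of_real x)) \<le> ?b * (?k * ?c)"
      using norm_cauchy_schwarz[of "p x" "K x * h (of_real x)"] norm_cauchy_schwarz[of "m x" "K x * h (of_real x)"]
      by (simp_all add: norm_mult k)
    moreover have "Re \<mu> * (p x \<bullet> p x) \<le> \<bar>Re \<mu>\<bar> * ?a\<^sup>2"
      unfolding power2_norm_eq_inner by (rule mult_right_mono) auto
    moreover have "Re (- \<mu>) * (m x \<bullet> m x) \<le> \<bar>Re \<mu>\<bar> * ?b\<^sup>2"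
      unfolding power2_norm_eq_inner by (rule mult_right_mono) auto
    ultimately have "T' x \<le> 2 * (\<bar>Re \<mu>\<bar> * ?a\<^sup>2 + ?a * (?k * ?c)) + 2 * (\<bar>Re \<mu>\<bar> * ?b\<^sup>2 + ?b * (?k * ?c))"
      unfolding T'_def inner_add_right inner_mu by (simp only: distrib_left)
    also have "\<dots> = 2 * \<bar>Re \<mu>\<bar> * T x + ?k * ((?a + ?b) * (2 * ?c))"
      unfolding TT by (simp add: algebra_simps)
    also have "\<dots> \<le> 2 * \<bar>Re \<mu>\<bar> * T x + ?k * ((?a + ?b) * (?a + ?b))"
      by (intro add_left_mono mult_left_mono hle) auto
    \<comment> \<open>The perturbation couples the two equations through h, which is half the
      difference of p and m up to a unit factor. Hence it is bounded by a multiple of T and enters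
      only the integrable part of the rate.\<close>
    also have "\<dots> \<le> 2 * \<bar>Re \<mu>\<bar> * T x + ?k * (2 * T x)"
    proof (intro add_left_mono mult_left_mono)
      have "0 \<le> (?a - ?b)\<^sup>2" by simp
      then show "(?a + ?b) * (?a + ?b) \<le> 2 * T x" unfolding TT by (simp add: power2_eq_square algebra_simps)
    qed simp
    finally show ?thesis by (simp add: algebra_simps)
  qed
  have dE: "(E has_real_derivative E x * - (2 * \<bar>Re \<mu>\<bar> + 2 * (norm q / x\<^sup>2))) (at x)" if "x > 0" for x
    unfolding E_def using that by (auto intro!: derivative_eq_intros simp: power2_eq_square field_simps)
  have "T r * E r \<le> T 1 * E 1"
  proof (rule DERIV_nonpos_imp_nonincreasing[OF r])
    fix x assume "1 \<le> x" "x \<le> r"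
    then have x: "x > 0" by simp
    have "((\<lambda>x. T x * E x) has_real_derivative T x * (E x * - (2 * \<bar>Re \<mu>\<bar> + 2 * (norm q / x\<^sup>2))) + T' x * E x) (at x)"
      by (rule DERIV_mult'[OF vT[OF x] dE[OF x]])
    moreover have "T' x * E x \<le> (2 * \<bar>Re \<mu>\<bar> + 2 * (norm q / x\<^sup>2)) * T x * E x"
      by (intro mult_right_mono T'le[OF x]) (simp add: E_def)
    then have "T x * (E x * - (2 * \<bar>Re \<mu>\<bar> + 2 * (norm q / x\<^sup>2))) + T' x * E x \<le> 0"
      by (simp add: algebra_simps)
    ultimately show "\<exists>y. ((\<lambda>x. T x * E x) has_real_derivative y) (at x) \<and> y \<le> 0" by blast
  qed
  moreover have "T 1 \<le> 2 * B\<^sup>2"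
  proof -
    have "norm (p 1) \<le> B" "norm (m 1) \<le> B"
      using B unfolding p_def m_def d_def h_def by simp_all
    then have "(norm (p 1))\<^sup>2 \<le> B\<^sup>2" "(norm (m 1))\<^sup>2 \<le> B\<^sup>2"
      by (auto intro!: power_mono)
    then show ?thesis unfolding T_def by (simp add: power2_norm_eq_inner)
  qed
  moreover have "E 1 \<le> exp (2 * norm q)"
    unfolding E_def by simp
  moreover have "E r \<ge> exp (- (2 * \<bar>Re \<mu>\<bar> * r))" unfolding E_def using r by simp
  moreover have Tn: "T x \<ge> 0" for x unfolding T_def by simp
  ultimately have "T r * exp (- (2 * \<bar>Re \<mu>\<bar> * r)) \<le> 2 * B\<^sup>2 * exp (2 * norm q)"
  proof -
    assume a: "T r * E r \<le> T 1 * E 1" "T 1 \<le> 2 * B\<^sup>2" "E 1 \<le> exp (2 * norm q)" "exp (- (2 * \<bar>Re \<mu>\<bar> * r)) \<le> E r" "\<And>x. T x \<ge> 0"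
    have "T r * exp (- (2 * \<bar>Re \<mu>\<bar> * r)) \<le> T r * E r" by (rule mult_left_mono[OF a(4) a(5)])
    also note a(1)
    also have "T 1 * E 1 \<le> 2 * B\<^sup>2 * exp (2 * norm q)"
      by (rule mult_mono[OF a(2,3)]) (simp_all add: E_def)
    finally show ?thesis .
  qed
  then have Tr: "T r \<le> 2 * B\<^sup>2 * exp (2 * norm q) * exp (2 * \<bar>Re \<mu>\<bar> * r)"
    by (simp add: exp_minus field_simps)
  have B0: "B \<ge> 0" using B(1) norm_ge_zero order.trans by blast
  have "(norm (h (of_real r)))\<^sup>2 \<le> T r"
  proof -
    have "(2 * norm (h (of_real r)))\<^sup>2 \<le> (norm (p r) + norm (m r))\<^sup>2"
      by (intro power_mono hle) simp
    also have "\<dots> \<le> 2 * T r"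
    proof -
      have "0 \<le> (norm (p r) - norm (m r))\<^sup>2" by simp
      then show ?thesis unfolding T_def by (simp add: power2_norm_eq_inner[symmetric] power2_eq_square algebra_simps)
    qed
    finally have "4 * (norm (h (of_real r)))\<^sup>2 \<le> 2 * T r" by (simp add: power_mult_distrib)
    then show ?thesis using Tn[of r] by linarith
  qed
  also have "T r \<le> (2 * B * exp (norm q) * exp (\<bar>Re \<mu>\<bar> * r))\<^sup>2"
  proof -
    have "(2 * B * exp (norm q) * exp (\<bar>Re \<mu>\<bar> * r))\<^sup>2 = 4 * B\<^sup>2 * exp (2 * norm q) * exp (2 * \<bar>Re \<mu>\<bar> * r)"
      by (simp add: power_mult_distrib exp_double[symmetric] mult_ac)
    moreover have "2 * B\<^sup>2 * exp (2 * norm q) * exp (2 * \<bar>Re \<mu>\<bar> * r) \<le> 4 * B\<^sup>2 * exp (2 * norm q) * exp (2 * \<bar>Re \<mu>\<bar> * r)"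
      by (intro mult_right_mono) auto
    ultimately show ?thesis using Tr by linarith
  qed
  finally have "norm (h (of_real r)) \<le> 2 * B * exp (norm q) * exp (\<bar>Re \<mu>\<bar> * r)"
    by (rule power2_le_imp_le) (use B0 in simp)
  then show ?thesis
    using r unfolding h_def q_def by (simp add: norm_mult norm_powr_of_real_pos)
qed

text \<open>The estimate along a ray needs only the data at radius 1, which are bounded uniformly in
  the direction by compactness of the unit circle. Inside the unit disc the function itself is
  bounded.\<close>

lemma bes_growth:
  assumes \<alpha>: "Re \<alpha> > 0"
  shows "\<exists>C>0. \<forall>x. norm x powr Re \<alpha> * norm (bes \<alpha> x) \<le> C * exp \<bar>Re x\<bar>"
proof -
  have hb: "bes \<alpha> holomorphic_on UNIV" by (rule holomorphic_on_bes[OF \<alpha>])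
  have cb: "continuous_on S (bes \<alpha>)" for S
    by (rule holomorphic_on_imp_continuous_on[OF holomorphic_on_bes[OF \<alpha>]])
  have cb1: "continuous_on S (bes1 \<alpha>)" for S
    by (intro continuous_at_imp_continuous_on ballI DERIV_isCont[OF has_field_derivative_bes1[OF \<alpha>]])
  have "compact ((\<lambda>\<mu>. \<alpha> * bes \<alpha> \<mu> + \<mu> * bes1 \<alpha> \<mu> + \<mu> * bes \<alpha> \<mu>) ` sphere 0 1)"
    by (intro compact_continuous_image continuous_intros cb cb1 compact_sphere)
  then obtain B1 where B1: "\<And>\<mu>. \<mu> \<in> sphere 0 1 \<Longrightarrow> norm (\<alpha> * bes \<alpha> \<mu> + \<mu> * bes1 \<alpha> \<mu> + \<mu> * bes \<alpha> \<mu>) \<le> B1"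
    using compact_imp_bounded bounded_iff by (metis (no_types, lifting) imageI)
  have "compact ((\<lambda>\<mu>. \<alpha> * bes \<alpha> \<mu> + \<mu> * bes1 \<alpha> \<mu> - \<mu> * bes \<alpha> \<mu>) ` sphere 0 1)"
    by (intro compact_continuous_image continuous_intros cb cb1 compact_sphere)
  then obtain B2 where B2: "\<And>\<mu>. \<mu> \<in> sphere 0 1 \<Longrightarrow> norm (\<alpha> * bes \<alpha> \<mu> + \<mu> * bes1 \<alpha> \<mu> - \<mu> * bes \<alpha> \<mu>) \<le> B2"
    using compact_imp_bounded bounded_iff by (metis (no_types, lifting) imageI)
  have "compact (bes \<alpha> ` cball 0 1)"
    by (intro compact_continuous_image cb compact_cball)
  then obtain B3 where B3: "\<And>x. x \<in> cball 0 1 \<Longrightarrow> norm (bes \<alpha> x) \<le> B3"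
    using compact_imp_bounded bounded_iff by (metis (no_types, lifting) imageI)
  define B where "B = max 1 (max B1 (max B2 B3))"
  define C where "C = 2 * B * exp (norm (\<alpha> * (\<alpha> - 1)))"
  have B: "B1 \<le> B" "B2 \<le> B" "B3 \<le> B" "1 \<le> B" by (simp_all add: B_def)
  have CB: "B \<le> C"
  proof -
    have "B * 1 \<le> (2 * B) * exp (norm (\<alpha> * (\<alpha> - 1)))" using B(4) by (intro mult_mono) auto
    then show ?thesis by (simp add: C_def)
  qed
  have "norm x powr Re \<alpha> * norm (bes \<alpha> x) \<le> C * exp \<bar>Re x\<bar>" for x
  proof (cases "norm x \<le> 1")
    case True
    have "norm x powr Re \<alpha> * norm (bes \<alpha> x) \<le> 1 * B"
    proof (intro mult_mono)
      have "norm x powr Re \<alpha> \<le> 1 powr Re \<alpha>" using True \<alpha> by (intro powr_mono2) auto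
      then show "norm x powr Re \<alpha> \<le> 1" by simp
      show "norm (bes \<alpha> x) \<le> B" using B3[of x] B(3) True by simp
    qed auto
    also have "\<dots> \<le> C * exp \<bar>Re x\<bar>"
    proof -
      have "C * 1 \<le> C * exp \<bar>Re x\<bar>" using CB B(4) by (intro mult_left_mono) auto
      then show ?thesis using CB by simp
    qed
    finally show ?thesis .
  next
    case False
    define r where "r = norm x"
    define \<mu> where "\<mu> = x / of_real r"
    have r: "r \<ge> 1" "r > 0" using False unfolding r_def by linarith+
    have \<mu>: "norm \<mu> = 1" using r by (simp add: \<mu>_def norm_divide r_def[symmetric])
    have x: "\<mu> * of_real r = x" using r by (simp add: \<mu>_def)
    have "\<bar>Re \<mu>\<bar> * r = \<bar>Re x\<bar>" using r by (simp add: \<mu>_def)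
    moreover have "r powr Re \<alpha> * norm (bes \<alpha> (\<mu> * of_real r)) \<le> 2 * B * exp (norm (\<alpha> * (\<alpha> - 1))) * exp (\<bar>Re \<mu>\<bar> * r)"
    proof (rule bes_growth_ray[OF \<alpha> \<mu> r(1)])
      have s: "\<mu> \<in> sphere 0 1" using \<mu> by simp
      show "norm (\<alpha> * bes \<alpha> \<mu> + \<mu> * bes1 \<alpha> \<mu> + \<mu> * bes \<alpha> \<mu>) \<le> B" using B1[OF s] B by linarith
      show "norm (\<alpha> * bes \<alpha> \<mu> + \<mu> * bes1 \<alpha> \<mu> - \<mu> * bes \<alpha> \<mu>) \<le> B" using B2[OF s] B by linarith
    qed
    ultimately have "r powr Re \<alpha> * norm (bes \<alpha> x) \<le> C * exp \<bar>Re x\<bar>" by (simp only: C_def x)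
    then show ?thesis by (simp only: r_def)
  qed
  then show ?thesis using CB B(4) by (intro exI[of _ C]) auto
qed

section \<open>Poisson's integral\<close>

text \<open>The weight of Poisson's integral for the order \<alpha> - 1/2, extended by zero so that
  affine substitutions on the whole line apply.\<close>

definition gegenbauer_weight :: "complex \<Rightarrow> real \<Rightarrow> complex" where
  "gegenbauer_weight \<alpha> y = (if \<bar>y\<bar> < 1 then of_real (1 - y\<^sup>2) powr (\<alpha> - 1) else 0)"

lemma measurable_gegenbauer_weight: "gegenbauer_weight \<alpha> \<in> borel_measurable lborel"
proof -
  have "(\<lambda>y. indicator {-1<..<1} y *\<^sub>R complex_of_real (1 - y\<^sup>2) powr (\<alpha> - 1)) \<in> borel_measurable borel"
  proof (rule borel_measurable_continuous_on_indicator)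
    have "continuous_on {-1<..<1} (\<lambda>y. (\<lambda>z. (1 - z\<^sup>2) powr (\<alpha> - 1)) (complex_of_real y))"
    proof (rule continuous_on_of_real_holomorphic[of _ "{z. 1 - z\<^sup>2 \<notin> \<real>\<^sub>\<le>\<^sub>0}"])
      show "(\<lambda>z. (1 - z\<^sup>2) powr (\<alpha> - 1)) holomorphic_on {z. 1 - z\<^sup>2 \<notin> \<real>\<^sub>\<le>\<^sub>0}"
        by (intro holomorphic_intros) auto
      fix t :: real assume "t \<in> {-1<..<1}"
      then have "t\<^sup>2 < 1" by (simp add: abs_square_less_1 abs_less_iff)
      then have "complex_of_real (1 - t\<^sup>2) \<notin> \<real>\<^sub>\<le>\<^sub>0" by (simp only: nonpos_Reals_of_real_iff)
      then show "complex_of_real t \<in> {z. 1 - z\<^sup>2 \<notin> \<real>\<^sub>\<le>\<^sub>0}" by simp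
    qed
    then show "continuous_on {-1<..<1} (\<lambda>y. complex_of_real (1 - y\<^sup>2) powr (\<alpha> - 1))" by simp
  qed simp
  also have "(\<lambda>y. indicator {-1<..<1} y *\<^sub>R complex_of_real (1 - y\<^sup>2) powr (\<alpha> - 1)) = gegenbauer_weight \<alpha>"
    by (auto simp: fun_eq_iff gegenbauer_weight_def indicator_def abs_less_iff)
  finally show ?thesis by simp
qed

lemma gegenbauer_weight_affine:
  "gegenbauer_weight \<alpha> (-1 + 2 * u) = (if 0 < u \<and> u < 1 then 4 powr (\<alpha> - 1) * (of_real u powr (\<alpha> - 1) * of_real (1 - u) powr (\<alpha> - 1)) else 0)"
proof -
  have "1 - (-1 + 2 * u)\<^sup>2 = 4 * (u * (1 - u))" by (simp add: power2_eq_square algebra_simps)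
  moreover have "\<bar>-1 + 2 * u\<bar> < 1 \<longleftrightarrow> 0 < u \<and> u < 1" by (auto simp: abs_less_iff)
  moreover have "complex_of_real (4 * (u * (1 - u))) powr (\<alpha> - 1) = 4 powr (\<alpha> - 1) * (of_real u powr (\<alpha> - 1) * of_real (1 - u) powr (\<alpha> - 1))"
    if "0 < u" "u < 1"
    using that powr_times_real[of 4 "of_real (u * (1 - u))" "\<alpha> - 1"] powr_times_real[of "of_real u" "of_real (1 - u)" "\<alpha> - 1"]
    by simp
  ultimately show ?thesis unfolding gegenbauer_weight_def by simp
qed

lemma norm_gegenbauer_weight: "norm (gegenbauer_weight \<alpha> y) = norm (gegenbauer_weight (of_real (Re \<alpha>)) y)"
proof (cases "\<bar>y\<bar> < 1")
  case True
  then have "y\<^sup>2 < 1" by (simp add: abs_square_less_1)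
  then have "1 - y\<^sup>2 > 0" by simp
  from norm_powr_of_real_pos[OF this] show ?thesis using True by (simp add: gegenbauer_weight_def)
qed (simp add: gegenbauer_weight_def)

lemma gegenbauer_weight_real_integral:
  assumes "x > 0"
  shows "integrable lborel (gegenbauer_weight (of_real x))"
    and "(LINT y|lborel. gegenbauer_weight (of_real x) y) = of_real (2 * 4 powr (x - 1) * Beta x x)"
proof -
  let ?b = "\<lambda>u. u powr (x - 1) * (1 - u) powr (x - 1)"
  have "set_integrable lborel {0..1} ?b" by (rule integrable_Beta) (use assms in auto)
  moreover have "integral {0..1} ?b = Beta x x"
    using has_integral_Beta_real[OF assms assms] by (rule integral_unique)
  ultimately have I: "integrable lborel (\<lambda>u. indicator {0..1} u *\<^sub>R ?b u)" "(LINT u|lborel. indicator {0..1} u *\<^sub>R ?b u) = Beta x x"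
    using set_borel_integral_eq_integral[of "{0..1}" ?b] by (simp_all only: set_integrable_def set_lebesgue_integral_def)
  have eq: "gegenbauer_weight (of_real x) (-1 + 2 * u) = of_real (4 powr (x - 1) * (indicator {0..1} u *\<^sub>R ?b u))" for u
    unfolding gegenbauer_weight_affine using powr_of_real[of 4 "x - 1"] powr_of_real[of u "x - 1"] powr_of_real[of "1 - u" "x - 1"]
    by (auto simp: indicator_def)
  have "integrable lborel (\<lambda>u. complex_of_real (4 powr (x - 1) * (indicator {0..1} u *\<^sub>R ?b u)))"
    by (intro integrable_of_real integrable_mult_right I(1))
  then have "integrable lborel (\<lambda>u. gegenbauer_weight (of_real x) (-1 + 2 * u))" by (simp only: eq)
  then show "integrable lborel (gegenbauer_weight (of_real x))"
    by (rule lborel_integrable_real_affine_iff[THEN iffD1, rotated]) simp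
  have "(LINT y|lborel. gegenbauer_weight (of_real x) y) = \<bar>2\<bar> *\<^sub>R (LINT u|lborel. gegenbauer_weight (of_real x) (-1 + 2 * u))"
    by (rule lborel_integral_real_affine) simp
  also have "(LINT u|lborel. gegenbauer_weight (of_real x) (-1 + 2 * u)) = of_real (4 powr (x - 1) * Beta x x)"
    unfolding eq integral_complex_of_real integral_mult_right_zero I(2) ..
  finally show "(LINT y|lborel. gegenbauer_weight (of_real x) y) = of_real (2 * 4 powr (x - 1) * Beta x x)"
    by (simp add: scaleR_conv_of_real)
qed

lemma integrable_gegenbauer_weight:
  assumes "Re \<alpha> > 0"
  shows "integrable lborel (gegenbauer_weight \<alpha>)"
  by (rule Bochner_Integration.integrable_bound[OF gegenbauer_weight_real_integral(1)[OF assms] measurable_gegenbauer_weight]) (simp add: norm_gegenbauer_weight[of \<alpha>])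

text \<open>The substitution y = 2 u - 1 has produced Beta x x with a power of 2. Legendre's
  duplication formula removes that power together with Gamma (2 x).\<close>

lemma gegenbauer_weight_real_integral':
  assumes "x > 0"
  shows "(LINT y|lborel. gegenbauer_weight (of_real x) y) = of_real (sqrt pi) * Gamma (of_real x) * rGamma (of_real x + 1/2)"
proof -
  let ?x = "complex_of_real x"
  have r: "Re ?x > 0" "Re (?x + 1/2) > 0" "Re (2 * ?x) > 0" using assms by auto
  have nz: "Gamma (?x + 1/2) \<noteq> 0" "Gamma (2 * ?x) \<noteq> 0" by (intro Gamma_nonzero_Re_pos r)+
  have dup: "Gamma ?x * Gamma (?x + 1/2) = exp ((1 - 2 * ?x) * of_real (ln 2)) * of_real (sqrt pi) * Gamma (2 * ?x)"
    by (rule Gamma_legendre_duplication[OF Re_pos_not_nonpos_Ints Re_pos_not_nonpos_Ints]) (use r in auto)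
  have "2 * 4 powr (x - 1) = exp ((2 * x - 1) * ln 2)"
  proof -
    have "(2::real) * 4 powr (x - 1) = 2 powr 1 * (2 powr 2) powr (x - 1)" by simp
    also have "\<dots> = 2 powr (1 + 2 * (x - 1))" unfolding powr_powr powr_add ..
    also have "1 + 2 * (x - 1) = 2 * x - 1" by simp
    finally show ?thesis by (simp add: powr_def)
  qed
  then have E: "complex_of_real (2 * 4 powr (x - 1)) = exp ((2 * ?x - 1) * of_real (ln 2))"
    by (simp add: exp_of_real[symmetric])
  have "of_real (Beta x x) = Gamma ?x * Gamma ?x / Gamma (2 * ?x)"
    using Beta_complex_of_real[of x x] unfolding Beta_def[of ?x ?x] mult_2 by (rule sym)
  then have "(LINT y|lborel. gegenbauer_weight ?x y) = exp ((2 * ?x - 1) * of_real (ln 2)) * (Gamma ?x * Gamma ?x / Gamma (2 * ?x))"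
    unfolding gegenbauer_weight_real_integral(2)[OF assms] of_real_mult[of "2 * 4 powr (x - 1)"] E by (simp only:)
  also have "\<dots> = Gamma ?x * (exp ((2 * ?x - 1) * of_real (ln 2)) * (Gamma ?x * Gamma (?x + 1/2))) / (Gamma (2 * ?x) * Gamma (?x + 1/2))"
    using nz by simp
  also have "exp ((2 * ?x - 1) * of_real (ln 2)) * (Gamma ?x * Gamma (?x + 1/2)) = of_real (sqrt pi) * Gamma (2 * ?x)"
  proof -
    have "exp ((2 * ?x - 1) * of_real (ln 2)) * exp ((1 - 2 * ?x) * of_real (ln 2)) = 1"
      unfolding exp_add[symmetric] by (simp add: algebra_simps)
    then show ?thesis unfolding dup by (simp add: mult.assoc[symmetric])
  qed
  also have "Gamma ?x * (of_real (sqrt pi) * Gamma (2 * ?x)) / (Gamma (2 * ?x) * Gamma (?x + 1/2)) =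
      of_real (sqrt pi) * Gamma ?x * rGamma (?x + 1/2)"
    using nz by (simp add: rGamma_inverse_Gamma field_simps)
  finally show ?thesis .
qed

text \<open>Both sides are holomorphic for Re \<alpha> > 0 and agree for positive real \<alpha>,
  where the Beta integral evaluates the left side.\<close>

lemma gegenbauer_weight_integral:
  assumes \<alpha>: "Re \<alpha> > 0"
  shows "(LINT y|lborel. gegenbauer_weight \<alpha> y) = of_real (sqrt pi) * Gamma \<alpha> * rGamma (\<alpha> + 1/2)"
proof -
  let ?S = "{z. Re z > 0}"
  let ?F = "\<lambda>z. (LINT y|lborel. gegenbauer_weight z y) - of_real (sqrt pi) * Gamma z * rGamma (z + 1/2)"
  have oS: "open ?S" by (rule open_halfspace_Re_gt)
  have "?F \<alpha> = 0"
  proof (rule analytic_continuation[of ?F ?S "complex_of_real ` {0<..}" 1])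
    have "(\<lambda>z. LINT y|lborel. gegenbauer_weight z y) holomorphic_on ?S"
    proof (rule holomorphic_onI)
      fix w :: complex assume "w \<in> ?S"
      define r where "r = Re w / 2"
      have r: "r > 0" "Re w - r > 0" using \<open>w \<in> ?S\<close> by (simp_all add: r_def)
      have "((\<lambda>v. LINT y|lborel. gegenbauer_weight v y) has_field_derivative (LINT y|lborel. deriv (\<lambda>v. gegenbauer_weight v y) w)) (at w)"
      proof (rule has_field_derivative_integral_dominated[OF r(1), where g = "\<lambda>y. norm (gegenbauer_weight (of_real (Re w - r)) y)"])
        show "gegenbauer_weight v \<in> borel_measurable lborel" for v by (rule measurable_gegenbauer_weight)
        show "integrable lborel (\<lambda>y. norm (gegenbauer_weight (of_real (Re w - r)) y))"
          by (rule integrable_norm[OF gegenbauer_weight_real_integral(1)[OF r(2)]])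
        show "(\<lambda>v. gegenbauer_weight v y) holomorphic_on ball w r" for y
        proof (cases "\<bar>y\<bar> < 1")
          case True
          then have "complex_of_real (1 - y\<^sup>2) \<noteq> 0" by (metis abs_square_less_1 diff_gt_0_iff_gt less_irrefl of_real_eq_0_iff)
          then have "(\<lambda>v. gegenbauer_weight v y) = (\<lambda>v. exp ((v - 1) * Ln (of_real (1 - y\<^sup>2))))"
            using True by (simp add: gegenbauer_weight_def powr_def fun_eq_iff)
          then show ?thesis by (simp only:) (intro holomorphic_intros)
        qed (simp add: gegenbauer_weight_def)
        fix v y assume "v \<in> ball w r"
        then have "\<bar>Re (v - w)\<bar> < r" using abs_Re_le_cmod[of "v - w"] by (simp add: dist_norm norm_minus_commute)
        then have vr: "Re w - r \<le> Re v" by simp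
        show "norm (gegenbauer_weight v y) \<le> norm (gegenbauer_weight (of_real (Re w - r)) y)"
        proof (cases "\<bar>y\<bar> < 1")
          case True
          then have "y\<^sup>2 < 1" by (simp add: abs_square_less_1)
          then have p: "1 - y\<^sup>2 > 0" by simp
          \<comment> \<open>Since 0 < 1 - y^2 \<le> 1, the smallest real part in the disc gives the
            largest power.\<close>
          have "(1 - y\<^sup>2) powr (Re v - 1) \<le> (1 - y\<^sup>2) powr (Re w - r - 1)"
            using p vr by (intro powr_mono') auto
          then show ?thesis using True norm_powr_of_real_pos[OF p, of "v - 1"] norm_powr_of_real_pos[OF p, of "of_real (Re w - r) - 1"]
            by (simp add: gegenbauer_weight_def)
        qed (simp add: gegenbauer_weight_def)
      qed
      from has_field_derivative_at_within[OF this]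
      show "(\<lambda>z. LINT y|lborel. gegenbauer_weight z y) field_differentiable at w within ?S"
        unfolding field_differentiable_def by (rule exI)
    qed
    moreover have "?S \<inter> \<int>\<^sub>\<le>\<^sub>0 = {}" using Re_pos_not_nonpos_Ints by blast
    then have "Gamma holomorphic_on ?S" by (rule holomorphic_Gamma)
    moreover have "(\<lambda>z. rGamma (z + 1/2)) holomorphic_on ?S" by (intro holomorphic_intros)
    ultimately show "?F holomorphic_on ?S"
      by (intro holomorphic_on_diff holomorphic_on_mult holomorphic_on_const)
    show "connected ?S" by (intro convex_connected convex_halfspace_Re_gt)
    show "1 islimpt complex_of_real ` {0<..}"
    proof (rule islimptI)
      fix T :: "complex set" assume "1 \<in> T" "open T"
      then obtain e where e: "e > 0" "ball 1 e \<subseteq> T" using openE by blast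
      have "complex_of_real (1 + e/2) \<in> ball 1 e" using e(1) by (simp add: dist_norm)
      then have "complex_of_real (1 + e/2) \<in> T" using e(2) by blast
      moreover have "complex_of_real (1 + e/2) \<noteq> 1" using e(1) by simp
      moreover have "complex_of_real (1 + e/2) \<in> complex_of_real ` {0<..}"
        by (rule imageI) (use e(1) in simp)
      ultimately show "\<exists>y\<in>complex_of_real ` {0<..}. y \<in> T \<and> y \<noteq> 1" by blast
    qed
    show "?F z = 0" if "z \<in> complex_of_real ` {0<..}" for z
    proof -
      from that obtain x where "x \<in> {0<..}" "z = of_real x" by (rule imageE)
      then show ?thesis using gegenbauer_weight_real_integral'[of x] by simp
    qed
    show "complex_of_real ` {0<..} \<subseteq> ?S" by auto
  qed (simp_all add: oS \<alpha>)
  then show ?thesis by simp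
qed

lemma integrable_gegenbauer_weight_bounded:
  fixes f :: "real \<Rightarrow> complex"
  assumes "Re \<alpha> > 0" "continuous_on UNIV f" "\<And>y. \<bar>y\<bar> < 1 \<Longrightarrow> norm (f y) \<le> K"
  shows "integrable lborel (\<lambda>y. gegenbauer_weight \<alpha> y * f y)"
proof (rule Bochner_Integration.integrable_bound[OF integrable_mult_right[OF integrable_norm[OF integrable_gegenbauer_weight[OF assms(1)]], of K]])
  show "(\<lambda>y. gegenbauer_weight \<alpha> y * f y) \<in> borel_measurable lborel"
    using borel_measurable_times[OF measurable_gegenbauer_weight[of \<alpha>], of f] borel_measurable_continuous_onI[OF assms(2)] by simp
  show "AE y in lborel. norm (gegenbauer_weight \<alpha> y * f y) \<le> norm (K * norm (gegenbauer_weight \<alpha> y))"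
  proof (rule AE_I2)
    fix y
    show "norm (gegenbauer_weight \<alpha> y * f y) \<le> norm (K * norm (gegenbauer_weight \<alpha> y))"
    proof (cases "\<bar>y\<bar> < 1")
      case True
      have "norm (f y) \<le> \<bar>K\<bar>" using assms(3)[OF True] by simp
      from mult_right_mono[OF this, of "norm (gegenbauer_weight \<alpha> y)"] show ?thesis by (simp add: norm_mult abs_mult mult_ac)
    qed (simp add: gegenbauer_weight_def)
  qed
qed

text \<open>From y^2 = 1 - (1 - y^2) the next moment is the difference of the moments with \<alpha>
  and with \<alpha> + 1, which is why \<alpha> is arbitrary in the induction.\<close>

lemma gegenbauer_weight_moment:
  assumes "Re \<alpha> > 0"
  shows "(LINT y|lborel. gegenbauer_weight \<alpha> y * of_real (y ^ (2 * k))) = Gamma (of_nat k + 1/2) * Gamma \<alpha> * rGamma (\<alpha> + 1/2 + of_nat k)"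
  using assms
proof (induction k arbitrary: \<alpha>)
  case 0
  then show ?case using gegenbauer_weight_integral[OF 0] by (simp add: Gamma_one_half_complex)
next
  case (Suc k)
  have "Re (\<alpha> + 1) > 0" using Suc.prems by simp
  have I: "integrable lborel (\<lambda>y. gegenbauer_weight \<beta> y * of_real (y ^ (2 * k)))" if "Re \<beta> > 0" for \<beta>
    by (rule integrable_gegenbauer_weight_bounded[OF that, where K = 1]) (auto intro!: continuous_intros power_le_one simp: norm_power)
  have "(LINT y|lborel. gegenbauer_weight \<alpha> y * of_real (y ^ (2 * Suc k))) =
     (LINT y|lborel. gegenbauer_weight \<alpha> y * of_real (y ^ (2 * k)) - gegenbauer_weight (\<alpha> + 1) y * of_real (y ^ (2 * k)))"
  proof (rule Bochner_Integration.integral_cong[OF refl])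
    fix y
    show "gegenbauer_weight \<alpha> y * of_real (y ^ (2 * Suc k)) = gegenbauer_weight \<alpha> y * of_real (y ^ (2 * k)) - gegenbauer_weight (\<alpha> + 1) y * of_real (y ^ (2 * k))"
    proof (cases "\<bar>y\<bar> < 1")
      case True
      then have "complex_of_real (1 - y\<^sup>2) \<noteq> 0" by (metis abs_square_less_1 diff_gt_0_iff_gt less_irrefl of_real_eq_0_iff)
      then have "complex_of_real (1 - y\<^sup>2) powr \<alpha> = of_real (1 - y\<^sup>2) * of_real (1 - y\<^sup>2) powr (\<alpha> - 1)"
        by (simp add: powr_diff)
      then have E: "gegenbauer_weight (\<alpha> + 1) y = of_real (1 - y\<^sup>2) * gegenbauer_weight \<alpha> y" using True by (simp add: gegenbauer_weight_def)
      show ?thesis unfolding E by (simp add: algebra_simps power2_eq_square)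
    qed (simp add: gegenbauer_weight_def)
  qed
  also have "\<dots> = Gamma (of_nat k + 1/2) * Gamma \<alpha> * rGamma (\<alpha> + 1/2 + of_nat k) -
      Gamma (of_nat k + 1/2) * Gamma (\<alpha> + 1) * rGamma (\<alpha> + 1 + 1/2 + of_nat k)"
    unfolding Bochner_Integration.integral_diff[OF I[OF Suc.prems] I[OF \<open>Re (\<alpha> + 1) > 0\<close>]]
      Suc.IH[OF Suc.prems] Suc.IH[OF \<open>Re (\<alpha> + 1) > 0\<close>] ..
  also have "\<dots> = Gamma (of_nat (Suc k) + 1/2) * Gamma \<alpha> * rGamma (\<alpha> + 1/2 + of_nat (Suc k))"
  proof -
    have g1: "Gamma (\<alpha> + 1) = \<alpha> * Gamma \<alpha>" by (rule Gamma_plus1[OF Re_pos_not_nonpos_Ints[OF Suc.prems]])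
    have "Re (of_nat k + 1/2) > 0" by simp
    from Gamma_plus1[OF Re_pos_not_nonpos_Ints[OF this]]
    have g2: "Gamma (of_nat (Suc k) + 1/2) = (of_nat k + 1/2) * Gamma (of_nat k + 1/2 :: complex)" by (simp add: add_ac)
    have g3: "rGamma (\<alpha> + 1/2 + of_nat k) = (\<alpha> + 1/2 + of_nat k) * rGamma (\<alpha> + 1/2 + of_nat (Suc k))"
      using rGamma_plus1[of "\<alpha> + 1/2 + of_nat k"] by (simp add: add_ac)
    have e: "\<alpha> + 1 + 1/2 + of_nat k = \<alpha> + 1/2 + of_nat (Suc k)" by simp
    show ?thesis unfolding g1 g2 g3 e by (simp add: algebra_simps)
  qed
  finally show ?case .
qed

lemma Gamma_half_nat: "Gamma (of_nat k + 1/2) * (fact k * 4 ^ k) = of_real (sqrt pi) * (fact (2 * k) :: complex)"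
proof (induction k)
  case 0
  then show ?case by (simp add: Gamma_one_half_complex)
next
  case (Suc k)
  have "Re (of_nat k + 1/2) > 0" by simp
  from Gamma_plus1[OF Re_pos_not_nonpos_Ints[OF this]]
  have g2: "Gamma (of_nat (Suc k) + 1/2) = (of_nat k + 1/2) * Gamma (of_nat k + 1/2 :: complex)" by (simp add: add_ac)
  have "Gamma (of_nat (Suc k) + 1/2) * (fact (Suc k) * 4 ^ Suc k) = ((of_nat k + 1/2) * (of_nat (Suc k) * 4)) * (Gamma (of_nat k + 1/2 :: complex) * (fact k * 4 ^ k))"
    unfolding g2 by (simp del: of_nat_Suc)
  also have "\<dots> = ((of_nat k + 1/2) * (of_nat (Suc k) * 4)) * (of_real (sqrt pi) * fact (2 * k))"
    by (simp only: Suc.IH)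
  also have "\<dots> = of_real (sqrt pi) * fact (2 * Suc k)"
    by (simp add: algebra_simps)
  finally show ?case .
qed

text \<open>Expand the exponential and integrate term by term. The odd moments vanish by symmetry,
  and \<open>Gamma_half_nat\<close> turns the even ones into the coefficients of
  \<open>bes\<close>.\<close>

lemma poisson_integral:
  assumes \<alpha>: "Re \<alpha> > 0"
  shows "(LINT y|lborel. gegenbauer_weight \<alpha> y * exp (\<kappa> * of_real y)) = of_real (sqrt pi) * Gamma \<alpha> * bes \<alpha> \<kappa>"
proof -
  let ?f = "\<lambda>n y. gegenbauer_weight \<alpha> y * ((\<kappa> * of_real y) ^ n /\<^sub>R fact n)"
  have bd: "norm ((\<kappa> * of_real y) ^ n /\<^sub>R fact n) \<le> norm \<kappa> ^ n /\<^sub>R fact n" if "\<bar>y\<bar> < 1" for y n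
  proof -
    have "norm (\<kappa> * of_real y) \<le> norm \<kappa> * 1" unfolding norm_mult using that by (intro mult_left_mono) auto
    then have "norm (\<kappa> * of_real y) ^ n \<le> norm \<kappa> ^ n" by (intro power_mono) auto
    then show ?thesis by (simp add: norm_power divide_right_mono)
  qed
  have I: "integrable lborel (?f n)" for n
    by (rule integrable_gegenbauer_weight_bounded[OF \<alpha> _ bd]) (auto intro!: continuous_intros)
  have s: "(\<lambda>n. (\<kappa> * of_real y) ^ n /\<^sub>R fact n) sums exp (\<kappa> * of_real y)" for y
    by (rule exp_converges)
  have sn: "summable (\<lambda>n. norm ((\<kappa> * of_real y) ^ n /\<^sub>R fact n))" for y
    by (rule summable_norm_exp)
  have "(\<lambda>n. LINT y|lborel. ?f n y) sums (LINT y|lborel. (\<Sum>n. ?f n y))"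
  proof (rule sums_integral[OF I])
    show "AE y in lborel. summable (\<lambda>n. norm (?f n y))"
      unfolding norm_mult by (intro AE_I2 summable_mult sn)
    have "norm (LINT y|lborel. norm (?f n y)) \<le> (norm \<kappa> ^ n /\<^sub>R fact n) * (LINT y|lborel. norm (gegenbauer_weight \<alpha> y))" for n
    proof -
      have "(LINT y|lborel. norm (?f n y)) \<le> (LINT y|lborel. (norm \<kappa> ^ n /\<^sub>R fact n) * norm (gegenbauer_weight \<alpha> y))"
      proof (rule integral_mono)
        show "integrable lborel (\<lambda>y. norm (?f n y))" by (rule integrable_norm[OF I])
        show "integrable lborel (\<lambda>y. (norm \<kappa> ^ n /\<^sub>R fact n) * norm (gegenbauer_weight \<alpha> y))"
          by (rule integrable_mult_right[OF integrable_norm[OF integrable_gegenbauer_weight[OF \<alpha>]]])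
        show "norm (?f n y) \<le> (norm \<kappa> ^ n /\<^sub>R fact n) * norm (gegenbauer_weight \<alpha> y)" for y
        proof (cases "\<bar>y\<bar> < 1")
          case True
          have "norm (gegenbauer_weight \<alpha> y) * norm ((\<kappa> * of_real y) ^ n /\<^sub>R fact n) \<le> norm (gegenbauer_weight \<alpha> y) * (norm \<kappa> ^ n /\<^sub>R fact n)"
            by (rule mult_left_mono[OF bd[OF True]]) simp
          then show ?thesis by (simp only: norm_mult mult_ac)
        qed (simp add: gegenbauer_weight_def)
      qed
      also have "\<dots> = (norm \<kappa> ^ n /\<^sub>R fact n) * (LINT y|lborel. norm (gegenbauer_weight \<alpha> y))" by (rule integral_mult_right_zero)
      finally show ?thesis by (simp add: Bochner_Integration.integral_nonneg)
    qed
    moreover have "summable (\<lambda>n. (norm \<kappa> ^ n /\<^sub>R fact n) * (LINT y|lborel. norm (gegenbauer_weight \<alpha> y)))"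
      by (intro summable_mult2) (rule summable_exp_generic)
    ultimately show "summable (\<lambda>n. LINT y|lborel. norm (?f n y))"
      by (intro summable_comparison_test[of "\<lambda>n. LINT y|lborel. norm (?f n y)"]) auto
  qed
  also have "(\<lambda>y. \<Sum>n. ?f n y) = (\<lambda>y. gegenbauer_weight \<alpha> y * exp (\<kappa> * of_real y))"
    using sums_unique[OF sums_mult[OF s]] by (simp add: fun_eq_iff)
  finally have S: "(\<lambda>n. LINT y|lborel. ?f n y) sums (LINT y|lborel. gegenbauer_weight \<alpha> y * exp (\<kappa> * of_real y))" .
  have odd: "(LINT y|lborel. ?f n y) = 0" if "n \<notin> range ((*) 2)" for n
  proof -
    have "odd n" using that by (auto simp: dvd_def)
    have "(LINT y|lborel. ?f n y) = \<bar>-1\<bar> *\<^sub>R (LINT y|lborel. ?f n (0 + -1 * y))"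
      by (rule lborel_integral_real_affine) simp
    also have "\<dots> = (LINT y|lborel. - ?f n y)"
    proof -
      have "gegenbauer_weight \<alpha> (- y) = gegenbauer_weight \<alpha> y" for y by (simp add: gegenbauer_weight_def)
      then show ?thesis using \<open>odd n\<close> by (simp add: power_minus_odd)
    qed
    finally have "(LINT y|lborel. ?f n y) = - (LINT y|lborel. ?f n y)"
      by (simp only: Bochner_Integration.integral_minus)
    then show ?thesis by simp
  qed
  have "(\<lambda>k. LINT y|lborel. ?f (2 * k) y) sums (LINT y|lborel. gegenbauer_weight \<alpha> y * exp (\<kappa> * of_real y))"
    using sums_mono_reindex[of "(*) 2" "\<lambda>n. LINT y|lborel. ?f n y", OF _ odd] S by (simp add: strict_mono_def)
  moreover have "(LINT y|lborel. ?f (2 * k) y) = of_real (sqrt pi) * Gamma \<alpha> * (rGamma (\<alpha> + 1/2 + of_nat k) / (fact k * 4 ^ k) * (\<kappa>\<^sup>2) ^ k)" for k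
  proof -
    have "(LINT y|lborel. ?f (2 * k) y) = (LINT y|lborel. (\<kappa> ^ (2 * k) / fact (2 * k)) * (gegenbauer_weight \<alpha> y * of_real (y ^ (2 * k))))"
      by (rule Bochner_Integration.integral_cong[OF refl]) (simp add: scaleR_conv_of_real power_mult_distrib divide_inverse)
    also have "\<dots> = (\<kappa> ^ (2 * k) / fact (2 * k)) * (Gamma (of_nat k + 1/2) * Gamma \<alpha> * rGamma (\<alpha> + 1/2 + of_nat k))"
      unfolding integral_mult_right_zero gegenbauer_weight_moment[OF \<alpha>] ..
    also have "Gamma (of_nat k + 1/2) = of_real (sqrt pi) * fact (2 * k) / (fact k * 4 ^ k :: complex)"
      using Gamma_half_nat[of k] by (simp add: field_simps)
    finally show ?thesis by (simp add: power_mult)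
  qed
  ultimately have "(\<lambda>k. of_real (sqrt pi) * Gamma \<alpha> * (rGamma (\<alpha> + 1/2 + of_nat k) / (fact k * 4 ^ k) * (\<kappa>\<^sup>2) ^ k)) sums
      (LINT y|lborel. gegenbauer_weight \<alpha> y * exp (\<kappa> * of_real y))" by simp
  from sums_unique2[OF this sums_mult[OF bes_sums[OF \<alpha>]]] show ?thesis .
qed

section \<open>A Laplace transform of the Bessel function\<close>

text \<open>Extension by zero encodes the region of integration in the integrand: the set where 2 x
  u - x^2 - 1 > 0 then needs no description of its own when the order of integration is
  exchanged.\<close>

definition cut_powr :: "complex \<Rightarrow> real \<Rightarrow> complex" where
  "cut_powr a x = (if x > 0 then of_real x powr a else 0)"

lemma measurable_cut_powr: "cut_powr a \<in> borel_measurable borel"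
proof -
  have "(\<lambda>x. indicator {0<..} x *\<^sub>R complex_of_real x powr a) \<in> borel_measurable borel"
  proof (rule borel_measurable_continuous_on_indicator)
    show "continuous_on {0<..} (\<lambda>x. complex_of_real x powr a)"
      by (rule continuous_on_of_real_holomorphic[of "\<lambda>z. z powr a" "- \<real>\<^sub>\<le>\<^sub>0"]) (auto intro!: holomorphic_intros)
  qed simp
  also have "(\<lambda>x. indicator {0<..} x *\<^sub>R complex_of_real x powr a) = cut_powr a"
    by (auto simp: fun_eq_iff cut_powr_def indicator_def)
  finally show ?thesis .
qed

lemma of_real_norm_cut_powr: "complex_of_real (norm (cut_powr a x)) = cut_powr (of_real (Re a)) x"
  using powr_of_real[of x "Re a"] by (auto simp: norm_powr_of_real_pos cut_powr_def)

lemma powr_half_of_real_square: "s > 0 \<Longrightarrow> complex_of_real (s\<^sup>2) powr (1/2) = of_real s"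
  using powr_of_real[of "s\<^sup>2" "1/2"] by (simp add: powr_half_sqrt)

lemma bes_even: "bes \<alpha> (- x) = bes \<alpha> x"
  by (simp add: bes_def)

text \<open>Poisson's integral in the light-cone coordinate x = u + y sqrt (u^2 - 1).\<close>

lemma poisson_integral_light_cone:
  assumes \<alpha>: "Re \<alpha> > 0" and u: "u > 1"
  shows "integrable posm (\<lambda>x. cut_powr (\<alpha> - 1) (2 * x * u - x\<^sup>2 - 1) * exp (- (\<delta> * of_real (x - u))))"
    and "(LINT x|posm. cut_powr (\<alpha> - 1) (2 * x * u - x\<^sup>2 - 1) * exp (- (\<delta> * of_real (x - u)))) =
      of_real (sqrt pi) * Gamma \<alpha> * of_real (u\<^sup>2 - 1) powr (\<alpha> - 1/2) * bes \<alpha> (\<delta> * of_real (sqrt (u\<^sup>2 - 1)))"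
proof -
  define s where "s = sqrt (u\<^sup>2 - 1)"
  have u2: "u\<^sup>2 > 1" using u by (simp add: one_less_power)
  then have s: "s > 0" "s\<^sup>2 = u\<^sup>2 - 1" by (simp_all add: s_def)
  let ?g = "\<lambda>x. cut_powr (\<alpha> - 1) (2 * x * u - x\<^sup>2 - 1) * exp (- (\<delta> * of_real (x - u)))"
  \<comment> \<open>With x = u + s y the quadratic 2 x u - x^2 - 1 becomes s^2 (1 - y^2), so what
    remains is Poisson's integral at - \<delta> s.\<close>
  have gy: "?g (u + s * y) = of_real (s\<^sup>2) powr (\<alpha> - 1) * (gegenbauer_weight \<alpha> y * exp ((- \<delta> * of_real s) * of_real y))" for y
  proof -
    have D: "2 * (u + s * y) * u - (u + s * y)\<^sup>2 - 1 = s\<^sup>2 * (1 - y\<^sup>2)"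
      using s(2) by (simp add: power2_eq_square algebra_simps)
    have "s\<^sup>2 * (1 - y\<^sup>2) > 0 \<longleftrightarrow> \<bar>y\<bar> < 1"
      using s(1) by (simp add: zero_less_mult_iff abs_square_less_1)
    moreover have "complex_of_real (s\<^sup>2 * (1 - y\<^sup>2)) powr (\<alpha> - 1) = of_real (s\<^sup>2) powr (\<alpha> - 1) * of_real (1 - y\<^sup>2) powr (\<alpha> - 1)" if "\<bar>y\<bar> < 1"
    proof -
      have "1 - y\<^sup>2 \<ge> 0" using that by (simp add: abs_square_le_1)
      then show ?thesis using powr_times_real[of "of_real (s\<^sup>2)" "of_real (1 - y\<^sup>2)" "\<alpha> - 1"] by simp
    qed
    ultimately show ?thesis unfolding D cut_powr_def gegenbauer_weight_def by (simp add: mult_ac)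
  qed
  \<comment> \<open>The integrand is supported in x > 0, so the half-line integral is an integral
    over the whole line, where the affine substitution is available.\<close>
  have pos: "x > 0" if "cut_powr (\<alpha> - 1) (2 * x * u - x\<^sup>2 - 1) \<noteq> 0" for x
  proof (rule ccontr)
    assume "\<not> x > 0"
    then have "2 * x * u \<le> 0" using u by (simp add: mult_nonpos_nonneg)
    moreover have "x\<^sup>2 \<ge> 0" by simp
    ultimately have "\<not> 2 * x * u - x\<^sup>2 - 1 > 0" by linarith
    with that show False by (simp add: cut_powr_def)
  qed
  have ind: "indicator {0<..} x *\<^sub>R ?g x = ?g x" for x
    using pos[of x] by (cases "x > 0") auto
  have Iy: "integrable lborel (\<lambda>y. gegenbauer_weight \<alpha> y * exp ((- \<delta> * of_real s) * of_real y))"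
  proof (rule integrable_gegenbauer_weight_bounded[OF \<alpha>])
    show "continuous_on UNIV (\<lambda>y. exp ((- \<delta> * of_real s) * complex_of_real y))" by (intro continuous_intros)
    fix y :: real assume "\<bar>y\<bar> < 1"
    have "norm (exp ((- \<delta> * of_real s) * complex_of_real y)) \<le> exp (norm ((- \<delta> * of_real s) * complex_of_real y))"
      by (rule norm_exp)
    also have "\<dots> \<le> exp (norm (- \<delta> * of_real s) * 1)"
      unfolding norm_mult[of "- \<delta> * of_real s"] using \<open>\<bar>y\<bar> < 1\<close> by (intro iffD2[OF exp_le_cancel_iff] mult_left_mono) auto
    finally show "norm (exp ((- \<delta> * of_real s) * complex_of_real y)) \<le> exp (norm (- \<delta> * of_real s) * 1)" .
  qed
  have "integrable lborel (\<lambda>y. ?g (u + s * y))"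
    unfolding gy by (rule integrable_mult_right[OF Iy])
  then have "integrable lborel ?g"
    by (rule lborel_integrable_real_affine_iff[THEN iffD1, rotated]) (use s in simp)
  then show "integrable posm ?g"
    unfolding integrable_posm set_integrable_def ind .
  have "(LINT x|posm. ?g x) = (LINT x|lborel. ?g x)"
    unfolding integral_posm set_lebesgue_integral_def ind ..
  also have "\<dots> = \<bar>s\<bar> *\<^sub>R (LINT y|lborel. ?g (u + s * y))"
    by (rule lborel_integral_real_affine) (use s in simp)
  also have "\<dots> = of_real s * (of_real (s\<^sup>2) powr (\<alpha> - 1) * (of_real (sqrt pi) * Gamma \<alpha> * bes \<alpha> (- \<delta> * of_real s)))"
    unfolding gy integral_mult_right_zero poisson_integral[OF \<alpha>] using s by (simp add: scaleR_conv_of_real)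
  also have "bes \<alpha> (- \<delta> * of_real s) = bes \<alpha> (\<delta> * of_real s)"
    using bes_even[of \<alpha> "\<delta> * of_real s"] by simp
  also have "of_real s * (of_real (s\<^sup>2) powr (\<alpha> - 1) * (of_real (sqrt pi) * Gamma \<alpha> * bes \<alpha> (\<delta> * of_real s))) =
     of_real (sqrt pi) * Gamma \<alpha> * (of_real s * of_real (s\<^sup>2) powr (\<alpha> - 1)) * bes \<alpha> (\<delta> * of_real s)"
    by (simp only: mult_ac)
  also have "of_real s * complex_of_real (s\<^sup>2) powr (\<alpha> - 1) = of_real (u\<^sup>2 - 1) powr (\<alpha> - 1/2)"
  proof -
    have "complex_of_real (s\<^sup>2) powr (\<alpha> - 1/2) = of_real (s\<^sup>2) powr (\<alpha> - 1 + 1/2)" by simp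
    also have "\<dots> = of_real (s\<^sup>2) powr (\<alpha> - 1) * of_real (s\<^sup>2) powr (1/2)" by (rule powr_add)
    also have "complex_of_real (s\<^sup>2) powr (1/2) = of_real s"
      by (rule powr_half_of_real_square[OF s(1)])
    finally show ?thesis unfolding s(2) by (simp only: mult_ac)
  qed
  finally show "(LINT x|posm. ?g x) = of_real (sqrt pi) * Gamma \<alpha> * of_real (u\<^sup>2 - 1) powr (\<alpha> - 1/2) * bes \<alpha> (\<delta> * of_real (sqrt (u\<^sup>2 - 1)))"
    by (simp only: s_def)
qed

text \<open>At fixed x the base 2 x (1 + m) - x^2 - 1 is affine in m, so the integral over m is a
  Gamma integral. It leaves exp (- (A x + B / x)).\<close>

lemma light_cone_inner:
  assumes \<alpha>: "Re \<alpha> > 0" and B: "B > 0" and x: "x > 0"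
  shows "integrable posm (\<lambda>m. cut_powr (\<alpha> - 1) (2 * x * (1 + m) - x\<^sup>2 - 1) * exp (- of_real (2 * B * (1 + m) + (A - B) * x)))"
    and "(LINT m|posm. cut_powr (\<alpha> - 1) (2 * x * (1 + m) - x\<^sup>2 - 1) * exp (- of_real (2 * B * (1 + m) + (A - B) * x))) =
      1/2 * Gamma \<alpha> * of_real B powr (- \<alpha>) * (of_real x powr (\<alpha> - 1) * exp (- of_real (A * x + B / x)))"
proof -
  let ?g = "\<lambda>m. cut_powr (\<alpha> - 1) (2 * x * (1 + m) - x\<^sup>2 - 1) * exp (- of_real (2 * B * (1 + m) + (A - B) * x))"
  \<comment> \<open>The value of m at which the base of the power vanishes; it is nonnegative for x
    > 0. The new variable z below is the base itself.\<close>
  let ?t = "(x - 1)\<^sup>2 / (2 * x)"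
  let ?K = "exp (- complex_of_real (A * x + B / x))"
  have gz: "?g (?t + 1 / (2 * x) * z) = indicator {0<..} z *\<^sub>R (?K * (of_real z powr (\<alpha> - 1) * exp (- (of_real (B / x) * of_real z))))" for z
  proof -
    have D: "2 * x * (1 + (?t + 1 / (2 * x) * z)) - x\<^sup>2 - 1 = z"
      using x by (simp add: field_simps power2_eq_square)
    have E: "2 * B * (1 + (?t + 1 / (2 * x) * z)) + (A - B) * x = (A * x + B / x) + B / x * z"
      using x by (simp add: field_simps power2_eq_square)
    show ?thesis unfolding D E cut_powr_def by (simp add: exp_diff exp_minus divide_inverse mult_ac)
  qed
  have pos: "m > 0" if "cut_powr (\<alpha> - 1) (2 * x * (1 + m) - x\<^sup>2 - 1) \<noteq> 0" for m
  proof (rule ccontr)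
    assume "\<not> m > 0"
    then have "2 * x * m \<le> 0" using x by (simp add: mult_nonneg_nonpos)
    moreover have "(x - 1)\<^sup>2 \<ge> 0" by simp
    ultimately have "\<not> 2 * x * (1 + m) - x\<^sup>2 - 1 > 0" by (simp add: power2_eq_square algebra_simps)
    with that show False by (simp add: cut_powr_def)
  qed
  have ind: "indicator {0<..} m *\<^sub>R ?g m = ?g m" for m
    using pos[of m] by (cases "m > 0") auto
  have Bx: "B / x > 0" using B x by simp
  have "integrable posm (\<lambda>z. ?K * (of_real z powr (\<alpha> - 1) * exp (- (of_real (B / x) * of_real z))))"
    by (rule integrable_mult_right[OF integrable_Gamma_posm_complex[OF \<alpha> Bx]])
  then have "integrable lborel (\<lambda>z. ?g (?t + 1 / (2 * x) * z))"
    unfolding gz integrable_posm set_integrable_def .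
  then have "integrable lborel ?g"
    by (rule lborel_integrable_real_affine_iff[THEN iffD1, rotated]) (use x in simp)
  then show "integrable posm ?g"
    unfolding integrable_posm set_integrable_def ind .
  have "(LINT m|posm. ?g m) = (LINT m|lborel. ?g m)"
    unfolding integral_posm set_lebesgue_integral_def ind ..
  also have "\<dots> = \<bar>1 / (2 * x)\<bar> *\<^sub>R (LINT z|lborel. ?g (?t + 1 / (2 * x) * z))"
    by (rule lborel_integral_real_affine) (use x in simp)
  also have "(LINT z|lborel. ?g (?t + 1 / (2 * x) * z)) = (LINT z|posm. ?K * (of_real z powr (\<alpha> - 1) * exp (- (of_real (B / x) * of_real z))))"
    unfolding gz integral_posm set_lebesgue_integral_def ..
  also have "\<dots> = ?K * (Gamma \<alpha> * of_real (B / x) powr (- \<alpha>))"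
    unfolding integral_mult_right_zero integral_Gamma_posm_scaled[OF \<alpha> Bx] ..
  also have "\<bar>1 / (2 * x)\<bar> *\<^sub>R (?K * (Gamma \<alpha> * of_real (B / x) powr (- \<alpha>))) =
      1/2 * Gamma \<alpha> * of_real B powr (- \<alpha>) * (of_real x powr (\<alpha> - 1) * ?K)"
  proof -
    have "complex_of_real B powr (- \<alpha>) = of_real (x * (B / x)) powr (- \<alpha>)" using x by simp
    also have "\<dots> = of_real x powr (- \<alpha>) * of_real (B / x) powr (- \<alpha>)"
      using powr_times_real[of "of_real x" "of_real (B / x)" "- \<alpha>"] x B by simp
    finally have 1: "complex_of_real B powr (- \<alpha>) = of_real x powr (- \<alpha>) * of_real (B / x) powr (- \<alpha>)" .
    have 2: "complex_of_real x powr (- \<alpha>) * of_real x powr (\<alpha> - 1) = 1 / of_real x"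
    proof -
      have "complex_of_real x powr (- \<alpha>) * of_real x powr (\<alpha> - 1) = of_real x powr (- \<alpha> + (\<alpha> - 1))"
        by (rule powr_add[symmetric])
      also have "- \<alpha> + (\<alpha> - 1) = - 1" by simp
      finally show ?thesis using x by (simp add: powr_minus_divide)
    qed
    have "1/2 * Gamma \<alpha> * (of_real x powr (- \<alpha>) * of_real (B / x) powr (- \<alpha>)) * (of_real x powr (\<alpha> - 1) * ?K)
      = 1/2 * Gamma \<alpha> * of_real (B / x) powr (- \<alpha>) * ?K * (complex_of_real x powr (- \<alpha>) * of_real x powr (\<alpha> - 1))"
      by (simp only: mult_ac)
    also have "\<dots> = \<bar>1 / (2 * x)\<bar> *\<^sub>R (?K * (Gamma \<alpha> * of_real (B / x) powr (- \<alpha>)))"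
      unfolding 2 using x by (simp add: scaleR_conv_of_real field_simps)
    finally show ?thesis unfolding 1 by (rule sym)
  qed
  finally show "(LINT m|posm. ?g m) = 1/2 * Gamma \<alpha> * of_real B powr (- \<alpha>) * (of_real x powr (\<alpha> - 1) * ?K)" .
qed

lemma integrable_xi:
  assumes "p > 0" "A > 0" "B \<ge> 0"
  shows "integrable posm (\<lambda>x. x powr (p - 1) * exp (- (A * x + B / x)))"
proof (rule Bochner_Integration.integrable_bound[OF integrable_Gamma_posm[OF assms(1,2)]])
  show "(\<lambda>x. x powr (p - 1) * exp (- (A * x + B / x))) \<in> borel_measurable posm"
    by (rule borel_measurable_posm_continuous_on) (auto intro!: continuous_intros)
  show "AE x in posm. norm (x powr (p - 1) * exp (- (A * x + B / x))) \<le> norm (x powr (p - 1) * exp (- (A * x)))"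
  proof (rule AE_I2)
    fix x assume "x \<in> space posm"
    then have "B / x \<ge> 0" using assms by simp
    then have "exp (- (A * x + B / x)) \<le> exp (- (A * x))" by simp
    then show "norm (x powr (p - 1) * exp (- (A * x + B / x))) \<le> norm (x powr (p - 1) * exp (- (A * x)))"
      by (simp add: abs_mult mult_left_mono)
  qed
qed

text \<open>One double integral in x and m evaluated in both orders, with u = 1 + m. Integrating
  over x gives the Bessel factor by Poisson's integral, integrating over m gives
  \<open>light_cone_inner\<close>, and the common factor Gamma \<alpha> cancels.\<close>

lemma Laplace_bes:
  assumes \<alpha>: "Re \<alpha> > 0" and B: "B > 0" and A: "A > 0"
  shows "of_real (sqrt pi) * (LINT m|posm. of_real ((1 + m)\<^sup>2 - 1) powr (\<alpha> - 1/2) * exp (- of_real ((A + B) * (1 + m))) *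
      bes \<alpha> (of_real (A - B) * of_real (sqrt ((1 + m)\<^sup>2 - 1)))) =
    1/2 * of_real B powr (- \<alpha>) * (LINT x|posm. of_real x powr (\<alpha> - 1) * exp (- of_real (A * x + B / x)))"
proof -
  let ?f = "\<lambda>x m. cut_powr (\<alpha> - 1) (2 * x * (1 + m) - x\<^sup>2 - 1) * exp (- complex_of_real (2 * B * (1 + m) + (A - B) * x))"
  have G: "Gamma \<alpha> \<noteq> 0" by (rule Gamma_nonzero_Re_pos[OF \<alpha>])
  have fst_m: "fst \<in> borel_measurable (posm \<Otimes>\<^sub>M posm)" and snd_m: "snd \<in> borel_measurable (posm \<Otimes>\<^sub>M posm)"
    by (rule measurable_fst_posm measurable_snd_posm)+
  have int: "integrable (posm \<Otimes>\<^sub>M posm) (\<lambda>(x,m). ?f x m)"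
  proof (rule integrable_posm_pairI)
    have "(\<lambda>p. 2 * fst p * (1 + snd p) - (fst p)\<^sup>2 - 1) \<in> borel_measurable (posm \<Otimes>\<^sub>M posm)"
      by (intro borel_measurable_diff borel_measurable_times borel_measurable_power borel_measurable_add borel_measurable_const fst_m snd_m)
    from measurable_compose[OF this measurable_cut_powr]
    have m1: "(\<lambda>p. cut_powr (\<alpha> - 1) (2 * fst p * (1 + snd p) - (fst p)\<^sup>2 - 1)) \<in> borel_measurable (posm \<Otimes>\<^sub>M posm)" .
    have "(\<lambda>p. 2 * B * (1 + snd p) + (A - B) * fst p) \<in> borel_measurable (posm \<Otimes>\<^sub>M posm)"
      by (intro borel_measurable_times borel_measurable_add borel_measurable_const fst_m snd_m)
    from borel_measurable_uminus[OF measurable_compose[OF this borel_measurable_of_real]]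
    have "(\<lambda>p. - complex_of_real (2 * B * (1 + snd p) + (A - B) * fst p)) \<in> borel_measurable (posm \<Otimes>\<^sub>M posm)" .
    from borel_measurable_times[OF m1 measurable_compose[OF this borel_measurable_exp]]
    show "(\<lambda>(x,m). ?f x m) \<in> borel_measurable (posm \<Otimes>\<^sub>M posm)"
      unfolding case_prod_unfold .
    show "integrable posm (?f x)" if "x > 0" for x by (rule light_cone_inner(1)[OF \<alpha> B that])
    show "(LINT m|posm. norm (?f x m)) = norm (1/2 * Gamma (of_real (Re \<alpha>)) * of_real B powr (- of_real (Re \<alpha>)) :: complex) * (x powr (Re \<alpha> - 1) * exp (- (A * x + B / x)))"
      if x: "x > 0" for x
    proof -
      let ?r = "complex_of_real (Re \<alpha>)"
      have r: "Re ?r > 0" using \<alpha> by simp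
      have n: "complex_of_real (norm (?f x m)) = cut_powr (?r - 1) (2 * x * (1 + m) - x\<^sup>2 - 1) * exp (- complex_of_real (2 * B * (1 + m) + (A - B) * x))" for m
        unfolding norm_mult of_real_mult of_real_norm_cut_powr by (simp add: exp_of_real[symmetric])
      have "complex_of_real (LINT m|posm. norm (?f x m)) = (LINT m|posm. complex_of_real (norm (?f x m)))"
        by (rule integral_complex_of_real[symmetric])
      also have "\<dots> = 1/2 * Gamma ?r * of_real B powr (- ?r) * (of_real x powr (?r - 1) * exp (- of_real (A * x + B / x)))"
        unfolding n by (rule light_cone_inner(2)[OF r B x])
      finally have *: "complex_of_real (LINT m|posm. norm (?f x m)) = 1/2 * Gamma ?r * of_real B powr (- ?r) * (of_real x powr (?r - 1) * exp (- of_real (A * x + B / x)))" .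
      have "(LINT m|posm. norm (?f x m)) = norm (complex_of_real (LINT m|posm. norm (?f x m)))"
        by (simp add: Bochner_Integration.integral_nonneg)
      also have "\<dots> = norm (1/2 * Gamma ?r * of_real B powr (- ?r)) * (x powr (Re \<alpha> - 1) * exp (- (A * x + B / x)))"
        unfolding * norm_mult[of "1/2 * Gamma ?r * of_real B powr (- ?r)"] norm_mult[of "of_real x powr (?r - 1)"]
        using norm_powr_of_real_pos[OF x, of "?r - 1"] by simp
      finally show ?thesis .
    qed
    show "integrable posm (\<lambda>x. norm (1/2 * Gamma (of_real (Re \<alpha>)) * of_real B powr (- of_real (Re \<alpha>)) :: complex) * (x powr (Re \<alpha> - 1) * exp (- (A * x + B / x))))"
      using \<alpha> A B by (intro integrable_mult_right integrable_xi) auto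
  qed
  have "(LINT m|posm. LINT x|posm. ?f x m) = (LINT x|posm. LINT m|posm. ?f x m)"
    by (rule integrable_posm_swap(2)[OF int, symmetric])
  also have "\<dots> = (LINT x|posm. (1/2 * Gamma \<alpha> * of_real B powr (- \<alpha>)) * (of_real x powr (\<alpha> - 1) * exp (- of_real (A * x + B / x))))"
    by (rule Bochner_Integration.integral_cong[OF refl], rule light_cone_inner(2)[OF \<alpha> B]) simp
  also have "\<dots> = (1/2 * Gamma \<alpha> * of_real B powr (- \<alpha>)) * (LINT x|posm. of_real x powr (\<alpha> - 1) * exp (- of_real (A * x + B / x)))"
    by (rule integral_mult_right_zero)
  finally have R: "(LINT m|posm. LINT x|posm. ?f x m) = \<dots>" .
  let ?L = "\<lambda>m. of_real ((1 + m)\<^sup>2 - 1) powr (\<alpha> - 1/2) * exp (- of_real ((A + B) * (1 + m))) * bes \<alpha> (of_real (A - B) * of_real (sqrt ((1 + m)\<^sup>2 - 1)))"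
  have "(LINT m|posm. LINT x|posm. ?f x m) = (LINT m|posm. (of_real (sqrt pi) * Gamma \<alpha>) * ?L m)"
  proof (rule Bochner_Integration.integral_cong[OF refl])
    fix m assume "m \<in> space posm"
    then have m: "1 + m > 1" by simp
    have "?f x m = exp (- of_real ((A + B) * (1 + m))) * (cut_powr (\<alpha> - 1) (2 * x * (1 + m) - x\<^sup>2 - 1) * exp (- (of_real (A - B) * of_real (x - (1 + m)))))" for x
    proof -
      \<comment> \<open>Centring x at u = 1 + m separates the factor exp (- (A + B) u) from
        Poisson's integral with \<delta> = A - B.\<close>
      have "2 * B * (1 + m) + (A - B) * x = (A + B) * (1 + m) + (A - B) * (x - (1 + m))" by (simp add: algebra_simps)
      then have "exp (- complex_of_real (2 * B * (1 + m) + (A - B) * x)) = exp (- of_real ((A + B) * (1 + m))) * exp (- (of_real (A - B) * of_real (x - (1 + m))))"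
        by (simp only: of_real_add of_real_mult minus_add_distrib exp_add)
      then show ?thesis by (simp only: mult_ac)
    qed
    then have "(LINT x|posm. ?f x m) = exp (- of_real ((A + B) * (1 + m))) * (of_real (sqrt pi) * Gamma \<alpha> * of_real ((1 + m)\<^sup>2 - 1) powr (\<alpha> - 1/2) * bes \<alpha> (of_real (A - B) * of_real (sqrt ((1 + m)\<^sup>2 - 1))))"
      by (simp only: integral_mult_right_zero poisson_integral_light_cone(2)[OF \<alpha> m])
    then show "(LINT x|posm. ?f x m) = (of_real (sqrt pi) * Gamma \<alpha>) * ?L m"
      by (simp only: mult_ac)
  qed
  also have "\<dots> = Gamma \<alpha> * (of_real (sqrt pi) * (LINT m|posm. ?L m))"
    unfolding integral_mult_right_zero by (simp only: mult_ac)
  finally have "Gamma \<alpha> * (of_real (sqrt pi) * (LINT m|posm. ?L m)) =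
     Gamma \<alpha> * (1/2 * of_real B powr (- \<alpha>) * (LINT x|posm. of_real x powr (\<alpha> - 1) * exp (- of_real (A * x + B / x))))"
    unfolding R by (simp only: mult_ac)
  then show ?thesis by (rule mult_left_cancel[THEN iffD1, OF G])
qed

section \<open>The product formula for positive arguments\<close>

lemma powr_of_real_exp_ln: "x > 0 \<Longrightarrow> complex_of_real x powr a = exp (a * of_real (ln x))"
  by (simp add: powr_def Ln_of_real)

lemma of_real_exp_ln: "x > 0 \<Longrightarrow> complex_of_real x = exp (of_real (ln x))"
  by (simp add: exp_of_real)

lemma integrable_tricomi_Laplace:
  assumes "Re c > 0" "Re a > 0" "w > 0"
  shows "integrable posm (\<lambda>x. complex_of_real x powr (a - 1) * of_real (1 + x) powr (- c) * exp (- (of_real w * of_real x)))"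
proof (rule Bochner_Integration.integrable_bound[OF integrable_Gamma_posm[OF assms(2,3)]])
  show "(\<lambda>x. complex_of_real x powr (a - 1) * of_real (1 + x) powr (- c) * exp (- (of_real w * of_real x))) \<in> borel_measurable posm"
  proof (rule borel_measurable_posm_continuous_on)
    have "continuous_on {0<..} (\<lambda>x. (\<lambda>z. z powr (a - 1) * (1 + z) powr (- c) * exp (- (of_real w * z))) (complex_of_real x))"
    proof (rule continuous_on_of_real_holomorphic[of _ "{z. z \<notin> \<real>\<^sub>\<le>\<^sub>0 \<and> 1 + z \<notin> \<real>\<^sub>\<le>\<^sub>0}"])
      show "(\<lambda>z. z powr (a - 1) * (1 + z) powr (- c) * exp (- (of_real w * z))) holomorphic_on {z. z \<notin> \<real>\<^sub>\<le>\<^sub>0 \<and> 1 + z \<notin> \<real>\<^sub>\<le>\<^sub>0}"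
        by (intro holomorphic_intros) auto
    qed (auto simp: complex_nonpos_Reals_iff)
    then show "continuous_on {0<..} (\<lambda>x. complex_of_real x powr (a - 1) * of_real (1 + x) powr (- c) * exp (- (of_real w * of_real x)))"
      by simp
  qed
  show "AE x in posm. norm (complex_of_real x powr (a - 1) * of_real (1 + x) powr (- c) * exp (- (of_real w * of_real x))) \<le> norm (x powr (Re a - 1) * exp (- (w * x)))"
  proof (rule AE_I2)
    fix x assume "x \<in> space posm"
    then have x: "x > 0" "1 + x > 0" by simp_all
    have "(1 + x) powr (- Re c) \<le> (1 + x) powr 0" using x assms by (intro powr_mono) auto
    then have "(1 + x) powr (- Re c) \<le> 1" using x by simp
    from mult_left_mono[OF this, of "x powr (Re a - 1) * exp (- (w * x))"]
    show "norm (complex_of_real x powr (a - 1) * of_real (1 + x) powr (- c) * exp (- (of_real w * of_real x))) \<le> norm (x powr (Re a - 1) * exp (- (w * x)))"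
      using norm_powr_of_real_pos[OF x(1), of "a - 1"] norm_powr_of_real_pos[OF x(2), of "- c"]
      by (simp add: norm_mult mult_ac)
  qed
qed

lemma integrable_posm_product:
  fixes f g :: "real \<Rightarrow> complex"
  assumes "integrable posm f" "integrable posm g"
  shows "integrable (posm \<Otimes>\<^sub>M posm) (\<lambda>(x,y). f x * g y)"
proof (rule integrable_posm_pairI[where h = "\<lambda>x. norm (f x) * (LINT y|posm. norm (g y))"])
  have "(\<lambda>p. f (fst p) * g (snd p)) \<in> borel_measurable (posm \<Otimes>\<^sub>M posm)"
    by (rule borel_measurable_times[OF measurable_compose[OF measurable_fst borel_measurable_integrable[OF assms(1)]]
          measurable_compose[OF measurable_snd borel_measurable_integrable[OF assms(2)]]])
  then show "(\<lambda>(x,y). f x * g y) \<in> borel_measurable (posm \<Otimes>\<^sub>M posm)" unfolding case_prod_unfold .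
  show "integrable posm (\<lambda>y. f x * g y)" for x by (rule integrable_mult_right[OF assms(2)])
  show "(LINT y|posm. norm (f x * g y)) = norm (f x) * (LINT y|posm. norm (g y))" for x
    unfolding norm_mult by (rule integral_mult_right_zero)
  show "integrable posm (\<lambda>x. norm (f x) * (LINT y|posm. norm (g y)))"
    by (rule integrable_mult_left[OF integrable_norm[OF assms(1)]])
qed

text \<open>
  The substitution x = u + v, y = u (1 + u + v) / v, carried out as a chain of scalings.  It cancels all powers
  of x and of 1 + x when the two factors are written with opposite Laplace representations.
\<close>

lemma tricomi_product_substitution:
  assumes c: "Re c > 0" and \<alpha>: "Re \<alpha> > 0" and a: "a = \<alpha> + c" and X: "X > 0" and Y: "Y > 0"
  defines "k \<equiv> sqrt (X * Y)"
  shows "of_real Y powr (- \<alpha>) * ((LINT x|posm. of_real x powr (a - 1) * of_real (1 + x) powr (- c) * exp (- (of_real X * of_real x))) *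
      (LINT y|posm. of_real y powr (c - 1) * of_real (1 + y) powr (- a) * exp (- (of_real Y * of_real y)))) =
    of_real k powr (- \<alpha>) * (LINT u|posm. of_real u powr (c - 1) * of_real (1 + u) powr (- c) * exp (- of_real ((X + Y) * u)) *
      (LINT x|posm. of_real x powr (\<alpha> - 1) * exp (- of_real ((1 + u) * k * x + u * k / x))))"
proof -
  have ra: "Re a > 0" using a c \<alpha> by simp
  have k: "k > 0" "k * k = X * Y" using X Y by (simp_all add: k_def)
  let ?f = "\<lambda>x. complex_of_real x powr (a - 1) * of_real (1 + x) powr (- c) * exp (- (of_real X * of_real x))"
  let ?g = "\<lambda>y. complex_of_real y powr (c - 1) * of_real (1 + y) powr (- a) * exp (- (of_real Y * of_real y))"
  define f0 where "f0 = (\<lambda>x y. ?f x * ?g y)"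
  \<comment> \<open>The substitutions are y = (1 + x) q, then x = (1 + q) v, then q = u / v, each
    with its Jacobian. Together they give x = u + v and y = u (1 + u + v) / v. Finally v is rescaled
    at fixed u.\<close>
  define f1 where "f1 = (\<lambda>x q. of_real (1 + x) * f0 x ((1 + x) * q))"
  define f2 where "f2 = (\<lambda>q v. of_real (1 + q) * f1 ((1 + q) * v) q)"
  define f3 where "f3 = (\<lambda>v u. of_real (1 / v) * f2 (1 / v * u) v)"
  \<comment> \<open>With v = \<rho>(u) x the terms of the exponent that depend on v become X v = (1
    + u) k x and Y u (1 + u) / v = u k / x, the shape A x + B / x of the Laplace transform.\<close>
  define \<rho> where "\<rho> = (\<lambda>u. k * (1 + u) / X)"
  define f4 where "f4 = (\<lambda>u x. of_real (\<rho> u) * f3 (\<rho> u * x) u)"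
  have If: "integrable posm ?f" by (rule integrable_tricomi_Laplace[OF c ra X])
  have Ig: "integrable posm ?g" by (rule integrable_tricomi_Laplace[OF ra c Y])
  have m1: "(\<lambda>x. 1 + x) \<in> borel_measurable posm"
    by (intro borel_measurable_add borel_measurable_const measurable_ident_posm)
  have m2: "(\<lambda>v. 1 / v) \<in> borel_measurable posm"
    by (intro borel_measurable_divide borel_measurable_const measurable_ident_posm)
  have m3: "\<rho> \<in> borel_measurable posm"
    unfolding \<rho>_def by (intro borel_measurable_divide borel_measurable_times borel_measurable_add borel_measurable_const measurable_ident_posm)
  have p1: "1 + x > 0" if "x > 0" for x :: real using that by simp
  have p2: "1 / v > 0" if "v > 0" for v :: real using that by simp
  have p3: "\<rho> u > 0" if "u > 0" for u using that k X by (simp add: \<rho>_def)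
  have I0: "integrable (posm \<Otimes>\<^sub>M posm) (\<lambda>(x,y). f0 x y)"
    unfolding f0_def by (rule integrable_posm_product[OF If Ig])
  have I1: "integrable (posm \<Otimes>\<^sub>M posm) (\<lambda>(x,q). f1 x q)"
    unfolding f1_def by (rule integrable_posm_skew(1)[OF m1 p1 I0])
  have I2: "integrable (posm \<Otimes>\<^sub>M posm) (\<lambda>(q,v). f2 q v)"
    unfolding f2_def by (rule integrable_posm_skew(1)[OF m1 p1 integrable_posm_swap(1)[OF I1]])
  have I3: "integrable (posm \<Otimes>\<^sub>M posm) (\<lambda>(v,u). f3 v u)"
    unfolding f3_def by (rule integrable_posm_skew(1)[OF m2 p2 integrable_posm_swap(1)[OF I2]])
  have "(LINT x|posm. LINT y|posm. f0 x y) = (LINT x|posm. LINT q|posm. f1 x q)"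
    unfolding f1_def by (rule integrable_posm_skew(2)[OF m1 p1 I0])
  also have "\<dots> = (LINT q|posm. LINT x|posm. f1 x q)"
    by (rule integrable_posm_swap(2)[OF I1])
  also have "\<dots> = (LINT q|posm. LINT v|posm. f2 q v)"
    unfolding f2_def by (rule integrable_posm_skew(2)[OF m1 p1 integrable_posm_swap(1)[OF I1]])
  also have "\<dots> = (LINT v|posm. LINT q|posm. f2 q v)"
    by (rule integrable_posm_swap(2)[OF I2])
  also have "\<dots> = (LINT v|posm. LINT u|posm. f3 v u)"
    unfolding f3_def by (rule integrable_posm_skew(2)[OF m2 p2 integrable_posm_swap(1)[OF I2]])
  also have "\<dots> = (LINT u|posm. LINT v|posm. f3 v u)"
    by (rule integrable_posm_swap(2)[OF I3])
  also have "\<dots> = (LINT u|posm. LINT x|posm. f4 u x)"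
    unfolding f4_def by (rule integrable_posm_skew(2)[OF m3 p3 integrable_posm_swap(1)[OF I3]])
  finally have chain: "(LINT x|posm. LINT y|posm. f0 x y) = (LINT u|posm. LINT x|posm. f4 u x)" .
  have key: "of_real Y powr (- \<alpha>) * f4 u x = of_real k powr (- \<alpha>) * (of_real u powr (c - 1) * of_real (1 + u) powr (- c) * exp (- of_real ((X + Y) * u))) *
      (of_real x powr (\<alpha> - 1) * exp (- of_real ((1 + u) * k * x + u * k / x)))" if u: "u > 0" and x: "x > 0" for u x
  proof -
    define v where "v = \<rho> u * x"
    have v: "v > 0" unfolding v_def using p3[OF u] x by simp
    define xx where "xx = (1 + 1 / v * u) * v"
    define yy where "yy = (1 + xx) * (1 / v * u)"
    have xx: "xx = u + v" unfolding xx_def using v by (simp add: field_simps)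
    have yy: "yy = u * (1 + u + v) / v" unfolding yy_def xx by simp
    have yy1: "1 + yy = (u + v) * (1 + u) / v" unfolding yy using v by (simp add: field_simps)
    have f4v: "f4 u x = of_real (\<rho> u) * (of_real (1 / v) * (of_real (1 + 1 / v * u) * (of_real (1 + xx) * (?f xx * ?g yy))))"
      unfolding f4_def f3_def f2_def f1_def f0_def v_def[symmetric] xx_def[symmetric] yy_def[symmetric] ..
    have q: "1 + 1 / v * u = (u + v) / v" using v by (simp add: field_simps)
    have e: "X * xx + Y * yy = (X + Y) * u + ((1 + u) * k * x + u * k / x)"
    proof -
      have 1: "X * v = (1 + u) * k * x" unfolding v_def \<rho>_def using X by simp
      have "Y * (u * (1 + u) / v) = u * k / x"
      proof -
        have "Y * (u * (1 + u) / v) = Y * u * X / (k * x)" 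
        proof -
          have "Y * (u * w / (k * w / X * x)) = Y * u * X / (k * x)" if "w \<noteq> 0" for w
            using that X k(1) x by (simp add: field_simps)
          from this[of "1 + u"] show ?thesis unfolding v_def \<rho>_def using u by simp
        qed
        also have "Y * u * X = u * (k * k)" unfolding k(2) by simp
        also have "u * (k * k) / (k * x) = u * k / x" using k(1) by simp
        finally show ?thesis .
      qed
      moreover have "Y * yy = Y * u + Y * (u * (1 + u) / v)" unfolding yy using v by (simp add: field_simps)
      ultimately show ?thesis unfolding xx using 1 by (simp add: algebra_simps)
    qed
    have lv: "ln v = ln k + ln (1 + u) - ln X + ln x"
      unfolding v_def \<rho>_def using k u X x by (simp add: ln_mult ln_div)
    have lk: "2 * ln k = ln X + ln Y"
    proof -
      have "ln (k * k) = ln k + ln k" using k(1) by (simp add: ln_mult)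
      moreover have "ln (X * Y) = ln X + ln Y" using X Y by (simp add: ln_mult)
      ultimately show ?thesis using k(2) by simp
    qed
    have lyy: "ln yy = ln u + ln (1 + u + v) - ln v" unfolding yy using u v by (simp add: ln_mult ln_div)
    have lyy1: "ln (1 + yy) = ln (u + v) + ln (1 + u) - ln v" unfolding yy1 using u v by (simp add: ln_mult ln_div)
    have lq: "ln (1 + 1 / v * u) = ln (u + v) - ln v" unfolding q using u v by (simp add: ln_div)
    have l\<rho>: "ln (\<rho> u) = ln k + ln (1 + u) - ln X" unfolding \<rho>_def using k u X by (simp add: ln_mult ln_div)
    have lxx: "ln (1 + xx) = ln (1 + u + v)" "ln xx = ln (u + v)" unfolding xx by (simp_all add: add_ac)
    have li: "ln (1 / v) = - ln v" using v by (simp add: ln_div)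
    have ps: "\<rho> u > 0" "1 / v > 0" "1 + 1 / v * u > 0" "1 + xx > 0" "xx > 0" "yy > 0" "1 + yy > 0" "1 + u > 0"
      using p3[OF u] u v unfolding xx yy by (auto intro!: add_pos_pos divide_pos_pos mult_pos_pos)
    have ex: "exp (- (complex_of_real X * of_real xx)) * exp (- (of_real Y * of_real yy)) = exp (- of_real ((X + Y) * u)) * exp (- of_real ((1 + u) * k * x + u * k / x))"
      unfolding exp_add[symmetric] of_real_mult[symmetric] of_real_minus[symmetric] of_real_add[symmetric]
      using e by (intro arg_cong[where f = exp] arg_cong[where f = of_real]) simp
    have "of_real Y powr (- \<alpha>) * f4 u x = (of_real Y powr (- \<alpha>) * of_real (\<rho> u) * of_real (1 / v) * of_real (1 + 1 / v * u) * of_real (1 + xx) *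
        of_real xx powr (a - 1) * of_real (1 + xx) powr (- c) * of_real yy powr (c - 1) * of_real (1 + yy) powr (- a)) *
        (exp (- (complex_of_real X * of_real xx)) * exp (- (of_real Y * of_real yy)))"
      unfolding f4v by (simp only: mult_ac)
    also have "of_real Y powr (- \<alpha>) * of_real (\<rho> u) * of_real (1 / v) * of_real (1 + 1 / v * u) * of_real (1 + xx) *
        of_real xx powr (a - 1) * of_real (1 + xx) powr (- c) * of_real yy powr (c - 1) * of_real (1 + yy) powr (- a) =
      of_real k powr (- \<alpha>) * of_real u powr (c - 1) * of_real (1 + u) powr (- c) * of_real x powr (\<alpha> - 1)"
    proof -
      \<comment> \<open>In logarithms the identity is linear: the terms with ln (u + v) and ln (1 +
        u + v) cancel, and 2 ln k = ln X + ln Y eliminates ln X.\<close>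
      have l: "complex_of_real (2 * ln k) = of_real (ln X + ln Y)" unfolding lk ..
      have lX: "complex_of_real (ln X) = 2 * of_real (ln k) - of_real (ln Y)" using l by (simp add: algebra_simps)
      have "- \<alpha> * of_real (ln Y) + of_real (ln (\<rho> u)) + of_real (ln (1 / v)) + of_real (ln (1 + 1 / v * u)) + of_real (ln (1 + xx))
         + (a - 1) * of_real (ln xx) + - c * of_real (ln (1 + xx)) + (c - 1) * of_real (ln yy) + - a * of_real (ln (1 + yy))
         = - \<alpha> * of_real (ln k) + (c - 1) * of_real (ln u) + - c * of_real (ln (1 + u)) + (\<alpha> - 1) * of_real (ln x)"
        unfolding lyy lyy1 lq l\<rho> lxx li lv a of_real_add of_real_diff of_real_minus lX by (simp add: algebra_simps)
      then have E: "exp (- \<alpha> * of_real (ln Y) + of_real (ln (\<rho> u)) + of_real (ln (1 / v)) + of_real (ln (1 + 1 / v * u)) + of_real (ln (1 + xx))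
         + (a - 1) * of_real (ln xx) + - c * of_real (ln (1 + xx)) + (c - 1) * of_real (ln yy) + - a * of_real (ln (1 + yy)))
         = exp (- \<alpha> * of_real (ln k) + (c - 1) * of_real (ln u) + - c * of_real (ln (1 + u)) + (\<alpha> - 1) * of_real (ln x))"
        by (simp only:)
      show ?thesis
        unfolding of_real_exp_ln[OF ps(1)] of_real_exp_ln[OF ps(2)] of_real_exp_ln[OF ps(3)]
          powr_of_real_exp_ln[OF Y] powr_of_real_exp_ln[OF ps(5)] powr_of_real_exp_ln[OF ps(4)] powr_of_real_exp_ln[OF ps(6)]
          powr_of_real_exp_ln[OF ps(7)] powr_of_real_exp_ln[OF k(1)] powr_of_real_exp_ln[OF u] powr_of_real_exp_ln[OF ps(8)] powr_of_real_exp_ln[OF x]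
        using E unfolding exp_add of_real_exp_ln[OF ps(4), symmetric] .
    qed
    finally show ?thesis unfolding ex by (simp only: mult_ac)
  qed
  have "(LINT x|posm. ?f x) * (LINT y|posm. ?g y) = (LINT x|posm. LINT y|posm. f0 x y)"
    unfolding f0_def integral_mult_right_zero integral_mult_left_zero ..
  then have "of_real Y powr (- \<alpha>) * ((LINT x|posm. ?f x) * (LINT y|posm. ?g y)) = (LINT u|posm. LINT x|posm. of_real Y powr (- \<alpha>) * f4 u x)"
    unfolding chain by (simp only: integral_mult_right_zero)
  also have "\<dots> = (LINT u|posm. of_real k powr (- \<alpha>) * (of_real u powr (c - 1) * of_real (1 + u) powr (- c) * exp (- of_real ((X + Y) * u)) *
      (LINT x|posm. of_real x powr (\<alpha> - 1) * exp (- of_real ((1 + u) * k * x + u * k / x)))))"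
  proof (rule Bochner_Integration.integral_cong[OF refl])
    fix u assume "u \<in> space posm"
    then have u: "u > 0" by simp
    have "(LINT x|posm. of_real Y powr (- \<alpha>) * f4 u x) = (LINT x|posm. of_real k powr (- \<alpha>) * (of_real u powr (c - 1) * of_real (1 + u) powr (- c) * exp (- of_real ((X + Y) * u))) *
      (of_real x powr (\<alpha> - 1) * exp (- of_real ((1 + u) * k * x + u * k / x))))"
      by (rule Bochner_Integration.integral_cong[OF refl], rule key[OF u]) simp
    then show "(LINT x|posm. of_real Y powr (- \<alpha>) * f4 u x) = of_real k powr (- \<alpha>) * (of_real u powr (c - 1) * of_real (1 + u) powr (- c) * exp (- of_real ((X + Y) * u)) *
      (LINT x|posm. of_real x powr (\<alpha> - 1) * exp (- of_real ((1 + u) * k * x + u * k / x))))"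
      unfolding integral_mult_right_zero by (simp only: mult_ac)
  qed
  finally show ?thesis unfolding integral_mult_right_zero .
qed

text \<open>The substitution m = cosh t - 1 maps the half-line onto itself with Jacobian sinh t. The
  change of variables theorem is stated for the completed measure, so integrals are carried there
  and back.\<close>

lemma integral_cosh_substitution:
  fixes f :: "real \<Rightarrow> complex"
  assumes f: "continuous_on {0<..} f"
  shows "integrable posm (\<lambda>t. of_real (sinh t) * f (cosh t - 1)) \<longleftrightarrow> integrable posm f"
    and "integrable posm f \<Longrightarrow> (LINT t|posm. of_real (sinh t) * f (cosh t - 1)) = (LINT m|posm. f m)"
proof -
  let ?g = "\<lambda>t::real. cosh t - 1"
  have img: "?g ` {0<..} = {0<..}"
  proof
    show "?g ` {0<..} \<subseteq> {0<..}" using cosh_real_strict_mono[of 0] by (auto simp: image_iff)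
    show "{0<..} \<subseteq> ?g ` {0<..}"
    proof
      fix m :: real assume "m \<in> {0<..}"
      then have "m = ?g (arcosh (1 + m))" "arcosh (1 + m) \<in> {0<..}" by simp_all
      then show "m \<in> ?g ` {0<..}" by (rule image_eqI)
    qed
  qed
  have S: "{0<..} \<in> sets (lebesgue :: real measure)" by simp
  have der: "(?g has_field_derivative sinh t) (at t within {0<..})" for t
    by (auto intro!: derivative_eq_intros)
  have inj: "inj_on ?g {0<..}"
    by (auto intro!: inj_onI simp: cosh_real_nonneg_le_iff order_eq_iff)
  have cg: "continuous_on {0<..} (\<lambda>t. of_real (sinh t) * f (cosh t - 1))"
    by (intro continuous_intros continuous_on_compose2[OF f]) (use img in auto)
  have conv: "set_integrable lebesgue {0<..} h \<longleftrightarrow> integrable posm h"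
    "integrable posm h \<Longrightarrow> integral {0<..} h = (LINT t|posm. h t)" if h: "continuous_on {0<..} h" for h :: "real \<Rightarrow> complex"
  proof -
    have "(\<lambda>x. indicator {0<..} x *\<^sub>R h x) \<in> borel_measurable lborel"
      using borel_measurable_continuous_on_indicator[OF _ h] by simp
    then show "set_integrable lebesgue {0<..} h \<longleftrightarrow> integrable posm h"
      unfolding integrable_posm set_integrable_def by (rule integrable_completion)
    assume "integrable posm h"
    then show "integral {0<..} h = (LINT t|posm. h t)"
      unfolding integrable_posm integral_posm by (rule set_borel_integral_eq_integral(2)[symmetric])
  qed
  have cv: "set_integrable lebesgue {0<..} (\<lambda>t. \<bar>sinh t\<bar> *\<^sub>R f (?g t)) \<and> integral {0<..} (\<lambda>t. \<bar>sinh t\<bar> *\<^sub>R f (?g t)) = b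
     \<longleftrightarrow> set_integrable lebesgue {0<..} f \<and> integral {0<..} f = b" for b
    using has_absolute_integral_change_of_variables_real[OF S der inj, of f b] unfolding img .
  have e1: "set_integrable lebesgue {0<..} (\<lambda>t. \<bar>sinh t\<bar> *\<^sub>R f (?g t)) \<longleftrightarrow> set_integrable lebesgue {0<..} (\<lambda>t. of_real (sinh t) * f (cosh t - 1))"
    by (rule set_integrable_cong) (simp_all add: scaleR_conv_of_real)
  have e2: "integral {0<..} (\<lambda>t. \<bar>sinh t\<bar> *\<^sub>R f (?g t)) = integral {0<..} (\<lambda>t. of_real (sinh t) * f (cosh t - 1))"
    by (rule Henstock_Kurzweil_Integration.integral_cong) (simp add: scaleR_conv_of_real)
  show i: "integrable posm (\<lambda>t. of_real (sinh t) * f (cosh t - 1)) \<longleftrightarrow> integrable posm f"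
    using cv conv(1)[OF f] conv(1)[OF cg] e1 by blast
  assume "integrable posm f"
  then show "(LINT t|posm. of_real (sinh t) * f (cosh t - 1)) = (LINT m|posm. f m)"
    using cv[of "integral {0<..} f"] conv[OF f] conv[OF cg] e1 e2 i by metis
qed

text \<open>If one side is not integrable then neither is the other, and both integrals take the
  default value 0.\<close>

lemma integral_cosh_minus_one:
  fixes f :: "real \<Rightarrow> complex"
  assumes f: "continuous_on {0<..} f"
  shows "(LINT t|posm. of_real (sinh t) * f (cosh t - 1)) = (LINT m|posm. f m)"
  using integral_cosh_substitution[OF f] by (cases "integrable posm f") (simp_all add: not_integrable_integral_eq)

lemma continuous_on_bes_compose:
  assumes "Re \<alpha> > 0" "continuous_on S f"
  shows "continuous_on S (\<lambda>x. bes \<alpha> (f x))"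
  by (rule continuous_on_compose2[OF holomorphic_on_imp_continuous_on[OF holomorphic_on_bes[OF assms(1), of UNIV]] assms(2)]) simp

text \<open>Minus the argument of the Laguerre function in the product formula, with w1 w2 in place
  of the square root of z1 z2. The sign is there because the confluent function is taken at
  -z.\<close>

abbreviation kern_arg :: "complex \<Rightarrow> complex \<Rightarrow> complex \<Rightarrow> complex" where
  "kern_arg w1 w2 t \<equiv> - (w1\<^sup>2 + w2\<^sup>2 + 2 * (w1 * w2) * cosh t)"

text \<open>The integrand of the product formula for the arguments w1^2 and w2^2, up to constant factors.\<close>

definition kern :: "complex \<Rightarrow> complex \<Rightarrow> complex \<Rightarrow> complex \<Rightarrow> complex \<Rightarrow> complex" where
  "kern c \<alpha> w1 w2 t = tricomi c (\<alpha> + c) (kern_arg w1 w2 t) * exp (w1 * w2 * cosh t) *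
      sinh t powr (2 * \<alpha>) * bes \<alpha> (w1 * w2 * sinh t)"

text \<open>The growth of the Bessel factor is absorbed by exp (- k cosh t), which leaves e^(t Re
  \<alpha>). The Gamma integral over x contributes e^(-t (Re \<alpha> + Re c)), so e^(-t Re c)
  remains. This permits exchanging t with the Laplace variable x.\<close>

lemma kern_base_integrable:
  assumes c: "Re c > 0" and \<alpha>: "Re \<alpha> > 0" and k: "k > 0" and S: "S \<ge> 0"
  shows "integrable (posm \<Otimes>\<^sub>M posm) (\<lambda>(t,x). (complex_of_real (sinh t) powr (2 * \<alpha>) * exp (- of_real (k * cosh t)) * bes \<alpha> (of_real (k * sinh t))) *
     ((of_real x powr (\<alpha> + c - 1) * of_real (1 + x) powr (- c)) * exp (- (of_real (S + 2 * k * cosh t) * of_real x))))"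
proof -
  let ?A = "\<lambda>t. complex_of_real (sinh t) powr (2 * \<alpha>) * exp (- of_real (k * cosh t)) * bes \<alpha> (of_real (k * sinh t))"
  let ?P = "\<lambda>x. complex_of_real x powr (\<alpha> + c - 1) * of_real (1 + x) powr (- c)"
  let ?B = "\<lambda>t x. ?P x * exp (- (complex_of_real (S + 2 * k * cosh t) * of_real x))"
  define p where "p = Re (\<alpha> + c)"
  have p: "p > 0" using c \<alpha> by (simp add: p_def)
  obtain C where C: "C > 0" "\<And>x. norm x powr Re \<alpha> * norm (bes \<alpha> x) \<le> C * exp \<bar>Re x\<bar>"
    using bes_growth[OF \<alpha>] by blast
  define K where "K = C * k powr (- Re \<alpha>)"
  have K0: "K \<ge> 0" using C(1) by (simp add: K_def)
  have Ab: "norm (?A t) \<le> K * exp (Re \<alpha> * t)" if t: "t > 0" for t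
  proof -
    have s: "sinh t > 0" "sinh t \<le> cosh t" "sinh t \<le> exp t" using t by (auto simp: sinh_def cosh_def field_simps)
    have n: "norm (complex_of_real (k * sinh t)) = k * sinh t" using k s by (simp add: norm_mult)
    have "(k * sinh t) powr Re \<alpha> * norm (bes \<alpha> (of_real (k * sinh t))) \<le> C * exp (k * sinh t)"
      using C(2)[of "of_real (k * sinh t)"] unfolding n using k s(1) by simp
    also have "\<dots> \<le> C * exp (k * cosh t)" using C(1) k s(2) by (intro mult_left_mono) auto
    finally have b: "norm (bes \<alpha> (of_real (k * sinh t))) \<le> C * exp (k * cosh t) * (k * sinh t) powr (- Re \<alpha>)"
      using k s(1) by (simp add: powr_minus field_simps)
    have "norm (?A t) = sinh t powr (2 * Re \<alpha>) * exp (- (k * cosh t)) * norm (bes \<alpha> (of_real (k * sinh t)))"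
      unfolding norm_mult norm_powr_of_real_pos[OF s(1)] norm_exp_eq_Re by simp
    also have "\<dots> \<le> sinh t powr (2 * Re \<alpha>) * exp (- (k * cosh t)) * (C * exp (k * cosh t) * (k * sinh t) powr (- Re \<alpha>))"
      by (intro mult_left_mono b) auto
    also have "\<dots> = K * (sinh t powr (2 * Re \<alpha>) * sinh t powr (- Re \<alpha>))"
      using k s(1) unfolding K_def by (simp add: powr_mult exp_minus field_simps)
    also have "sinh t powr (2 * Re \<alpha>) * sinh t powr (- Re \<alpha>) = sinh t powr Re \<alpha>"
      unfolding powr_add[symmetric] by simp
    also have "K * sinh t powr Re \<alpha> \<le> K * exp t powr Re \<alpha>"
      using s \<alpha> K0 by (intro mult_left_mono powr_mono2) auto
    finally show ?thesis by (simp add: exp_powr_real mult.commute)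
  qed
  have Bb: "norm (?B t x) \<le> x powr (p - 1) * exp (- (k * exp t * x))" if x: "x > 0" for t x
  proof -
    have x1: "1 + x > 0" using x by simp
    have "(1 + x) powr (- Re c) \<le> (1 + x) powr 0" using x c by (intro powr_mono) auto
    then have "(1 + x) powr (- Re c) \<le> 1" using x by simp
    moreover have "k * exp t \<le> S + 2 * k * cosh t" using S k by (simp add: cosh_def field_simps)
    then have "k * exp t * x \<le> (S + 2 * k * cosh t) * x" using x by (intro mult_right_mono) auto
    then have "exp (- ((S + 2 * k * cosh t) * x)) \<le> exp (- (k * exp t * x))" by simp
    ultimately have "(1 + x) powr (- Re c) * exp (- ((S + 2 * k * cosh t) * x)) \<le> 1 * exp (- (k * exp t * x))"
      by (rule mult_mono) auto
    from mult_left_mono[OF this, of "x powr (p - 1)"]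
    have "x powr (p - 1) * ((1 + x) powr (- Re c) * exp (- ((S + 2 * k * cosh t) * x))) \<le> x powr (p - 1) * exp (- (k * exp t * x))" by simp
    moreover have "norm (?B t x) = x powr (p - 1) * ((1 + x) powr (- Re c) * exp (- ((S + 2 * k * cosh t) * x)))"
      unfolding norm_mult norm_powr_of_real_pos[OF x] norm_powr_of_real_pos[OF x1] norm_exp_eq_Re p_def by simp
    ultimately show ?thesis by simp
  qed
  let ?G = "\<lambda>t x. complex_of_real (K * exp (Re \<alpha> * t) * (x powr (p - 1) * exp (- (k * exp t * x))))"
  have fst_m: "fst \<in> borel_measurable (posm \<Otimes>\<^sub>M posm)" and snd_m: "snd \<in> borel_measurable (posm \<Otimes>\<^sub>M posm)"
    by (rule measurable_fst_posm measurable_snd_posm)+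
  have hm: "(\<lambda>t. K * exp (Re \<alpha> * t)) \<in> borel_measurable posm"
    by (rule borel_measurable_posm_continuous_on) (intro continuous_intros)
  have em: "(\<lambda>t. k * exp t) \<in> borel_measurable posm"
    by (rule borel_measurable_posm_continuous_on) (intro continuous_intros)
  have pm: "(\<lambda>x. x powr (p - 1)) \<in> borel_measurable posm"
    by (rule borel_measurable_posm_continuous_on) (auto intro!: continuous_intros)
  have IG: "integrable (posm \<Otimes>\<^sub>M posm) (\<lambda>(t,x). ?G t x)"
  proof (rule integrable_posm_pairI)
    from measurable_compose[OF borel_measurable_uminus[OF borel_measurable_times[OF measurable_compose[OF measurable_fst em] snd_m]] borel_measurable_exp]
    have "(\<lambda>q. K * exp (Re \<alpha> * fst q) * (snd q powr (p - 1) * exp (- (k * exp (fst q) * snd q)))) \<in> borel_measurable (posm \<Otimes>\<^sub>M posm)"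
      by (rule borel_measurable_times[OF measurable_compose[OF measurable_fst hm] borel_measurable_times[OF measurable_compose[OF measurable_snd pm]]])
    from measurable_compose[OF this borel_measurable_of_real]
    show "(\<lambda>(t,x). ?G t x) \<in> borel_measurable (posm \<Otimes>\<^sub>M posm)" unfolding case_prod_unfold .
    fix t :: real
    have km: "k * exp t > 0" using k by simp
    show "integrable posm (?G t)"
      by (intro integrable_of_real integrable_mult_right integrable_Gamma_posm[OF p km])
    \<comment> \<open>The factor t powr 0 is written out to match the Gamma integrand with exponent
      parameter 1.\<close>
    show "(LINT x|posm. norm (?G t x)) = (K * Gamma p * k powr (- p)) * (t powr (1 - 1) * exp (- (Re c * t)))" if t: "t > 0"
    proof -
      have n: "norm (?G t x) = (K * exp (Re \<alpha> * t)) * (x powr (p - 1) * exp (- (k * exp t * x)))" for x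
        using K0 by (simp add: norm_mult)
      have "complex_of_real (LINT x|posm. x powr (p - 1) * exp (- (k * exp t * x))) =
          (LINT x|posm. complex_of_real (x powr (p - 1) * exp (- (k * exp t * x))))"
        by (rule integral_complex_of_real[symmetric])
      also have "\<dots> = (LINT x|posm. complex_of_real x powr (of_real p - 1) * exp (- (of_real (k * exp t) * of_real x)))"
        by (rule Bochner_Integration.integral_cong[OF refl]) (simp add: powr_of_real[symmetric] exp_of_real[symmetric])
      also have "\<dots> = Gamma (of_real p) * of_real (k * exp t) powr (- of_real p)"
        by (rule integral_Gamma_posm_scaled) (use p km in auto)
      also have "\<dots> = of_real (Gamma p * (k * exp t) powr (- p))"
        using km powr_of_real[of "k * exp t" "- p"] by (simp only: Gamma_complex_of_real of_real_mult of_real_minus less_imp_le)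
      finally have "(LINT x|posm. x powr (p - 1) * exp (- (k * exp t * x))) = Gamma p * (k * exp t) powr (- p)"
        by (simp only: of_real_eq_iff)
      also have "(k * exp t) powr (- p) = k powr (- p) * exp (- (p * t))"
        using k by (simp add: powr_mult exp_powr_real mult.commute)
      finally have "(LINT x|posm. norm (?G t x)) = (K * exp (Re \<alpha> * t)) * (Gamma p * (k powr (- p) * exp (- (p * t))))"
        unfolding n integral_mult_right_zero by simp
      also have "\<dots> = (K * Gamma p * k powr (- p)) * (exp (Re \<alpha> * t) * exp (- (p * t)))" by (simp only: mult_ac)
      also have "exp (Re \<alpha> * t) * exp (- (p * t)) = exp (- (Re c * t))"
        unfolding exp_add[symmetric] p_def by (simp add: algebra_simps)
      finally show ?thesis using t by simp
    qed
  next
    show "integrable posm (\<lambda>t. (K * Gamma p * k powr (- p)) * (t powr (1 - 1) * exp (- (Re c * t))))"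
      by (rule integrable_mult_right[OF integrable_Gamma_posm[OF zero_less_one c]])
  qed
  show ?thesis
  proof (rule Bochner_Integration.integrable_bound[OF IG])
    have Am: "?A \<in> borel_measurable posm"
    proof (rule borel_measurable_posm_continuous_on, intro continuous_on_mult)
      show "continuous_on {0<..} (\<lambda>t. complex_of_real (sinh t) powr (2 * \<alpha>))"
      proof (rule continuous_on_compose2[of "{0<..}" "\<lambda>s. complex_of_real s powr (2 * \<alpha>)" _ sinh])
        show "continuous_on {0<..} (\<lambda>s. complex_of_real s powr (2 * \<alpha>))"
          by (rule continuous_on_of_real_holomorphic[of "\<lambda>z. z powr (2 * \<alpha>)" "- \<real>\<^sub>\<le>\<^sub>0"]) (auto intro!: holomorphic_intros)
        show "continuous_on {0<..} (sinh :: real \<Rightarrow> real)" by (intro continuous_intros)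
      qed auto
      show "continuous_on {0<..} (\<lambda>t. exp (- complex_of_real (k * cosh t)))" by (intro continuous_intros)
      show "continuous_on {0<..} (\<lambda>t. bes \<alpha> (of_real (k * sinh t)))"
        by (intro continuous_on_bes_compose[OF \<alpha>] continuous_intros)
    qed
    have "continuous_on {0<..} (\<lambda>x. (\<lambda>z. z powr (\<alpha> + c - 1) * (1 + z) powr (- c)) (complex_of_real x))"
    proof (rule continuous_on_of_real_holomorphic[of _ "{z. z \<notin> \<real>\<^sub>\<le>\<^sub>0 \<and> 1 + z \<notin> \<real>\<^sub>\<le>\<^sub>0}"])
      show "(\<lambda>z. z powr (\<alpha> + c - 1) * (1 + z) powr (- c)) holomorphic_on {z. z \<notin> \<real>\<^sub>\<le>\<^sub>0 \<and> 1 + z \<notin> \<real>\<^sub>\<le>\<^sub>0}"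
        by (intro holomorphic_intros) auto
    qed (auto simp: complex_nonpos_Reals_iff)
    then have Pm: "?P \<in> borel_measurable posm"
      by (intro borel_measurable_posm_continuous_on) simp
    have wm: "(\<lambda>t. complex_of_real (S + 2 * k * cosh t)) \<in> borel_measurable posm"
      by (rule borel_measurable_posm_continuous_on) (intro continuous_intros)
    have "(\<lambda>q. exp (- (complex_of_real (S + 2 * k * cosh (fst q)) * of_real (snd q)))) \<in> borel_measurable (posm \<Otimes>\<^sub>M posm)"
      by (rule measurable_compose[OF borel_measurable_uminus[OF borel_measurable_times[OF measurable_compose[OF measurable_fst wm]
            measurable_compose[OF snd_m borel_measurable_of_real]]] borel_measurable_exp])
    from borel_measurable_times[OF measurable_compose[OF measurable_fst Am] borel_measurable_times[OF measurable_compose[OF measurable_snd Pm] this]]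
    show "(\<lambda>(t,x). ?A t * ?B t x) \<in> borel_measurable (posm \<Otimes>\<^sub>M posm)"
      unfolding case_prod_unfold .
    show "AE q in posm \<Otimes>\<^sub>M posm. norm (case q of (t,x) \<Rightarrow> ?A t * ?B t x) \<le> norm (case q of (t,x) \<Rightarrow> ?G t x)"
    proof (rule AE_I2)
      fix q assume q: "q \<in> space (posm \<Otimes>\<^sub>M posm)"
      obtain t x where tx: "q = (t, x)" by (rule prod.exhaust)
      have "t > 0" "x > 0" using q unfolding tx by (auto simp: space_pair_measure)
      have "norm (?A t) * norm (?B t x) \<le> (K * exp (Re \<alpha> * t)) * (x powr (p - 1) * exp (- (k * exp t * x)))"
        by (rule mult_mono[OF Ab[OF \<open>t > 0\<close>] Bb[OF \<open>x > 0\<close>]]) (use K0 in auto)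
      also have "\<dots> = norm (?G t x)" using K0 by (simp add: norm_mult)
      finally show "norm (case q of (t,x) \<Rightarrow> ?A t * ?B t x) \<le> norm (case q of (t,x) \<Rightarrow> ?G t x)"
        unfolding tx prod.case norm_mult[of "?A t"] .
    qed
  qed
qed

text \<open>Put 1 + m = cosh t in \<open>Laplace_bes\<close>: the Jacobian sinh t and the power
  \<alpha> - 1/2 of sinh^2 combine to sinh^(2 \<alpha>).\<close>

lemma Laplace_bes_cosh:
  assumes \<alpha>: "Re \<alpha> > 0" and B: "B > 0" and A: "A > 0"
  shows "of_real (sqrt pi) * (LINT t|posm. complex_of_real (sinh t) powr (2 * \<alpha>) * exp (- of_real ((A + B) * cosh t)) * bes \<alpha> (of_real ((A - B) * sinh t))) =
    1/2 * of_real B powr (- \<alpha>) * (LINT x|posm. of_real x powr (\<alpha> - 1) * exp (- of_real (A * x + B / x)))"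
proof -
  let ?f = "\<lambda>m. of_real ((1 + m)\<^sup>2 - 1) powr (\<alpha> - 1/2) * exp (- of_real ((A + B) * (1 + m))) * bes \<alpha> (of_real (A - B) * of_real (sqrt ((1 + m)\<^sup>2 - 1)))"
  have sq: "(1 + m)\<^sup>2 - 1 > 0" if "m > 0" for m :: real
    using that by (simp add: power2_eq_square algebra_simps add_pos_pos)
  have cf: "continuous_on {0<..} ?f"
  proof (intro continuous_on_mult)
    have "continuous_on {0<..} (\<lambda>m. (\<lambda>z. ((1 + z)\<^sup>2 - 1) powr (\<alpha> - 1/2)) (complex_of_real m))"
    proof (rule continuous_on_of_real_holomorphic[of _ "{z. (1 + z)\<^sup>2 - 1 \<notin> \<real>\<^sub>\<le>\<^sub>0}"])
      show "(\<lambda>z. ((1 + z)\<^sup>2 - 1) powr (\<alpha> - 1/2)) holomorphic_on {z. (1 + z)\<^sup>2 - 1 \<notin> \<real>\<^sub>\<le>\<^sub>0}"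
        by (intro holomorphic_intros) auto
      fix t :: real assume "t \<in> {0<..}"
      then have "0 < (1 + t)\<^sup>2 - 1" by (intro sq) simp
      then have "\<not> (1 + t)\<^sup>2 - 1 \<le> 0" by (simp only: not_le)
      then have "complex_of_real ((1 + t)\<^sup>2 - 1) \<notin> \<real>\<^sub>\<le>\<^sub>0" by (simp only: nonpos_Reals_of_real_iff simp_thms)
      then show "complex_of_real t \<in> {z. (1 + z)\<^sup>2 - 1 \<notin> \<real>\<^sub>\<le>\<^sub>0}" by simp
    qed
    then show "continuous_on {0<..} (\<lambda>m. complex_of_real ((1 + m)\<^sup>2 - 1) powr (\<alpha> - 1/2))" by simp
    show "continuous_on {0<..} (\<lambda>m. exp (- complex_of_real ((A + B) * (1 + m))))" by (intro continuous_intros)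
    show "continuous_on {0<..} (\<lambda>m. bes \<alpha> (of_real (A - B) * of_real (sqrt ((1 + m)\<^sup>2 - 1))))"
      by (intro continuous_on_bes_compose[OF \<alpha>] continuous_intros)
  qed
  have "(LINT t|posm. complex_of_real (sinh t) powr (2 * \<alpha>) * exp (- of_real ((A + B) * cosh t)) * bes \<alpha> (of_real ((A - B) * sinh t)))
     = (LINT t|posm. of_real (sinh t) * ?f (cosh t - 1))"
  proof (rule Bochner_Integration.integral_cong[OF refl])
    fix t assume "t \<in> space posm"
    then have s: "sinh t > 0" by simp
    have c: "1 + (cosh t - 1) = cosh t" by simp
    have h: "(cosh t)\<^sup>2 - 1 = (sinh t)\<^sup>2" using cosh_square_eq[of t] by simp
    have r: "sqrt ((sinh t)\<^sup>2) = sinh t" using s by simp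
    have "complex_of_real (sinh t) * of_real ((sinh t)\<^sup>2) powr (\<alpha> - 1/2) = of_real (sinh t) powr (2 * \<alpha>)"
    proof -
      have s2: "(sinh t)\<^sup>2 > 0" using s by simp
      have l: "ln ((sinh t)\<^sup>2) = 2 * ln (sinh t)" using s by (simp add: ln_realpow)
      have "complex_of_real (sinh t) * of_real ((sinh t)\<^sup>2) powr (\<alpha> - 1/2) = exp (of_real (ln (sinh t)) + (\<alpha> - 1/2) * of_real (2 * ln (sinh t)))"
        unfolding exp_add powr_of_real_exp_ln[OF s2] l of_real_exp_ln[OF s, symmetric] ..
      also have "of_real (ln (sinh t)) + (\<alpha> - 1/2) * of_real (2 * ln (sinh t)) = 2 * \<alpha> * of_real (ln (sinh t))"
        by (simp add: algebra_simps)
      finally show ?thesis unfolding powr_of_real_exp_ln[OF s] .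
    qed
    then show "complex_of_real (sinh t) powr (2 * \<alpha>) * exp (- of_real ((A + B) * cosh t)) * bes \<alpha> (of_real ((A - B) * sinh t)) = of_real (sinh t) * ?f (cosh t - 1)"
      unfolding c h r by (simp add: mult.assoc[symmetric])
  qed
  also have "\<dots> = (LINT m|posm. ?f m)" by (rule integral_cosh_minus_one[OF cf])
  finally show ?thesis using Laplace_bes[OF assms] by simp
qed

lemma cosh_complex_of_real: "cosh (complex_of_real t) = of_real (cosh t)"
  by (simp add: cosh_field_def exp_of_real[symmetric])

lemma sinh_complex_of_real: "sinh (complex_of_real t) = of_real (sinh t)"
  by (simp add: sinh_field_def exp_of_real[symmetric])

text \<open>On the imaginary axis w1 w2 = -k is negative and the argument of the confluent function
  is positive. Inserting its Laplace representation and integrating over t first leaves exactly the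
  double integral that \<open>tricomi_product_substitution\<close> identifies with the
  product.\<close>

lemma tricomi_product_base:
  assumes c: "Re c > 0" and \<alpha>: "Re \<alpha> > 0" and X: "X > 0" and Y: "Y > 0"
  shows "tricomi c (\<alpha> + c) (of_real X) * tricomi c (\<alpha> + c) (of_real Y) =
    2 * of_real (sqrt pi) * (LINT t|posm. kern c \<alpha> (\<i> * of_real (sqrt X)) (\<i> * of_real (sqrt Y)) (of_real t))"
proof -
  define k where "k = sqrt (X * Y)"
  have k: "k > 0" using X Y by (simp add: k_def)
  let ?a = "\<alpha> + c"
  have ra: "Re ?a > 0" using c \<alpha> by simp
  have nz: "Gamma c \<noteq> 0" "Gamma ?a \<noteq> 0" by (intro Gamma_nonzero_Re_pos c ra)+
  let ?A = "\<lambda>t. complex_of_real (sinh t) powr (2 * \<alpha>) * exp (- of_real (k * cosh t)) * bes \<alpha> (of_real (k * sinh t))"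
  let ?P = "\<lambda>x. complex_of_real x powr (\<alpha> + c - 1) * of_real (1 + x) powr (- c)"
  let ?B = "\<lambda>t x. ?P x * exp (- (complex_of_real (X + Y + 2 * k * cosh t) * of_real x))"
  let ?R = "\<lambda>u. LINT x|posm. of_real x powr (\<alpha> - 1) * exp (- complex_of_real ((1 + u) * k * x + u * k / x))"
  have kern: "kern c \<alpha> (\<i> * of_real (sqrt X)) (\<i> * of_real (sqrt Y)) (of_real t) = Gamma c / Gamma ?a * (LINT x|posm. ?A t * ?B t x)" for t
  proof -
    have w: "(\<i> * complex_of_real (sqrt X))\<^sup>2 = - of_real X" "(\<i> * complex_of_real (sqrt Y))\<^sup>2 = - of_real Y"
      using X Y by (simp_all add: power_mult_distrib of_real_power[symmetric])
    have ww: "\<i> * complex_of_real (sqrt X) * (\<i> * of_real (sqrt Y)) = - of_real k"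
      unfolding k_def by (simp add: real_sqrt_mult algebra_simps)
    have W: "X + Y + 2 * k * cosh t > 0" using X Y k by (simp add: add_pos_pos)
    have "- (- complex_of_real X + - of_real Y + 2 * (- of_real k) * cosh (of_real t)) = of_real (X + Y + 2 * k * cosh t)"
      by (simp add: cosh_complex_of_real)
    moreover have "tricomi c ?a (of_real (X + Y + 2 * k * cosh t)) = Gamma c / Gamma ?a * (LINT x|posm. ?B t x)"
      using tricomi_Laplace[OF c ra W] nz by (simp add: field_simps)
    moreover have "- complex_of_real k * cosh (of_real t) = - of_real (k * cosh t)" "bes \<alpha> (- complex_of_real k * sinh (of_real t)) = bes \<alpha> (of_real (k * sinh t))"
      using bes_even[of \<alpha> "of_real (k * sinh t)"] by (simp_all add: cosh_complex_of_real sinh_complex_of_real)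
    ultimately show ?thesis
      unfolding kern_def w ww integral_mult_right_zero by (simp only: sinh_complex_of_real mult_ac)
  qed
  have re2: "2 * ((P * C) * E) * (1/2 * (p * q) * R) = q * ((P * p) * C * E * R)" for P C E p q R :: complex
    by simp
  have int: "integrable (posm \<Otimes>\<^sub>M posm) (\<lambda>(t,x). ?A t * ?B t x)"
    using kern_base_integrable[OF c \<alpha> k, of "X + Y"] X Y by simp
  have "2 * of_real (sqrt pi) * (LINT t|posm. kern c \<alpha> (\<i> * of_real (sqrt X)) (\<i> * of_real (sqrt Y)) (of_real t))
     = Gamma c / Gamma ?a * (2 * of_real (sqrt pi) * (LINT t|posm. LINT x|posm. ?A t * ?B t x))"
    unfolding kern integral_mult_right_zero by (simp only: mult_ac)
  also have "(LINT t|posm. LINT x|posm. ?A t * ?B t x) = (LINT x|posm. LINT t|posm. ?A t * ?B t x)"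
    by (rule integrable_posm_swap(2)[OF int])
  also have "2 * of_real (sqrt pi) * \<dots> = (LINT x|posm. 2 * of_real (sqrt pi) * (LINT t|posm. ?A t * ?B t x))"
    by (rule integral_mult_right_zero[symmetric])
  also have "\<dots> = (LINT x|posm. of_real k powr (- \<alpha>) * (of_real x powr (c - 1) * of_real (1 + x) powr (- c) * exp (- of_real ((X + Y) * x)) * ?R x))"
  proof (rule Bochner_Integration.integral_cong[OF refl])
    fix x assume "x \<in> space posm"
    then have x: "x > 0" by simp
    have xk: "x * k > 0" "(1 + x) * k > 0" using x k by simp_all
    \<comment> \<open>\<open>Laplace_bes_cosh\<close> is applied with A = (1 + x) k and B = x k:
      then A - B = k is the factor of sinh t, and A + B = k + 2 k x collects the factors of cosh t
      from the kernel and from the Laplace representation.\<close>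
    have e1: "(1 + x) * k + x * k = k + 2 * k * x" "(1 + x) * k - x * k = k" by (simp_all add: algebra_simps)
    have "(LINT t|posm. ?A t * ?B t x) = (LINT t|posm. (?P x * exp (- of_real ((X + Y) * x))) *
        (complex_of_real (sinh t) powr (2 * \<alpha>) * exp (- of_real (((1 + x) * k + x * k) * cosh t)) * bes \<alpha> (of_real (((1 + x) * k - x * k) * sinh t))))"
    proof (rule Bochner_Integration.integral_cong[OF refl])
      fix t :: real
      have E: "exp (- complex_of_real (k * cosh t)) * exp (- (complex_of_real (X + Y + 2 * k * cosh t) * of_real x)) =
         exp (- of_real ((X + Y) * x)) * exp (- of_real ((k + 2 * k * x) * cosh t))"
        unfolding exp_add[symmetric] by (simp add: algebra_simps)
      have re: "(a * e1 * b) * (P * e2) = (P * E) * (a * E' * b)" if "e1 * e2 = E * E'" for a e1 b P e2 E E' :: complex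
        using arg_cong[OF that, of "\<lambda>y. a * b * P * y"] by (simp only: mult_ac)
      show "?A t * ?B t x = (?P x * exp (- of_real ((X + Y) * x))) *
        (complex_of_real (sinh t) powr (2 * \<alpha>) * exp (- of_real (((1 + x) * k + x * k) * cosh t)) * bes \<alpha> (of_real (((1 + x) * k - x * k) * sinh t)))"
        unfolding e1 by (rule re[OF E])
    qed
    also have "\<dots> = (?P x * exp (- of_real ((X + Y) * x))) * (LINT t|posm.
        complex_of_real (sinh t) powr (2 * \<alpha>) * exp (- of_real (((1 + x) * k + x * k) * cosh t)) * bes \<alpha> (of_real (((1 + x) * k - x * k) * sinh t)))"
      by (rule integral_mult_right_zero)
    finally have "2 * of_real (sqrt pi) * (LINT t|posm. ?A t * ?B t x) = 2 * (?P x * exp (- of_real ((X + Y) * x))) * (of_real (sqrt pi) * (LINT t|posm.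
        complex_of_real (sinh t) powr (2 * \<alpha>) * exp (- of_real (((1 + x) * k + x * k) * cosh t)) * bes \<alpha> (of_real (((1 + x) * k - x * k) * sinh t))))"
      by (simp only: mult_ac)
    also have "\<dots> = 2 * (?P x * exp (- of_real ((X + Y) * x))) * (1/2 * of_real (x * k) powr (- \<alpha>) * ?R x)"
      unfolding Laplace_bes_cosh[OF \<alpha> xk] ..
    also have "complex_of_real (x * k) powr (- \<alpha>) = of_real x powr (- \<alpha>) * of_real k powr (- \<alpha>)"
      using powr_times_real[of "of_real x" "of_real k" "- \<alpha>"] x k by simp
    also have "2 * (?P x * exp (- of_real ((X + Y) * x))) * (1/2 * (of_real x powr (- \<alpha>) * of_real k powr (- \<alpha>)) * ?R x) =
       of_real k powr (- \<alpha>) * ((of_real x powr (\<alpha> + c - 1) * of_real x powr (- \<alpha>)) * of_real (1 + x) powr (- c) * exp (- of_real ((X + Y) * x)) * ?R x)"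
      by (rule re2)
    also have "complex_of_real x powr (\<alpha> + c - 1) * of_real x powr (- \<alpha>) = of_real x powr (c - 1)"
      unfolding powr_add[symmetric] by simp
    finally show "2 * of_real (sqrt pi) * (LINT t|posm. ?A t * ?B t x) = of_real k powr (- \<alpha>) * (of_real x powr (c - 1) * of_real (1 + x) powr (- c) * exp (- of_real ((X + Y) * x)) * ?R x)" .
  qed
  also have "\<dots> = of_real k powr (- \<alpha>) * (LINT x|posm. of_real x powr (c - 1) * of_real (1 + x) powr (- c) * exp (- of_real ((X + Y) * x)) * ?R x)"
    by (rule integral_mult_right_zero)
  also have "\<dots> = of_real Y powr (- \<alpha>) * ((LINT x|posm. of_real x powr (?a - 1) * of_real (1 + x) powr (- c) * exp (- (of_real X * of_real x))) *
      (LINT y|posm. of_real y powr (c - 1) * of_real (1 + y) powr (- ?a) * exp (- (of_real Y * of_real y))))"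
    unfolding k_def by (rule tricomi_product_substitution[OF c \<alpha> refl X Y, symmetric])
  also have "\<dots> = (LINT x|posm. of_real x powr (?a - 1) * of_real (1 + x) powr (- c) * exp (- (of_real X * of_real x))) * tricomi c ?a (of_real Y)"
    unfolding tricomi_scaled[OF Y] by simp
  also have "Gamma c / Gamma ?a * \<dots> = tricomi c ?a (of_real X) * tricomi c ?a (of_real Y)"
  proof -
    have "(LINT x|posm. of_real x powr (?a - 1) * of_real (1 + x) powr (- c) * exp (- (of_real X * of_real x))) = Gamma ?a / Gamma c * tricomi c ?a (of_real X)"
      using tricomi_Laplace[OF c ra X] nz by (simp add: field_simps)
    then show ?thesis using nz by simp
  qed
  finally show ?thesis by (rule sym)
qed

section \<open>Bounds for the integrand\<close>

lemma kern_commute: "kern c \<alpha> w1 w2 t = kern c \<alpha> w2 w1 t"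
  by (simp add: kern_def mult.commute add.commute)

lemma norm_sinh_le_exp:
  fixes t :: complex
  assumes "Re t \<ge> 0"
  shows "norm (sinh t) \<le> exp (Re t)"
proof -
  have "norm (sinh t) = norm (exp t - exp (- t)) / 2" by (simp add: sinh_field_def norm_divide)
  also have "\<dots> \<le> (norm (exp t) + norm (exp (- t))) / 2" by (intro divide_right_mono norm_triangle_ineq4) simp
  also have "\<dots> = (exp (Re t) + exp (- Re t)) / 2" by (simp add: norm_exp_eq_Re)
  also have "\<dots> \<le> exp (Re t)" using assms by simp
  finally show ?thesis .
qed

text \<open>The decay of the confluent factor beats the power of sinh t by e^(- Re c Re t), and the
  remaining exponentials are controlled by the growth of w1 w2 e^t alone. C depends only on c and
  \<alpha>, so the bound is locally uniform in w1 and w2 as soon as \<delta> is.\<close>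

lemma kern_bound:
  assumes c: "Re c > 0" and \<alpha>: "Re \<alpha> > 0"
  shows "\<exists>C. \<forall>w1 w2 t \<delta>. \<delta> > 0 \<longrightarrow> w1 \<noteq> 0 \<longrightarrow> w2 \<noteq> 0 \<longrightarrow> Re t \<ge> 0 \<longrightarrow>
     (\<forall>u\<ge>0. norm (kern_arg w1 w2 t + complex_of_real u) \<ge> \<delta> * exp (Re t)) \<longrightarrow>
     Re (w1 * w2 * exp t) \<le> norm (w1 * w2) \<longrightarrow>
     norm (kern c \<alpha> w1 w2 t) \<le> C * (\<delta> powr (- (Re \<alpha> + Re c)) * norm (w1 * w2) powr (- Re \<alpha>) * exp (norm (w1 * w2))) * exp (- (Re c * Re t))"
proof -
  obtain C0 where C0: "C0 > 0" "\<And>x. norm x powr Re \<alpha> * norm (bes \<alpha> x) \<le> C0 * exp \<bar>Re x\<bar>"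
    using bes_growth[OF \<alpha>] by blast
  define K where "K = exp (pi * \<bar>Im (\<alpha> + c)\<bar>) * (LINT t|posm. t powr (Re c - 1) * exp (- (1 * t)))"
  define E where "E = exp (pi * \<bar>Im (2 * \<alpha>)\<bar>)"
  have K0: "K \<ge> 0" unfolding K_def by (intro mult_nonneg_nonneg Bochner_Integration.integral_nonneg) auto
  have E0: "E > 0" unfolding E_def by simp
  have main: "norm (kern c \<alpha> w1 w2 t) \<le> (K * E * C0) * (\<delta> powr (- (Re \<alpha> + Re c)) * norm (w1 * w2) powr (- Re \<alpha>) * exp (norm (w1 * w2))) * exp (- (Re c * Re t))"
    if \<delta>: "\<delta> > 0" and w: "w1 \<noteq> 0" "w2 \<noteq> 0" and r: "Re t \<ge> 0"
      and geo: "\<And>u. u \<ge> 0 \<Longrightarrow> norm (kern_arg w1 w2 t + complex_of_real u) \<ge> \<delta> * exp (Re t)"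
      and grow: "Re (w1 * w2 * exp t) \<le> norm (w1 * w2)" for w1 w2 t \<delta>
  \<comment> \<open>At a zero of sinh the kernel is 0, by the convention for powers of 0; elsewhere
    one may divide by norm (sinh t).\<close>
  proof (cases "sinh t = 0")
    case True
    then have "kern c \<alpha> w1 w2 t = 0" by (simp add: kern_def)
    then show ?thesis using K0 E0 C0(1) by simp
  next
    case False
    define s where "s = w1 * w2"
    define H where "H = norm (sinh t)"
    define Z where "Z = kern_arg w1 w2 t"
    have s0: "norm s > 0" using w by (simp add: s_def)
    have H0: "H > 0" using False by (simp add: H_def)
    have He: "H \<le> exp (Re t)" unfolding H_def by (rule norm_sinh_le_exp[OF r])
    have T: "norm (tricomi c (\<alpha> + c) Z) \<le> \<delta> powr (- (Re \<alpha> + Re c)) * exp (- ((Re \<alpha> + Re c) * Re t)) * K"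
    proof -
      have "norm (tricomi c (\<alpha> + c) Z) \<le> (\<delta> * exp (Re t)) powr (- Re (\<alpha> + c)) * K"
        unfolding K_def by (rule norm_tricomi_le) (use geo \<delta> c \<alpha> in \<open>auto simp: Z_def\<close>)
      also have "(\<delta> * exp (Re t)) powr (- Re (\<alpha> + c)) = \<delta> powr (- (Re \<alpha> + Re c)) * exp (- ((Re \<alpha> + Re c) * Re t))"
        using \<delta> by (simp add: powr_mult exp_powr_real algebra_simps)
      finally show ?thesis .
    qed
    \<comment> \<open>Since cosh t + sinh t = e^t and cosh t - sinh t = e^(-t), the exponent is the
      larger of Re (s e^t) and Re (s e^(-t)). The first is bounded by assumption, the second because
      Re t \<ge> 0.\<close>
    have X: "exp (Re (s * cosh t)) * exp \<bar>Re (s * sinh t)\<bar> \<le> exp (norm s)"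
    proof -
      have "s * cosh t + s * sinh t = s * exp t"
        using cosh_plus_sinh[of t] by (metis distrib_left)
      then have 1: "Re (s * cosh t) + Re (s * sinh t) \<le> norm s"
        using grow unfolding s_def by (metis plus_complex.sel(1))
      have "s * cosh t - s * sinh t = s * exp (- t)"
        using cosh_minus_sinh[of t] by (metis right_diff_distrib)
      then have "Re (s * cosh t) - Re (s * sinh t) \<le> norm (s * exp (- t))"
        using complex_Re_le_cmod[of "s * exp (- t)"] by (metis minus_complex.sel(1))
      also have "\<dots> \<le> norm s * 1" unfolding norm_mult norm_exp_eq_Re using r by (intro mult_left_mono) auto
      finally have 2: "Re (s * cosh t) - Re (s * sinh t) \<le> norm s" by simp
      from 1 2 have "Re (s * cosh t) + \<bar>Re (s * sinh t)\<bar> \<le> norm s" by linarith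
      then show ?thesis unfolding exp_add[symmetric] by simp
    qed
    have nb: "norm (bes \<alpha> (s * sinh t)) \<le> C0 * exp \<bar>Re (s * sinh t)\<bar> * (norm s powr (- Re \<alpha>) * H powr (- Re \<alpha>))"
    proof -
      have "(norm s * H) powr Re \<alpha> * norm (bes \<alpha> (s * sinh t)) \<le> C0 * exp \<bar>Re (s * sinh t)\<bar>"
        using C0(2)[of "s * sinh t"] unfolding norm_mult H_def .
      then show ?thesis using s0 H0 by (simp add: powr_mult powr_minus field_simps)
    qed
    have np: "norm (sinh t powr (2 * \<alpha>)) \<le> H powr (2 * Re \<alpha>) * E"
      using norm_powr_complex_le[OF False, of "2 * \<alpha>"] unfolding H_def E_def by simp
    have "norm (sinh t powr (2 * \<alpha>)) * norm (bes \<alpha> (s * sinh t)) \<le>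
       (H powr (2 * Re \<alpha>) * E) * (C0 * exp \<bar>Re (s * sinh t)\<bar> * (norm s powr (- Re \<alpha>) * H powr (- Re \<alpha>)))"
      by (rule mult_mono[OF np nb]) (use E0 in auto)
    also have "\<dots> = (E * C0 * norm s powr (- Re \<alpha>) * exp \<bar>Re (s * sinh t)\<bar>) * (H powr (2 * Re \<alpha>) * H powr (- Re \<alpha>))"
      by (simp only: mult_ac)
    also have "H powr (2 * Re \<alpha>) * H powr (- Re \<alpha>) = H powr Re \<alpha>"
      unfolding powr_add[symmetric] by simp
    also have "(E * C0 * norm s powr (- Re \<alpha>) * exp \<bar>Re (s * sinh t)\<bar>) * H powr Re \<alpha> \<le>
       (E * C0 * norm s powr (- Re \<alpha>) * exp \<bar>Re (s * sinh t)\<bar>) * exp (Re t) powr Re \<alpha>"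
      using E0 C0(1) H0 He \<alpha> by (intro mult_left_mono powr_mono2) auto
    also have "exp (Re t) powr Re \<alpha> = exp (Re \<alpha> * Re t)" by (simp add: exp_powr_real mult.commute)
    finally have pb: "norm (sinh t powr (2 * \<alpha>)) * norm (bes \<alpha> (s * sinh t)) \<le>
       E * C0 * norm s powr (- Re \<alpha>) * exp \<bar>Re (s * sinh t)\<bar> * exp (Re \<alpha> * Re t)" .
    have "norm (kern c \<alpha> w1 w2 t) = (norm (tricomi c (\<alpha> + c) Z) * exp (Re (s * cosh t))) * (norm (sinh t powr (2 * \<alpha>)) * norm (bes \<alpha> (s * sinh t)))"
      unfolding kern_def Z_def s_def by (simp add: norm_mult norm_exp_eq_Re)
    also have "\<dots> \<le> ((\<delta> powr (- (Re \<alpha> + Re c)) * exp (- ((Re \<alpha> + Re c) * Re t)) * K) * exp (Re (s * cosh t))) *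
        (E * C0 * norm s powr (- Re \<alpha>) * exp \<bar>Re (s * sinh t)\<bar> * exp (Re \<alpha> * Re t))"
      by (intro mult_mono[OF mult_right_mono[OF T] pb]) (use K0 in auto)
    also have "\<dots> = (K * E * C0) * (\<delta> powr (- (Re \<alpha> + Re c)) * norm s powr (- Re \<alpha>)) * (exp (- ((Re \<alpha> + Re c) * Re t)) * exp (Re \<alpha> * Re t)) * (exp (Re (s * cosh t)) * exp \<bar>Re (s * sinh t)\<bar>)"
      by (simp only: mult_ac)
    also have "exp (- ((Re \<alpha> + Re c) * Re t)) * exp (Re \<alpha> * Re t) = exp (- (Re c * Re t))"
      unfolding exp_add[symmetric] by (simp add: algebra_simps)
    also have "(K * E * C0) * (\<delta> powr (- (Re \<alpha> + Re c)) * norm s powr (- Re \<alpha>)) * exp (- (Re c * Re t)) * (exp (Re (s * cosh t)) * exp \<bar>Re (s * sinh t)\<bar>) \<le>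
       (K * E * C0) * (\<delta> powr (- (Re \<alpha> + Re c)) * norm s powr (- Re \<alpha>)) * exp (- (Re c * Re t)) * exp (norm s)"
      using K0 E0 C0(1) by (intro mult_left_mono[OF X]) auto
    finally show ?thesis unfolding s_def by (simp only: mult_ac)
  qed
  then show ?thesis by blast
qed

lemma integrable_exp_posm:
  assumes "k > 0"
  shows "integrable posm (\<lambda>t. exp (- (k * t)))"
proof -
  have "integrable posm (\<lambda>t. t powr (1 - 1) * exp (- (k * t))) = integrable posm (\<lambda>t. exp (- (k * t)))"
    by (rule Bochner_Integration.integrable_cong[OF refl]) simp
  with integrable_Gamma_posm[OF _ assms, of 1] show ?thesis by simp
qed

lemma not_nonpos_Reals_of_norm_add_ge:
  assumes "\<And>u. u \<ge> 0 \<Longrightarrow> norm (z + complex_of_real u) \<ge> \<delta>" "\<delta> > 0"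
  shows "z \<notin> \<real>\<^sub>\<le>\<^sub>0"
proof
  assume "z \<in> \<real>\<^sub>\<le>\<^sub>0"
  then obtain x where x: "z = of_real x" "x \<le> 0" by (rule nonpos_Reals_cases)
  have "norm (z + of_real (- x)) \<ge> \<delta>" by (rule assms(1)) (use x in simp)
  then show False using x assms(2) by simp
qed

lemma continuous_on_kern:
  fixes S :: "'a::t2_space set"
  assumes c: "Re c > 0" and \<alpha>: "Re \<alpha> > 0" and \<rho>: "continuous_on S \<rho>"
    and Z: "\<And>t. t \<in> S \<Longrightarrow> kern_arg w1 w2 (\<rho> t) \<notin> \<real>\<^sub>\<le>\<^sub>0"
    and sh: "\<And>t. t \<in> S \<Longrightarrow> sinh (\<rho> t) \<notin> \<real>\<^sub>\<le>\<^sub>0 \<or> sinh (\<rho> t) = 0"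
  shows "continuous_on S (\<lambda>t. kern c \<alpha> w1 w2 (\<rho> t))"
proof -
  have a: "Re (\<alpha> + c) > 0" using c \<alpha> by simp
  have ch: "continuous_on S (\<lambda>t. cosh (\<rho> t))" "continuous_on S (\<lambda>t. sinh (\<rho> t))"
    by (intro continuous_intros \<rho>)+
  have "continuous_on S (\<lambda>t. tricomi c (\<alpha> + c) (kern_arg w1 w2 (\<rho> t)))"
    by (rule continuous_on_compose2[OF holomorphic_on_imp_continuous_on[OF holomorphic_on_tricomi[OF c a]]])
      (use Z in \<open>auto intro!: continuous_intros \<rho>\<close>)
  moreover have "continuous_on S (\<lambda>t. exp (w1 * w2 * cosh (\<rho> t)))" by (intro continuous_intros ch)
  moreover have "continuous_on S (\<lambda>t. bes \<alpha> (w1 * w2 * sinh (\<rho> t)))"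
    by (intro continuous_on_bes_compose[OF \<alpha>] continuous_intros ch)
  moreover have "continuous_on S (\<lambda>t. sinh (\<rho> t) powr (2 * \<alpha>))"
    unfolding continuous_on_def
  proof
    fix t assume t: "t \<in> S"
    have lim: "((\<lambda>t. sinh (\<rho> t)) \<longlongrightarrow> sinh (\<rho> t)) (at t within S)"
      using ch(2) t unfolding continuous_on_def by blast
    from sh[OF t] show "((\<lambda>t. sinh (\<rho> t) powr (2 * \<alpha>)) \<longlongrightarrow> sinh (\<rho> t) powr (2 * \<alpha>)) (at t within S)"
    proof
      assume "sinh (\<rho> t) \<notin> \<real>\<^sub>\<le>\<^sub>0"
      then show ?thesis by (intro tendsto_powr_complex[OF _ lim tendsto_const])
    next
      assume z: "sinh (\<rho> t) = 0"
      have "((\<lambda>t. sinh (\<rho> t) powr (2 * \<alpha>)) \<longlongrightarrow> 0) (at t within S)"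
        by (rule tendsto_powr_complex_0[OF lim[unfolded z] tendsto_const]) (use \<alpha> in simp)
      then show ?thesis using z by simp
    qed
  qed
  ultimately show ?thesis unfolding kern_def by (intro continuous_on_mult)
qed

text \<open>All three arguments may vary, so the lemma serves both for analyticity in w at a fixed
  point of the path and for analyticity in t inside the half-strip.\<close>

lemma holomorphic_on_kern:
  assumes c: "Re c > 0" and \<alpha>: "Re \<alpha> > 0"
    and f: "f1 holomorphic_on S" "f2 holomorphic_on S" "\<rho> holomorphic_on S"
    and Z: "\<And>v. v \<in> S \<Longrightarrow> kern_arg (f1 v) (f2 v) (\<rho> v) \<notin> \<real>\<^sub>\<le>\<^sub>0"
    and sh: "\<And>v. v \<in> S \<Longrightarrow> sinh (\<rho> v) \<notin> \<real>\<^sub>\<le>\<^sub>0"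
  shows "(\<lambda>v. kern c \<alpha> (f1 v) (f2 v) (\<rho> v)) holomorphic_on S"
proof -
  have a: "Re (\<alpha> + c) > 0" using c \<alpha> by simp
  have ch: "(\<lambda>v. cosh (\<rho> v)) holomorphic_on S" "(\<lambda>v. sinh (\<rho> v)) holomorphic_on S"
    unfolding cosh_field_def sinh_field_def by (intro holomorphic_intros f; simp)+
  have "(tricomi c (\<alpha> + c) \<circ> (\<lambda>v. kern_arg (f1 v) (f2 v) (\<rho> v))) holomorphic_on S"
    by (rule holomorphic_on_compose_gen[OF _ holomorphic_on_tricomi[OF c a]])
      (use Z in \<open>auto intro!: holomorphic_intros f ch\<close>)
  moreover have "(bes \<alpha> \<circ> (\<lambda>v. f1 v * f2 v * sinh (\<rho> v))) holomorphic_on S"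
    by (rule holomorphic_on_compose[OF _ holomorphic_on_bes[OF \<alpha>]]) (intro holomorphic_intros f ch)
  moreover have "(\<lambda>v. exp (f1 v * f2 v * cosh (\<rho> v))) holomorphic_on S" by (intro holomorphic_intros f ch)
  moreover have "(\<lambda>v. sinh (\<rho> v) powr (2 * \<alpha>)) holomorphic_on S" by (intro holomorphic_intros ch sh)
  ultimately show ?thesis unfolding kern_def comp_def by (intro holomorphic_on_mult)
qed

lemma integrable_kern_path:
  fixes \<rho> :: "real \<Rightarrow> complex"
  assumes c: "Re c > 0" and \<alpha>: "Re \<alpha> > 0" and w: "w1 \<noteq> 0" "w2 \<noteq> 0" and \<delta>: "\<delta> > 0"
    and \<rho>: "continuous_on {0<..} \<rho>" "\<And>t. t > 0 \<Longrightarrow> Re (\<rho> t) = t" "\<And>t. t > 0 \<Longrightarrow> sinh (\<rho> t) \<notin> \<real>\<^sub>\<le>\<^sub>0"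
    and geo: "\<And>t u. t > 0 \<Longrightarrow> u \<ge> 0 \<Longrightarrow>
      norm (kern_arg w1 w2 (\<rho> t) + complex_of_real u) \<ge> \<delta> * exp (Re (\<rho> t))"
    and grow: "\<And>t. t > 0 \<Longrightarrow> Re (w1 * w2 * exp (\<rho> t)) \<le> norm (w1 * w2)"
  shows "integrable posm (\<lambda>t. kern c \<alpha> w1 w2 (\<rho> t))"
proof -
  obtain C where C: "\<And>w1 w2 t \<delta>. \<delta> > 0 \<Longrightarrow> w1 \<noteq> 0 \<Longrightarrow> w2 \<noteq> 0 \<Longrightarrow> Re t \<ge> 0 \<Longrightarrow>
     (\<forall>u\<ge>0. norm (kern_arg w1 w2 t + complex_of_real u) \<ge> \<delta> * exp (Re t)) \<Longrightarrow>
     Re (w1 * w2 * exp t) \<le> norm (w1 * w2) \<Longrightarrow>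
     norm (kern c \<alpha> w1 w2 t) \<le> C * (\<delta> powr (- (Re \<alpha> + Re c)) * norm (w1 * w2) powr (- Re \<alpha>) * exp (norm (w1 * w2))) * exp (- (Re c * Re t))"
    using kern_bound[OF c \<alpha>] by blast
  define B where "B = C * (\<delta> powr (- (Re \<alpha> + Re c)) * norm (w1 * w2) powr (- Re \<alpha>) * exp (norm (w1 * w2)))"
  have b: "norm (kern c \<alpha> w1 w2 (\<rho> t)) \<le> B * exp (- (Re c * t))" if t: "t > 0" for t
  proof -
    have "Re (\<rho> t) \<ge> 0" using \<rho>(2)[OF t] t by simp
    from C[OF \<delta> w this _ grow[OF t]] geo[OF t] show ?thesis unfolding B_def \<rho>(2)[OF t] by blast
  qed
  have m: "(\<lambda>t. kern c \<alpha> w1 w2 (\<rho> t)) \<in> borel_measurable posm"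
  proof (rule borel_measurable_posm_continuous_on, rule continuous_on_kern[OF c \<alpha> \<rho>(1)])
    fix t :: real assume "t \<in> {0<..}"
    then have t: "t > 0" by simp
    show "kern_arg w1 w2 (\<rho> t) \<notin> \<real>\<^sub>\<le>\<^sub>0"
      by (rule not_nonpos_Reals_of_norm_add_ge[OF geo[OF t]]) (use \<delta> in simp_all)
    show "sinh (\<rho> t) \<notin> \<real>\<^sub>\<le>\<^sub>0 \<or> sinh (\<rho> t) = 0" using \<rho>(3)[OF t] by (rule disjI1)
  qed
  have e: "integrable posm (\<lambda>t. B * exp (- (Re c * t)))"
    by (rule integrable_mult_right[OF integrable_exp_posm[OF c]])
  show ?thesis
  proof (rule Bochner_Integration.integrable_bound[OF e m], rule AE_I2)
    fix t assume "t \<in> space posm"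
    then have "t > 0" by simp
    from b[OF this] show "norm (kern c \<alpha> w1 w2 (\<rho> t)) \<le> norm (B * exp (- (Re c * t)))" by simp
  qed
qed

text \<open>The weight v lets one statement cover the half-lines, with v = 1, and the segment up to
  the corner, with v the speed on (0, 1] and 0 afterwards. Continuity of D makes the majorant
  uniform on small discs.\<close>

lemma holomorphic_on_kern_path_integral:
  fixes D :: "complex \<Rightarrow> real" and \<rho> v :: "real \<Rightarrow> complex"
  assumes c: "Re c > 0" and \<alpha>: "Re \<alpha> > 0" and U: "open U" and w1: "w1 \<noteq> 0" and U0: "0 \<notin> U"
    and D: "continuous_on U D" "\<And>w. w \<in> U \<Longrightarrow> D w > 0"
    and \<rho>: "continuous_on {0<..} \<rho>" "\<And>t. t > 0 \<Longrightarrow> Re (\<rho> t) \<ge> 0" "\<And>t. t > 0 \<Longrightarrow> sinh (\<rho> t) \<notin> \<real>\<^sub>\<le>\<^sub>0"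
    and v: "v \<in> borel_measurable posm" "integrable posm (\<lambda>t. norm (v t) * exp (- (Re c * Re (\<rho> t))))"
    and geo: "\<And>w t u. w \<in> U \<Longrightarrow> t > 0 \<Longrightarrow> u \<ge> 0 \<Longrightarrow>
      norm (kern_arg w1 w (\<rho> t) + complex_of_real u) \<ge> D w * exp (Re (\<rho> t))"
    and grow: "\<And>w t. w \<in> U \<Longrightarrow> t > 0 \<Longrightarrow> Re (w1 * w * exp (\<rho> t)) \<le> norm (w1 * w)"
  shows "(\<lambda>w. LINT t|posm. v t * kern c \<alpha> w1 w (\<rho> t)) holomorphic_on U"
proof -
  obtain C where C: "\<And>w1 w2 t \<delta>. \<delta> > 0 \<Longrightarrow> w1 \<noteq> 0 \<Longrightarrow> w2 \<noteq> 0 \<Longrightarrow> Re t \<ge> 0 \<Longrightarrow>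
     (\<forall>u\<ge>0. norm (kern_arg w1 w2 t + complex_of_real u) \<ge> \<delta> * exp (Re t)) \<Longrightarrow>
     Re (w1 * w2 * exp t) \<le> norm (w1 * w2) \<Longrightarrow>
     norm (kern c \<alpha> w1 w2 t) \<le> C * (\<delta> powr (- (Re \<alpha> + Re c)) * norm (w1 * w2) powr (- Re \<alpha>) * exp (norm (w1 * w2))) * exp (- (Re c * Re t))"
    using kern_bound[OF c \<alpha>] by blast
  let ?B = "\<lambda>w. C * (D w powr (- (Re \<alpha> + Re c)) * norm (w1 * w) powr (- Re \<alpha>) * exp (norm (w1 * w)))"
  have Z: "kern_arg w1 w (\<rho> t) \<notin> \<real>\<^sub>\<le>\<^sub>0" if "w \<in> U" "t > 0" for w t
    by (rule not_nonpos_Reals_of_norm_add_ge[OF geo[OF that]]) (use D(2)[OF that(1)] in simp_all)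
  have cB: "continuous_on U ?B"
    by (intro continuous_intros D(1)) (use D(2) U0 w1 in \<open>auto simp: less_imp_neq[symmetric]\<close>)
  have meas: "(\<lambda>t. v t * kern c \<alpha> w1 w (\<rho> t)) \<in> borel_measurable posm" if w: "w \<in> U" for w
  proof (rule borel_measurable_times[OF v(1) borel_measurable_posm_continuous_on])
    show "continuous_on {0<..} (\<lambda>t. kern c \<alpha> w1 w (\<rho> t))"
    proof (rule continuous_on_kern[OF c \<alpha> \<rho>(1)])
      fix t :: real assume "t \<in> {0<..}"
      then have t: "t > 0" by simp
      show "kern_arg w1 w (\<rho> t) \<notin> \<real>\<^sub>\<le>\<^sub>0" by (rule Z[OF w t])
      show "sinh (\<rho> t) \<notin> \<real>\<^sub>\<le>\<^sub>0 \<or> sinh (\<rho> t) = 0" using \<rho>(3)[OF t] by (rule disjI1)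
    qed
  qed
  have key: "\<exists>r>0. ball w r \<subseteq> U \<and> (\<exists>B. \<forall>x\<in>ball w r. \<forall>t\<in>space posm. norm (v t * kern c \<alpha> w1 x (\<rho> t)) \<le> B * (norm (v t) * exp (- (Re c * Re (\<rho> t)))))"
    if w: "w \<in> U" for w
  proof -
    obtain r where r: "r > 0" "cball w r \<subseteq> U" using U w open_contains_cball_eq by blast
    have "bounded (?B ` cball w r)"
      by (intro compact_imp_bounded compact_continuous_image continuous_on_subset[OF cB r(2)] compact_cball)
    then obtain B where B: "\<And>x. x \<in> cball w r \<Longrightarrow> norm (?B x) \<le> B" unfolding bounded_iff by blast
    have "norm (v t * kern c \<alpha> w1 x (\<rho> t)) \<le> B * (norm (v t) * exp (- (Re c * Re (\<rho> t))))" if x: "x \<in> ball w r" and t: "t \<in> space posm" for x t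
    proof -
      have xc: "x \<in> cball w r" using x by simp
      with r(2) have xU: "x \<in> U" by blast
      have t0: "t > 0" using t by simp
      have x0: "x \<noteq> 0" using xU U0 by blast
      have "norm (kern c \<alpha> w1 x (\<rho> t)) \<le> ?B x * exp (- (Re c * Re (\<rho> t)))"
        by (rule C[OF D(2)[OF xU] w1 x0 \<rho>(2)[OF t0] _ grow[OF xU t0]]) (intro allI impI geo[OF xU t0])
      also have "\<dots> \<le> B * exp (- (Re c * Re (\<rho> t)))"
        using B[OF xc] by (intro mult_right_mono) auto
      finally have "norm (v t) * norm (kern c \<alpha> w1 x (\<rho> t)) \<le> norm (v t) * (B * exp (- (Re c * Re (\<rho> t))))"
        by (rule mult_left_mono) simp
      then show ?thesis unfolding norm_mult by (simp only: mult_ac)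
    qed
    then show ?thesis using r ball_subset_cball[of w r] by blast
  qed
  have hol: "(\<lambda>x. v t * kern c \<alpha> w1 x (\<rho> t)) holomorphic_on U" if "t \<in> space posm" for t
  proof -
    have t: "t > 0" using that by simp
    have "(\<lambda>x. kern c \<alpha> w1 x (\<rho> t)) holomorphic_on U"
      by (rule holomorphic_on_kern[OF c \<alpha>]) (use Z[OF _ t] \<rho>(3)[OF t] in \<open>auto intro!: holomorphic_intros\<close>)
    then show ?thesis by (intro holomorphic_on_mult holomorphic_on_const)
  qed
  show "(\<lambda>w. LINT t|posm. v t * kern c \<alpha> w1 w (\<rho> t)) holomorphic_on U"
  proof (rule holomorphic_onI)
    fix w assume w: "w \<in> U"
    obtain r B where r: "r > 0" "ball w r \<subseteq> U" and B: "\<And>x t. x \<in> ball w r \<Longrightarrow> t \<in> space posm \<Longrightarrow> norm (v t * kern c \<alpha> w1 x (\<rho> t)) \<le> B * (norm (v t) * exp (- (Re c * Re (\<rho> t))))"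
      using key[OF w] by blast
    have "((\<lambda>w. LINT t|posm. v t * kern c \<alpha> w1 w (\<rho> t)) has_field_derivative (LINT t|posm. deriv (\<lambda>x. v t * kern c \<alpha> w1 x (\<rho> t)) w)) (at w)"
    proof (rule has_field_derivative_integral_dominated[OF r(1), where g = "\<lambda>t. B * (norm (v t) * exp (- (Re c * Re (\<rho> t))))"])
      show "(\<lambda>t. v t * kern c \<alpha> w1 x (\<rho> t)) \<in> borel_measurable posm" if "x \<in> ball w r" for x
        using meas r(2) that by blast
      show "(\<lambda>x. v t * kern c \<alpha> w1 x (\<rho> t)) holomorphic_on ball w r" if "t \<in> space posm" for t
        by (rule holomorphic_on_subset[OF hol[OF that] r(2)])
      show "integrable posm (\<lambda>t. B * (norm (v t) * exp (- (Re c * Re (\<rho> t)))))" by (intro integrable_mult_right v(2))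
    qed (rule B)
    from has_field_derivative_at_within[OF this]
    show "(\<lambda>w. LINT t|posm. v t * kern c \<alpha> w1 w (\<rho> t)) field_differentiable at w within U"
      unfolding field_differentiable_def by (rule exI)
  qed
qed

text \<open>Dividing by w1 + w2 moves the argument of the confluent function, shifted by any nonnegative u,
  into the lower half-plane.\<close>

lemma norm_arg_ge_upper_half_plane:
  assumes w: "Im w1 > 0" "Im w2 > 0" and t: "t \<ge> 0" and u: "u \<ge> 0"
  shows "norm (w1 + w2) * min (Im (w1 + w2)) (2 * Im (w1 * w2 / (w1 + w2))) / 2 * exp t
     \<le> norm (kern_arg w1 w2 (complex_of_real t) + complex_of_real u)"
    and "Im (w1 * w2 / (w1 + w2)) > 0"
proof -
  define z where "z = w1 + w2"
  define \<kappa> where "\<kappa> = Im (w1 * w2 / z)"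
  have z: "Im z > 0" using w by (simp add: z_def)
  then have z0: "z \<noteq> 0" by auto
  \<comment> \<open>The quotient is the reciprocal of 1/w1 + 1/w2, which lies in the lower
    half-plane. Multiplying by the conjugate of z displays the sign of \<kappa>.\<close>
  have "w1 * w2 / z = w1 * w2 * cnj z / of_real ((norm z)\<^sup>2)"
    using z0 complex_norm_square[of z] by (simp add: field_simps)
  then have "\<kappa> = Im (w1 * w2 * cnj z) / (norm z)\<^sup>2" unfolding \<kappa>_def by (simp only: Im_divide_of_real)
  also have "Im (w1 * w2 * cnj z) = (norm w1)\<^sup>2 * Im w2 + (norm w2)\<^sup>2 * Im w1"
    unfolding z_def cmod_power2 by (simp add: algebra_simps power2_eq_square)
  finally have \<kappa>: "\<kappa> > 0"
    using w z0 by (auto intro!: divide_pos_pos add_pos_pos mult_pos_pos)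
  then show "Im (w1 * w2 / (w1 + w2)) > 0" by (simp add: \<kappa>_def z_def)
  define Z where "Z = kern_arg w1 w2 (complex_of_real t) + complex_of_real u"
  define \<mu> where "\<mu> = min (Im z) (2 * \<kappa>)"
  have ct: "cosh t \<ge> 1" by (rule cosh_real_ge_1)
  have "Z = - z\<^sup>2 - 2 * (w1 * w2) * of_real (cosh t - 1) + of_real u"
    unfolding Z_def z_def cosh_complex_of_real by (simp add: power2_eq_square algebra_simps)
  then have Zz: "Z / z = - z - of_real (2 * (cosh t - 1)) * (w1 * w2 / z) + of_real u * inverse z"
    using z0 by (simp add: field_simps power2_eq_square)
  have im: "Im (- z - of_real A * q + of_real u * y) = - Im z - A * Im q + u * Im y" for A q y
    by simp
  \<comment> \<open>All three contributions are nonpositive, so they cannot cancel and the shift by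
    u only increases the distance from 0.\<close>
  have "Im (Z / z) = - Im z - 2 * (cosh t - 1) * \<kappa> + u * Im (inverse z)"
    unfolding \<kappa>_def Zz by (rule im)
  moreover have "u * Im (inverse z) \<le> 0"
    using z u by (auto intro!: mult_nonneg_nonpos divide_nonpos_nonneg)
  ultimately have "Im z + 2 * (cosh t - 1) * \<kappa> \<le> \<bar>Im (Z / z)\<bar>" by linarith
  moreover have "\<mu> + (cosh t - 1) * \<mu> \<le> Im z + (cosh t - 1) * (2 * \<kappa>)"
    using ct by (intro add_mono mult_left_mono) (auto simp: \<mu>_def)
  ultimately have "\<mu> * cosh t \<le> \<bar>Im (Z / z)\<bar>" by (simp add: algebra_simps)
  also have "\<dots> \<le> norm (Z / z)" by (rule abs_Im_le_cmod)
  finally have "\<mu> * cosh t * norm z \<le> norm Z" using z0 by (simp add: norm_divide field_simps)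
  moreover have "norm z * \<mu> / 2 * exp t \<le> \<mu> * cosh t * norm z"
  proof -
    have "exp t / 2 \<le> cosh t" by (simp add: cosh_def)
    moreover have "\<mu> \<ge> 0" using z \<kappa> by (simp add: \<mu>_def)
    ultimately have "(norm z * \<mu>) * (exp t / 2) \<le> (norm z * \<mu>) * cosh t" by (intro mult_left_mono) auto
    then show ?thesis by (simp add: algebra_simps)
  qed
  ultimately show "norm (w1 + w2) * min (Im (w1 + w2)) (2 * Im (w1 * w2 / (w1 + w2))) / 2 * exp t
     \<le> norm (kern_arg w1 w2 (complex_of_real t) + complex_of_real u)"
    unfolding Z_def z_def \<mu>_def \<kappa>_def by linarith
qed

lemma cosh_Complex: "cosh (Complex r p) = Complex (cosh r * cos p) (sinh r * sin p)"
  unfolding cosh_field_def by (simp add: complex_eq_iff Re_exp Im_exp cosh_def sinh_def field_simps)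

lemma sinh_Complex: "sinh (Complex r p) = Complex (sinh r * cos p) (cosh r * sin p)"
  unfolding sinh_field_def by (simp add: complex_eq_iff Re_exp Im_exp cosh_def sinh_def field_simps)

text \<open>Here one divides by the factor with the smaller phase instead, which works on the whole half-strip.\<close>

lemma norm_arg_ge_quadrant_aux:
  assumes w: "Re w1 > 0" "Im w1 > 0" "Re w2 > 0" "Im w2 > 0" and le: "Im (w2 / w1) \<ge> 0"
    and t: "Re t \<ge> 0" "0 \<le> Im t" "Im t \<le> pi / 2" and u: "u \<ge> 0"
    and \<mu>: "\<mu> > 0" "\<mu> \<le> Im w1" "\<mu> \<le> Re w2" "\<mu> \<le> Im w2"
  shows "norm w1 * \<mu> * exp (Re t) \<le> norm (kern_arg w1 w2 t + complex_of_real u)"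
proof -
  define r p where "r = Re t" and "p = Im t"
  have r: "r \<ge> 0" and p: "cos p \<ge> 0" "sin p \<ge> 0"
    using t cos_ge_zero[of p] sin_ge_zero[of p] by (auto simp: r_def p_def)
  have tt: "t = Complex r p" by (simp add: r_def p_def)
  define Z where "Z = kern_arg w1 w2 t + complex_of_real u"
  have w0: "w1 \<noteq> 0" using w by auto
  \<comment> \<open>The assumption says that the phase of w2 is not below that of w1. So q stays in
    the closed first quadrant, and w2 q contributes to the imaginary part with the same sign as the
    other terms.\<close>
  define q where "q = w2 / w1"
  have q: "Re q > 0" "Im q \<ge> 0"
    using le unfolding q_def
    by (simp_all only: Re_divide) (intro divide_pos_pos add_pos_pos mult_pos_pos zero_less_power w)
  have red: "(- (w1\<^sup>2 + w2\<^sup>2 + 2 * (w1 * w2) * C) + y) / w1 = - w1 - w2 * (w2 / w1) - 2 * w2 * C + y * inverse w1" for C y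
    using w0 by (simp add: field_simps power2_eq_square)
  have Zw: "Z / w1 = - w1 - w2 * q - 2 * w2 * cosh t + of_real u * inverse w1"
    unfolding Z_def q_def by (rule red)
  have im: "Im (- w1 - w2 * q - 2 * w2 * Complex A B + of_real u * y) = - Im w1 - (Re w2 * Im q + Im w2 * Re q) - 2 * (Re w2 * B + Im w2 * A) + u * Im y" for A B y
    by (simp add: algebra_simps)
  have "Im (Z / w1) = - Im w1 - (Re w2 * Im q + Im w2 * Re q) - 2 * (Re w2 * (sinh r * sin p) + Im w2 * (cosh r * cos p)) + u * Im (inverse w1)"
    unfolding Zw tt cosh_Complex by (rule im)
  moreover have "Im (inverse w1) \<le> 0"
    using w by (auto intro!: divide_nonpos_nonneg)
  then have "u * Im (inverse w1) \<le> 0" by (rule mult_nonneg_nonpos[OF u])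
  moreover have "Re w2 * Im q + Im w2 * Re q \<ge> 0"
    by (rule add_nonneg_nonneg[OF mult_nonneg_nonneg[OF less_imp_le[OF w(3)] q(2)] mult_nonneg_nonneg[OF less_imp_le[OF w(4)] less_imp_le[OF q(1)]]])
  ultimately have 1: "Im w1 + 2 * (Re w2 * (sinh r * sin p) + Im w2 * (cosh r * cos p)) \<le> \<bar>Im (Z / w1)\<bar>" by linarith
  have hyp: "0 \<le> sinh r" "sinh r \<le> cosh r" using r by (auto intro: less_imp_le sinh_less_cosh_real)
  \<comment> \<open>The lower bound is \<mu> (1 + 2 sinh r (sin p + cos p)). It is at least \<mu>
    e^r because sin p + cos p \<ge> 1 for 0 \<le> p \<le> pi/2, and e^r = 2 sinh r + e^(-r) \<le> 2
    sinh r + 1.\<close>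
  have "\<mu> * (sinh r * sin p) \<le> Re w2 * (sinh r * sin p)" by (rule mult_right_mono[OF \<mu>(3) mult_nonneg_nonneg[OF hyp(1) p(2)]])
  moreover have "\<mu> * (cosh r * cos p) \<le> Im w2 * (cosh r * cos p)"
    by (rule mult_right_mono[OF \<mu>(4) mult_nonneg_nonneg[OF cosh_real_nonneg p(1)]])
  moreover have "\<mu> * (sinh r * cos p) \<le> \<mu> * (cosh r * cos p)"
    by (rule mult_left_mono[OF mult_right_mono[OF hyp(2) p(1)] less_imp_le[OF \<mu>(1)]])
  ultimately have "\<mu> + 2 * (\<mu> * (sinh r * (sin p + cos p))) \<le> \<bar>Im (Z / w1)\<bar>"
    using 1 \<mu>(2) unfolding distrib_left by linarith
  moreover have "sinh r * 1 \<le> sinh r * (sin p + cos p)"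
  proof (rule mult_left_mono)
    have "1\<^sup>2 \<le> (sin p + cos p)\<^sup>2" using p sin_cos_squared_add[of p] by (simp add: power2_sum)
    then show "1 \<le> sin p + cos p" by (rule power2_le_imp_le) (use p in simp)
  qed (use r in auto)
  then have "\<mu> * sinh r \<le> \<mu> * (sinh r * (sin p + cos p))" using \<mu> by (intro mult_left_mono) auto
  ultimately have "\<mu> + 2 * (\<mu> * sinh r) \<le> \<bar>Im (Z / w1)\<bar>" by linarith
  moreover have "exp r \<le> 1 + 2 * sinh r"
    using r cosh_plus_sinh[of r] cosh_minus_sinh[of r] exp_le_one_iff[of "- r"] by linarith
  then have "\<mu> * exp r \<le> \<mu> * (1 + 2 * sinh r)" using \<mu> by (intro mult_left_mono) auto
  ultimately have "\<mu> * exp r \<le> \<bar>Im (Z / w1)\<bar>" unfolding distrib_left by linarith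
  also have "\<dots> \<le> norm (Z / w1)" by (rule abs_Im_le_cmod)
  finally have "norm w1 * \<mu> * exp r \<le> norm Z" using w0 by (simp add: norm_divide field_simps)
  then show ?thesis by (simp add: Z_def r_def)
qed

text \<open>A symmetric lower bound for the constant norm w1 * \<mu> of the preceding estimate,
  valid whichever factor has the smaller phase. Being built from minima it is continuous in both
  arguments.\<close>

definition quad_dist :: "complex \<Rightarrow> complex \<Rightarrow> real" where
  "quad_dist w1 w2 = min (norm w1) (norm w2) * min (min (Re w1) (Im w1)) (min (Re w2) (Im w2))"

lemma norm_arg_ge_quadrant:
  assumes w: "Re w1 > 0" "Im w1 > 0" "Re w2 > 0" "Im w2 > 0"
    and t: "Re t \<ge> 0" "0 \<le> Im t" "Im t \<le> pi / 2" and u: "u \<ge> 0"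
  shows "quad_dist w1 w2 * exp (Re t) \<le> norm (kern_arg w1 w2 t + complex_of_real u)"
proof -
  define \<mu> where "\<mu> = min (min (Re w1) (Im w1)) (min (Re w2) (Im w2))"
  have \<mu>: "\<mu> > 0" "\<mu> \<le> Re w1" "\<mu> \<le> Im w1" "\<mu> \<le> Re w2" "\<mu> \<le> Im w2" using w by (auto simp: \<mu>_def)
  have le: "quad_dist w1 w2 * exp (Re t) \<le> norm w1 * \<mu> * exp (Re t)" "quad_dist w1 w2 * exp (Re t) \<le> norm w2 * \<mu> * exp (Re t)"
    unfolding quad_dist_def \<mu>_def[symmetric] using \<mu>(1) by (auto intro!: mult_right_mono)
  have i: "Im (w2 / w1) = (Im w2 * Re w1 - Re w2 * Im w1) / ((Re w1)\<^sup>2 + (Im w1)\<^sup>2)" "Im (w1 / w2) = (Im w1 * Re w2 - Re w1 * Im w2) / ((Re w2)\<^sup>2 + (Im w2)\<^sup>2)"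
    by (simp_all add: Im_divide)
  show ?thesis
  proof (cases "Im w2 * Re w1 - Re w2 * Im w1 \<ge> 0")
    case True
    then have "Im (w2 / w1) \<ge> 0" unfolding i by (intro divide_nonneg_nonneg) auto
    from norm_arg_ge_quadrant_aux[OF w this t u \<mu>(1,3-5)] le(1) show ?thesis by linarith
  next
    case False
    then have "Im (w1 / w2) \<ge> 0" unfolding i by (intro divide_nonneg_nonneg) (auto simp: mult.commute)
    from norm_arg_ge_quadrant_aux[OF w(3,4,1,2) this t u \<mu>(1,5,2,3)]
    have "norm w2 * \<mu> * exp (Re t) \<le> norm (kern_arg w1 w2 t + complex_of_real u)"
      by (simp only: mult.commute[of w2 w1] add.commute[of "w2\<^sup>2" "w1\<^sup>2"])
    with le(2) show ?thesis by (rule order.trans)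
  qed
qed

section \<open>Analytic continuation in the two arguments\<close>

lemma integral_posm_indicator:
  fixes f :: "real \<Rightarrow> complex"
  assumes i: "set_integrable lborel {0<..R} f" and I: "(f has_integral I) {0..R}"
  shows "(LINT t|posm. indicator {..R} t * f t) = I"
proof -
  have "(LINT t|posm. indicator {..R} t * f t) = (LINT t:{0<..R}|lborel. f t)"
    unfolding integral_posm set_lebesgue_integral_def
    by (rule Bochner_Integration.integral_cong) (auto simp: indicator_def)
  also have "\<dots> = integral {0<..R} f" by (rule set_borel_integral_eq_integral(2)[OF i])
  also have "(f has_integral I) {0..R} \<longleftrightarrow> (f has_integral I) {0<..R}"
    by (rule has_integral_spike_set_eq; rule negligible_subset[of "{0}"]; auto)
  with I have "integral {0<..R} f = I" by (simp add: integral_unique)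
  finally show ?thesis .
qed

text \<open>The fundamental theorem on [0, R] followed by R to infinity, with the truncated
  integrals dominated by the norm of f.\<close>

lemma tendsto_primitive_posm:
  fixes f G :: "real \<Rightarrow> complex"
  assumes f: "integrable posm f"
    and G: "\<And>t. t \<ge> 0 \<Longrightarrow> (G has_vector_derivative f t) (at t within {0..})"
  shows "(G \<longlongrightarrow> G 0 + (LINT t|posm. f t)) at_top"
proof -
  have eq: "(LINT t|posm. indicator {..R} t * f t) = G R - G 0" if R: "R \<ge> 0" for R
  proof (rule integral_posm_indicator)
    show "set_integrable lborel {0<..R} f"
      by (rule set_integrable_subset[OF f[unfolded integrable_posm]]) auto
    show "(f has_integral G R - G 0) {0..R}"
      by (rule fundamental_theorem_of_calculus[OF R], rule has_vector_derivative_within_subset[OF G]) auto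
  qed
  have "((\<lambda>R. LINT t|posm. indicator {..R} t * f t) \<longlongrightarrow> (LINT t|posm. f t)) at_top"
  proof (rule integral_dominated_convergence_at_top[where w = "\<lambda>t. norm (f t)"])
    show fm: "f \<in> borel_measurable posm" using f by (rule borel_measurable_integrable)
    have "(indicator {..R} :: real \<Rightarrow> complex) \<in> borel_measurable posm" for R
      by (rule measurable_compose[OF measurable_ident_posm borel_measurable_indicator]) simp
    then show "(\<lambda>t. indicator {..R} t * f t) \<in> borel_measurable posm" for R
      by (intro borel_measurable_times fm)
    show "integrable posm (\<lambda>t. norm (f t))" using f by simp
    show "AE t in posm. ((\<lambda>R. indicator {..R} t * f t) \<longlongrightarrow> f t) at_top"
    proof (rule AE_I2)
      fix t :: real
      have "eventually (\<lambda>R. indicator {..R} t * f t = f t) at_top"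
        using eventually_ge_at_top[of t] by eventually_elim simp
      then show "((\<lambda>R. indicator {..R} t * f t) \<longlongrightarrow> f t) at_top" by (rule tendsto_eventually)
    qed
    show "\<forall>\<^sub>F R in at_top. AE t in posm. norm (indicator {..R} t * f t) \<le> norm (f t)"
      by (rule always_eventually, rule allI, rule AE_I2) (simp add: indicator_def)
  qed
  moreover have "eventually (\<lambda>R. (LINT t|posm. indicator {..R} t * f t) = G R - G 0) at_top"
    using eventually_ge_at_top[of 0] by eventually_elim (rule eq)
  ultimately have "((\<lambda>R. G R - G 0) \<longlongrightarrow> (LINT t|posm. f t)) at_top"
    by (simp add: tendsto_cong)
  from tendsto_add[OF tendsto_const[of "G 0"] this] show ?thesis by simp
qed

lemma minus_square_not_nonpos:
  assumes "Im w > 0"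
  shows "- (w\<^sup>2) \<notin> \<real>\<^sub>\<le>\<^sub>0"
proof
  assume "- (w\<^sup>2) \<in> \<real>\<^sub>\<le>\<^sub>0"
  then have "Im (w\<^sup>2) = 0" "Re (w\<^sup>2) \<ge> 0" by (auto simp: complex_nonpos_Reals_iff)
  then have "Re w = 0" "(Re w)\<^sup>2 - (Im w)\<^sup>2 \<ge> 0" using assms by (auto simp: power2_eq_square)
  then show False using assms by simp
qed

lemma holomorphic_on_tricomi_minus_square:
  assumes c: "Re c > 0" and \<alpha>: "Re \<alpha> > 0" and "\<And>w. w \<in> U \<Longrightarrow> Im w > 0"
  shows "(\<lambda>w. tricomi c (\<alpha> + c) (- (w\<^sup>2))) holomorphic_on U"
proof -
  have a: "Re (\<alpha> + c) > 0" using c \<alpha> by simp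
  have "(tricomi c (\<alpha> + c) \<circ> (\<lambda>w. - (w\<^sup>2))) holomorphic_on U"
    by (rule holomorphic_on_compose_gen[OF _ holomorphic_on_tricomi[OF c a]])
      (use assms(3) minus_square_not_nonpos in \<open>auto intro!: holomorphic_intros\<close>)
  then show ?thesis by (simp add: comp_def)
qed

lemma sinh_of_real_not_nonpos: "t > 0 \<Longrightarrow> sinh (complex_of_real t) \<notin> \<real>\<^sub>\<le>\<^sub>0"
  unfolding sinh_complex_of_real by simp

lemma Re_mult_exp_of_real_le:
  assumes "Re s \<le> 0"
  shows "Re (s * exp (complex_of_real t)) \<le> norm s"
proof -
  have "Re (s * exp (complex_of_real t)) = Re s * exp t" by (simp add: exp_of_real)
  also have "\<dots> \<le> 0" using assms by (intro mult_nonpos_nonneg) auto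
  also have "0 \<le> norm s" by simp
  finally show ?thesis .
qed

lemma upper_half_dist_pos:
  assumes "Im w1 > 0" "Im w2 > 0"
  shows "norm (w1 + w2) * min (Im (w1 + w2)) (2 * Im (w1 * w2 / (w1 + w2))) / 2 > 0"
proof -
  have "w1 + w2 \<noteq> 0" "Im (w1 + w2) > 0" using assms by (auto simp: complex_eq_iff)
  with norm_arg_ge_upper_half_plane(2)[OF assms, of 0 0] show ?thesis by simp
qed

lemma integrable_kern_line:
  assumes c: "Re c > 0" and \<alpha>: "Re \<alpha> > 0" and w: "Im w1 > 0" "Im w2 > 0" "Re (w1 * w2) \<le> 0"
  shows "integrable posm (\<lambda>t. kern c \<alpha> w1 w2 (of_real t))"
proof (rule integrable_kern_path[OF c \<alpha> _ _ upper_half_dist_pos[OF w(1,2)]])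
  show "w1 \<noteq> 0" "w2 \<noteq> 0" using w by auto
  show "continuous_on {0<..} complex_of_real" by (intro continuous_intros)
  show "norm (w1 + w2) * min (Im (w1 + w2)) (2 * Im (w1 * w2 / (w1 + w2))) / 2 * exp (Re (complex_of_real t))
     \<le> norm (kern_arg w1 w2 (complex_of_real t) + complex_of_real u)" if "t > 0" "u \<ge> 0" for t u
    using norm_arg_ge_upper_half_plane(1)[OF w(1,2), of t u] that by simp
  show "Re (w1 * w2 * exp (complex_of_real t)) \<le> norm (w1 * w2)" for t
    by (rule Re_mult_exp_of_real_le[OF w(3)])
qed (simp_all add: sinh_of_real_not_nonpos)

lemma open_Im_pos: "open {w. Im w > 0}" and open_Re_mult_neg: "open {w. Re (w1 * w) < 0}"
  by (intro open_Collect_less continuous_intros)+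

lemma holomorphic_on_kern_line_integral:
  assumes c: "Re c > 0" and \<alpha>: "Re \<alpha> > 0" and w1: "Im w1 > 0"
  shows "(\<lambda>w. LINT t|posm. kern c \<alpha> w1 w (of_real t)) holomorphic_on {w. Im w > 0} \<inter> {w. Re (w1 * w) < 0}"
proof -
  let ?U = "{w. Im w > 0} \<inter> {w. Re (w1 * w) < 0}"
  let ?D = "\<lambda>w. norm (w1 + w) * min (Im (w1 + w)) (2 * Im (w1 * w / (w1 + w))) / 2"
  have "(\<lambda>w. LINT t|posm. 1 * kern c \<alpha> w1 w (of_real t)) holomorphic_on ?U"
  proof (rule holomorphic_on_kern_path_integral[OF c \<alpha>, where D = ?D])
    show "open ?U" by (intro open_Int open_Im_pos open_Re_mult_neg)
    show "w1 \<noteq> 0" "0 \<notin> ?U" using w1 by auto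
    have "w1 + w \<noteq> 0" if "w \<in> ?U" for w using that w1 by (auto simp: complex_eq_iff)
    then show "continuous_on ?U ?D" by (intro continuous_intros) auto
    show "?D w > 0" if "w \<in> ?U" for w using upper_half_dist_pos[OF w1, of w] that by simp
    show "continuous_on {0<..} complex_of_real" by (intro continuous_intros)
    show "integrable posm (\<lambda>t. norm (1::complex) * exp (- (Re c * Re (complex_of_real t))))"
      using integrable_exp_posm[OF c] by simp
    show "?D w * exp (Re (complex_of_real t))
       \<le> norm (kern_arg w1 w (complex_of_real t) + complex_of_real u)" if "w \<in> ?U" "t > 0" "u \<ge> 0" for w t u
      using norm_arg_ge_upper_half_plane(1)[OF w1, of w t u] that by simp
    show "Re (w1 * w * exp (complex_of_real t)) \<le> norm (w1 * w)" if "w \<in> ?U" for w t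
      by (rule Re_mult_exp_of_real_le) (use that in simp)
  qed (simp_all add: sinh_of_real_not_nonpos)
  then show ?thesis by simp
qed

lemma imaginary_axis_islimpt: "\<i> islimpt {\<i> * of_real y |y. y > 0}"
proof (rule islimptI)
  fix T :: "complex set" assume T: "\<i> \<in> T" "open T"
  then obtain e where e: "e > 0" "ball \<i> e \<subseteq> T" using open_contains_ball by blast
  have "\<i> * of_real (1 + e/2) \<in> ball \<i> e" using e by (simp add: dist_norm algebra_simps norm_mult)
  then show "\<exists>y\<in>{\<i> * of_real y |y. y > 0}. y \<in> T \<and> y \<noteq> \<i>"
    using e by (intro bexI[of _ "\<i> * of_real (1 + e/2)"]) (auto intro!: exI[of _ "1 + e/2"] simp: complex_eq_iff)
qed

text \<open>For v in the upper half-plane the set of admissible w is an intersection of two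
  half-planes, hence connected, and it contains the whole positive imaginary axis because Re (v * i
  y) = - y Im v. So each variable in turn can be continued from the axis, and the symmetry of f lets
  one argument do both.\<close>

lemma tricomi_product_line:
  assumes c: "Re c > 0" and \<alpha>: "Re \<alpha> > 0" and w: "Im w1 > 0" "Im w2 > 0" "Re (w1 * w2) < 0"
  shows "tricomi c (\<alpha> + c) (- (w1\<^sup>2)) * tricomi c (\<alpha> + c) (- (w2\<^sup>2)) =
    2 * of_real (sqrt pi) * (LINT t|posm. kern c \<alpha> w1 w2 (of_real t))"
proof -
  let ?I = "{\<i> * complex_of_real y |y. y > 0}"
  define f where "f = (\<lambda>v w. tricomi c (\<alpha> + c) (- (v\<^sup>2)) * tricomi c (\<alpha> + c) (- (w\<^sup>2)) -
    2 * of_real (sqrt pi) * (LINT t|posm. kern c \<alpha> v w (of_real t)))"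
  have comm: "f v w = f w v" for v w
    unfolding f_def by (simp only: kern_commute[of c \<alpha> v w] mult.commute)
  have cont: "f v w = 0" if v: "Im v > 0" and ax: "\<And>y. y \<in> ?I \<Longrightarrow> f v y = 0" and w: "Im w > 0" "Re (v * w) < 0" for v w
  proof (rule analytic_continuation[of "f v"])
    let ?U = "{w. Im w > 0} \<inter> {w. Re (v * w) < 0}"
    show "f v holomorphic_on ?U" unfolding f_def
      by (intro holomorphic_intros holomorphic_on_kern_line_integral[OF c \<alpha> v] holomorphic_on_tricomi_minus_square[OF c \<alpha>]) auto
    show "open ?U" by (intro open_Int open_Im_pos open_Re_mult_neg)
    have "convex {w. Im w > 0}" by (rule convex_halfspace_Im_gt)
    moreover have "{w. Re (v * w) < 0} = {w. inner (cnj v) w < 0}" by (simp add: inner_complex_def)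
    then have "convex {w. Re (v * w) < 0}" by (simp only: convex_halfspace_lt)
    ultimately show "connected ?U" by (intro convex_connected convex_Int)
    show "?I \<subseteq> ?U" using v by auto
    show "\<i> \<in> ?U" using v by simp
    show "\<i> islimpt ?I" by (rule imaginary_axis_islimpt)
    show "w \<in> ?U" using w by simp
  qed (rule ax)
  have base: "f (\<i> * of_real x) (\<i> * of_real y) = 0" if "x > 0" "y > 0" for x y
    using tricomi_product_base[OF c \<alpha>, of "x\<^sup>2" "y\<^sup>2"] that unfolding f_def by (simp add: power_mult_distrib)
  have 1: "f v y = 0" if y: "y \<in> ?I" and v: "Im v > 0" for v y
  proof -
    obtain x where x: "x > 0" "y = \<i> * of_real x" using y by blast
    have "f y v = 0"
    proof (rule cont)
      show "Im y > 0" "Re (y * v) < 0" using x v by simp_all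
      show "f y z = 0" if "z \<in> ?I" for z using that base[OF x(1)] unfolding x(2) by blast
    qed (rule v)
    then show ?thesis by (simp only: comm[of v y])
  qed
  have "f w1 w2 = 0" by (rule cont[OF w(1) 1[OF _ w(1)] w(2,3)])
  then show ?thesis unfolding f_def by simp
qed

section \<open>The closed half-strip and the path with a corner\<close>

definition half_strip :: "complex set" where
  "half_strip = {t. 0 \<le> Re t} \<inter> ({t. 0 \<le> Im t} \<inter> {t. Im t \<le> pi / 2})"

lemma mem_half_strip: "t \<in> half_strip \<longleftrightarrow> 0 \<le> Re t \<and> 0 \<le> Im t \<and> Im t \<le> pi / 2"
  by (simp add: half_strip_def)

lemma convex_half_strip: "convex half_strip"
  unfolding half_strip_def
  by (intro convex_Int convex_halfspace_Re_ge convex_halfspace_Im_ge convex_halfspace_Im_le)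

text \<open>The imaginary part cosh r sin p of sinh vanishes only on the real side, where sinh is
  positive except at 0. Hence the principal power of sinh t is analytic across the region between
  the two paths.\<close>

lemma sinh_half_strip:
  assumes "t \<in> half_strip"
  shows "sinh t \<notin> \<real>\<^sub>\<le>\<^sub>0 \<or> t = 0"
proof (rule disjCI, rule notI)
  assume nz: "t \<noteq> 0" and "sinh t \<in> \<real>\<^sub>\<le>\<^sub>0"
  define r p where "r = Re t" and "p = Im t"
  have tt: "t = Complex r p" by (simp add: r_def p_def)
  have b: "0 \<le> r" "0 \<le> p" "p \<le> pi / 2" using assms by (simp_all add: mem_half_strip r_def p_def)
  from \<open>sinh t \<in> \<real>\<^sub>\<le>\<^sub>0\<close> have h: "cosh r * sin p = 0" "sinh r * cos p \<le> 0"
    unfolding tt sinh_Complex by (simp_all add: complex_nonpos_Reals_iff)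
  from h(1) have "sin p = 0" by simp
  then have "p = 0" using b sin_gt_zero[of p] pi_gt_zero by fastforce
  then have "r = 0" using h(2) b by simp
  with \<open>p = 0\<close> nz tt show False by (simp add: complex_eq_iff)
qed

lemma corner_path: "Re (\<i> * of_real (pi / 2) + complex_of_real t) = t" "Im (\<i> * of_real (pi / 2) + complex_of_real t) = pi / 2"
  by simp_all

lemma corner_half_strip: "t \<ge> 0 \<Longrightarrow> \<i> * of_real (pi / 2) + complex_of_real t \<in> half_strip"
  by (simp add: mem_half_strip)

lemma sinh_corner: "sinh (\<i> * of_real (pi / 2) + complex_of_real t) \<notin> \<real>\<^sub>\<le>\<^sub>0" if "t > 0"
  using sinh_half_strip[OF corner_half_strip[of t]] that by (auto simp: complex_eq_iff)

lemma segment_half_strip: "closed_segment 0 (\<i> * complex_of_real (pi / 2)) \<subseteq> half_strip"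
  by (rule closed_segment_subset[OF _ _ convex_half_strip]) (simp_all add: mem_half_strip)

lemma open_quadrant: "open {w. Re w > 0 \<and> Im w > 0}"
  by (intro open_Collect_conj open_Collect_less continuous_intros)

context
  fixes w1 :: complex
  assumes w1: "Re w1 > 0" "Im w1 > 0"
begin

lemma quad_dist_pos: "Re w > 0 \<Longrightarrow> Im w > 0 \<Longrightarrow> quad_dist w1 w > 0"
  using w1 unfolding quad_dist_def by (intro mult_pos_pos) (auto simp: complex_eq_iff)

lemma continuous_on_quad_dist: "continuous_on S (quad_dist w1)"
  unfolding quad_dist_def by (intro continuous_intros)

lemma kern_arg_half_strip:
  assumes w: "Re w > 0" "Im w > 0" and t: "t \<in> half_strip"
  shows "kern_arg w1 w t \<notin> \<real>\<^sub>\<le>\<^sub>0"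
proof (rule not_nonpos_Reals_of_norm_add_ge)
  show "quad_dist w1 w * exp (Re t) \<le> norm (kern_arg w1 w t + complex_of_real u)" if "u \<ge> 0" for u
    using norm_arg_ge_quadrant[OF w1 w _ _ _ that, of t] t by (simp add: mem_half_strip)
  show "quad_dist w1 w * exp (Re t) > 0" using quad_dist_pos[OF w] by simp
qed

lemma Im_mult_pos: "Re w > 0 \<Longrightarrow> Im w > 0 \<Longrightarrow> Im (w1 * w) > 0"
  using w1 by (simp add: add_pos_pos)

text \<open>Shifting t by i pi / 2 multiplies e^t by i, so the real part of s e^t becomes - Im s
  e^t, and Im s > 0 in the first quadrant whatever the sign of Re s.\<close>

lemma corner_growth:
  assumes w: "Re w > 0" "Im w > 0"
  shows "Re (w1 * w * exp (\<i> * of_real (pi / 2) + of_real t)) \<le> norm (w1 * w)"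
proof -
  have "exp (\<i> * of_real (pi / 2) + complex_of_real t) = \<i> * of_real (exp t)"
    unfolding exp_add cis_conv_exp[symmetric] cis_pi_half exp_of_real ..
  then have "Re (w1 * w * exp (\<i> * of_real (pi / 2) + of_real t)) = - (Im (w1 * w) * exp t)" by (simp add: algebra_simps)
  also have "\<dots> \<le> 0" using Im_mult_pos[OF w] by simp
  also have "0 \<le> norm (w1 * w)" by simp
  finally show ?thesis .
qed

end

context
  fixes c \<alpha> w1 :: complex
  assumes c: "Re c > 0" and \<alpha>: "Re \<alpha> > 0" and w1: "Re w1 > 0" "Im w1 > 0"
begin

lemma continuous_on_kern_half_strip:
  assumes w: "Re w > 0" "Im w > 0"
  shows "continuous_on half_strip (kern c \<alpha> w1 w)"
proof (rule continuous_on_kern[OF c \<alpha> continuous_on_id])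
  show "sinh t \<notin> \<real>\<^sub>\<le>\<^sub>0 \<or> sinh t = 0" if "t \<in> half_strip" for t
    using sinh_half_strip[OF that] by auto
qed (rule kern_arg_half_strip[OF w1 w])

text \<open>Cauchy's theorem in the form of a primitive on a convex set: analyticity in the interior
  and continuity up to the boundary suffice, so the branch point of the power at 0 does no
  harm.\<close>

lemma kern_half_strip_primitive:
  assumes w: "Re w > 0" "Im w > 0"
  obtains g where "\<And>t. t \<in> half_strip \<Longrightarrow> (g has_field_derivative kern c \<alpha> w1 w t) (at t within half_strip)"
proof (rule holomorphic_convex_primitive[OF convex_half_strip _ continuous_on_kern_half_strip[OF w], of "{0}"])
  fix t assume t: "t \<in> interior half_strip - {0}"
  have "(\<lambda>t. kern c \<alpha> w1 w t) holomorphic_on interior half_strip - {0}"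
  proof (rule holomorphic_on_kern[OF c \<alpha>])
    fix t assume "t \<in> interior half_strip - {0}"
    then have t: "t \<in> half_strip" "t \<noteq> 0" using interior_subset by auto
    show "kern_arg w1 w t \<notin> \<real>\<^sub>\<le>\<^sub>0" by (rule kern_arg_half_strip[OF w1 w t(1)])
    show "sinh t \<notin> \<real>\<^sub>\<le>\<^sub>0" using sinh_half_strip[OF t(1)] t(2) by simp
  qed (intro holomorphic_intros)+
  then show "kern c \<alpha> w1 w field_differentiable at t"
    by (rule holomorphic_on_imp_differentiable_at) (use t in auto)
qed auto

definition corner_integral :: "complex \<Rightarrow> complex" where
  "corner_integral w = contour_integral (linepath 0 (\<i> * of_real (pi / 2))) (kern c \<alpha> w1 w) +
     (LINT t|posm. kern c \<alpha> w1 w (\<i> * of_real (pi / 2) + of_real t))"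

lemma integrable_kern_corner:
  assumes w: "Re w > 0" "Im w > 0"
  shows "integrable posm (\<lambda>t. kern c \<alpha> w1 w (\<i> * of_real (pi / 2) + of_real t))"
proof (rule integrable_kern_path[OF c \<alpha> _ _ quad_dist_pos[OF w1 w]])
  show "w1 \<noteq> 0" "w \<noteq> 0" using w w1 by auto
  show "continuous_on {0<..} (\<lambda>t. \<i> * of_real (pi / 2) + complex_of_real t)" by (intro continuous_intros)
  show "quad_dist w1 w * exp (Re (\<i> * of_real (pi / 2) + complex_of_real t))
     \<le> norm (kern_arg w1 w (\<i> * of_real (pi / 2) + complex_of_real t) + complex_of_real u)" if "t > 0" "u \<ge> 0" for t u
    by (rule norm_arg_ge_quadrant[OF w1 w]) (unfold corner_path, use that in simp_all)
  show "Re (w1 * w * exp (\<i> * of_real (pi / 2) + of_real t)) \<le> norm (w1 * w)" for t by (rule corner_growth[OF w1 w])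
  show "sinh (\<i> * of_real (pi / 2) + complex_of_real t) \<notin> \<real>\<^sub>\<le>\<^sub>0" if "t > 0" for t by (rule sinh_corner[OF that])
qed (rule corner_path)

text \<open>Each half-line integral is the limit of the primitive minus its value at the starting
  point, and the segment accounts for the difference of these values. It remains to see that the
  primitive has the same limit along both half-lines.\<close>

lemma corner_integral_eq_line:
  assumes w: "Re w > 0" "Im w > 0" and s: "Re (w1 * w) \<le> 0"
  shows "corner_integral w = (LINT t|posm. kern c \<alpha> w1 w (of_real t))"
proof -
  let ?k = "kern c \<alpha> w1 w" and ?\<omega> = "\<i> * complex_of_real (pi / 2)"
  obtain g where g: "\<And>t. t \<in> half_strip \<Longrightarrow> (g has_field_derivative ?k t) (at t within half_strip)"
    using kern_half_strip_primitive[OF w] by blast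
  have vd: "((\<lambda>t. g (z + of_real t)) has_vector_derivative ?k (z + of_real t)) (at t within {0..})"
    if z: "\<And>t. t \<ge> 0 \<Longrightarrow> z + of_real t \<in> half_strip" and t: "t \<ge> 0" for z t
  proof -
    have "((\<lambda>t. z + complex_of_real t) has_vector_derivative 1) (at t within {0..})"
      by (auto intro!: derivative_eq_intros)
    moreover have "(g has_field_derivative ?k (z + of_real t)) (at (z + of_real t) within (\<lambda>t. z + complex_of_real t) ` {0..})"
      by (rule DERIV_subset[OF g[OF z[OF t]]]) (use z in auto)
    ultimately have "(g \<circ> (\<lambda>t. z + complex_of_real t) has_vector_derivative 1 * ?k (z + of_real t)) (at t within {0..})"
      by (rule field_vector_diff_chain_within)
    then show ?thesis by (simp add: comp_def)
  qed
  have int0: "integrable posm (\<lambda>t. ?k (0 + of_real t))"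
    using integrable_kern_line[OF c \<alpha> w1(2) w(2) s] by simp
  have L0: "((\<lambda>t. g (0 + of_real t)) \<longlongrightarrow> g (0 + of_real 0) + (LINT t|posm. ?k (0 + of_real t))) at_top"
    by (rule tendsto_primitive_posm[OF int0]) (rule vd, simp_all add: mem_half_strip)
  have L1: "((\<lambda>t. g (?\<omega> + of_real t)) \<longlongrightarrow> g (?\<omega> + of_real 0) + (LINT t|posm. ?k (?\<omega> + of_real t))) at_top"
    by (rule tendsto_primitive_posm[OF integrable_kern_corner[OF w]]) (rule vd[OF corner_half_strip])
  obtain C where C: "\<And>w1 w2 t \<delta>. \<delta> > 0 \<Longrightarrow> w1 \<noteq> 0 \<Longrightarrow> w2 \<noteq> 0 \<Longrightarrow> Re t \<ge> 0 \<Longrightarrow>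
     (\<forall>u\<ge>0. norm (kern_arg w1 w2 t + complex_of_real u) \<ge> \<delta> * exp (Re t)) \<Longrightarrow>
     Re (w1 * w2 * exp t) \<le> norm (w1 * w2) \<Longrightarrow>
     norm (kern c \<alpha> w1 w2 t) \<le> C * (\<delta> powr (- (Re \<alpha> + Re c)) * norm (w1 * w2) powr (- Re \<alpha>) * exp (norm (w1 * w2))) * exp (- (Re c * Re t))"
    using kern_bound[OF c \<alpha>] by blast
  define B where "B = C * (quad_dist w1 w powr (- (Re \<alpha> + Re c)) * norm (w1 * w) powr (- Re \<alpha>) * exp (norm (w1 * w)))"
  have b: "norm (?k t) \<le> B * exp (- (Re c * Re t))" if t: "t \<in> half_strip" for t
  proof -
    have tt: "Re t \<ge> 0" "0 \<le> Im t" "Im t \<le> pi / 2" using t by (simp_all add: mem_half_strip)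
    have cs: "cos (Im t) \<ge> 0" "sin (Im t) \<ge> 0" using tt by (auto intro!: cos_ge_zero sin_ge_zero)
    \<comment> \<open>With Re s \<le> 0 and Im s > 0, both terms are nonpositive for phases of e^t
      in [0, pi/2], so the kernel decays on the whole half-strip and not only on its two
      sides.\<close>
    have "Re (w1 * w * exp t) = exp (Re t) * (Re (w1 * w) * cos (Im t) - Im (w1 * w) * sin (Im t))"
      by (simp add: Re_exp Im_exp algebra_simps)
    also have "\<dots> \<le> 0"
    proof (rule mult_nonneg_nonpos)
      have "Re (w1 * w) * cos (Im t) \<le> 0" by (rule mult_nonpos_nonneg[OF s cs(1)])
      moreover have "Im (w1 * w) * sin (Im t) \<ge> 0" by (rule mult_nonneg_nonneg[OF less_imp_le[OF Im_mult_pos[OF w1 w]] cs(2)])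
      ultimately show "Re (w1 * w) * cos (Im t) - Im (w1 * w) * sin (Im t) \<le> 0" by linarith
    qed simp
    also have "0 \<le> norm (w1 * w)" by simp
    finally have grow: "Re (w1 * w * exp t) \<le> norm (w1 * w)" .
    have nz: "w1 \<noteq> 0" "w \<noteq> 0" using w w1 by auto
    show ?thesis unfolding B_def
      by (rule C[OF quad_dist_pos[OF w1 w] nz tt(1) _ grow]) (intro allI impI norm_arg_ge_quadrant[OF w1 w tt])
  qed
  \<comment> \<open>The vertical side at real part t has length pi/2, and the kernel on it is at
    most B e^(- Re c t).\<close>
  have diff: "norm (g (?\<omega> + of_real t) - g (0 + of_real t)) \<le> B * exp (- (Re c * t)) * (pi / 2)" if t: "t \<ge> 0" for t
  proof -
    let ?T = "half_strip \<inter> {x. Re x = t}"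
    have "norm (g (?\<omega> + of_real t) - g (0 + of_real t)) \<le> B * exp (- (Re c * t)) * norm ((?\<omega> + of_real t) - (0 + of_real t))"
    proof (rule field_differentiable_bound[where S = ?T and f = g and f' = ?k])
      have "{x. Re x = t} = {x. inner 1 x = t}" by (simp add: inner_complex_def)
      then have "convex {x. Re x = t}" by (simp only: convex_hyperplane)
      then show "convex ?T" by (intro convex_Int convex_half_strip)
      show "(g has_field_derivative ?k x) (at x within ?T)" if "x \<in> ?T" for x
        by (rule DERIV_subset[OF g]) (use that in auto)
      show "norm (?k x) \<le> B * exp (- (Re c * t))" if "x \<in> ?T" for x using b[of x] that by auto
      show "?\<omega> + of_real t \<in> ?T" "0 + of_real t \<in> ?T" using t by (simp_all add: mem_half_strip)
    qed
    also have "norm ((?\<omega> + of_real t) - (0 + complex_of_real t)) = pi / 2" by (simp add: norm_mult)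
    finally show ?thesis .
  qed
  have "((\<lambda>t. B * exp (- (Re c * t)) * (pi / 2)) \<longlongrightarrow> 0) at_top"
    using c by real_asymp
  moreover have "eventually (\<lambda>t. norm (g (?\<omega> + of_real t) - g (0 + of_real t)) \<le> B * exp (- (Re c * t)) * (pi / 2)) at_top"
    using eventually_ge_at_top[of 0] by eventually_elim (rule diff)
  ultimately have "((\<lambda>t. g (?\<omega> + of_real t) - g (0 + of_real t)) \<longlongrightarrow> 0) at_top"
    by (rule Lim_null_comparison[rotated])
  from tendsto_unique[OF _ tendsto_diff[OF L1 L0] this]
  have eq: "g ?\<omega> - g 0 + (LINT t|posm. ?k (?\<omega> + of_real t)) = (LINT t|posm. ?k (of_real t))"
    by (simp add: algebra_simps)
  have seg: "closed_segment 0 ?\<omega> \<subseteq> half_strip"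
    by (rule closed_segment_subset[OF _ _ convex_half_strip]) (simp_all add: mem_half_strip)
  have "(?k has_contour_integral g (pathfinish (linepath 0 ?\<omega>)) - g (pathstart (linepath 0 ?\<omega>))) (linepath 0 ?\<omega>)"
    by (rule contour_integral_primitive[OF g valid_path_linepath]) (use seg in auto)
  then have "contour_integral (linepath 0 ?\<omega>) ?k = g ?\<omega> - g 0" by (simp add: contour_integral_unique)
  with eq show ?thesis unfolding corner_integral_def by simp
qed

text \<open>Written over the half-line so that \<open>holomorphic_on_kern_path_integral\<close>
  applies. Beyond t = 1 the indicator removes the integrand, and min t 1 keeps the point on the
  segment, where the geometric hypotheses hold.\<close>

lemma contour_integral_kern_segment:
  assumes w: "Re w > 0" "Im w > 0"
  shows "contour_integral (linepath 0 (\<i> * of_real (pi / 2))) (kern c \<alpha> w1 w) =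
    (LINT t|posm. (indicator {..1} t * (\<i> * of_real (pi / 2))) * kern c \<alpha> w1 w (\<i> * of_real (min t 1 * (pi / 2))))"
proof -
  let ?k = "kern c \<alpha> w1 w" and ?\<omega> = "\<i> * complex_of_real (pi / 2)"
  let ?h = "\<lambda>t. ?k (linepath 0 ?\<omega> t) * (?\<omega> - 0)"
  have ck: "continuous_on (closed_segment 0 ?\<omega>) ?k"
    by (rule continuous_on_subset[OF continuous_on_kern_half_strip[OF w] segment_half_strip])
  have "continuous_on {0..1} (\<lambda>t. ?k (linepath 0 ?\<omega> t))"
    by (rule continuous_on_compose2[OF ck continuous_on_linepath]) (simp only: linepath_image_01 order_refl)
  then have "continuous_on {0..1} ?h" by (intro continuous_on_mult continuous_on_const)
  then have "set_integrable lborel {0..1} ?h" by (rule borel_integrable_atLeastAtMost')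
  then have si: "set_integrable lborel {0<..1} ?h" by (rule set_integrable_subset) auto
  have "(?k has_contour_integral contour_integral (linepath 0 ?\<omega>) ?k) (linepath 0 ?\<omega>)"
    by (rule has_contour_integral_integral[OF contour_integrable_continuous_linepath[OF ck]])
  then have "(?h has_integral contour_integral (linepath 0 ?\<omega>) ?k) {0..1}"
    unfolding has_contour_integral_linepath .
  from integral_posm_indicator[OF si this]
  have "contour_integral (linepath 0 ?\<omega>) ?k = (LINT t|posm. indicator {..1} t * ?h t)" by (rule sym)
  also have "\<dots> = (LINT t|posm. (indicator {..1} t * ?\<omega>) * ?k (\<i> * of_real (min t 1 * (pi / 2))))"
  proof (rule Bochner_Integration.integral_cong[OF refl])
    fix t :: real
    show "indicator {..1} t * ?h t = (indicator {..1} t * ?\<omega>) * ?k (\<i> * of_real (min t 1 * (pi / 2)))"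
    proof (cases "t \<le> 1")
      case True
      then have "linepath 0 ?\<omega> t = \<i> * of_real (min t 1 * (pi / 2))"
        by (simp add: linepath_def scaleR_conv_of_real)
      then show ?thesis by (simp only: mult_ac diff_zero)
    qed simp
  qed
  finally show ?thesis .
qed

lemma holomorphic_on_corner_integral: "corner_integral holomorphic_on {w. Re w > 0 \<and> Im w > 0}"
proof -
  let ?Q = "{w. Re w > 0 \<and> Im w > 0}" and ?\<omega> = "\<i> * complex_of_real (pi / 2)"
  have w10: "w1 \<noteq> 0" using w1 by auto
  have "(\<lambda>w. LINT t|posm. (indicator {..1} t * ?\<omega>) * kern c \<alpha> w1 w (\<i> * of_real (min t 1 * (pi / 2)))) holomorphic_on ?Q"
  proof (rule holomorphic_on_kern_path_integral[OF c \<alpha> open_quadrant w10, where D = "quad_dist w1"])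
    have mem: "\<i> * of_real (min t 1 * (pi / 2)) \<in> half_strip" if "t > 0" for t
      using that by (simp add: mem_half_strip)
    show "continuous_on ?Q (quad_dist w1)" by (rule continuous_on_quad_dist[OF w1])
    show "quad_dist w1 w > 0" if "w \<in> ?Q" for w using quad_dist_pos[OF w1] that by simp
    show "continuous_on {0<..} (\<lambda>t. \<i> * complex_of_real (min t 1 * (pi / 2)))" by (intro continuous_intros)
    show "sinh (\<i> * complex_of_real (min t 1 * (pi / 2))) \<notin> \<real>\<^sub>\<le>\<^sub>0" if "t > 0" for t
      using sinh_half_strip[OF mem[OF that]] that by (auto simp: complex_eq_iff)
    show im: "(\<lambda>t. indicator {..1} t * ?\<omega>) \<in> borel_measurable posm"
      by (intro borel_measurable_times borel_measurable_const measurable_compose[OF measurable_ident_posm borel_measurable_indicator]) simp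
    have "set_integrable lborel {0..1::real} (\<lambda>t. pi / 2)"
      by (rule borel_integrable_atLeastAtMost') (rule continuous_on_const)
    then have "set_integrable lborel {0<..1::real} (\<lambda>t. pi / 2)" by (rule set_integrable_subset) auto
    then have "integrable lborel (\<lambda>t. indicator {0<..1::real} t *\<^sub>R (pi / 2 :: real))" unfolding set_integrable_def .
    also have "?this \<longleftrightarrow> integrable lborel (\<lambda>t. indicator {0<..} t *\<^sub>R (norm (indicator {..1} t * ?\<omega>) * exp (- (Re c * Re (\<i> * complex_of_real (min t 1 * (pi / 2)))))))"
      by (rule Bochner_Integration.integrable_cong) (auto simp: indicator_def norm_mult)
    finally show "integrable posm (\<lambda>t. norm (indicator {..1} t * ?\<omega>) * exp (- (Re c * Re (\<i> * complex_of_real (min t 1 * (pi / 2))))))"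
      unfolding integrable_posm set_integrable_def .
    show "quad_dist w1 w * exp (Re (\<i> * complex_of_real (min t 1 * (pi / 2))))
       \<le> norm (kern_arg w1 w (\<i> * complex_of_real (min t 1 * (pi / 2))) + complex_of_real u)" if "w \<in> ?Q" "t > 0" "u \<ge> 0" for w t u
      using norm_arg_ge_quadrant[OF w1, of w "\<i> * of_real (min t 1 * (pi / 2))" u] mem[OF that(2)] that unfolding mem_half_strip by blast
    \<comment> \<open>On the segment e^t has norm 1, so the growth condition holds for every
      w.\<close>
    show "Re (w1 * w * exp (\<i> * complex_of_real (min t 1 * (pi / 2)))) \<le> norm (w1 * w)" for w t
    proof -
      have "Re (w1 * w * exp (\<i> * complex_of_real (min t 1 * (pi / 2)))) \<le> norm (w1 * w * exp (\<i> * complex_of_real (min t 1 * (pi / 2))))"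
        by (rule complex_Re_le_cmod)
      also have "\<dots> = norm (w1 * w)" unfolding norm_mult norm_exp_i_times by simp
      finally show ?thesis .
    qed
  qed simp_all
  moreover have "(\<lambda>w. LINT t|posm. 1 * kern c \<alpha> w1 w (?\<omega> + of_real t)) holomorphic_on ?Q"
  proof (rule holomorphic_on_kern_path_integral[OF c \<alpha> open_quadrant w10, where D = "quad_dist w1"])
    show "continuous_on ?Q (quad_dist w1)" by (rule continuous_on_quad_dist[OF w1])
    show "quad_dist w1 w > 0" if "w \<in> ?Q" for w using quad_dist_pos[OF w1] that by simp
    show "continuous_on {0<..} (\<lambda>t. ?\<omega> + complex_of_real t)" by (intro continuous_intros)
    show "sinh (?\<omega> + complex_of_real t) \<notin> \<real>\<^sub>\<le>\<^sub>0" if "t > 0" for t by (rule sinh_corner[OF that])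
    show "integrable posm (\<lambda>t. norm (1::complex) * exp (- (Re c * Re (?\<omega> + complex_of_real t))))"
      unfolding corner_path using integrable_exp_posm[OF c] by simp
    show "quad_dist w1 w * exp (Re (?\<omega> + complex_of_real t))
       \<le> norm (kern_arg w1 w (?\<omega> + complex_of_real t) + complex_of_real u)" if "w \<in> ?Q" "t > 0" "u \<ge> 0" for w t u
      by (rule norm_arg_ge_quadrant[OF w1]) (unfold corner_path, use that in simp_all)
    show "Re (w1 * w * exp (?\<omega> + of_real t)) \<le> norm (w1 * w)" if "w \<in> ?Q" for w t
      by (rule corner_growth[OF w1]) (use that in simp_all)
  qed simp_all
  ultimately have "(\<lambda>w. (LINT t|posm. (indicator {..1} t * ?\<omega>) * kern c \<alpha> w1 w (\<i> * of_real (min t 1 * (pi / 2)))) +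
      (LINT t|posm. 1 * kern c \<alpha> w1 w (?\<omega> + of_real t))) holomorphic_on ?Q"
    by (rule holomorphic_on_add)
  then show ?thesis
  proof (rule holomorphic_transform)
    fix w assume "w \<in> ?Q"
    then have "Re w > 0" "Im w > 0" by simp_all
    from contour_integral_kern_segment[OF this]
    show "(LINT t|posm. (indicator {..1} t * ?\<omega>) * kern c \<alpha> w1 w (\<i> * of_real (min t 1 * (pi / 2)))) +
      (LINT t|posm. 1 * kern c \<alpha> w1 w (?\<omega> + of_real t)) = corner_integral w"
      unfolding corner_integral_def by simp
  qed
qed

text \<open>The corner integral is analytic in the whole quadrant and equals the integral over the
  half-line where Re (w1 w) < 0. The known formula on that nonempty open part extends by the
  identity theorem.\<close>

lemma tricomi_product_corner:
  assumes w: "Re w > 0" "Im w > 0"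
  shows "tricomi c (\<alpha> + c) (- (w1\<^sup>2)) * tricomi c (\<alpha> + c) (- (w\<^sup>2)) = 2 * of_real (sqrt pi) * corner_integral w"
proof (rule analytic_continuation_open[where f = "\<lambda>w. tricomi c (\<alpha> + c) (- (w1\<^sup>2)) * tricomi c (\<alpha> + c) (- (w\<^sup>2))"
      and g = "\<lambda>w. 2 * of_real (sqrt pi) * corner_integral w" and s' = "{w. Re w > 0 \<and> Im w > 0}"
      and s = "{w. Re w > 0 \<and> Im w > 0} \<inter> {w. Re (w1 * w) < 0}"])
  show "open ({w. Re w > 0 \<and> Im w > 0} \<inter> {w. Re (w1 * w) < 0})"
    by (intro open_Int open_quadrant open_Re_mult_neg)
  show "open {w. Re w > 0 \<and> Im w > 0}" by (rule open_quadrant)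
  \<comment> \<open>The point i * cnj w1 has product i |w1|^2 with w1, exactly on the boundary.
    Halving its real part makes the real part of the product negative.\<close>
  have "Complex (Im w1 / 2) (Re w1) \<in> {w. Re w > 0 \<and> Im w > 0} \<inter> {w. Re (w1 * w) < 0}"
    using w1 by simp
  then show "{w. Re w > 0 \<and> Im w > 0} \<inter> {w. Re (w1 * w) < 0} \<noteq> {}" by blast
  have "{w. Re w > 0 \<and> Im w > 0} = {w. Re w > 0} \<inter> {w. Im w > 0}" by auto
  then show "connected {w. Re w > 0 \<and> Im w > 0}"
    by (simp only: convex_connected convex_Int convex_halfspace_Re_gt convex_halfspace_Im_gt)
  show "(\<lambda>w. tricomi c (\<alpha> + c) (- (w1\<^sup>2)) * tricomi c (\<alpha> + c) (- (w\<^sup>2))) holomorphic_on {w. Re w > 0 \<and> Im w > 0}"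
    by (intro holomorphic_intros holomorphic_on_tricomi_minus_square[OF c \<alpha>]) simp
  show "(\<lambda>w. 2 * of_real (sqrt pi) * corner_integral w) holomorphic_on {w. Re w > 0 \<and> Im w > 0}"
    by (intro holomorphic_intros holomorphic_on_corner_integral)
  fix z assume "z \<in> {w. Re w > 0 \<and> Im w > 0} \<inter> {w. Re (w1 * w) < 0}"
  then have z: "Re z > 0" "Im z > 0" "Re (w1 * z) < 0" by simp_all
  show "tricomi c (\<alpha> + c) (- (w1\<^sup>2)) * tricomi c (\<alpha> + c) (- (z\<^sup>2)) = 2 * of_real (sqrt pi) * corner_integral z"
    unfolding corner_integral_eq_line[OF z(1,2) less_imp_le[OF z(3)]]
    by (rule tricomi_product_line[OF c \<alpha> w1(2) z(2,3)])
qed (use w in auto)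

end

section \<open>Reflection in the imaginary axis\<close>

lemma tricomi_cnj:
  assumes "w \<notin> \<real>\<^sub>\<le>\<^sub>0"
  shows "cnj (tricomi c a w) = tricomi (cnj c) (cnj a) (cnj w)"
proof -
  have "cnj (of_real t powr (c - 1) * exp (- of_real t) * (w + of_real t) powr (- a)) =
     of_real t powr (cnj c - 1) * exp (- of_real t) * (cnj w + of_real t) powr (- cnj a)" if "t \<in> space posm" for t
  proof -
    have t: "t > 0" using that by simp
    then have "w + of_real t \<notin> \<real>\<^sub>\<le>\<^sub>0" using assms by (intro add_of_real_not_nonpos_Reals) simp_all
    then have "cnj ((w + of_real t) powr (- a)) = (cnj w + of_real t) powr (- cnj a)"
      by (subst cnj_powr) (auto simp: complex_nonpos_Reals_iff)
    moreover have "cnj (complex_of_real t powr (c - 1)) = of_real t powr (cnj c - 1)"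
      using t by (subst cnj_powr) auto
    ultimately show ?thesis by (simp add: exp_cnj)
  qed
  then show ?thesis unfolding tricomi_def Bochner_Integration.integral_cnj[symmetric]
    by (intro Bochner_Integration.integral_cong refl)
qed

lemma bes_cnj:
  assumes "Re \<alpha> > 0"
  shows "cnj (bes \<alpha> x) = bes (cnj \<alpha>) (cnj x)"
proof -
  have "(\<lambda>k. cnj (rGamma (\<alpha> + 1/2 + of_nat k) / (fact k * 4 ^ k) * (x\<^sup>2) ^ k)) sums cnj (bes \<alpha> x)"
    using bes_sums[OF assms] by (simp only: sums_cnj)
  then have "(\<lambda>k. rGamma (cnj \<alpha> + 1/2 + of_nat k) / (fact k * 4 ^ k) * ((cnj x)\<^sup>2) ^ k) sums cnj (bes \<alpha> x)"
    by (simp add: cnj_rGamma)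
  moreover have "Re (cnj \<alpha>) > 0" using assms by simp
  ultimately show ?thesis using bes_sums sums_unique2 by blast
qed

lemma cosh_cnj: "cnj (cosh z) = cosh (cnj z)" and sinh_cnj: "cnj (sinh z) = sinh (cnj z)"
  by (simp_all add: cosh_field_def sinh_field_def exp_cnj)

lemma kern_cnj:
  assumes \<alpha>: "Re \<alpha> > 0" and Z: "kern_arg w1 w2 t \<notin> \<real>\<^sub>\<le>\<^sub>0"
    and sh: "sinh t \<notin> \<real>\<^sub>\<le>\<^sub>0 \<or> sinh t = 0"
  shows "cnj (kern c \<alpha> w1 w2 t) = kern (cnj c) (cnj \<alpha>) (cnj w1) (cnj w2) (cnj t)"
proof -
  have "cnj (sinh t powr (2 * \<alpha>)) = sinh (cnj t) powr (2 * cnj \<alpha>)"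
  proof (cases "sinh t = 0")
    case True
    then have "sinh (cnj t) = 0" unfolding sinh_cnj[symmetric] by simp
    with True show ?thesis by simp
  next
    case False
    with sh have "sinh t \<notin> \<real>\<^sub>\<le>\<^sub>0" by simp
    then show ?thesis unfolding sinh_cnj[symmetric]
      by (subst cnj_powr) (auto simp: complex_nonpos_Reals_iff)
  qed
  then show ?thesis unfolding kern_def complex_cnj_mult tricomi_cnj[OF Z] bes_cnj[OF \<alpha>] exp_cnj
    by (simp add: cosh_cnj sinh_cnj)
qed

text \<open>The map w to - cnj w is reflection in the imaginary axis and exchanges the two upper
  quadrants. It conjugates w1^2, w2^2 and w1 w2, since the signs cancel, and the kernel depends on
  nothing else.\<close>

lemma kern_mirror:
  assumes \<alpha>: "Re \<alpha> > 0" and w: "Re w1 < 0" "Im w1 > 0" "Re w2 < 0" "Im w2 > 0" and t: "t \<in> half_strip"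
  shows "kern c \<alpha> w1 w2 (cnj t) = cnj (kern (cnj c) (cnj \<alpha>) (- cnj w1) (- cnj w2) t)"
proof -
  let ?v1 = "- cnj w1" and ?v2 = "- cnj w2"
  have "kern_arg ?v1 ?v2 t \<notin> \<real>\<^sub>\<le>\<^sub>0"
    by (rule kern_arg_half_strip) (use w t in simp_all)
  moreover have "sinh t \<notin> \<real>\<^sub>\<le>\<^sub>0 \<or> sinh t = 0" using sinh_half_strip[OF t] by auto
  moreover have "Re (cnj \<alpha>) > 0" using \<alpha> by simp
  ultimately have "cnj (kern (cnj c) (cnj \<alpha>) ?v1 ?v2 t) = kern (cnj (cnj c)) (cnj (cnj \<alpha>)) (cnj ?v1) (cnj ?v2) (cnj t)"
    by (intro kern_cnj)
  \<comment> \<open>Conjugating twice leaves - w1 and - w2, and the kernel does not change when both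
    signs are reversed.\<close>
  also have "\<dots> = kern c \<alpha> w1 w2 (cnj t)" by (simp add: kern_def)
  finally show ?thesis by (rule sym)
qed

definition corner_formula :: "complex \<Rightarrow> complex \<Rightarrow> complex \<Rightarrow> complex \<Rightarrow> complex \<Rightarrow> bool" where
  "corner_formula c \<alpha> w1 w2 \<omega> \<longleftrightarrow>
     kern c \<alpha> w1 w2 contour_integrable_on linepath 0 \<omega> \<and>
     integrable posm (\<lambda>t. kern c \<alpha> w1 w2 (\<omega> + of_real t)) \<and>
     tricomi c (\<alpha> + c) (- (w1\<^sup>2)) * tricomi c (\<alpha> + c) (- (w2\<^sup>2)) = 2 * of_real (sqrt pi) *
       (contour_integral (linepath 0 \<omega>) (kern c \<alpha> w1 w2) + (LINT t|posm. kern c \<alpha> w1 w2 (\<omega> + of_real t)))"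

lemma corner_formula_first_quadrant:
  assumes c: "Re c > 0" and \<alpha>: "Re \<alpha> > 0" and w: "Re w1 > 0" "Im w1 > 0" "Re w2 > 0" "Im w2 > 0"
  shows "corner_formula c \<alpha> w1 w2 (\<i> * of_real (pi / 2))"
  unfolding corner_formula_def
proof (intro conjI)
  show "kern c \<alpha> w1 w2 contour_integrable_on linepath 0 (\<i> * of_real (pi / 2))"
    by (rule contour_integrable_continuous_linepath,
        rule continuous_on_subset[OF continuous_on_kern_half_strip[OF c \<alpha> w] segment_half_strip])
  show "integrable posm (\<lambda>t. kern c \<alpha> w1 w2 (\<i> * of_real (pi / 2) + of_real t))"
    by (rule integrable_kern_corner[OF c \<alpha> w])
qed (rule tricomi_product_corner[OF c \<alpha> w, unfolded corner_integral_def[OF c \<alpha> w(1,2)]])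

text \<open>Reflection carries the formula over from the first quadrant and conjugates the path,
  which therefore turns at - i pi / 2.\<close>

lemma corner_formula_second_quadrant:
  assumes c: "Re c > 0" and \<alpha>: "Re \<alpha> > 0" and w: "Re w1 < 0" "Im w1 > 0" "Re w2 < 0" "Im w2 > 0"
  shows "corner_formula c \<alpha> w1 w2 (- \<i> * of_real (pi / 2))"
proof -
  let ?c = "cnj c" and ?\<alpha> = "cnj \<alpha>" and ?v1 = "- cnj w1" and ?v2 = "- cnj w2" and ?\<omega> = "\<i> * complex_of_real (pi / 2)"
  let ?k = "kern ?c ?\<alpha> ?v1 ?v2"
  have v: "Re ?v1 > 0" "Im ?v1 > 0" "Re ?v2 > 0" "Im ?v2 > 0" and ca: "Re ?c > 0" "Re ?\<alpha> > 0"
    using w c \<alpha> by simp_all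
  have I: "?k contour_integrable_on linepath 0 ?\<omega>" "integrable posm (\<lambda>t. ?k (?\<omega> + of_real t))"
    and eq: "tricomi ?c (?\<alpha> + ?c) (- (?v1\<^sup>2)) * tricomi ?c (?\<alpha> + ?c) (- (?v2\<^sup>2)) = 2 * of_real (sqrt pi) *
       (contour_integral (linepath 0 ?\<omega>) ?k + (LINT t|posm. ?k (?\<omega> + of_real t)))"
    using corner_formula_first_quadrant[OF ca v] unfolding corner_formula_def by blast+
  have w': "- \<i> * of_real (pi / 2) = cnj ?\<omega>" by simp
  have seg: "linepath 0 ?\<omega> x \<in> half_strip" if "x \<in> {0..1}" for x
    using linepath_in_path[OF that] segment_half_strip by blast
  have lp: "linepath 0 (cnj ?\<omega>) x = cnj (linepath 0 ?\<omega> x)" for x by (simp add: linepath_def)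
  have "((\<lambda>x. ?k (linepath 0 ?\<omega> x) * (?\<omega> - 0)) has_integral contour_integral (linepath 0 ?\<omega>) ?k) {0..1}"
    using has_contour_integral_integral[OF I(1)] unfolding has_contour_integral_linepath .
  then have "(cnj \<circ> (\<lambda>x. ?k (linepath 0 ?\<omega> x) * (?\<omega> - 0)) has_integral cnj (contour_integral (linepath 0 ?\<omega>) ?k)) {0..1}"
    by (simp only: has_integral_cnj)
  then have "((\<lambda>x. kern c \<alpha> w1 w2 (linepath 0 (cnj ?\<omega>) x) * (cnj ?\<omega> - 0)) has_integral cnj (contour_integral (linepath 0 ?\<omega>) ?k)) {0..1}"
  proof (rule has_integral_eq[rotated])
    fix x :: real assume "x \<in> {0..1}"
    from kern_mirror[OF \<alpha> w seg[OF this], of c]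
    show "(cnj \<circ> (\<lambda>x. ?k (linepath 0 ?\<omega> x) * (?\<omega> - 0))) x = kern c \<alpha> w1 w2 (linepath 0 (cnj ?\<omega>) x) * (cnj ?\<omega> - 0)"
      unfolding lp comp_def by simp
  qed
  then have ci: "(kern c \<alpha> w1 w2 has_contour_integral cnj (contour_integral (linepath 0 ?\<omega>) ?k)) (linepath 0 (cnj ?\<omega>))"
    unfolding has_contour_integral_linepath .
  have kt: "kern c \<alpha> w1 w2 (cnj ?\<omega> + of_real t) = cnj (?k (?\<omega> + of_real t))" if "t \<in> space posm" for t
  proof -
    have "?\<omega> + of_real t \<in> half_strip" by (rule corner_half_strip) (use that in simp)
    from kern_mirror[OF \<alpha> w this, of c] show ?thesis by simp
  qed
  have "integrable posm (\<lambda>t. cnj (?k (?\<omega> + of_real t)))" using I(2) by (rule integrable_cnj)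
  then have i2: "integrable posm (\<lambda>t. kern c \<alpha> w1 w2 (cnj ?\<omega> + of_real t))"
    by (subst Bochner_Integration.integrable_cong[OF refl kt]) simp_all
  have l2: "(LINT t|posm. kern c \<alpha> w1 w2 (cnj ?\<omega> + of_real t)) = cnj (LINT t|posm. ?k (?\<omega> + of_real t))"
    unfolding Bochner_Integration.integral_cnj[symmetric] by (rule Bochner_Integration.integral_cong[OF refl kt])
  have tr: "cnj (tricomi ?c (?\<alpha> + ?c) (- ((- cnj w)\<^sup>2))) = tricomi c (\<alpha> + c) (- (w\<^sup>2))" if "Im w > 0" for w
    using tricomi_cnj[OF minus_square_not_nonpos[of "- cnj w"], of ?c "?\<alpha> + ?c"] that by simp
  have "tricomi c (\<alpha> + c) (- (w1\<^sup>2)) * tricomi c (\<alpha> + c) (- (w2\<^sup>2)) = cnj (2 * of_real (sqrt pi) *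
       (contour_integral (linepath 0 ?\<omega>) ?k + (LINT t|posm. ?k (?\<omega> + of_real t))))"
    unfolding eq[symmetric] complex_cnj_mult tr[OF w(2)] tr[OF w(4)] ..
  also have "\<dots> = 2 * of_real (sqrt pi) * (contour_integral (linepath 0 (cnj ?\<omega>)) (kern c \<alpha> w1 w2) + (LINT t|posm. kern c \<alpha> w1 w2 (cnj ?\<omega> + of_real t)))"
    unfolding l2 contour_integral_unique[OF ci] by (simp only: complex_cnj_mult complex_cnj_add complex_cnj_numeral complex_cnj_complex_of_real)
  finally show ?thesis unfolding corner_formula_def w'
    by (intro conjI i2 has_contour_integral_integrable[OF ci])
qed

text \<open>Re (w1 w2) \<ge> 0 means Re w1 Re w2 \<ge> Im w1 Im w2 > 0. So the two quadrants exhaust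
  all cases in which the path needs a corner.\<close>

lemma same_quadrant:
  assumes "Im w1 > 0" "Im w2 > 0" "Re (w1 * w2) \<ge> 0"
  shows "Re w1 > 0 \<and> Re w2 > 0 \<or> Re w1 < 0 \<and> Re w2 < 0"
proof -
  have "Re w1 * Re w2 > 0" using assms(3) mult_pos_pos[OF assms(1,2)] by simp
  then show ?thesis by (simp add: zero_less_mult_iff)
qed

lemma corner_formula_path_corner:
  assumes c: "Re c > 0" and \<alpha>: "Re \<alpha> > 0" and w: "Im w1 > 0" "Im w2 > 0" and s: "Re (w1 * w2) \<ge> 0"
  shows "corner_formula c \<alpha> w1 w2 (path_corner (w1 * w2))"
  using same_quadrant[OF w s]
proof
  assume r: "Re w1 > 0 \<and> Re w2 > 0"
  then have "Im (w1 * w2) > 0" using w by (simp add: add_pos_pos)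
  then have "path_corner (w1 * w2) = \<i> * of_real (pi / 2)" by (simp add: path_corner_def)
  with corner_formula_first_quadrant[OF c \<alpha> _ w(1) _ w(2)] r show ?thesis by (simp only: simp_thms)
next
  assume r: "Re w1 < 0 \<and> Re w2 < 0"
  then have "\<not> Im (w1 * w2) > 0" using w by (simp add: not_less add_nonpos_nonpos mult_nonpos_nonneg mult_nonneg_nonpos)
  then have "path_corner (w1 * w2) = - \<i> * of_real (pi / 2)" by (simp add: path_corner_def)
  with corner_formula_second_quadrant[OF c \<alpha> _ w(1) _ w(2)] r show ?thesis by (simp only: simp_thms)
qed

text \<open>The boundary case Re (w1 w2) = 0 lies outside the open region of continuation. There
  both arguments share a quadrant, the corner formula holds, and Cauchy's theorem still moves the
  path back to the real axis.\<close>

lemma tricomi_product_closed_line: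
  assumes c: "Re c > 0" and \<alpha>: "Re \<alpha> > 0" and w: "Im w1 > 0" "Im w2 > 0" and s: "Re (w1 * w2) \<le> 0"
  shows "tricomi c (\<alpha> + c) (- (w1\<^sup>2)) * tricomi c (\<alpha> + c) (- (w2\<^sup>2)) =
    2 * of_real (sqrt pi) * (LINT t|posm. kern c \<alpha> w1 w2 (of_real t))"
proof (cases "Re (w1 * w2) < 0")
  case True
  then show ?thesis by (rule tricomi_product_line[OF c \<alpha> w])
next
  case False
  with s have s0: "Re (w1 * w2) \<ge> 0" by simp
  have quad: "tricomi c (\<alpha> + c) (- (w1\<^sup>2)) * tricomi c (\<alpha> + c) (- (w2\<^sup>2)) =
    2 * of_real (sqrt pi) * (LINT t|posm. kern c \<alpha> w1 w2 (of_real t))"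
    if c: "Re c > 0" and \<alpha>: "Re \<alpha> > 0" and w: "Re w1 > 0" "Im w1 > 0" "Re w2 > 0" "Im w2 > 0" and s: "Re (w1 * w2) \<le> 0" for c \<alpha> w1 w2
    using tricomi_product_corner[OF c \<alpha> w] corner_integral_eq_line[OF c \<alpha> w s] by simp
  from same_quadrant[OF w s0] show ?thesis
  proof
    assume "Re w1 > 0 \<and> Re w2 > 0"
    then show ?thesis using w by (intro quad[OF c \<alpha> _ _ _ _ s]) simp_all
  next
    assume r: "Re w1 < 0 \<and> Re w2 < 0"
    let ?c = "cnj c" and ?\<alpha> = "cnj \<alpha>" and ?v1 = "- cnj w1" and ?v2 = "- cnj w2"
    have v: "Re ?v1 > 0" "Im ?v1 > 0" "Re ?v2 > 0" "Im ?v2 > 0" and ca: "Re ?c > 0" "Re ?\<alpha> > 0"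
      using w r c \<alpha> by simp_all
    have vs: "Re (?v1 * ?v2) \<le> 0" using s by simp
    have tr: "cnj (tricomi ?c (?\<alpha> + ?c) (- ((- cnj w)\<^sup>2))) = tricomi c (\<alpha> + c) (- (w\<^sup>2))" if "Im w > 0" for w
      using tricomi_cnj[OF minus_square_not_nonpos[of "- cnj w"], of ?c "?\<alpha> + ?c"] that by simp
    have k: "kern c \<alpha> w1 w2 (of_real t) = cnj (kern ?c ?\<alpha> ?v1 ?v2 (of_real t))" if "t \<in> space posm" for t
    proof -
      have "complex_of_real t \<in> half_strip" using that by (simp add: mem_half_strip)
      from kern_mirror[OF \<alpha> conjunct1[OF r] w(1) conjunct2[OF r] w(2) this, of c] show ?thesis by simp
    qed
    have "(LINT t|posm. kern c \<alpha> w1 w2 (of_real t)) = cnj (LINT t|posm. kern ?c ?\<alpha> ?v1 ?v2 (of_real t))"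
      unfolding Bochner_Integration.integral_cnj[symmetric] by (rule Bochner_Integration.integral_cong[OF refl k])
    then have "2 * of_real (sqrt pi) * (LINT t|posm. kern c \<alpha> w1 w2 (of_real t)) =
       cnj (2 * of_real (sqrt pi) * (LINT t|posm. kern ?c ?\<alpha> ?v1 ?v2 (of_real t)))" by simp
    also have "\<dots> = tricomi c (\<alpha> + c) (- (w1\<^sup>2)) * tricomi c (\<alpha> + c) (- (w2\<^sup>2))"
      unfolding quad[OF ca v vs, symmetric] complex_cnj_mult tr[OF w(1)] tr[OF w(2)] ..
    finally show ?thesis by (rule sym)
  qed
qed

section \<open>The product formula\<close>

lemma sqrt_2pi_power2: "(sqrt_2pi z)\<^sup>2 = z"
proof (cases "z = 0")
  case False
  have "(sqrt_2pi z)\<^sup>2 = of_real (cmod z) * cis (Arg2pi z)"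
    unfolding sqrt_2pi_def power_mult_distrib of_real_power[symmetric] Complex.DeMoivre by simp
  also have "\<dots> = z" using Arg2pi[of z] by (simp add: is_Arg_def cis_conv_exp)
  finally show ?thesis .
qed (simp add: sqrt_2pi_def)

lemma Im_sqrt_2pi_pos:
  assumes "z \<notin> \<real>\<^sub>\<ge>\<^sub>0"
  shows "Im (sqrt_2pi z) > 0"
proof -
  have z0: "z \<noteq> 0" using assms by auto
  have "Arg2pi z \<noteq> 0" using assms Arg2pi_eq_0[of z] by (auto simp: complex_nonneg_Reals_iff complex_is_Real_iff)
  then have "0 < Arg2pi z / 2" "Arg2pi z / 2 < pi" using Arg2pi[of z] by simp_all
  then have "sin (Arg2pi z / 2) > 0" by (rule sin_gt_zero)
  with z0 show ?thesis by (simp add: sqrt_2pi_def)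
qed

text \<open>A principal power of a product splits only if the phases add up inside (-pi, pi]; the
  positive factor 1/2 does not change the phase.\<close>

lemma powr_mult_half:
  fixes s x \<nu> :: complex
  assumes "s \<noteq> 0" "x \<noteq> 0" "- pi < Im (ln s) + Im (ln x)" "Im (ln s) + Im (ln x) \<le> pi"
  shows "(s * x / 2) powr \<nu> = s powr \<nu> / 2 powr \<nu> * x powr \<nu>"
proof -
  have "ln (s * x / 2) = ln (of_real (1/2) * (s * x))" by (simp add: mult.commute)
  also have "\<dots> = ln (complex_of_real (1/2)) + ln (s * x)" by (rule Ln_times_of_real) (use assms in auto)
  also have "ln (s * x) = ln s + ln x" by (rule Ln_times_simple) (use assms in auto)
  also have "ln (complex_of_real (1/2)) = - ln 2" using Ln_of_real[of 2] Ln_of_real[of "1/2"] by (simp add: ln_div)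
  finally have l: "ln (s * x / 2) = - ln 2 + (ln s + ln x)" .
  have "s * x / 2 \<noteq> 0" using assms by simp
  then have "(s * x / 2) powr \<nu> = exp (\<nu> * (- ln 2 + (ln s + ln x)))" by (simp only: powr_def l if_False)
  also have "\<dots> = exp (\<nu> * ln s) / exp (\<nu> * ln 2) * exp (\<nu> * ln x)"
    by (simp add: exp_add exp_diff ring_distribs)
  finally show ?thesis using assms by (simp add: powr_def)
qed

text \<open>The powers \<alpha> - 1/2 and \<alpha> + 1/2 of sinh t merge to 2 \<alpha>. The
  exponential of the Laguerre function turns exp (- s cosh t) into exp (s cosh t) and leaves exp (z1
  + z2), and the power of s comes out as a constant.\<close>

lemma product_integrand_eq_kern:
  assumes \<alpha>: "Re \<alpha> > 0" and \<gamma>: "Re \<gamma> > -1" and s: "sqrt_2pi z1 * sqrt_2pi z2 \<noteq> 0"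
    and Z: "- ((sqrt_2pi z1)\<^sup>2 + (sqrt_2pi z2)\<^sup>2 + 2 * (sqrt_2pi z1 * sqrt_2pi z2) * cosh t) \<notin> \<real>\<^sub>\<le>\<^sub>0"
    and sh: "sinh t \<noteq> 0 \<Longrightarrow> - pi < Im (ln (sqrt_2pi z1 * sqrt_2pi z2)) + Im (ln (sinh t))"
      "sinh t \<noteq> 0 \<Longrightarrow> Im (ln (sqrt_2pi z1 * sqrt_2pi z2)) + Im (ln (sinh t)) \<le> pi"
  shows "product_integrand \<gamma> \<alpha> z1 z2 t =
    (1/2 * Gamma (\<alpha> + \<gamma> + 1) / Gamma (\<gamma> + 1) * exp (z1 + z2) * ((sqrt_2pi z1 * sqrt_2pi z2) powr (\<alpha> - 1/2) / 2 powr (\<alpha> - 1/2))) *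
      kern (\<gamma> + 1) \<alpha> (sqrt_2pi z1) (sqrt_2pi z2) t"
proof (cases "sinh t = 0")
  case True
  then show ?thesis by (simp add: product_integrand_def kern_def Let_def)
next
  case False
  define s where "s = sqrt_2pi z1 * sqrt_2pi z2"
  define W where "W = z1 + z2 + 2 * s * cosh t"
  have W: "W \<notin> \<real>\<^sub>\<ge>\<^sub>0" using Z unfolding sqrt_2pi_power2 s_def[symmetric] W_def
    by (auto simp: complex_nonpos_Reals_iff complex_nonneg_Reals_iff)
  have kern: "kern (\<gamma> + 1) \<alpha> (sqrt_2pi z1) (sqrt_2pi z2) t =
      tricomi (\<gamma> + 1) (\<alpha> + \<gamma> + 1) (- W) * exp (s * cosh t) * sinh t powr (2 * \<alpha>) * bes \<alpha> (s * sinh t)"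
    unfolding kern_def sqrt_2pi_power2 s_def[symmetric] W_def by (simp add: add.assoc)
  have F: "product_integrand \<gamma> \<alpha> z1 z2 t =
      (1/2 * Gamma (\<alpha> + \<gamma> + 1) / Gamma (\<gamma> + 1) * exp W * tricomi (\<gamma> + 1) (\<alpha> + \<gamma> + 1) (- W)) * exp (- s * cosh t) *
      ((s powr (\<alpha> - 1/2) / 2 powr (\<alpha> - 1/2) * sinh t powr (\<alpha> - 1/2)) * bes \<alpha> (s * sinh t)) * sinh t powr (\<alpha> + 1/2)"
    using powr_mult_half[OF assms(3) False sh(1)[OF False] sh(2)[OF False], of "\<alpha> - 1/2"]
    unfolding product_integrand_def Let_def s_def[symmetric] W_def[symmetric] laguerre_N_eq_tricomi[OF W \<alpha> \<gamma>] bessel_I_eq_bes[OF \<alpha>] by simp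
  have e: "exp W * exp (- s * cosh t) = exp (z1 + z2) * exp (s * cosh t)"
    unfolding exp_add[symmetric] W_def by (simp add: algebra_simps)
  have p: "sinh t powr (\<alpha> - 1/2) * sinh t powr (\<alpha> + 1/2) = sinh t powr (2 * \<alpha>)"
    unfolding powr_add[symmetric] by simp
  have re: "(A * E * T) * E' * ((S * P) * B) * P' = (A * (X * S)) * (T * Y * PP * B)" if "E * E' = X * Y" "P * P' = PP" for A E T E' S P B P' X Y PP :: complex
    unfolding that(2)[symmetric] using arg_cong[OF that(1), of "\<lambda>x. x * (A * T * S * P * B * P')"] by (simp only: mult_ac)
  show ?thesis unfolding F kern s_def[symmetric] by (subst re[OF e p]) (simp only: mult_ac)
qed

lemma Re_sinh_half_strip:
  assumes "t \<in> half_strip"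
  shows "Re (sinh t) \<ge> 0"
proof -
  have "Re (sinh (Complex (Re t) (Im t))) \<ge> 0"
    unfolding sinh_Complex using assms by (auto simp: mem_half_strip intro!: mult_nonneg_nonneg cos_ge_zero)
  then show ?thesis by simp
qed

lemma path_corner_half_strip:
  assumes "t \<in> closed_segment 0 (path_corner s) \<or> (\<exists>u\<ge>0. t = path_corner s + of_real u)"
  shows "(if Im s > 0 then t else cnj t) \<in> half_strip"
  using assms
proof
  assume "t \<in> closed_segment 0 (path_corner s)"
  then obtain u where "0 \<le> u" "u \<le> 1" "t = u *\<^sub>R path_corner s" by (auto simp: in_segment)
  then show ?thesis by (simp add: path_corner_def mem_half_strip mult_left_le_one_le)
next
  assume "\<exists>u\<ge>0. t = path_corner s + of_real u"
  then show ?thesis by (auto simp: path_corner_def mem_half_strip)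
qed

lemma kern_arg_path_corner:
  assumes w: "Im w1 > 0" "Im w2 > 0" and s: "Re (w1 * w2) \<ge> 0"
    and t: "(if Im (w1 * w2) > 0 then t else cnj t) \<in> half_strip"
  shows "kern_arg w1 w2 t \<notin> \<real>\<^sub>\<le>\<^sub>0"
  using same_quadrant[OF w s]
proof
  assume r: "Re w1 > 0 \<and> Re w2 > 0"
  then have "Im (w1 * w2) > 0" using w by (simp add: add_pos_pos)
  then have "t \<in> half_strip" using t by (simp only: if_True)
  with r w show ?thesis by (intro kern_arg_half_strip) simp_all
next
  assume r: "Re w1 < 0 \<and> Re w2 < 0"
  then have "\<not> Im (w1 * w2) > 0" using w by (simp add: not_less add_nonpos_nonpos mult_nonpos_nonneg mult_nonneg_nonpos)
  then have "cnj t \<in> half_strip" using t by (simp only: if_False)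
  then have n: "kern_arg (- cnj w1) (- cnj w2) (cnj t) \<notin> \<real>\<^sub>\<le>\<^sub>0"
    using r w by (intro kern_arg_half_strip) simp_all
  have e: "kern_arg (- cnj w1) (- cnj w2) (cnj t) = cnj (kern_arg w1 w2 t)"
    by (simp add: cosh_cnj)
  have "cnj Y \<in> \<real>\<^sub>\<le>\<^sub>0 \<longleftrightarrow> Y \<in> \<real>\<^sub>\<le>\<^sub>0" for Y by (auto simp: complex_nonpos_Reals_iff)
  with n show ?thesis unfolding e by blast
qed

theorem theorem60:
  fixes \<gamma> \<alpha> z1 z2 :: complex
  assumes "Re \<alpha> > 0" and "Re \<gamma> > -1"
    and "z1 \<notin> \<real>\<^sub>\<ge>\<^sub>0" and "z2 \<notin> \<real>\<^sub>\<ge>\<^sub>0"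
  defines "s \<equiv> sqrt_2pi z1 * sqrt_2pi z2"
  defines "F \<equiv> product_integrand \<gamma> \<alpha> z1 z2"
  shows "(Re s \<le> 0 \<longrightarrow>
            set_integrable lborel {0<..} (\<lambda>t. F (of_real t)) \<and>
            laguerre_N \<gamma> \<alpha> z1 * laguerre_N \<gamma> \<alpha> z2 =
              product_factor \<gamma> \<alpha> z1 z2 * (LINT t:{0<..}|lborel. F (of_real t))) \<and>
         (Re s > 0 \<longrightarrow>
            F contour_integrable_on linepath 0 (path_corner s) \<and>
            set_integrable lborel {0<..} (\<lambda>t. F (path_corner s + of_real t)) \<and>
            laguerre_N \<gamma> \<alpha> z1 * laguerre_N \<gamma> \<alpha> z2 =
              product_factor \<gamma> \<alpha> z1 z2 *
              (contour_integral (linepath 0 (path_corner s)) F +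
               (LINT t:{0<..}|lborel. F (path_corner s + of_real t))))"
proof -
  define w1 w2 where "w1 = sqrt_2pi z1" and "w2 = sqrt_2pi z2"
  define G where "G = Gamma (\<alpha> + \<gamma> + 1) / Gamma (\<gamma> + 1)"
  define P where "P = s powr (\<alpha> - 1/2) / 2 powr (\<alpha> - 1/2)"
  define K where "K = 1/2 * Gamma (\<alpha> + \<gamma> + 1) / Gamma (\<gamma> + 1) * exp (z1 + z2) * (s powr (\<alpha> - 1/2) / 2 powr (\<alpha> - 1/2))"
  let ?k = "kern (\<gamma> + 1) \<alpha> w1 w2"
  have c: "Re (\<gamma> + 1) > 0" using assms(2) by simp
  have w: "Im w1 > 0" "Im w2 > 0" unfolding w1_def w2_def by (intro Im_sqrt_2pi_pos assms(3,4))+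
  have s: "s = w1 * w2" by (simp add: s_def w1_def w2_def)
  have s0: "s \<noteq> 0" using w unfolding s by auto
  have F: "F t = K * ?k t" if "kern_arg w1 w2 t \<notin> \<real>\<^sub>\<le>\<^sub>0"
     "sinh t \<noteq> 0 \<Longrightarrow> - pi < Im (ln s) + Im (ln (sinh t))" "sinh t \<noteq> 0 \<Longrightarrow> Im (ln s) + Im (ln (sinh t)) \<le> pi" for t
    using product_integrand_eq_kern[OF assms(1,2) s0[unfolded s_def] that[unfolded s_def w1_def w2_def]]
    unfolding F_def K_def s_def w1_def w2_def .
  have P0: "P \<noteq> 0" using s0 by (simp add: P_def)
  have K: "K = 1/2 * G * exp (z1 + z2) * P" by (simp add: K_def G_def P_def)
  have pf: "product_factor \<gamma> \<alpha> z1 z2 = of_real (sqrt pi) * G / P"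
    unfolding product_factor_def Let_def s_def[symmetric] G_def P_def using s0 by (simp add: field_simps)
  \<comment> \<open>The power of s in \<open>K\<close> cancels against the one in
    \<open>product_factor\<close>, and exp (z1 + z2) is the product of the two exponentials of the
    Laguerre functions. J is left open so that both kinds of path can be inserted.\<close>
  have N: "laguerre_N \<gamma> \<alpha> z1 * laguerre_N \<gamma> \<alpha> z2 = product_factor \<gamma> \<alpha> z1 z2 * (K * J)"
    if J: "tricomi (\<gamma> + 1) (\<alpha> + (\<gamma> + 1)) (- (w1\<^sup>2)) * tricomi (\<gamma> + 1) (\<alpha> + (\<gamma> + 1)) (- (w2\<^sup>2)) = 2 * of_real (sqrt pi) * J" for J
  proof -
    have "laguerre_N \<gamma> \<alpha> z1 * laguerre_N \<gamma> \<alpha> z2 = (1/2 * G)\<^sup>2 * (exp z1 * exp z2) *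
        (tricomi (\<gamma> + 1) (\<alpha> + (\<gamma> + 1)) (- (w1\<^sup>2)) * tricomi (\<gamma> + 1) (\<alpha> + (\<gamma> + 1)) (- (w2\<^sup>2)))"
      unfolding laguerre_N_eq_tricomi[OF assms(3,1,2)] laguerre_N_eq_tricomi[OF assms(4,1,2)] w1_def w2_def sqrt_2pi_power2
      by (simp add: G_def power2_eq_square add.assoc)
    also have "\<dots> = product_factor \<gamma> \<alpha> z1 z2 * (K * J)"
      unfolding J pf K exp_add using P0 by (simp add: power2_eq_square)
    finally show ?thesis .
  qed
  have line: "set_integrable lborel {0<..} (\<lambda>t. F (of_real t)) \<and>
            laguerre_N \<gamma> \<alpha> z1 * laguerre_N \<gamma> \<alpha> z2 =
              product_factor \<gamma> \<alpha> z1 z2 * (LINT t:{0<..}|lborel. F (of_real t))"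
    if r: "Re s \<le> 0"
  proof -
    have Ft: "F (of_real t) = K * ?k (of_real t)" if "t \<in> space posm" for t
    proof (rule F)
      have t: "t > 0" using that by simp
      show "kern_arg w1 w2 (complex_of_real t) \<notin> \<real>\<^sub>\<le>\<^sub>0"
        by (rule not_nonpos_Reals_of_norm_add_ge[OF norm_arg_ge_upper_half_plane(1)[OF w less_imp_le[OF t]]])
          (use upper_half_dist_pos[OF w] in simp_all)
      \<comment> \<open>On the real axis sinh t is positive, so the phase of s alone decides the
        branch.\<close>
      have "Im (ln (sinh (complex_of_real t))) = 0" using t unfolding sinh_complex_of_real by (simp add: Ln_of_real)
      then show "- pi < Im (ln s) + Im (ln (sinh (complex_of_real t)))" "Im (ln s) + Im (ln (sinh (complex_of_real t))) \<le> pi"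
        using mpi_less_Im_Ln[OF s0] Im_Ln_le_pi[OF s0] by simp_all
    qed
    have i: "integrable posm (\<lambda>t. ?k (of_real t))"
      by (rule integrable_kern_line[OF c assms(1) w r[unfolded s]])
    have "integrable posm (\<lambda>t. F (of_real t))"
      by (subst Bochner_Integration.integrable_cong[OF refl Ft]) (simp_all add: i)
    moreover have "(LINT t|posm. F (of_real t)) = (LINT t|posm. K * ?k (of_real t))"
      by (rule Bochner_Integration.integral_cong[OF refl Ft])
    then have "(LINT t|posm. F (of_real t)) = K * (LINT t|posm. ?k (of_real t))"
      by (simp only: integral_mult_right_zero)
    ultimately show ?thesis
      using N[OF tricomi_product_closed_line[OF c assms(1) w r[unfolded s]]]
      unfolding integrable_posm integral_posm by simp
  qed
  have corner: "F contour_integrable_on linepath 0 (path_corner s) \<and>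
            set_integrable lborel {0<..} (\<lambda>t. F (path_corner s + of_real t)) \<and>
            laguerre_N \<gamma> \<alpha> z1 * laguerre_N \<gamma> \<alpha> z2 =
              product_factor \<gamma> \<alpha> z1 z2 *
              (contour_integral (linepath 0 (path_corner s)) F +
               (LINT t:{0<..}|lborel. F (path_corner s + of_real t)))"
    if r: "Re s > 0"
  proof -
    let ?\<omega> = "path_corner s"
    have cf: "corner_formula (\<gamma> + 1) \<alpha> w1 w2 ?\<omega>"
      using corner_formula_path_corner[OF c assms(1) w] r unfolding s by simp
    then have ci: "?k contour_integrable_on linepath 0 ?\<omega>" and i: "integrable posm (\<lambda>t. ?k (?\<omega> + of_real t))"
      and eq: "tricomi (\<gamma> + 1) (\<alpha> + (\<gamma> + 1)) (- (w1\<^sup>2)) * tricomi (\<gamma> + 1) (\<alpha> + (\<gamma> + 1)) (- (w2\<^sup>2)) =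
         2 * of_real (sqrt pi) * (contour_integral (linepath 0 ?\<omega>) ?k + (LINT t|posm. ?k (?\<omega> + of_real t)))"
      unfolding corner_formula_def by blast+
    have Ft: "F t = K * ?k t" if "t \<in> closed_segment 0 ?\<omega> \<or> (\<exists>u\<ge>0. t = ?\<omega> + of_real u)" for t
    proof (rule F)
      have t: "(if Im s > 0 then t else cnj t) \<in> half_strip" by (rule path_corner_half_strip[OF that])
      show "kern_arg w1 w2 t \<notin> \<real>\<^sub>\<le>\<^sub>0"
        by (rule kern_arg_path_corner[OF w]) (use r t in \<open>simp_all only: s less_imp_le\<close>)
      have "Re (sinh t) \<ge> 0"
        using Re_sinh_half_strip[OF t] by (simp add: sinh_cnj[symmetric] split: if_splits)
      \<comment> \<open>The branch condition on the corner path: the phase of sinh t is at most pi/2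
        and that of s below pi/2 in absolute value, since Re s > 0.\<close>
      then have "\<bar>Im (ln (sinh t))\<bar> \<le> pi / 2" if "sinh t \<noteq> 0" using Re_Ln_pos_le[OF that] by simp
      moreover have "\<bar>Im (ln s)\<bar> < pi / 2" using Re_Ln_pos_lt[OF s0] r by simp
      ultimately show "- pi < Im (ln s) + Im (ln (sinh t))" "Im (ln s) + Im (ln (sinh t)) \<le> pi" if "sinh t \<noteq> 0"
        using that by fastforce+
    qed
    have "(?k has_contour_integral contour_integral (linepath 0 ?\<omega>) ?k) (linepath 0 ?\<omega>)"
      by (rule has_contour_integral_integral[OF ci])
    then have "((\<lambda>t. K * ?k t) has_contour_integral K * contour_integral (linepath 0 ?\<omega>) ?k) (linepath 0 ?\<omega>)"
      by (rule has_contour_integral_lmul)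
    then have hc: "(F has_contour_integral K * contour_integral (linepath 0 ?\<omega>) ?k) (linepath 0 ?\<omega>)"
    proof (rule has_contour_integral_eq)
      fix t assume "t \<in> path_image (linepath 0 ?\<omega>)"
      then have "t \<in> closed_segment 0 ?\<omega>" by simp
      then show "K * ?k t = F t" by (intro Ft[symmetric] disjI1)
    qed
    have Fp: "F (?\<omega> + of_real t) = K * ?k (?\<omega> + of_real t)" if "t \<in> space posm" for t
      by (rule Ft) (use that in auto)
    have "integrable posm (\<lambda>t. F (?\<omega> + of_real t))"
      by (subst Bochner_Integration.integrable_cong[OF refl Fp]) (simp_all add: i)
    moreover have "(LINT t|posm. F (?\<omega> + of_real t)) = (LINT t|posm. K * ?k (?\<omega> + of_real t))"
      by (rule Bochner_Integration.integral_cong[OF refl Fp])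
    then have "(LINT t|posm. F (?\<omega> + of_real t)) = K * (LINT t|posm. ?k (?\<omega> + of_real t))"
      by (simp only: integral_mult_right_zero)
    ultimately show ?thesis
      using N[OF eq] has_contour_integral_integrable[OF hc] contour_integral_unique[OF hc]
      unfolding integrable_posm integral_posm by (simp add: distrib_left)
  qed
  show ?thesis using line corner by blast
qed

end
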